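(* Let $H$ be a second countable compact Abelian group, $G_0$ a finite group, $\alpha$ an action of $G_0$ on $H$ by (continuous) automorphisms, and $G=H\rtimes_\alpha G_0$ the semi-direct product group, in which $H$ is regarded as a closed normal subgroup. Then $\mathcal{K}(\hat{G}\cup\hat{H})$, equipped with the convolution $*$ defined in the context for the pair $(G,H)$, is a hypergroup if and only if the action $\alpha$ is trivial, i.e. $G=H\times G_0$.
   Context: For a compact group $G$, $\hat G$ denotes the set of equivalence classes of (continuous, complex) irreducible representations of $G$. For a finite-dimensional representation $\pi$ of $G$ the normalized character is $ch(\pi)(g)=\frac{1}{\dim\pi}\mathrm{tr}(\pi(g))$, $g\in G$. Then $ch(\pi_i\otimes\pi_j)=ch(\pi_i)ch(\pi_j)$. Let $G$ be a compact group and $H$ a closed subgroup of finite index. The set: $\mathcal{K}(\hat{G}\cup\hat{H})=\{(ch(\pi),\circ),(ch(\tau),\bullet):\pi\in\hat G,\ \tau\in\hat{H}\}$ (a disjoint union, with discrete topology). If a finite-dimensional representation $\sigma$ of $G$ decomposes as $\sigma\cong\bigoplus_k m_k\sigma_k$ with distinct $\sigma_k\in\hat G$, then $ch(\sigma)=\sum_k\frac{m_k\dim\sigma_k}{\dim\sigma}ch(\sigma_k)$, and $(ch(\sigma),\circ)$ is understood as the finitely supported probability measure giving mass $\frac{m_k\dim\sigma_k}{\dim\sigma}$ to $(ch(\sigma_k),\circ)$; similarly $(ch(\sigma),\bullet)$ for finite-dimensional representations $\sigma$ of $H$. A point is identified with its Dirac measure. Convolution: for $\pi_i,\pi_j,\pi\in\hat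 G$ and $\tau_i,\tau_j,\tau\in\hat{H}$, $(ch(\pi_i),\circ)*(ch(\pi_j),\circ)=(ch(\pi_i)ch(\pi_j),\circ)$; $(ch(\pi),\circ)*(ch(\tau),\bullet)=(ch(\mathrm{res}_{H}^G\pi)\,ch(\tau),\bullet)$; $(ch(\tau),\bullet)*(ch(\pi),\circ)=(ch(\tau)\,ch(\mathrm{res}_{H}^G\pi),\bullet)$; $(ch(\tau_i),\bullet)*(ch(\tau_j),\bullet)=(ch(\mathrm{ind}_{H}^G(\tau_i\otimes\tau_j)),\circ)$, extended bilinearly (and continuously) to bounded measures. Hypergroup (discrete case): a set $K$ with discrete topology and a convolution $*$ is a hypergroup if: for all $x,y\in K$, $\delta_x*\delta_y$ is a finitely supported probability measure on $K$; the bilinear extension of $*$ to bounded measures on $K$ is associative (so that $M^b(K)=\ell^1(K)$ is a Banach algebra); there is a unit $e\in K$ with $\delta_e*\delta_x=\delta_x*\delta_e=\delta_x$ for all $x$; and there is an involution $x\mapsto x^-$ of $K$ (with $(x^-)^-=x$), extended to measures by push-forward, such that $\delta_{x^-}*\delta_{y^-}=(\delta_y*\delta_x)^-$ and $e\in\mathrm{supp}(\delta_x*\delta_y)$ if and only if $x=y^-$, for all $x,y\in K$. *)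

theory Defs
  imports
    "HOL-Analysis.Analysis"
    "HOL-Algebra.Group_Action"
    "HOL-Algebra.Left_Coset"
    "Jordan_Normal_Form.VS_Connect"
begin

section \<open>Discrete hypergroups\<close>

text \<open>A (real) measure on a discrete space is given by its mass function on points, a bounded
  complex measure by a summable complex mass function. Mass functions vanish off the carrier.\<close>

definition dirac :: "'k \<Rightarrow> 'k \<Rightarrow> real" where
  "dirac x = (\<lambda>z. if z = x then 1 else 0)"

definition fin_prob_measure :: "'k set \<Rightarrow> ('k \<Rightarrow> real) \<Rightarrow> bool" where
  "fin_prob_measure K p \<longleftrightarrow>
     finite {z. p z \<noteq> 0} \<and> {z. p z \<noteq> 0} \<subseteq> K \<and> (\<forall>z. p z \<ge> 0) \<and> (\<Sum>z | p z \<noteq> 0. p z) = 1"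

definition bounded_measures :: "'k set \<Rightarrow> ('k \<Rightarrow> complex) set" where
  "bounded_measures K = {\<mu>. (\<forall>z. z \<notin> K \<longrightarrow> \<mu> z = 0) \<and> (\<lambda>z. norm (\<mu> z)) summable_on K}"

text \<open>\<open>c x y\<close> is the measure \<open>\<delta>\<^sub>x * \<delta>\<^sub>y\<close>.\<close>

definition convolution ::
  "'k set \<Rightarrow> ('k \<Rightarrow> 'k \<Rightarrow> 'k \<Rightarrow> real) \<Rightarrow> ('k \<Rightarrow> complex) \<Rightarrow> ('k \<Rightarrow> complex) \<Rightarrow> 'k \<Rightarrow> complex" where
  "convolution K c \<mu> \<nu> = (\<lambda>z. \<Sum>\<^sub>\<infinity>(x, y)\<in>K \<times> K. \<mu> x * \<nu> y * complex_of_real (c x y z))"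

definition push_forward :: "'k set \<Rightarrow> ('k \<Rightarrow> 'k) \<Rightarrow> ('k \<Rightarrow> real) \<Rightarrow> 'k \<Rightarrow> real" where
  "push_forward K f p = (\<lambda>z. \<Sum>\<^sub>\<infinity>w\<in>{w \<in> K. f w = z}. p w)"

definition hypergroup :: "'k set \<Rightarrow> ('k \<Rightarrow> 'k \<Rightarrow> 'k \<Rightarrow> real) \<Rightarrow> bool" where
  "hypergroup K c \<longleftrightarrow>
     (\<forall>x\<in>K. \<forall>y\<in>K. fin_prob_measure K (c x y)) \<and>
     (\<forall>\<mu>\<in>bounded_measures K. \<forall>\<nu>\<in>bounded_measures K. \<forall>\<rho>\<in>bounded_measures K.
        convolution K c (convolution K c \<mu> \<nu>) \<rho> = convolution K c \<mu> (convolution K c \<nu> \<rho>)) \<and>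
     (\<exists>e\<in>K.
        (\<forall>x\<in>K. c e x = dirac x \<and> c x e = dirac x) \<and>
        (\<exists>\<iota>. (\<forall>x\<in>K. \<iota> x \<in> K \<and> \<iota> (\<iota> x) = x) \<and>
             (\<forall>x\<in>K. \<forall>y\<in>K. c (\<iota> x) (\<iota> y) = push_forward K \<iota> (c y x)) \<and>
             (\<forall>x\<in>K. \<forall>y\<in>K. c x y e \<noteq> 0 \<longleftrightarrow> x = \<iota> y)))"


section \<open>Compact groups and their representations\<close>

definition compact_group :: "'a monoid \<Rightarrow> 'a topology \<Rightarrow> bool" where
  "compact_group G T \<longleftrightarrow>
     group G \<and> topspace T = carrier G \<and>
     continuous_map (prod_topology T T) T (\<lambda>(x, y). x \<otimes>\<^bsub>G\<^esub> y) \<and>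
     continuous_map T T (\<lambda>x. inv\<^bsub>G\<^esub> x) \<and>
     compact_space T \<and> Hausdorff_space T"

text \<open>Finite-dimensional complex representations are given in coordinates; the space of a
  representation of degree \<open>n\<close> is \<open>\<complex>\<^sup>n\<close>. The values off the carrier are irrelevant.\<close>

definition degree_rep :: "'a monoid \<Rightarrow> ('a \<Rightarrow> complex mat) \<Rightarrow> nat" where
  "degree_rep G \<pi> = dim_row (\<pi> \<one>\<^bsub>G\<^esub>)"

definition representation :: "'a monoid \<Rightarrow> 'a topology \<Rightarrow> ('a \<Rightarrow> complex mat) \<Rightarrow> bool" where
  "representation G T \<pi> \<longleftrightarrow> (let n = degree_rep G \<pi> in
     (\<forall>g\<in>carrier G. \<pi> g \<in> carrier_mat n n) \<and>
     \<pi> \<one>\<^bsub>G\<^esub> = 1\<^sub>m n \<and>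
     (\<forall>g\<in>carrier G. \<forall>h\<in>carrier G. \<pi> (g \<otimes>\<^bsub>G\<^esub> h) = \<pi> g * \<pi> h) \<and>
     (\<forall>i<n. \<forall>j<n. continuous_map T euclidean (\<lambda>g. \<pi> g $$ (i, j))))"

definition irreducible_rep :: "'a monoid \<Rightarrow> 'a topology \<Rightarrow> ('a \<Rightarrow> complex mat) \<Rightarrow> bool" where
  "irreducible_rep G T \<pi> \<longleftrightarrow> (let n = degree_rep G \<pi> in
     representation G T \<pi> \<and> n > 0 \<and>
     (\<forall>W. VectorSpace.subspace class_ring W (module_vec TYPE(complex) n) \<and>
          (\<forall>g\<in>carrier G. \<forall>w\<in>W. \<pi> g *\<^sub>v w \<in> W) \<longrightarrow>
          W = {0\<^sub>v n} \<or> W = carrier_vec n))"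

definition equivalent_rep ::
  "'a monoid \<Rightarrow> ('a \<Rightarrow> complex mat) \<Rightarrow> ('a \<Rightarrow> complex mat) \<Rightarrow> bool" where
  "equivalent_rep G \<sigma> \<tau> \<longleftrightarrow> (\<exists>P Q. \<forall>g\<in>carrier G. similar_mat_wit (\<sigma> g) (\<tau> g) P Q)"

text \<open>The normalized character, a function on the carrier of \<open>G\<close>.\<close>

definition ch :: "'a monoid \<Rightarrow> ('a \<Rightarrow> complex mat) \<Rightarrow> 'a \<Rightarrow> complex" where
  "ch G \<pi> = restrict (\<lambda>g. (\<Sum>i<dim_row (\<pi> g). \<pi> g $$ (i, i)) / of_nat (degree_rep G \<pi>)) (carrier G)"

definition direct_sum_rep :: "('a \<Rightarrow> complex mat) list \<Rightarrow> 'a \<Rightarrow> complex mat" where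
  "direct_sum_rep \<rho>s = (\<lambda>g. diag_block_mat (map (\<lambda>\<rho>. \<rho> g) \<rho>s))"

definition tensor_rep ::
  "('a \<Rightarrow> complex mat) \<Rightarrow> ('a \<Rightarrow> complex mat) \<Rightarrow> 'a \<Rightarrow> complex mat" where
  "tensor_rep \<sigma> \<tau> = (\<lambda>g. let m = dim_row (\<sigma> g); n = dim_row (\<tau> g) in
     mat (m * n) (m * n)
       (\<lambda>(i, j). \<sigma> g $$ (i div n, j div n) * \<tau> g $$ (i mod n, j mod n)))"

definition left_transversal :: "'a monoid \<Rightarrow> 'a set \<Rightarrow> 'a list \<Rightarrow> bool" where
  "left_transversal G H rs \<longleftrightarrow> set rs \<subseteq> carrier G \<and>
     distinct (map (\<lambda>r. r <#\<^bsub>G\<^esub> H) rs) \<and> set (map (\<lambda>r. r <#\<^bsub>G\<^esub> H) rs) = lcosets\<^bsub>G\<^esub> H"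

text \<open>The induced representation, with blocks indexed by representatives \<open>r\<^sub>0, r\<^sub>1, \<dots>\<close> of the
  left cosets of \<open>H\<close> (which is of finite index): the block at \<open>(i, j)\<close> is \<open>\<sigma> (r\<^sub>i\<inverse> g r\<^sub>j)\<close> if
  \<open>g r\<^sub>j \<in> r\<^sub>i H\<close>, and zero otherwise. Its equivalence class does not depend on the choice of
  representatives.\<close>

definition induced_rep ::
  "'a monoid \<Rightarrow> 'a set \<Rightarrow> ('a \<Rightarrow> complex mat) \<Rightarrow> 'a \<Rightarrow> complex mat" where
  "induced_rep G H \<sigma> = (\<lambda>g.
     let rs = (SOME rs. left_transversal G H rs); n = degree_rep G \<sigma> in
     mat (length rs * n) (length rs * n) (\<lambda>(i, j).
       let x = inv\<^bsub>G\<^esub> (rs ! (i div n)) \<otimes>\<^bsub>G\<^esub> g \<otimes>\<^bsub>G\<^esub> (rs ! (j div n)) in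
       if x \<in> H then \<sigma> x $$ (i mod n, j mod n) else 0))"


section \<open>The convolution on the union of the duals of \<open>G\<close> and \<open>H\<close>\<close>

datatype tag = Circ | Bullet

type_synonym 'a point = "('a \<Rightarrow> complex) \<times> tag"

text \<open>\<open>dual_points G T s\<close> consists of the points \<open>(ch \<pi>, s)\<close>. Equivalent representations have
  the same character, so that it does not matter whether \<open>\<pi>\<close> ranges over the irreducible
  representations or over their classes.\<close>

definition dual_points :: "'a monoid \<Rightarrow> 'a topology \<Rightarrow> tag \<Rightarrow> 'a point set" where
  "dual_points G T s = {(ch G \<pi>, s) | \<pi>. irreducible_rep G T \<pi>}"

definition rep_of :: "'a monoid \<Rightarrow> 'a topology \<Rightarrow> ('a \<Rightarrow> complex) \<Rightarrow> 'a \<Rightarrow> complex mat" where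
  "rep_of G T f = (SOME \<pi>. irreducible_rep G T \<pi> \<and> ch G \<pi> = f)"

text \<open>Irreducible constituents, listed with repetitions: a class of multiplicity \<open>m\<close> occurs
  \<open>m\<close> times, up to equivalence.\<close>

definition irreducible_decomposition ::
  "'a monoid \<Rightarrow> 'a topology \<Rightarrow> ('a \<Rightarrow> complex mat) \<Rightarrow> ('a \<Rightarrow> complex mat) list \<Rightarrow> bool" where
  "irreducible_decomposition G T \<sigma> \<rho>s \<longleftrightarrow>
     (\<forall>\<rho>\<in>set \<rho>s. irreducible_rep G T \<rho>) \<and> equivalent_rep G \<sigma> (direct_sum_rep \<rho>s)"

text \<open>The measure \<open>(ch \<sigma>, s)\<close>. Summing \<open>dim \<rho> / dim \<sigma>\<close> over the constituents \<open>\<rho>\<close> with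
  repetitions gives the mass \<open>m\<^sub>k dim \<sigma>\<^sub>k / dim \<sigma>\<close> at the point \<open>(ch \<sigma>\<^sub>k, s)\<close>.\<close>

definition ch_measure ::
  "'a monoid \<Rightarrow> 'a topology \<Rightarrow> ('a \<Rightarrow> complex mat) \<Rightarrow> tag \<Rightarrow> 'a point \<Rightarrow> real" where
  "ch_measure G T \<sigma> s = (\<lambda>z.
     \<Sum>\<rho>\<leftarrow>(SOME \<rho>s. irreducible_decomposition G T \<sigma> \<rho>s).
       real (degree_rep G \<rho>) / real (degree_rep G \<sigma>) * dirac (ch G \<rho>, s) z)"

abbreviation subgroup_monoid :: "'a monoid \<Rightarrow> 'a set \<Rightarrow> 'a monoid" where
  "subgroup_monoid G H \<equiv> G\<lparr>carrier := H\<rparr>"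

definition K_points :: "'a monoid \<Rightarrow> 'a topology \<Rightarrow> 'a set \<Rightarrow> 'a point set" where
  "K_points G T H =
     dual_points G T Circ \<union> dual_points (subgroup_monoid G H) (subtopology T H) Bullet"

fun K_conv :: "'a monoid \<Rightarrow> 'a topology \<Rightarrow> 'a set \<Rightarrow> 'a point \<Rightarrow> 'a point \<Rightarrow> 'a point \<Rightarrow> real" where
  "K_conv G T H (f, Circ) (f', Circ) =
     ch_measure G T (tensor_rep (rep_of G T f) (rep_of G T f')) Circ"
| "K_conv G T H (f, Circ) (f', Bullet) =
     (let L = subgroup_monoid G H; S = subtopology T H in
      ch_measure L S (tensor_rep (restrict (rep_of G T f) H) (rep_of L S f')) Bullet)"
| "K_conv G T H (f, Bullet) (f', Circ) =
     (let L = subgroup_monoid G H; S = subtopology T H in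
      ch_measure L S (tensor_rep (rep_of L S f) (restrict (rep_of G T f') H)) Bullet)"
| "K_conv G T H (f, Bullet) (f', Bullet) =
     (let L = subgroup_monoid G H; S = subtopology T H in
      ch_measure G T (induced_rep G H (tensor_rep (rep_of L S f) (rep_of L S f'))) Circ)"


section \<open>Semidirect products with a finite group\<close>

definition semidirect :: "'h monoid \<Rightarrow> 'g monoid \<Rightarrow> ('g \<Rightarrow> 'h \<Rightarrow> 'h) \<Rightarrow> ('h \<times> 'g) monoid" where
  "semidirect H G\<^sub>0 \<alpha> =
     \<lparr>carrier = carrier H \<times> carrier G\<^sub>0,
      mult = (\<lambda>(h, g) (h', g'). (h \<otimes>\<^bsub>H\<^esub> \<alpha> g h', g \<otimes>\<^bsub>G\<^sub>0\<^esub> g')),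
      one = (\<one>\<^bsub>H\<^esub>, \<one>\<^bsub>G\<^sub>0\<^esub>)\<rparr>"

definition semidirect_topology :: "'h topology \<Rightarrow> 'g monoid \<Rightarrow> ('h \<times> 'g) topology" where
  "semidirect_topology T G\<^sub>0 = prod_topology T (discrete_topology (carrier G\<^sub>0))"

definition semidirect_normal :: "'h monoid \<Rightarrow> 'g monoid \<Rightarrow> ('h \<times> 'g) set" where
  "semidirect_normal H G\<^sub>0 = carrier H \<times> {\<one>\<^bsub>G\<^sub>0\<^esub>}"

text \<open>\<open>group_hom G\<^sub>0 (AutoGroup H) \<alpha>\<close> says that \<open>\<alpha>\<close> is an action by group automorphisms of \<open>H\<close>;
  continuity of the inverse automorphism follows, being \<open>\<alpha> (inv g)\<close>.\<close>

definition acts_by_continuous_automorphisms ::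
  "'g monoid \<Rightarrow> 'h monoid \<Rightarrow> 'h topology \<Rightarrow> ('g \<Rightarrow> 'h \<Rightarrow> 'h) \<Rightarrow> bool" where
  "acts_by_continuous_automorphisms G\<^sub>0 H T \<alpha> \<longleftrightarrow>
     group_hom G\<^sub>0 (AutoGroup H) \<alpha> \<and> (\<forall>g\<in>carrier G\<^sub>0. continuous_map T T (\<alpha> g))"

end

(* By associativity, the points of a character f of H, of its conjugate and of the trivial character
   of H, all with tag Bullet, satisfy: f(h) times the mean of cnj (f (alpha g h)) over g is 1. Since
   all values have modulus 1, f is invariant under alpha. The characters of H separate points, so
   alpha is trivial. Separation is obtained without the Peter-Weyl theorem, from an invariant
   mean, the common constant to which the convex combinations of translates of a continuous function
   can be brought uniformly close, and from the spectral theory of the compact self-adjoint operators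
   of convolution with a kernel.

   If alpha is trivial, extending the characters of H by zero to G turns all four cases of the
   convolution into pointwise multiplication of functions on G, and orthogonality of irreducible
   characters shows that a measure with support of one tag is determined by its function. Hence the
   identities of a hypergroup hold, and the mass of a product at the unit is a multiple of the mean
   of the product of the two functions. *)
theory Submission
  imports Defs "HOL-Complex_Analysis.Great_Picard" "Jordan_Normal_Form.Spectral_Radius"
begin

section \<open>Compact abelian groups\<close>

text \<open>Inducing a character from \<open>H\<close> and restricting back replaces it by the mean
  of its conjugates under the finite group. The two ways to bracket the three points differ only in
  whether this mean is taken before or after the factor \<open>f\<close> enters, which is where the
  identity for \<open>f\<close> comes from.

  Commutativity of \<open>H\<close> carries the invariant mean: averages commute, so that averages
  suited to different functions can be merged into one. The spectral argument stays inside the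
  continuous functions, the mean only supplying an inner product; convolution with a continuous
  kernel sends norm bounded sets to equicontinuous ones, so limits of maximizing sequences are again
  continuous and no completion has to be formed.

  For the converse, extension by zero is the right device because an induced character vanishes off
  the normal subgroup \<open>H\<close>, and under a trivial action all terms of the mean on
  \<open>H\<close> are equal. Two points with different tags can have the same extension, for
  instance when the finite group is trivial; hence supports are tracked by tag, in a grading by a
  group of order 2 with unit \<open>Circ\<close>.\<close>

lemma continuous_map_compose_continuous_on:
  assumes "continuous_on UNIV h" "continuous_map X euclidean f"
  shows "continuous_map X euclidean (\<lambda>x. h (f x))"
  using continuous_map_compose[OF assms(2), of euclidean h] assms(1) by (simp add: o_def)

lemma continuous_map_mult:
  fixes f g :: "'a \<Rightarrow> complex"
  assumes "continuous_map X euclidean f" "continuous_map X euclidean g"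
  shows "continuous_map X euclidean (\<lambda>x. f x * g x)"
proof -
  have "continuous_map X euclidean (\<lambda>x. (f x, g x))"
    using continuous_map_pairedI[OF assms] by simp
  then have "continuous_map X euclidean (\<lambda>x. (\<lambda>p. fst p * snd p) (f x, g x))"
    by (rule continuous_map_compose_continuous_on[rotated]) (intro continuous_intros)
  then show ?thesis by simp
qed

lemma continuous_map_scale:
  fixes f :: "'a \<Rightarrow> complex"
  shows "continuous_map X euclidean f \<Longrightarrow> continuous_map X euclidean (\<lambda>x. c * f x)"
  by (rule continuous_map_compose_continuous_on) (auto intro: continuous_intros)

lemma continuous_map_cnj:
  "continuous_map X euclidean f \<Longrightarrow> continuous_map X euclidean (\<lambda>x. cnj (f x))"
  by (rule continuous_map_compose_continuous_on) (auto intro: continuous_intros)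

lemma continuous_map_Re:
  "continuous_map X euclidean f \<Longrightarrow> continuous_map X euclidean (\<lambda>x. Re (f x))"
  by (rule continuous_map_compose_continuous_on) (auto intro: continuous_intros)

lemma continuous_map_of_real:
  "continuous_map X euclidean f \<Longrightarrow> continuous_map X euclidean (\<lambda>x. complex_of_real (f x))"
  by (rule continuous_map_compose_continuous_on) (auto intro: continuous_intros)

lemmas cont_intros =
  continuous_map_add continuous_map_diff continuous_map_mult continuous_map_scale
  continuous_map_cnj continuous_map_Re continuous_map_of_real continuous_map_norm

locale compact_abelian =
  fixes H :: "'a monoid" (structure) and T :: "'a topology"
  assumes compact_group: "compact_group H T" and comm_group: "comm_group H"
begin

sublocale comm_group H by (rule comm_group)

abbreviation cont :: "('a \<Rightarrow> complex) \<Rightarrow> bool" where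
  "cont f \<equiv> continuous_map T euclidean f"

lemma topspace_T: "topspace T = carrier H"
  and compact_T: "compact_space T" and Hausdorff_T: "Hausdorff_space T"
  and cont_mult: "continuous_map (prod_topology T T) T (\<lambda>(x, y). x \<otimes> y)"
  and cont_inv: "continuous_map T T (\<lambda>x. inv x)"
  using compact_group by (auto simp: compact_group_def)

lemma cont_mult2:
  assumes "continuous_map X T f" "continuous_map X T g"
  shows "continuous_map X T (\<lambda>x. f x \<otimes> g x)"
  using continuous_map_compose[OF continuous_map_pairedI[OF assms] cont_mult]
  by (simp add: o_def case_prod_beta)

lemma cont_inv2: "continuous_map X T f \<Longrightarrow> continuous_map X T (\<lambda>x. inv (f x))"
  using continuous_map_compose[OF _ cont_inv] by (simp add: o_def)

lemma cont_constT: "t \<in> carrier H \<Longrightarrow> continuous_map X T (\<lambda>x. t)"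
  by (simp add: topspace_T)

lemma cont_compT: "continuous_map X T h \<Longrightarrow> cont f \<Longrightarrow> continuous_map X euclidean (\<lambda>x. f (h x))"
  using continuous_map_compose[of X T h euclidean f] by (simp add: o_def)

lemma cont_translate: "t \<in> carrier H \<Longrightarrow> cont f \<Longrightarrow> cont (\<lambda>x. f (x \<otimes> t))"
  by (rule cont_compT[of _ "\<lambda>x. x \<otimes> t"]) (auto intro!: cont_mult2 cont_constT)

lemma cont_bounded:
  fixes f :: "'a \<Rightarrow> 'b::real_normed_vector"
  assumes "continuous_map T euclidean f"
  obtains B where "B > 0" "\<And>x. x \<in> carrier H \<Longrightarrow> norm (f x) \<le> B"
proof -
  have "compact (f ` carrier H)"
    using image_compactin[OF _ assms, of "topspace T"] compact_T
    by (simp add: compact_space_def topspace_T)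
  then have "bounded (f ` carrier H)" by (rule compact_imp_bounded)
  then show ?thesis using that by (auto simp: bounded_pos)
qed

text \<open>Compactness in the second variable: the set of pairs where the difference stays below
  \<open>e\<close> is open and contains the slice over \<open>x0\<close>, so it contains a whole
  tube around that slice.\<close>

lemma tube:
  fixes F :: "'a \<times> 'a \<Rightarrow> complex"
  assumes F: "continuous_map (prod_topology T T) euclidean F" and x0: "x0 \<in> carrier H" and e: "e > 0"
  obtains U where "openin T U" "x0 \<in> U"
    "\<And>x y. x \<in> U \<Longrightarrow> y \<in> carrier H \<Longrightarrow> norm (F (x, y) - F (x0, y)) < e"
proof -
  let ?W = "{p \<in> topspace (prod_topology T T). norm (F p - F (x0, snd p)) \<in> {..<e}}"
  have "continuous_map (prod_topology T T) (prod_topology T T) (\<lambda>p. (x0, snd p))"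
    using x0 by (auto simp: topspace_T continuous_map_snd intro!: continuous_map_pairedI)
  from continuous_map_compose[OF this F]
  have "continuous_map (prod_topology T T) euclidean (\<lambda>p. norm (F p - F (x0, snd p)))"
    using F by (intro cont_intros) (auto simp: o_def)
  then have W: "openin (prod_topology T T) ?W"
    by (rule openin_continuous_map_preimage) auto
  have "{x0} \<times> topspace T \<subseteq> ?W" using x0 e by (auto simp: topspace_T)
  then obtain U V where "openin T U" "x0 \<in> U" "topspace T \<subseteq> V" "U \<times> V \<subseteq> ?W"
    using tube_lemma_right[OF W, of "topspace T" x0] x0 compact_T
    by (auto simp: topspace_T compact_space_def)
  note UV = this
  show ?thesis
  proof (rule that[OF UV(1,2)])
    fix x y assume "x \<in> U" "y \<in> carrier H"
    then have "(x, y) \<in> U \<times> V" using UV(3) by (auto simp: topspace_T)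
    then have "(x, y) \<in> ?W" using UV(4) by (rule subsetD[rotated])
    then show "norm (F (x, y) - F (x0, y)) < e" by simp
  qed
qed

lemma uniformly_cont:
  assumes f: "cont f" and e: "e > 0"
  obtains U where "openin T U" "\<one> \<in> U"
    "\<And>u y. u \<in> U \<Longrightarrow> y \<in> carrier H \<Longrightarrow> norm (f (y \<otimes> u) - f y) < e"
proof -
  have "continuous_map (prod_topology T T) euclidean (\<lambda>p. f (snd p \<otimes> fst p))"
    by (rule cont_compT[OF _ f]) (intro cont_mult2 continuous_map_fst continuous_map_snd)
  from tube[OF this one_closed e] obtain U where U: "openin T U" "\<one> \<in> U"
    "\<And>x y. x \<in> U \<Longrightarrow> y \<in> carrier H \<Longrightarrow> norm (f (y \<otimes> x) - f (y \<otimes> \<one>)) < e"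
    by auto
  show ?thesis by (rule that[OF U(1,2)]) (use U(3) in simp)
qed

lemma openin_carrier: "openin T U \<Longrightarrow> x \<in> U \<Longrightarrow> x \<in> carrier H"
  using openin_subset topspace_T by fastforce

lemma open_translate:
  assumes "openin T U" "t \<in> carrier H"
  shows "openin T {x \<in> carrier H. x \<otimes> t \<in> U}"
proof -
  have "continuous_map T T (\<lambda>x. x \<otimes> t)" using assms by (intro cont_mult2 cont_constT) auto
  from openin_continuous_map_preimage[OF this assms(1)] show ?thesis by (simp add: topspace_T)
qed

text \<open>The factor \<open>inv x \<otimes> u\<close> moves any \<open>x\<close> into
  \<open>U\<close>, so the preimages of \<open>U\<close> under translations form an open cover, and
  compactness leaves finitely many of them.\<close>

lemma finite_translates:
  assumes U: "openin T U" "U \<noteq> {}"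
  obtains F where "finite F" "F \<subseteq> carrier H" "\<And>x. x \<in> carrier H \<Longrightarrow> \<exists>s\<in>F. x \<otimes> s \<in> U"
proof -
  obtain u where u: "u \<in> U" "u \<in> carrier H" using U openin_carrier by blast
  let ?C = "(\<lambda>s. {x \<in> carrier H. x \<otimes> s \<in> U}) ` carrier H"
  have "topspace T \<subseteq> \<Union>?C"
  proof
    fix x assume "x \<in> topspace T"
    then have x: "x \<in> carrier H" by (simp add: topspace_T)
    then have "x \<otimes> (inv x \<otimes> u) \<in> U" using u by (simp add: m_assoc[symmetric])
    moreover have "inv x \<otimes> u \<in> carrier H" using x u by simp
    ultimately show "x \<in> \<Union>?C" using x by blast
  qed
  moreover have "\<forall>U\<in>?C. openin T U" using open_translate U(1) by blast
  ultimately obtain D where D: "finite D" "D \<subseteq> ?C" "topspace T \<subseteq> \<Union>D"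
    using compact_T[unfolded compact_space_alt, rule_format, of ?C] by blast
  obtain F where "F \<subseteq> carrier H" "finite F" "D = (\<lambda>s. {x \<in> carrier H. x \<otimes> s \<in> U}) ` F"
    using finite_subset_image[OF D(1,2)] by blast
  with D(3) show ?thesis by (intro that[of F]) (auto simp: topspace_T)
qed

section \<open>Equicontinuity and uniformly convergent subsequences\<close>

definition equicont :: "('i \<Rightarrow> 'a \<Rightarrow> complex) \<Rightarrow> bool" where
  "equicont F \<longleftrightarrow> (\<forall>e>0. \<exists>U. openin T U \<and> \<one> \<in> U \<and>
     (\<forall>i. \<forall>u\<in>U. \<forall>y\<in>carrier H. norm (F i (y \<otimes> u) - F i y) \<le> e))"

lemma equicontD:
  assumes "equicont F" "e > 0"
  obtains U where "openin T U" "\<one> \<in> U"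
    "\<And>i u y. u \<in> U \<Longrightarrow> y \<in> carrier H \<Longrightarrow> norm (F i (y \<otimes> u) - F i y) \<le> e"
proof -
  obtain U where "openin T U \<and> \<one> \<in> U \<and>
     (\<forall>i. \<forall>u\<in>U. \<forall>y\<in>carrier H. norm (F i (y \<otimes> u) - F i y) \<le> e)"
    using assms(1)[unfolded equicont_def, rule_format, OF assms(2)] by (rule exE)
  then show ?thesis by (intro that[of U]) auto
qed

lemma open_nbhd:
  assumes "openin T U" "\<one> \<in> U" "y \<in> carrier H"
  shows "openin T {x \<in> carrier H. x \<otimes> inv y \<in> U}" "y \<in> {x \<in> carrier H. x \<otimes> inv y \<in> U}"
  using assms open_translate[of U "inv y"] by auto

lemma equicont_imp_cont:
  assumes "equicont F"
  shows "cont (F i)"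
  unfolding Met_TC.continuous_map_to_metric[of T, unfolded mtopology_is_euclidean mball_eq_ball]
proof (intro ballI allI impI)
  fix x and e :: real assume x: "x \<in> topspace T" and e: "e > 0"
  obtain U where U: "openin T U" "\<one> \<in> U"
    "\<And>i u y. u \<in> U \<Longrightarrow> y \<in> carrier H \<Longrightarrow> norm (F i (y \<otimes> u) - F i y) \<le> e / 2"
    using equicontD[OF assms, of "e/2"] e by auto
  have x': "x \<in> carrier H" using x by (simp add: topspace_T)
  let ?V = "{z \<in> carrier H. z \<otimes> inv x \<in> U}"
  have "F i z \<in> ball (F i x) e" if "z \<in> ?V" for z
  proof -
    have "norm (F i (x \<otimes> (z \<otimes> inv x)) - F i x) \<le> e / 2" using U(3) that x' by blast
    moreover have "x \<otimes> (z \<otimes> inv x) = z" using that x' by (simp add: m_comm[of x] m_assoc)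
    ultimately show ?thesis using e by (simp add: dist_norm norm_minus_commute)
  qed
  then show "\<exists>V. openin T V \<and> x \<in> V \<and> (\<forall>z\<in>V. F i z \<in> ball (F i x) e)"
    using open_nbhd[OF U(1,2) x'] by blast
qed

text \<open>A diagonal subsequence converges on the countable set \<open>D\<close>, which holds for
  every tolerance \<open>e m\<close> finitely many points such that each \<open>x\<close> is a small
  translate of one of them. Equicontinuity then spreads convergence on \<open>D\<close> to uniform
  convergence.\<close>

lemma Arzela_Ascoli_sequence:
  fixes F :: "nat \<Rightarrow> 'a \<Rightarrow> complex"
  assumes F: "equicont F" and B: "\<And>n x. x \<in> carrier H \<Longrightarrow> norm (F n x) \<le> B"
  obtains r g where "strict_mono (r :: nat \<Rightarrow> nat)" "cont g"
    "uniform_limit (carrier H) (\<lambda>n. F (r n)) g sequentially"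
proof -
  define e :: "nat \<Rightarrow> real" where "e m = 1 / real (Suc m)" for m
  have e: "e m > 0" for m by (simp add: e_def)
  have "\<exists>U X. finite X \<and> X \<subseteq> carrier H \<and> (\<forall>x\<in>carrier H. \<exists>s\<in>X. x \<otimes> s \<in> U) \<and>
      (\<forall>i. \<forall>u\<in>U. \<forall>y\<in>carrier H. norm (F i (y \<otimes> u) - F i y) \<le> e m)" for m
  proof -
    obtain U where U: "openin T U" "\<one> \<in> U"
      "\<And>i u y. u \<in> U \<Longrightarrow> y \<in> carrier H \<Longrightarrow> norm (F i (y \<otimes> u) - F i y) \<le> e m"
      using equicontD[OF F e] by blast
    from U(2) have "U \<noteq> {}" by auto
    from finite_translates[OF U(1) this] obtain X where "finite X" "X \<subseteq> carrier H"
       "\<And>x. x \<in> carrier H \<Longrightarrow> \<exists>s\<in>X. x \<otimes> s \<in> U" by blast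
    with U(3) show ?thesis by (intro exI[of _ U] exI[of _ X]) simp
  qed
  then obtain U X where X: "\<And>m. finite (X m)" "\<And>m. X m \<subseteq> carrier H"
    and cover: "\<And>m x. x \<in> carrier H \<Longrightarrow> \<exists>s\<in>X m. x \<otimes> s \<in> U m"
    and near: "\<And>m i u y. u \<in> U m \<Longrightarrow> y \<in> carrier H \<Longrightarrow> norm (F i (y \<otimes> u) - F i y) \<le> e m"
    by metis
  \<comment> \<open>Inverses appear because \<open>x \<otimes> s \<in> U m\<close> says that
    \<open>x\<close> arises from \<open>inv s\<close> by a translation in
    \<open>U m\<close>.\<close>
  define D where "D = (\<Union>m. (\<lambda>s. inv s) ` X m)"
  have "countable D" unfolding D_def using X(1) by (simp add: countable_finite)
  have D: "D \<subseteq> carrier H" unfolding D_def using X(2) by auto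
  obtain r where r: "strict_mono (r :: nat \<Rightarrow> nat)"
    and conv: "\<And>x. x \<in> D \<Longrightarrow> \<exists>l. (\<lambda>n. F (r n) x) \<longlonglongrightarrow> l"
    using function_convergent_subsequence[OF \<open>countable D\<close>, of F B] B D by blast
  have "uniformly_Cauchy_on (carrier H) (\<lambda>n. F (r n))"
    unfolding uniformly_Cauchy_on_def
  proof (intro allI impI)
    fix d :: real assume d: "d > 0"
    obtain m where m: "e m < d / 3"
      using reals_Archimedean[of "d/3"] d by (auto simp: e_def inverse_eq_divide)
    have "\<forall>s\<in>X m. \<exists>N. \<forall>i\<ge>N. \<forall>j\<ge>N. norm (F (r i) (inv s) - F (r j) (inv s)) < d / 3"
    proof
      fix s assume "s \<in> X m"
      then have "inv s \<in> D" by (auto simp: D_def)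
      then have "Cauchy (\<lambda>n. F (r n) (inv s))" using conv convergent_eq_Cauchy by blast
      then show "\<exists>N. \<forall>i\<ge>N. \<forall>j\<ge>N. norm (F (r i) (inv s) - F (r j) (inv s)) < d / 3"
        using d unfolding Cauchy_def dist_norm by (meson divide_pos_pos zero_less_numeral)
    qed
    then obtain N where N: "\<And>s i j. s \<in> X m \<Longrightarrow> i \<ge> N s \<Longrightarrow> j \<ge> N s \<Longrightarrow>
        norm (F (r i) (inv s) - F (r j) (inv s)) < d / 3" by metis
    define M where "M = (\<Sum>s\<in>X m. N s)"
    have M: "N s \<le> M" if "s \<in> X m" for s
      unfolding M_def using X(1) that by (intro member_le_sum) auto
    have "dist (F (r i) x) (F (r j) x) < d" if "x \<in> carrier H" "i \<ge> M" "j \<ge> M" for x i j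
    proof -
      obtain s where s: "s \<in> X m" "x \<otimes> s \<in> U m" using cover \<open>x \<in> carrier H\<close> by blast
      have s': "s \<in> carrier H" using s X by blast
      have "inv s \<otimes> (x \<otimes> s) = x" using s' that(1) by (simp add: m_comm[of x] m_assoc[symmetric])
      then have near': "norm (F k x - F k (inv s)) \<le> e m" for k
        using near[OF s(2), of "inv s" k] s' by simp
      have "norm (F (r i) (inv s) - F (r j) (inv s)) < d / 3"
        using N s M that by (meson order_trans)
      then have "dist (F (r i) (inv s)) (F (r j) (inv s)) < d / 3" by (simp add: dist_norm)
      moreover have "dist (F (r i) x) (F (r i) (inv s)) \<le> e m" "dist (F (r j) (inv s)) (F (r j) x) \<le> e m"
        using near'[of "r i"] near'[of "r j"] by (simp_all add: dist_norm norm_minus_commute)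
      ultimately show ?thesis
        using m dist_triangle[of "F (r i) x" "F (r j) x" "F (r i) (inv s)"]
          dist_triangle[of "F (r i) (inv s)" "F (r j) x" "F (r j) (inv s)"] by linarith
    qed
    then show "\<exists>M. \<forall>x\<in>carrier H. \<forall>i\<ge>M. \<forall>j\<ge>M. dist (F (r i) x) (F (r j) x) < d" by blast
  qed
  then obtain g where g: "uniform_limit (carrier H) (\<lambda>n. F (r n)) g sequentially"
    using Cauchy_uniformly_convergent uniformly_convergent_on_def by blast
  \<comment> \<open>The limit is treated as a family with one member, so that its continuity follows
    once equicontinuity is passed to the limit.\<close>
  have "equicont (\<lambda>i::unit. g)"
    unfolding equicont_def
  proof (intro allI impI)
    fix d :: real assume "d > 0"
    then obtain V where V: "openin T V" "\<one> \<in> V"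
      "\<And>i u y. u \<in> V \<Longrightarrow> y \<in> carrier H \<Longrightarrow> norm (F i (y \<otimes> u) - F i y) \<le> d"
      using equicontD[OF F] by metis
    have "norm (g (y \<otimes> u) - g y) \<le> d" if "u \<in> V" "y \<in> carrier H" for u y
    proof (rule LIMSEQ_le_const2[OF tendsto_norm[OF tendsto_diff]])
      have "u \<in> carrier H" using V(1) that openin_carrier by blast
      then show "(\<lambda>n. F (r n) (y \<otimes> u)) \<longlonglongrightarrow> g (y \<otimes> u)" "(\<lambda>n. F (r n) y) \<longlonglongrightarrow> g y"
        using tendsto_uniform_limitI[OF g] that by auto
    qed (use V(3) that in blast)
    with V(1,2) show "\<exists>U. openin T U \<and> \<one> \<in> U \<and>
        (\<forall>i::unit. \<forall>u\<in>U. \<forall>y\<in>carrier H. norm (g (y \<otimes> u) - g y) \<le> d)" by (intro exI[of _ V]) simp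
  qed
  then have "cont g" by (rule equicont_imp_cont)
  with that r g show ?thesis by blast
qed

section \<open>The invariant mean\<close>

definition shift :: "'a \<Rightarrow> ('a \<Rightarrow> complex) \<Rightarrow> 'a \<Rightarrow> complex" where
  "shift t = (\<lambda>f x. f (x \<otimes> t))"

definition mid :: "(('a \<Rightarrow> complex) \<Rightarrow> 'a \<Rightarrow> complex) \<Rightarrow> (('a \<Rightarrow> complex) \<Rightarrow> 'a \<Rightarrow> complex) \<Rightarrow>
    ('a \<Rightarrow> complex) \<Rightarrow> 'a \<Rightarrow> complex" where
  "mid A B = (\<lambda>f x. (A f x + B f x) / 2)"

text \<open>On the carrier these operators are the convex combinations of translations with dyadic
  coefficients. Midpoints avoid explicit weights, and closure under composition allows an average of
  an average.\<close>

inductive_set avg :: "(('a \<Rightarrow> complex) \<Rightarrow> 'a \<Rightarrow> complex) set" where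
  translation: "t \<in> carrier H \<Longrightarrow> shift t \<in> avg"
| midpoint: "A \<in> avg \<Longrightarrow> B \<in> avg \<Longrightarrow> mid A B \<in> avg"
| comp: "A \<in> avg \<Longrightarrow> B \<in> avg \<Longrightarrow> A \<circ> B \<in> avg"

lemmas avg_simps = shift_def mid_def o_def

lemma avg_cong:
  "A \<in> avg \<Longrightarrow> (\<And>x. x \<in> carrier H \<Longrightarrow> f x = g x) \<Longrightarrow> x \<in> carrier H \<Longrightarrow> A f x = A g x"
proof (induction arbitrary: f g x rule: avg.induct)
  case (translation t)
  show ?case unfolding shift_def by (rule translation(2)) (use translation in simp)
next
  case (midpoint A B)
  have "A f x = A g x" "B f x = B g x" by (rule midpoint.IH; use midpoint.prems in simp)+
  then show ?case by (simp add: mid_def)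
next
  case (comp A B)
  have "A (B f) x = A (B g) x"
    by (rule comp.IH(1), rule comp.IH(2)) (use comp.prems in simp_all)
  then show ?case by simp
qed

lemma avg_add: "A \<in> avg \<Longrightarrow> A (\<lambda>x. f x + g x) = (\<lambda>x. A f x + A g x)"
  by (induction arbitrary: f g rule: avg.induct) (auto simp: avg_simps add_divide_distrib)

lemma avg_scale: "A \<in> avg \<Longrightarrow> A (\<lambda>x. c * f x) = (\<lambda>x. c * A f x)"
  by (induction arbitrary: f rule: avg.induct) (auto simp: avg_simps algebra_simps)

lemma avg_const: "A \<in> avg \<Longrightarrow> A (\<lambda>x. c) = (\<lambda>x. c)"
  by (induction rule: avg.induct) (auto simp: avg_simps)

lemma avg_diff: "A \<in> avg \<Longrightarrow> A (\<lambda>x. f x - g x) = (\<lambda>x. A f x - A g x)"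
  using avg_add[of A f "\<lambda>x. -1 * g x"] avg_scale[of A "-1" g] by simp

lemma avg_convex:
  "A \<in> avg \<Longrightarrow> convex K \<Longrightarrow> (\<And>x. x \<in> carrier H \<Longrightarrow> f x \<in> K) \<Longrightarrow> x \<in> carrier H \<Longrightarrow> A f x \<in> K"
proof (induction arbitrary: f x rule: avg.induct)
  case (midpoint A B)
  then have "(1/2) *\<^sub>R A f x + (1/2) *\<^sub>R B f x \<in> K" by (intro convexD) auto
  then show ?case by (simp add: mid_def scaleR_conv_of_real add_divide_distrib)
qed (auto simp: avg_simps)

lemma avg_norm_le:
  assumes "A \<in> avg" "\<And>x. x \<in> carrier H \<Longrightarrow> norm (f x) \<le> b" "x \<in> carrier H"
  shows "norm (A f x) \<le> b"
  using avg_convex[OF assms(1) convex_cball[of 0 b], of f x] assms(2,3) by simp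

lemma avg_Re_ge:
  assumes "A \<in> avg" "\<And>x. x \<in> carrier H \<Longrightarrow> b \<le> Re (f x)" "x \<in> carrier H"
  shows "b \<le> Re (A f x)"
  using avg_convex[OF assms(1) convex_halfspace_Re_ge[of b], of f x] assms(2,3) by simp

lemma avg_Re_le:
  assumes "A \<in> avg" "\<And>x. x \<in> carrier H \<Longrightarrow> Re (f x) \<le> b" "x \<in> carrier H"
  shows "Re (A f x) \<le> b"
  using avg_convex[OF assms(1) convex_halfspace_Re_le[of b], of f x] assms(2,3) by simp

lemma avg_cont: "A \<in> avg \<Longrightarrow> cont f \<Longrightarrow> cont (A f)"
proof (induction arbitrary: f rule: avg.induct)
  case (midpoint A B)
  then have "cont (\<lambda>x. (1/2) * (A f x + B f x))" by (intro cont_intros) auto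
  then show ?case by (simp add: mid_def)
qed (auto simp: avg_simps intro: cont_translate)

lemma avg_translate:
  "A \<in> avg \<Longrightarrow> t \<in> carrier H \<Longrightarrow> x \<in> carrier H \<Longrightarrow> A (\<lambda>y. f (y \<otimes> t)) x = A f (x \<otimes> t)"
proof (induction arbitrary: f x rule: avg.induct)
  case (translation s)
  then show ?case by (simp add: shift_def m_assoc m_comm[of s t])
next
  case (comp A B)
  have "A (B (\<lambda>y. f (y \<otimes> t))) x = A (\<lambda>y. B f (y \<otimes> t)) x"
    by (rule avg_cong) (use comp in auto)
  with comp show ?case by (simp add: o_def)
qed (auto simp: mid_def)

text \<open>Rests on the commutativity of \<open>H\<close>. An average suited to one function and an
  average suited to another can be composed into one that is suited to both, since each may be taken
  to act first.\<close>

lemma avg_commute: "B \<in> avg \<Longrightarrow> A \<in> avg \<Longrightarrow> x \<in> carrier H \<Longrightarrow> A (B f) x = B (A f) x"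
proof (induction arbitrary: f x rule: avg.induct)
  case (translation t)
  then show ?case by (simp add: shift_def avg_translate)
next
  case (midpoint B C)
  have "A (\<lambda>x. (B f x + C f x) / 2) = (\<lambda>x. (A (B f) x + A (C f) x) / 2)"
    using avg_scale[OF midpoint(5), of "1/2" "\<lambda>x. B f x + C f x"] avg_add[OF midpoint(5)] by simp
  with midpoint show ?case by (simp add: mid_def)
next
  case (comp B C)
  then show ?case using avg_cong[of B "A (C f)" "C (A f)" x] by (simp add: o_def)
qed

text \<open>Averages commute with translations and do not increase the supremum norm, so every
  average of \<open>f\<close> inherits the modulus of continuity of \<open>f\<close>.\<close>

lemma avg_equicont:
  assumes "\<And>i. A i \<in> avg" and f: "cont f"
  shows "equicont (\<lambda>i. A i f)"
  unfolding equicont_def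
proof (intro allI impI)
  fix e :: real assume "e > 0"
  then obtain U where U: "openin T U" "\<one> \<in> U"
    "\<And>u y. u \<in> U \<Longrightarrow> y \<in> carrier H \<Longrightarrow> norm (f (y \<otimes> u) - f y) < e"
    using uniformly_cont[OF f] by blast
  have "norm (A i f (y \<otimes> u) - A i f y) \<le> e" if "u \<in> U" "y \<in> carrier H" for i u y
  proof -
    have u: "u \<in> carrier H" using U(1) that openin_carrier by blast
    have "A i f (y \<otimes> u) - A i f y = A i (\<lambda>y. f (y \<otimes> u) - f y) y"
      using avg_translate[OF assms(1) u that(2)] by (simp add: avg_diff[OF assms(1)])
    then show ?thesis using avg_norm_le[OF assms(1), of "\<lambda>y. f (y \<otimes> u) - f y" e y i] U(3) that
      by (simp add: less_imp_le)
  qed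
  with U(1,2) show "\<exists>U. openin T U \<and> \<one> \<in> U \<and>
      (\<forall>i. \<forall>u\<in>U. \<forall>y\<in>carrier H. norm (A i f (y \<otimes> u) - A i f y) \<le> e)" by (intro exI[of _ U]) simp
qed

text \<open>Finitely many translates of \<open>U\<close> cover the group, so an average over them
  sees \<open>U\<close> from every point. \<open>A\<close> and \<open>d\<close> depend on
  \<open>U\<close> alone.\<close>

lemma avg_spread:
  assumes U: "openin T U" "U \<noteq> {}"
  shows "\<exists>A\<in>avg. \<exists>d>0. \<forall>c f. c \<ge> 0 \<longrightarrow> (\<forall>x\<in>carrier H. Re (f x) \<ge> 0) \<longrightarrow> (\<forall>x\<in>U. Re (f x) \<ge> c) \<longrightarrow>
    (\<forall>x\<in>carrier H. Re (A f x) \<ge> d * c)"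
proof -
  obtain F where F: "finite F" "F \<subseteq> carrier H" "\<And>x. x \<in> carrier H \<Longrightarrow> \<exists>s\<in>F. x \<otimes> s \<in> U"
    using finite_translates[OF U] by blast
  have "\<exists>A\<in>avg. \<exists>d>0. \<forall>c f x. c \<ge> 0 \<longrightarrow> (\<forall>x\<in>carrier H. Re (f x) \<ge> 0) \<longrightarrow> (\<forall>x\<in>U. Re (f x) \<ge> c) \<longrightarrow>
      x \<in> carrier H \<longrightarrow> (\<exists>s\<in>F. x \<otimes> s \<in> U) \<longrightarrow> Re (A f x) \<ge> d * c"
    using F(1,2)
  proof (induction F rule: finite_induct)
    case empty
    show ?case by (intro bexI[OF _ avg.translation[OF one_closed]] exI[of _ 1]) simp
  next
    case (insert t F)
    then obtain A d where A: "A \<in> avg" and d: "d > 0"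
      and *: "\<forall>c f x. c \<ge> 0 \<longrightarrow> (\<forall>x\<in>carrier H. Re (f x) \<ge> 0) \<longrightarrow> (\<forall>x\<in>U. Re (f x) \<ge> c) \<longrightarrow>
      x \<in> carrier H \<longrightarrow> (\<exists>s\<in>F. x \<otimes> s \<in> U) \<longrightarrow> Re (A f x) \<ge> d * c" by auto
    have t: "t \<in> carrier H" using insert by simp
    \<comment> \<open>A point covered by the earlier translates gets at least \<open>d * c\<close>
      from the first summand, a point covered by \<open>t\<close> gets at least \<open>c\<close>
      from the second, and the other summand is nonnegative; halving explains
      \<open>min d 1 / 2\<close>.\<close>
    let ?A = "\<lambda>f x. (A f x + f (x \<otimes> t)) / 2"
    have "?A \<in> avg" using avg.midpoint[OF A avg.translation[OF t]] by (simp add: avg_simps)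
    moreover have "Re (?A f x) \<ge> (min d 1 / 2) * c"
      if c: "c \<ge> 0" and f0: "\<forall>x\<in>carrier H. Re (f x) \<ge> 0" and fc: "\<forall>x\<in>U. Re (f x) \<ge> c"
        and x: "x \<in> carrier H" and s: "\<exists>s\<in>insert t F. x \<otimes> s \<in> U" for c f x
    proof -
      have 1: "Re (A f x) \<ge> 0" using avg_Re_ge[OF A, of 0 f x] f0 x by blast
      have 2: "Re (f (x \<otimes> t)) \<ge> 0" using f0 t x by simp
      have 3: "min d 1 * c \<le> d * c" "min d 1 * c \<le> c" using c d
        by (auto intro: mult_right_mono mult_left_le_one_le)
      have "Re (A f x) \<ge> d * c \<or> Re (f (x \<otimes> t)) \<ge> c" using s *[rule_format, OF c _ _ x] f0 fc by auto
      with 1 2 3 show ?thesis by auto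
    qed
    moreover have "min d 1 / 2 > 0" using d by simp
    ultimately show ?case by (intro bexI[of _ ?A] exI[of _ "min d 1 / 2"]) simp_all
  qed
  then obtain A d where A: "A \<in> avg" "d > 0" and *: "\<forall>c f x. c \<ge> 0 \<longrightarrow> (\<forall>x\<in>carrier H. Re (f x) \<ge> 0) \<longrightarrow>
      (\<forall>x\<in>U. Re (f x) \<ge> c) \<longrightarrow> x \<in> carrier H \<longrightarrow> (\<exists>s\<in>F. x \<otimes> s \<in> U) \<longrightarrow> Re (A f x) \<ge> d * c"
    by auto
  show ?thesis by (intro bexI[OF _ A(1)] exI[of _ d] conjI[OF A(2)]) (use * F(3) in simp)
qed

definition has_mean :: "('a \<Rightarrow> complex) \<Rightarrow> complex \<Rightarrow> bool" where
  "has_mean f m \<longleftrightarrow> (\<forall>e>0. \<exists>A\<in>avg. \<forall>x\<in>carrier H. norm (A f x - m) \<le> e)"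

text \<open>On continuous functions this is the Haar integral. Without a constant as in
  \<open>has_mean\<close> the value is unspecified, hence the continuity hypotheses in its
  rules.\<close>

definition mean :: "('a \<Rightarrow> complex) \<Rightarrow> complex" where
  "mean f = (THE m. has_mean f m)"

lemma has_meanD:
  assumes "has_mean f m" "e > 0"
  obtains A where "A \<in> avg" "\<And>x. x \<in> carrier H \<Longrightarrow> norm (A f x - m) \<le> e"
  using assms(1)[unfolded has_mean_def, rule_format, OF assms(2)] by auto

lemma avg_close:
  assumes A: "A \<in> avg" and "\<And>x. x \<in> carrier H \<Longrightarrow> norm (f x - m) \<le> e" and x: "x \<in> carrier H"
  shows "norm (A f x - m) \<le> e"
  using avg_norm_le[OF A, of "\<lambda>x. f x - m" e x] assms(2) x by (simp add: avg_diff[OF A] avg_const[OF A])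

text \<open>Averaging a nearly constant function does not move the constant, so
  \<open>A (B f)\<close> is near \<open>n\<close>; being equal to \<open>B (A f)\<close>, it is near
  \<open>m\<close> as well.\<close>

lemma has_mean_unique:
  assumes "has_mean f m" "has_mean f n"
  shows "m = n"
proof (rule ccontr)
  assume "m \<noteq> n"
  then have e: "norm (m - n) / 3 > 0" by simp
  obtain A where A: "A \<in> avg" "\<And>x. x \<in> carrier H \<Longrightarrow> norm (A f x - m) \<le> norm (m - n) / 3"
    using has_meanD[OF assms(1) e] by auto
  obtain B where B: "B \<in> avg" "\<And>x. x \<in> carrier H \<Longrightarrow> norm (B f x - n) \<le> norm (m - n) / 3"
    using has_meanD[OF assms(2) e] by auto
  have "norm (A (B f) \<one> - n) \<le> norm (m - n) / 3" by (rule avg_close[OF A(1) B(2)]) auto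
  moreover have "norm (B (A f) \<one> - m) \<le> norm (m - n) / 3" by (rule avg_close[OF B(1) A(2)]) auto
  ultimately have "norm ((A (B f) \<one> - n) - (A (B f) \<one> - m)) \<le> norm (m - n) / 3 + norm (m - n) / 3"
    using avg_commute[OF B(1) A(1) one_closed] norm_triangle_ineq4 by (metis add_mono order_trans)
  then show False using \<open>m \<noteq> n\<close> by simp
qed

lemma mean_eqI: "has_mean f m \<Longrightarrow> mean f = m"
  unfolding mean_def using has_mean_unique by (blast intro: the_equality)

text \<open>Among the real parts of averages of \<open>f\<close>, a uniform limit with least upper bound must be
  constant: otherwise averaging over finitely many translates would lower the bound.\<close>
lemma Re_mean_exists:
  assumes f: "cont f"
  shows "\<exists>p. \<forall>e>0. \<exists>A\<in>avg. \<forall>x\<in>carrier H. \<bar>Re (A f x) - p\<bar> \<le> e"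
proof -
  obtain b where b: "\<And>x. x \<in> carrier H \<Longrightarrow> norm (f x) \<le> b" using cont_bounded[OF f] by auto
  define S where "S = {c. \<exists>A\<in>avg. \<forall>x\<in>carrier H. Re (A f x) \<le> c}"
  define p where "p = Inf S"
  have lower: "- b \<le> c" if c: "c \<in> S" for c
  proof -
    obtain A where A: "A \<in> avg" "\<forall>x\<in>carrier H. Re (A f x) \<le> c" using c by (auto simp: S_def)
    have "norm (A f \<one>) \<le> b" by (rule avg_norm_le[OF A(1) b]) auto
    then show ?thesis using A(2) abs_Re_le_cmod[of "A f \<one>"] one_closed by fastforce
  qed
  have "b \<in> S" unfolding S_def
    using avg.translation[OF one_closed] b by (auto intro!: bexI[of _ "shift \<one>"] order_trans[OF complex_Re_le_cmod] simp: shift_def)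
  have bdd: "bdd_below S" using lower by (rule bdd_belowI)
  have p_le: "p \<le> c" if "c \<in> S" for c unfolding p_def using bdd that by (rule cInf_lower[rotated])
  have "\<exists>A\<in>avg. \<forall>x\<in>carrier H. Re (A f x) \<le> p + 1 / real (Suc n)" for n
  proof -
    have "\<exists>c\<in>S. c < p + 1 / real (Suc n)"
      unfolding p_def by (rule cInf_lessD) (use \<open>b \<in> S\<close> in auto)
    then show ?thesis unfolding S_def by force
  qed
  then obtain A where A: "\<And>n. A n \<in> avg" and Ap: "\<And>n x. x \<in> carrier H \<Longrightarrow> Re (A n f x) \<le> p + 1 / real (Suc n)"
    by metis
  obtain r g where r: "strict_mono (r :: nat \<Rightarrow> nat)" and g: "cont g"
    and lim: "uniform_limit (carrier H) (\<lambda>n. A (r n) f) g sequentially"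
    by (rule Arzela_Ascoli_sequence[OF avg_equicont[OF A f] avg_norm_le[OF A b]]) auto
  have lim': "\<exists>N. \<forall>n\<ge>N. \<forall>x\<in>carrier H. norm (A (r n) f x - g x) < e" if "e > 0" for e
    using lim that unfolding uniform_limit_sequentially_iff dist_norm by blast
  have g_le: "Re (g x) \<le> p" if x: "x \<in> carrier H" for x
  proof (rule LIMSEQ_le)
    show "(\<lambda>n. Re (A (r n) f x)) \<longlonglongrightarrow> Re (g x)"
      using tendsto_uniform_limitI[OF lim x] by (rule tendsto_Re)
    have "(\<lambda>n. p + 1 / real (Suc n)) \<longlonglongrightarrow> p + 0"
      by (intro tendsto_add tendsto_const LIMSEQ_Suc[OF lim_1_over_n])
    from LIMSEQ_subseq_LIMSEQ[OF this r] show "(\<lambda>n. p + 1 / real (Suc (r n))) \<longlonglongrightarrow> p" by (simp add: o_def)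
    show "\<exists>N. \<forall>n\<ge>N. Re (A (r n) f x) \<le> p + 1 / real (Suc (r n))" using Ap x by auto
  qed
  have g_eq: "Re (g z) = p" if z: "z \<in> carrier H" for z
  proof (rule ccontr)
    assume "Re (g z) \<noteq> p"
    with g_le[OF z] have lt: "Re (g z) < p" by simp
    \<comment> \<open>On \<open>?U\<close> the nonnegative function \<open>p - Re g\<close> exceeds
      half of its value at \<open>z\<close>; averaging spreads this deficit to all of
      \<open>H\<close>, with size \<open>d * c\<close>.\<close>
    define c where "c = (p - Re (g z)) / 2"
    have c: "c > 0" using lt by (simp add: c_def)
    let ?U = "{x \<in> topspace T. Re (g x) \<in> {..<p - c}}"
    have U: "openin T ?U" by (rule openin_continuous_map_preimage[OF continuous_map_Re[OF g]]) simp
    have "z \<in> ?U" using z lt by (auto simp: topspace_T c_def field_simps)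
    then have "?U \<noteq> {}" by blast
    from avg_spread[OF U this] obtain B d where B: "B \<in> avg" "d > 0"
      and *: "\<forall>c f. c \<ge> 0 \<longrightarrow> (\<forall>x\<in>carrier H. Re (f x) \<ge> 0) \<longrightarrow> (\<forall>x\<in>?U. Re (f x) \<ge> c) \<longrightarrow>
         (\<forall>x\<in>carrier H. Re (B f x) \<ge> d * c)"
      by (elim bexE exE conjE)
    have Bg: "Re (B g x) \<le> p - d * c" if x: "x \<in> carrier H" for x
    proof -
      have "d * c \<le> Re (B (\<lambda>x. complex_of_real p - g x) x)"
        by (rule *[rule_format, OF less_imp_le[OF c] _ _ x]) (use g_le in auto)
      then show ?thesis by (simp add: avg_diff[OF B(1)] avg_const[OF B(1)])
    qed
    \<comment> \<open>Half of the deficit pays for replacing \<open>g\<close> by an actual average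
      of \<open>f\<close>; the other half still undercuts the infimum \<open>p\<close>.\<close>
    have dc: "d * c / 2 > 0" using B c by simp
    then obtain n where n: "\<And>x. x \<in> carrier H \<Longrightarrow> norm (A (r n) f x - g x) < d * c / 2"
      using lim' by blast
    have "Re (B (A (r n) f) x) \<le> p - d * c / 2" if x: "x \<in> carrier H" for x
    proof -
      have "norm (B (\<lambda>x. A (r n) f x - g x) x) \<le> d * c / 2"
        by (rule avg_norm_le[OF B(1) _ x]) (use n in \<open>simp add: less_imp_le\<close>)
      then have "norm (B (A (r n) f) x - B g x) \<le> d * c / 2" by (simp add: avg_diff[OF B(1)])
      then show ?thesis using Bg[OF x] complex_Re_le_cmod[of "B (A (r n) f) x - B g x"] by simp
    qed
    then have "p - d * c / 2 \<in> S" unfolding S_def using avg.comp[OF B(1) A[of "r n"]]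
      by (intro CollectI bexI[of _ "B \<circ> A (r n)"]) auto
    then show False using p_le dc by fastforce
  qed
  show ?thesis
  proof (intro exI[of _ p] allI impI)
    fix e :: real assume "e > 0"
    then obtain n where n: "\<And>x. x \<in> carrier H \<Longrightarrow> norm (A (r n) f x - g x) < e" using lim' by blast
    have "\<bar>Re (A (r n) f x) - p\<bar> \<le> e" if "x \<in> carrier H" for x
      using n[OF that] abs_Re_le_cmod[of "A (r n) f x - g x"] g_eq[OF that] by simp
    with A show "\<exists>A\<in>avg. \<forall>x\<in>carrier H. \<bar>Re (A f x) - p\<bar> \<le> e" by (intro bexI[of _ "A (r n)"]) auto
  qed
qed

text \<open>Real and imaginary parts are handled by separate averages, the imaginary part of
  \<open>f\<close> being the real part of \<open>- \<i> * f\<close>. Because averages commute, their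
  composition controls both parts at once.\<close>

lemma has_mean_exists:
  assumes f: "cont f"
  shows "\<exists>m. has_mean f m"
proof -
  obtain p where p: "\<And>e. e > 0 \<Longrightarrow> \<exists>A\<in>avg. \<forall>x\<in>carrier H. \<bar>Re (A f x) - p\<bar> \<le> e"
    using Re_mean_exists[OF f] by auto
  obtain q where q: "\<And>e. e > 0 \<Longrightarrow> \<exists>A\<in>avg. \<forall>x\<in>carrier H. \<bar>Re (A (\<lambda>x. - \<i> * f x) x) - q\<bar> \<le> e"
    using Re_mean_exists[OF continuous_map_scale[OF f, of "- \<i>"]] by auto
  have "has_mean f (Complex p q)"
    unfolding has_mean_def
  proof (intro allI impI)
    fix e :: real assume "e > 0"
    then have e: "e / 2 > 0" by simp
    obtain A where A: "A \<in> avg" "\<And>x. x \<in> carrier H \<Longrightarrow> \<bar>Re (A f x) - p\<bar> \<le> e / 2" using p[OF e] by auto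
    obtain B where B: "B \<in> avg" "\<And>x. x \<in> carrier H \<Longrightarrow> \<bar>Re (B (\<lambda>x. - \<i> * f x) x) - q\<bar> \<le> e / 2"
      using q[OF e] by auto
    have "Re (B (\<lambda>x. - \<i> * f x) x) = Im (B f x)" for x using avg_scale[OF B(1), of "- \<i>" f] by simp
    then have B': "q - e / 2 \<le> Im (B f x)" "Im (B f x) \<le> q + e / 2" if "x \<in> carrier H" for x
      using B(2)[OF that] by (simp_all only:)
    have A': "p - e / 2 \<le> Re (A f x)" "Re (A f x) \<le> p + e / 2" if "x \<in> carrier H" for x
      using A(2)[OF that] by linarith+
    have "norm ((A \<circ> B) f x - Complex p q) \<le> e" if x: "x \<in> carrier H" for x
    proof -
      have "p - e / 2 \<le> Re (B (A f) x)" by (rule avg_Re_ge[OF B(1) A'(1) x])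
      moreover have "Re (B (A f) x) \<le> p + e / 2" by (rule avg_Re_le[OF B(1) A'(2) x])
      ultimately have 1: "\<bar>Re (A (B f) x - Complex p q)\<bar> \<le> e / 2"
        using avg_commute[OF B(1) A(1) x, of f] by (simp only: minus_complex.sel complex.sel)
      have "q - e / 2 \<le> Re (A (\<lambda>x. - \<i> * B f x) x)" by (rule avg_Re_ge[OF A(1) _ x]) (use B' in simp)
      moreover have "Re (A (\<lambda>x. - \<i> * B f x) x) \<le> q + e / 2" by (rule avg_Re_le[OF A(1) _ x]) (use B' in simp)
      moreover have "Re (A (\<lambda>x. - \<i> * B f x) x) = Im (A (B f) x)"
        using avg_scale[OF A(1), of "- \<i>" "B f"] by simp
      ultimately have 2: "\<bar>Im (A (B f) x - Complex p q)\<bar> \<le> e / 2"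
        by (simp only: minus_complex.sel complex.sel)
      show ?thesis using cmod_le[of "A (B f) x - Complex p q"] 1 2 by simp
    qed
    then show "\<exists>A\<in>avg. \<forall>x\<in>carrier H. norm (A f x - Complex p q) \<le> e"
      using avg.comp[OF A(1) B(1)] by (intro bexI[of _ "A \<circ> B"]) auto
  qed
  then show ?thesis by blast
qed

lemma has_mean_mean: "cont f \<Longrightarrow> has_mean f (mean f)"
  using has_mean_exists mean_eqI by metis

lemma mean_approx:
  assumes "cont f" "e > 0"
  obtains A where "A \<in> avg" "\<And>x. x \<in> carrier H \<Longrightarrow> norm (A f x - mean f) \<le> e"
  using has_meanD[OF has_mean_mean[OF assms(1)] assms(2)] by auto

lemma mean_cong:
  assumes "cont f" "\<And>x. x \<in> carrier H \<Longrightarrow> f x = g x"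
  shows "mean g = mean f"
proof (rule mean_eqI)
  show "has_mean g (mean f)"
    unfolding has_mean_def
  proof (intro allI impI)
    fix e :: real assume "e > 0"
    then obtain A where A: "A \<in> avg" "\<And>x. x \<in> carrier H \<Longrightarrow> norm (A f x - mean f) \<le> e"
      using mean_approx[OF assms(1)] by auto
    then show "\<exists>A\<in>avg. \<forall>x\<in>carrier H. norm (A g x - mean f) \<le> e"
      using avg_cong[OF A(1), of f g] assms(2) by (intro bexI[of _ A]) auto
  qed
qed

lemma mean_const: "mean (\<lambda>x. c) = c"
proof (rule mean_eqI)
  show "has_mean (\<lambda>x. c) c"
    unfolding has_mean_def using avg.translation[OF one_closed]
    by (auto intro!: bexI[of _ "shift \<one>"] simp: shift_def)
qed

lemma mean_scale:
  assumes f: "cont f"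
  shows "mean (\<lambda>x. c * f x) = c * mean f"
proof (rule mean_eqI)
  show "has_mean (\<lambda>x. c * f x) (c * mean f)"
    unfolding has_mean_def
  proof (intro allI impI)
    fix e :: real assume e: "e > 0"
    have "e / (norm c + 1) > 0" using e by (simp add: add_nonneg_pos)
    then obtain A where A: "A \<in> avg" "\<And>x. x \<in> carrier H \<Longrightarrow> norm (A f x - mean f) \<le> e / (norm c + 1)"
      using mean_approx[OF f] by blast
    have "norm (A (\<lambda>x. c * f x) x - c * mean f) \<le> e" if x: "x \<in> carrier H" for x
    proof -
      have "norm (A (\<lambda>x. c * f x) x - c * mean f) = norm c * norm (A f x - mean f)"
        by (simp add: avg_scale[OF A(1)] right_diff_distrib[symmetric] norm_mult)
      also have "\<dots> \<le> norm c * (e / (norm c + 1))" using A(2)[OF x] by (intro mult_left_mono) auto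
      also have "\<dots> \<le> e" proof -
        have "norm c * e \<le> e * (norm c + 1)" using e by (simp add: algebra_simps)
        then show ?thesis by (simp add: pos_divide_le_eq add_nonneg_pos)
      qed
      finally show ?thesis .
    qed
    with A(1) show "\<exists>A\<in>avg. \<forall>x\<in>carrier H. norm (A (\<lambda>x. c * f x) x - c * mean f) \<le> e"
      by (intro bexI[of _ A]) auto
  qed
qed

lemma mean_add:
  assumes f: "cont f" and g: "cont g"
  shows "mean (\<lambda>x. f x + g x) = mean f + mean g"
proof (rule mean_eqI)
  show "has_mean (\<lambda>x. f x + g x) (mean f + mean g)"
    unfolding has_mean_def
  proof (intro allI impI)
    fix e :: real assume "e > 0"
    then have e: "e / 2 > 0" by simp
    obtain A where A: "A \<in> avg" "\<And>x. x \<in> carrier H \<Longrightarrow> norm (A f x - mean f) \<le> e / 2"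
      using mean_approx[OF f e] by auto
    obtain B where B: "B \<in> avg" "\<And>x. x \<in> carrier H \<Longrightarrow> norm (B g x - mean g) \<le> e / 2"
      using mean_approx[OF g e] by auto
    have "norm ((A \<circ> B) (\<lambda>x. f x + g x) x - (mean f + mean g)) \<le> e" if x: "x \<in> carrier H" for x
    proof -
      have "norm (B (A f) x - mean f) \<le> e / 2" by (rule avg_close[OF B(1) A(2) x])
      moreover have "norm (A (B g) x - mean g) \<le> e / 2" by (rule avg_close[OF A(1) B(2) x])
      moreover have "(A \<circ> B) (\<lambda>x. f x + g x) x = B (A f) x + A (B g) x"
        using avg_commute[OF B(1) A(1) x, of f] by (simp add: avg_add[OF A(1)] avg_add[OF B(1)])
      ultimately show ?thesis
        using norm_triangle_ineq[of "B (A f) x - mean f" "A (B g) x - mean g"] by (simp add: algebra_simps)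
    qed
    then show "\<exists>A\<in>avg. \<forall>x\<in>carrier H. norm (A (\<lambda>x. f x + g x) x - (mean f + mean g)) \<le> e"
      using avg.comp[OF A(1) B(1)] by (intro bexI[of _ "A \<circ> B"]) auto
  qed
qed

lemma mean_diff: "cont f \<Longrightarrow> cont g \<Longrightarrow> mean (\<lambda>x. f x - g x) = mean f - mean g"
  using mean_add[of f "\<lambda>x. -1 * g x"] mean_scale[of g "-1"] continuous_map_scale[of T g "-1"] by simp

lemma mean_sum:
  "finite I \<Longrightarrow> (\<And>i. i \<in> I \<Longrightarrow> cont (f i)) \<Longrightarrow> mean (\<lambda>x. \<Sum>i\<in>I. f i x) = (\<Sum>i\<in>I. mean (f i))"
proof (induction I rule: finite_induct)
  case (insert i I)
  then show ?case using mean_add[of "f i" "\<lambda>x. \<Sum>i\<in>I. f i x"] by (simp add: continuous_map_sum)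
qed (simp add: mean_const)

lemma mean_avg:
  assumes f: "cont f" and B: "B \<in> avg"
  shows "mean (B f) = mean f"
proof (rule mean_eqI)
  show "has_mean (B f) (mean f)"
    unfolding has_mean_def
  proof (intro allI impI)
    fix e :: real assume "e > 0"
    then obtain A where A: "A \<in> avg" "\<And>x. x \<in> carrier H \<Longrightarrow> norm (A f x - mean f) \<le> e"
      using mean_approx[OF f] by auto
    have "norm (A (B f) x - mean f) \<le> e" if x: "x \<in> carrier H" for x
      using avg_close[OF B A(2) x] avg_commute[OF B A(1) x, of f] by simp
    then show "\<exists>A\<in>avg. \<forall>x\<in>carrier H. norm (A (B f) x - mean f) \<le> e"
      using A(1) by (intro bexI[of _ A]) auto
  qed
qed

lemma mean_translate: "cont f \<Longrightarrow> t \<in> carrier H \<Longrightarrow> mean (\<lambda>x. f (x \<otimes> t)) = mean f"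
  using mean_avg[OF _ avg.translation] by (simp add: shift_def)

lemma avg_cnj: "A \<in> avg \<Longrightarrow> A (\<lambda>x. cnj (f x)) = (\<lambda>x. cnj (A f x))"
  by (induction arbitrary: f rule: avg.induct) (auto simp: avg_simps)

lemma mean_cnj:
  assumes f: "cont f"
  shows "mean (\<lambda>x. cnj (f x)) = cnj (mean f)"
proof (rule mean_eqI)
  show "has_mean (\<lambda>x. cnj (f x)) (cnj (mean f))"
    unfolding has_mean_def
  proof (intro allI impI)
    fix e :: real assume "e > 0"
    then obtain A where A: "A \<in> avg" "\<And>x. x \<in> carrier H \<Longrightarrow> norm (A f x - mean f) \<le> e"
      using mean_approx[OF f] by auto
    then show "\<exists>A\<in>avg. \<forall>x\<in>carrier H. norm (A (\<lambda>x. cnj (f x)) x - cnj (mean f)) \<le> e"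
      by (intro bexI[of _ A]) (auto simp: avg_cnj complex_cnj_diff[symmetric] simp del: complex_cnj_diff)
  qed
qed

lemma mean_norm_le:
  assumes f: "cont f" and b: "\<And>x. x \<in> carrier H \<Longrightarrow> norm (f x) \<le> b"
  shows "norm (mean f) \<le> b"
proof (rule field_le_epsilon)
  fix e :: real assume "e > 0"
  then obtain A where A: "A \<in> avg" "\<And>x. x \<in> carrier H \<Longrightarrow> norm (A f x - mean f) \<le> e"
    using mean_approx[OF f] by auto
  have "norm (A f \<one>) \<le> b" by (rule avg_norm_le[OF A(1) b]) auto
  moreover have "norm (A f \<one> - mean f) \<le> e" using A(2) by simp
  ultimately show "norm (mean f) \<le> b + e"
    using norm_triangle_ineq2[of "mean f" "A f \<one>"] by (simp add: norm_minus_commute)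
qed

lemma mean_Re_ge:
  assumes f: "cont f" and b: "\<And>x. x \<in> carrier H \<Longrightarrow> b \<le> Re (f x)"
  shows "b \<le> Re (mean f)"
proof (rule field_le_epsilon)
  fix e :: real assume "e > 0"
  then obtain A where A: "A \<in> avg" "\<And>x. x \<in> carrier H \<Longrightarrow> norm (A f x - mean f) \<le> e"
    using mean_approx[OF f] by auto
  have "b \<le> Re (A f \<one>)" by (rule avg_Re_ge[OF A(1) b]) auto
  moreover have "norm (A f \<one> - mean f) \<le> e" using A(2) by simp
  ultimately show "b \<le> Re (mean f) + e" using complex_Re_le_cmod[of "A f \<one> - mean f"] by simp
qed

text \<open>\<open>Re f\<close> stays above half of \<open>Re (f z)\<close> on an open set;
  averaging spreads a positive lower bound to the whole group and leaves the mean unchanged. This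
  makes the inner product below definite.\<close>

lemma mean_pos:
  assumes f: "cont f" and f0: "\<And>x. x \<in> carrier H \<Longrightarrow> 0 \<le> Re (f x)"
    and z: "z \<in> carrier H" "Re (f z) > 0"
  shows "Re (mean f) > 0"
proof -
  let ?U = "{x \<in> topspace T. Re (f x) \<in> {Re (f z) / 2<..}}"
  have U: "openin T ?U" by (rule openin_continuous_map_preimage[OF continuous_map_Re[OF f]]) simp
  have "z \<in> ?U" using z by (auto simp: topspace_T)
  then have "?U \<noteq> {}" by blast
  from avg_spread[OF U this] obtain B d where B: "B \<in> avg" "d > 0"
    and *: "\<forall>c f. c \<ge> 0 \<longrightarrow> (\<forall>x\<in>carrier H. Re (f x) \<ge> 0) \<longrightarrow> (\<forall>x\<in>?U. Re (f x) \<ge> c) \<longrightarrow>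
       (\<forall>x\<in>carrier H. Re (B f x) \<ge> d * c)"
    by (elim bexE exE conjE)
  have "d * (Re (f z) / 2) \<le> Re (mean (B f))"
  proof (rule mean_Re_ge[OF avg_cont[OF B(1) f]])
    fix x assume x: "x \<in> carrier H"
    show "d * (Re (f z) / 2) \<le> Re (B f x)" by (rule *[rule_format, OF _ _ _ x]) (use f0 z in auto)
  qed
  moreover have "d * (Re (f z) / 2) > 0" using B z by simp
  ultimately show ?thesis by (simp add: mean_avg[OF f B(1)])
qed

section \<open>Iterated means of functions of two variables\<close>

abbreviation cont2 :: "('a \<Rightarrow> 'a \<Rightarrow> complex) \<Rightarrow> bool" where
  "cont2 F \<equiv> continuous_map (prod_topology T T) euclidean (\<lambda>p. F (fst p) (snd p))"

lemma cont2_slice: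
  assumes F: "cont2 F"
  shows "x \<in> carrier H \<Longrightarrow> cont (\<lambda>y. F x y)" "y \<in> carrier H \<Longrightarrow> cont (\<lambda>x. F x y)"
proof -
  assume x: "x \<in> carrier H"
  have "continuous_map T (prod_topology T T) (\<lambda>y. (x, y))"
    using x by (auto simp: topspace_T intro!: continuous_map_pairedI)
  from continuous_map_compose[OF this F] show "cont (\<lambda>y. F x y)" by (simp add: o_def)
next
  assume y: "y \<in> carrier H"
  have "continuous_map T (prod_topology T T) (\<lambda>x. (x, y))"
    using y by (auto simp: topspace_T intro!: continuous_map_pairedI)
  from continuous_map_compose[OF this F] show "cont (\<lambda>x. F x y)" by (simp add: o_def)
qed

lemma cont2_swap: "cont2 F \<Longrightarrow> cont2 (\<lambda>x y. F y x)"
  using continuous_map_compose[OF continuous_map_pairedI[OF continuous_map_snd[of T T] continuous_map_fst[of T T]],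
      of euclidean "\<lambda>p. F (fst p) (snd p)"]
  by (simp add: o_def case_prod_beta)

lemma cont2_avg: "A \<in> avg \<Longrightarrow> cont2 F \<Longrightarrow> cont2 (\<lambda>x. A (F x))"
proof (induction arbitrary: F rule: avg.induct)
  case (translation t)
  have "continuous_map (prod_topology T T) (prod_topology T T) (\<lambda>p. (fst p, snd p \<otimes> t))"
    using translation by (intro continuous_map_pairedI cont_mult2 continuous_map_fst continuous_map_snd cont_constT)
  from continuous_map_compose[OF this translation(2)] show ?case by (simp add: o_def shift_def)
next
  case (midpoint A B)
  then have "cont2 (\<lambda>x y. (1/2) * (A (F x) y + B (F x) y))" by (intro cont_intros) auto
  then show ?case by (simp add: mid_def)
next
  case (comp A B)
  show ?case using comp.IH(1)[OF comp.IH(2)[OF comp.prems]] by (simp add: o_def)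
qed

text \<open>The averages found for the individual slices are composed; a further average does not
  spoil what has been reached.\<close>

lemma mean_approx_finite:
  assumes F: "cont2 F" and e: "e > 0"
  shows "finite X \<Longrightarrow> X \<subseteq> carrier H \<Longrightarrow>
    \<exists>A\<in>avg. \<forall>x\<in>X. \<forall>y\<in>carrier H. norm (A (F x) y - mean (F x)) \<le> e"
proof (induction X rule: finite_induct)
  case empty
  show ?case using avg.translation[OF one_closed] by auto
next
  case (insert z X)
  then obtain A where A: "A \<in> avg" "\<And>x y. x \<in> X \<Longrightarrow> y \<in> carrier H \<Longrightarrow> norm (A (F x) y - mean (F x)) \<le> e"
    by auto
  have z: "z \<in> carrier H" using insert by simp
  obtain B where B: "B \<in> avg" "\<And>y. y \<in> carrier H \<Longrightarrow> norm (B (F z) y - mean (F z)) \<le> e"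
    by (rule mean_approx[OF cont2_slice(1)[OF F z] e]) auto
  have "norm (B (A (F x)) y - mean (F x)) \<le> e" if "x \<in> insert z X" and y: "y \<in> carrier H" for x y
  proof (cases "x = z")
    case True
    have "norm (A (B (F z)) y - mean (F z)) \<le> e" by (rule avg_close[OF A(1) _ y]) (rule B(2))
    then show ?thesis using True avg_commute[OF B(1) A(1) y, of "F z"] by simp
  next
    case False
    then have "x \<in> X" using that by simp
    show ?thesis by (rule avg_close[OF B(1) A(2)[OF \<open>x \<in> X\<close>] y])
  qed
  then show ?case using avg.comp[OF B(1) A(1)] by (intro bexI[of _ "B \<circ> A"]) auto
qed

lemma mean_cont:
  assumes F: "cont2 F"
  shows "cont (\<lambda>x. mean (F x))"
  unfolding Met_TC.continuous_map_to_metric[of T, unfolded mtopology_is_euclidean mball_eq_ball]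
proof (intro ballI allI impI)
  fix x and e :: real assume "x \<in> topspace T" and e: "e > 0"
  then have x: "x \<in> carrier H" by (simp add: topspace_T)
  have "e / 2 > 0" using e by simp
  from tube[OF F x this] obtain U where U: "openin T U" "x \<in> U"
    "\<And>z y. z \<in> U \<Longrightarrow> y \<in> carrier H \<Longrightarrow> norm (F z y - F x y) < e / 2" by auto
  have "mean (F z) \<in> ball (mean (F x)) e" if z: "z \<in> U" for z
  proof -
    have z': "z \<in> carrier H" using U(1) z openin_carrier by blast
    have "norm (mean (\<lambda>y. F z y - F x y)) \<le> e / 2"
      by (rule mean_norm_le) (use U(3)[OF z] cont2_slice(1)[OF F] x z' in \<open>auto intro!: cont_intros less_imp_le\<close>)
    then show ?thesis
      using e by (simp add: mean_diff[OF cont2_slice(1)[OF F z'] cont2_slice(1)[OF F x]] dist_norm norm_minus_commute)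
  qed
  then show "\<exists>U. openin T U \<and> x \<in> U \<and> (\<forall>z\<in>U. mean (F z) \<in> ball (mean (F x)) e)"
    using U(1,2) by (intro exI[of _ U]) auto
qed

text \<open>By compactness every slice is uniformly close to one of finitely many, so an average for
  these finitely many serves all. Averages and means both move by at most the distance of the
  slices, hence three errors of \<open>e / 3\<close>.\<close>

lemma mean_approx_uniform:
  assumes F: "cont2 F" and e: "e > 0"
  shows "\<exists>A\<in>avg. \<forall>x\<in>carrier H. \<forall>y\<in>carrier H. norm (A (F x) y - mean (F x)) \<le> e"
proof -
  have e3: "e / 3 > 0" using e by simp
  have "\<exists>U. openin T U \<and> x \<in> U \<and> (\<forall>z\<in>U. \<forall>y\<in>carrier H. norm (F z y - F x y) < e / 3)"
    if x: "x \<in> carrier H" for x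
    by (rule tube[OF F x e3]) auto
  then obtain U where U: "\<And>x. x \<in> carrier H \<Longrightarrow> openin T (U x)" "\<And>x. x \<in> carrier H \<Longrightarrow> x \<in> U x"
    and near: "\<And>x z y. x \<in> carrier H \<Longrightarrow> z \<in> U x \<Longrightarrow> y \<in> carrier H \<Longrightarrow> norm (F z y - F x y) < e / 3"
    by metis
  have "topspace T \<subseteq> \<Union>(U ` carrier H)" using U(2) by (auto simp: topspace_T)
  moreover have "\<forall>V\<in>U ` carrier H. openin T V" using U(1) by auto
  ultimately obtain D where D: "finite D" "D \<subseteq> U ` carrier H" "topspace T \<subseteq> \<Union>D"
    using compact_T[unfolded compact_space_alt, rule_format, of "U ` carrier H"] by blast
  obtain X where X: "X \<subseteq> carrier H" "finite X" "D = U ` X"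
    using finite_subset_image[OF D(1,2)] by blast
  obtain A where A: "A \<in> avg" "\<And>x y. x \<in> X \<Longrightarrow> y \<in> carrier H \<Longrightarrow> norm (A (F x) y - mean (F x)) \<le> e / 3"
    using mean_approx_finite[OF F e3 X(2,1)] by auto
  have "norm (A (F z) y - mean (F z)) \<le> e" if z: "z \<in> carrier H" and y: "y \<in> carrier H" for z y
  proof -
    obtain x where x: "x \<in> X" "z \<in> U x" using D(3) X z by (auto simp: topspace_T)
    have x': "x \<in> carrier H" using x X by blast
    have "norm (A (\<lambda>y. F z y - F x y) y) \<le> e / 3"
      by (rule avg_norm_le[OF A(1) _ y]) (use near[OF x' x(2)] in \<open>simp add: less_imp_le\<close>)
    then have 1: "dist (A (F z) y) (A (F x) y) \<le> e / 3" by (simp add: avg_diff[OF A(1)] dist_norm)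
    have "norm (mean (\<lambda>y. F z y - F x y)) \<le> e / 3"
      by (rule mean_norm_le) (use near[OF x' x(2)] cont2_slice(1)[OF F] x' z in \<open>auto intro!: cont_intros less_imp_le\<close>)
    then have 2: "dist (mean (F x)) (mean (F z)) \<le> e / 3"
      by (simp add: mean_diff[OF cont2_slice(1)[OF F z] cont2_slice(1)[OF F x']] dist_norm norm_minus_commute)
    have 3: "dist (A (F x) y) (mean (F x)) \<le> e / 3" using A(2)[OF x(1) y] by (simp add: dist_norm)
    have "dist (A (F z) y) (mean (F z)) \<le> e"
      using 1 2 3 dist_triangle[of "A (F z) y" "mean (F z)" "A (F x) y"]
        dist_triangle[of "A (F x) y" "mean (F z)" "mean (F x)"] by linarith
    then show ?thesis by (simp add: dist_norm)
  qed
  then show ?thesis using A(1) by (intro bexI[of _ A]) auto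
qed

lemma mean_avg_swap:
  "A \<in> avg \<Longrightarrow> cont2 F \<Longrightarrow> y \<in> carrier H \<Longrightarrow> mean (\<lambda>x. A (F x) y) = A (\<lambda>y. mean (\<lambda>x. F x y)) y"
proof (induction arbitrary: F y rule: avg.induct)
  case (translation t)
  show ?case by (simp add: shift_def)
next
  case (midpoint A B)
  have c: "cont (\<lambda>x. A (F x) y)" "cont (\<lambda>x. B (F x) y)"
    using cont2_slice(2)[OF cont2_avg[OF midpoint.hyps(1) midpoint.prems(1)] midpoint.prems(2)]
      cont2_slice(2)[OF cont2_avg[OF midpoint.hyps(2) midpoint.prems(1)] midpoint.prems(2)] .
  have "mean (\<lambda>x. (1/2) * (A (F x) y + B (F x) y)) = (1/2) * (mean (\<lambda>x. A (F x) y) + mean (\<lambda>x. B (F x) y))"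
    using c by (simp only: mean_scale[OF continuous_map_add[OF c]] mean_add[OF c])
  then show ?case using midpoint by (simp add: mid_def)
next
  case (comp A B)
  have "mean (\<lambda>x. A (B (F x)) y) = A (\<lambda>y. mean (\<lambda>x. B (F x) y)) y"
    using comp.IH(1)[OF cont2_avg[OF comp.hyps(2) comp.prems(1)] comp.prems(2)] .
  also have "\<dots> = A (B (\<lambda>y. mean (\<lambda>x. F x y))) y"
    by (rule avg_cong[OF comp.hyps(1) _ comp.prems(2)]) (rule comp.IH(2)[OF comp.prems(1)])
  finally show ?case by (simp add: o_def)
qed

text \<open>One average in \<open>y\<close> approximates \<open>mean (F x)\<close> for all
  \<open>x\<close> simultaneously, and such an average passes through the mean over \<open>x\<close>
  by linearity.\<close>

lemma mean_Fubini:
  assumes F: "cont2 F"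
  shows "mean (\<lambda>x. mean (F x)) = mean (\<lambda>y. mean (\<lambda>x. F x y))"
proof (rule mean_eqI[symmetric])
  show "has_mean (\<lambda>y. mean (\<lambda>x. F x y)) (mean (\<lambda>x. mean (F x)))"
    unfolding has_mean_def
  proof (intro allI impI)
    fix e :: real assume "e > 0"
    then obtain A where A: "A \<in> avg" "\<And>x y. x \<in> carrier H \<Longrightarrow> y \<in> carrier H \<Longrightarrow> norm (A (F x) y - mean (F x)) \<le> e"
      using mean_approx_uniform[OF F] by blast
    have "norm (A (\<lambda>y. mean (\<lambda>x. F x y)) y - mean (\<lambda>x. mean (F x))) \<le> e" if y: "y \<in> carrier H" for y
    proof -
      have c: "cont (\<lambda>x. A (F x) y)" using cont2_slice(2)[OF cont2_avg[OF A(1) F] y] .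
      have "norm (mean (\<lambda>x. A (F x) y - mean (F x))) \<le> e"
        by (rule mean_norm_le[OF continuous_map_diff[OF c mean_cont[OF F]]]) (use A(2) y in auto)
      then show ?thesis by (simp add: mean_diff[OF c mean_cont[OF F]] mean_avg_swap[OF A(1) F y])
    qed
    with A(1) show "\<exists>A\<in>avg. \<forall>y\<in>carrier H.
        norm (A (\<lambda>y. mean (\<lambda>x. F x y)) y - mean (\<lambda>x. mean (F x))) \<le> e"
      by (intro bexI[of _ A]) auto
  qed
qed

section \<open>Convolution operators\<close>

text \<open>With \<open>nsq\<close>, the L2 inner product and squared norm for the Haar integral,
  used on continuous functions only.\<close>

definition ip :: "('a \<Rightarrow> complex) \<Rightarrow> ('a \<Rightarrow> complex) \<Rightarrow> complex" where
  "ip g h = mean (\<lambda>x. g x * cnj (h x))"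

definition nsq :: "('a \<Rightarrow> complex) \<Rightarrow> real" where
  "nsq g = Re (ip g g)"

lemma ip_cong:
  assumes "cont g" "cont h" "\<And>x. x \<in> carrier H \<Longrightarrow> g x = g' x" "\<And>x. x \<in> carrier H \<Longrightarrow> h x = h' x"
  shows "ip g' h' = ip g h"
  unfolding ip_def by (rule mean_cong) (use assms in \<open>auto intro!: cont_intros\<close>)

lemma ip_cnj: "cont g \<Longrightarrow> cont h \<Longrightarrow> ip h g = cnj (ip g h)"
  unfolding ip_def using mean_cnj[of "\<lambda>x. g x * cnj (h x)"]
  by (simp add: cont_intros mult.commute)

lemma ip_add: "cont f \<Longrightarrow> cont g \<Longrightarrow> cont h \<Longrightarrow> ip (\<lambda>x. f x + g x) h = ip f h + ip g h"
  unfolding ip_def using mean_add[of "\<lambda>x. f x * cnj (h x)" "\<lambda>x. g x * cnj (h x)"]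
  by (simp add: cont_intros distrib_right)

lemma ip_diff: "cont f \<Longrightarrow> cont g \<Longrightarrow> cont h \<Longrightarrow> ip (\<lambda>x. f x - g x) h = ip f h - ip g h"
  unfolding ip_def using mean_diff[of "\<lambda>x. f x * cnj (h x)" "\<lambda>x. g x * cnj (h x)"]
  by (simp add: cont_intros left_diff_distrib)

lemma ip_scale: "cont g \<Longrightarrow> cont h \<Longrightarrow> ip (\<lambda>x. c * g x) h = c * ip g h"
  unfolding ip_def using mean_scale[of "\<lambda>x. g x * cnj (h x)" c]
  by (simp add: cont_intros mult.assoc)

lemma ip_sum:
  "finite I \<Longrightarrow> (\<And>i. i \<in> I \<Longrightarrow> cont (f i)) \<Longrightarrow> cont h \<Longrightarrow> ip (\<lambda>x. \<Sum>i\<in>I. f i x) h = (\<Sum>i\<in>I. ip (f i) h)"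
  unfolding ip_def sum_distrib_right by (rule mean_sum) (auto intro!: cont_intros)

lemma ip_diff_right: "cont f \<Longrightarrow> cont g \<Longrightarrow> cont h \<Longrightarrow> ip h (\<lambda>x. f x - g x) = ip h f - ip h g"
  using ip_cnj[of "\<lambda>x. f x - g x" h] ip_cnj[of f h] ip_cnj[of g h] ip_diff[of f g h]
  by (simp add: continuous_map_diff)

lemma ip_scale_right: "cont g \<Longrightarrow> cont h \<Longrightarrow> ip h (\<lambda>x. c * g x) = cnj c * ip h g"
  using ip_cnj[of "\<lambda>x. c * g x" h] ip_cnj[of g h] ip_scale[of g h c]
  by (simp add: continuous_map_scale)

lemma ip_sum_right:
  assumes "finite I" "\<And>i. i \<in> I \<Longrightarrow> cont (f i)" "cont h"
  shows "ip h (\<lambda>x. \<Sum>i\<in>I. f i x) = (\<Sum>i\<in>I. ip h (f i))"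
proof -
  have "ip h (f i) = cnj (ip (f i) h)" if "i \<in> I" for i using ip_cnj[of "f i" h] assms that by simp
  moreover have "ip h (\<lambda>x. \<Sum>i\<in>I. f i x) = cnj (ip (\<lambda>x. \<Sum>i\<in>I. f i x) h)"
    using assms by (intro ip_cnj continuous_map_sum) auto
  ultimately show ?thesis using ip_sum[OF assms] by simp
qed

lemma ip_self: "cont g \<Longrightarrow> ip g g = complex_of_real (nsq g)"
  unfolding nsq_def using ip_cnj[of g g] by (simp add: complex_eq_iff)

lemma nsq_nonneg: "cont g \<Longrightarrow> 0 \<le> nsq g"
  unfolding nsq_def ip_def by (rule mean_Re_ge) (auto intro!: cont_intros)

lemma nsq_le:
  assumes g: "cont g" and b: "\<And>x. x \<in> carrier H \<Longrightarrow> norm (g x) \<le> b"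
  shows "nsq g \<le> b\<^sup>2"
proof -
  have "norm (mean (\<lambda>x. g x * cnj (g x))) \<le> b\<^sup>2"
  proof (rule mean_norm_le)
    fix x assume "x \<in> carrier H"
    then show "norm (g x * cnj (g x)) \<le> b\<^sup>2"
      using power_mono[OF b, of x 2] by (simp add: norm_mult power2_eq_square)
  qed (use g in \<open>auto intro!: cont_intros\<close>)
  then show ?thesis unfolding nsq_def ip_def using complex_Re_le_cmod order_trans by blast
qed

lemma nsq_pos:
  assumes g: "cont g" and z: "z \<in> carrier H" "g z \<noteq> 0"
  shows "0 < nsq g"
  unfolding nsq_def ip_def
  by (rule mean_pos[OF _ _ z(1)])
     (use g z in \<open>auto intro!: cont_intros simp: complex_neq_0 power2_eq_square\<close>)

lemma nsq_scale: "cont g \<Longrightarrow> nsq (\<lambda>x. c * g x) = (norm c)\<^sup>2 * nsq g"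
  unfolding nsq_def
  using ip_scale[of g "\<lambda>x. c * g x" c] ip_scale_right[of g g c] ip_self[of g] complex_norm_square[of c]
  by (simp add: continuous_map_scale mult.assoc[symmetric] cmod_power2 power2_eq_square[of "Re c"]
      power2_eq_square[of "Im c"])

lemma nsq_diff:
  assumes g: "cont g" and h: "cont h"
  shows "nsq (\<lambda>x. g x - c * h x) = nsq g - 2 * Re (cnj c * ip g h) + (norm c)\<^sup>2 * nsq h"
proof -
  have ch: "cont (\<lambda>x. c * h x)" using h by (rule continuous_map_scale)
  have gch: "cont (\<lambda>x. g x - c * h x)" using g ch by (rule continuous_map_diff)
  have "ip (\<lambda>x. g x - c * h x) (\<lambda>x. g x - c * h x) =
    ip g g - cnj c * ip g h - (c * cnj (ip g h) - c * (cnj c * ip h h))"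
    using ip_diff[OF g ch gch] ip_diff_right[OF g ch g] ip_diff_right[OF g ch ch]
      ip_scale_right[OF h g, of c] ip_scale[OF h g, of c] ip_scale[OF h ch, of c] ip_scale_right[OF h h, of c]
      ip_cnj[OF g h] by simp
  also have "Re \<dots> = Re (ip g g) - 2 * Re (cnj c * ip g h) + (norm c)\<^sup>2 * Re (ip h h)"
    unfolding ip_self[OF h] by (simp add: cmod_power2 power2_eq_square[of "Re c"] power2_eq_square[of "Im c"] algebra_simps)
  finally show ?thesis by (simp add: nsq_def)
qed

lemma Cauchy_Schwarz:
  assumes g: "cont g" and h: "cont h"
  shows "(norm (ip g h))\<^sup>2 \<le> nsq g * nsq h"
proof (cases "\<exists>z\<in>carrier H. h z \<noteq> 0")
  case True
  then have pos: "nsq h > 0" using nsq_pos[OF h] by blast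
  \<comment> \<open>The coefficient of the orthogonal projection of \<open>g\<close> onto
    \<open>h\<close>.\<close>
  define c where "c = ip g h / nsq h"
  have "0 \<le> nsq (\<lambda>x. g x - c * h x)" by (rule nsq_nonneg) (use g h in \<open>auto intro!: cont_intros\<close>)
  also have "\<dots> = nsq g - 2 * Re (cnj c * ip g h) + (norm c)\<^sup>2 * nsq h" by (rule nsq_diff[OF g h])
  also have "cnj c * ip g h = complex_of_real ((norm (ip g h))\<^sup>2 / nsq h)"
    unfolding c_def using complex_norm_square[of "ip g h"] by (simp add: mult.commute)
  also have "(norm c)\<^sup>2 * nsq h = (norm (ip g h))\<^sup>2 / nsq h"
    unfolding c_def using pos by (simp add: norm_divide power_divide power2_eq_square)
  finally have "(norm (ip g h))\<^sup>2 / nsq h \<le> nsq g" by simp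
  then show ?thesis using pos by (simp add: pos_divide_le_eq)
next
  case False
  then have "ip g h = ip g (\<lambda>x. 0 * h x)" using h by (intro ip_cong) (auto simp: g intro!: cont_intros)
  also have "\<dots> = 0" using ip_scale_right[OF h g, of 0] by simp
  finally show ?thesis using nsq_nonneg g h by simp
qed

definition conv :: "('a \<Rightarrow> complex) \<Rightarrow> ('a \<Rightarrow> complex) \<Rightarrow> 'a \<Rightarrow> complex" where
  "conv k g x = mean (\<lambda>y. k (x \<otimes> inv y) * g y)"

lemma cont2_conv:
  assumes k: "cont k" and g: "cont g"
  shows "cont2 (\<lambda>x y. k (x \<otimes> inv y) * g y)"
proof (rule continuous_map_mult)
  show "continuous_map (prod_topology T T) euclidean (\<lambda>p. k (fst p \<otimes> inv (snd p)))"
    by (rule cont_compT[OF _ k]) (intro cont_mult2 cont_inv2 continuous_map_fst continuous_map_snd)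
  show "continuous_map (prod_topology T T) euclidean (\<lambda>p. g (snd p))"
    by (rule cont_compT[OF continuous_map_snd g])
qed

lemma cont_kernel:
  assumes k: "cont k" and x: "x \<in> carrier H"
  shows "cont (\<lambda>y. k (x \<otimes> inv y))"
  by (rule cont_compT[OF _ k]) (use x in \<open>auto intro!: cont_mult2 cont_inv2 cont_constT\<close>)

lemma cont_conv: "cont k \<Longrightarrow> cont g \<Longrightarrow> cont (conv k g)"
  unfolding conv_def by (rule mean_cont[OF cont2_conv])

lemma conv_add: "cont k \<Longrightarrow> cont g \<Longrightarrow> cont h \<Longrightarrow> x \<in> carrier H \<Longrightarrow>
    conv k (\<lambda>x. g x + h x) x = conv k g x + conv k h x"
  unfolding conv_def distrib_left by (rule mean_add) (auto intro!: cont_intros cont_kernel)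

lemma conv_diff: "cont k \<Longrightarrow> cont g \<Longrightarrow> cont h \<Longrightarrow> x \<in> carrier H \<Longrightarrow>
    conv k (\<lambda>x. g x - h x) x = conv k g x - conv k h x"
  unfolding conv_def right_diff_distrib by (rule mean_diff) (auto intro!: cont_intros cont_kernel)

lemma conv_scale: "cont k \<Longrightarrow> cont g \<Longrightarrow> x \<in> carrier H \<Longrightarrow> conv k (\<lambda>x. c * g x) x = c * conv k g x"
  unfolding conv_def
  using mean_scale[OF continuous_map_mult[OF cont_kernel[of k x]], of g c]
  by (simp add: mult.left_commute)

lemma conv_add_kernel: "cont k \<Longrightarrow> cont l \<Longrightarrow> cont g \<Longrightarrow> x \<in> carrier H \<Longrightarrow>
    conv (\<lambda>x. k x + l x) g x = conv k g x + conv l g x"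
  unfolding conv_def distrib_right by (rule mean_add) (auto intro!: cont_intros cont_kernel)

lemma conv_scale_kernel: "cont k \<Longrightarrow> cont g \<Longrightarrow> x \<in> carrier H \<Longrightarrow> conv (\<lambda>x. c * k x) g x = c * conv k g x"
  unfolding conv_def mult.assoc by (rule mean_scale) (auto intro!: cont_intros cont_kernel)

lemma conv_norm_le:
  assumes k: "cont k" and g: "cont g" and x: "x \<in> carrier H" and B: "\<And>x. x \<in> carrier H \<Longrightarrow> norm (k x) \<le> B"
    and b: "\<And>x. x \<in> carrier H \<Longrightarrow> norm (g x) \<le> b"
  shows "norm (conv k g x) \<le> B * b"
  unfolding conv_def
proof (rule mean_norm_le)
  fix y assume y: "y \<in> carrier H"
  then have "norm (k (x \<otimes> inv y)) * norm (g y) \<le> B * b"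
    using B[of "x \<otimes> inv y"] order_trans[OF norm_ge_zero B[OF x]] b[OF y] x by (intro mult_mono) auto
  then show "norm (k (x \<otimes> inv y) * g y) \<le> B * b" by (simp add: norm_mult)
qed (use k g x in \<open>auto intro!: cont_intros cont_kernel\<close>)

lemma conv_eq_ip: "conv k g x = ip g (\<lambda>y. cnj (k (x \<otimes> inv y)))"
  unfolding conv_def ip_def by (simp add: mult.commute)

text \<open>Cauchy-Schwarz against the conjugated kernel. Bounding the supremum norm by the L2 norm
  is the smoothing property from which compactness of the operator is drawn.\<close>

lemma conv_norm_le_nsq:
  assumes k: "cont k" and g: "cont g" and x: "x \<in> carrier H" and B: "\<And>x. x \<in> carrier H \<Longrightarrow> norm (k x) \<le> B"
  shows "norm (conv k g x) \<le> B * sqrt (nsq g)"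
proof -
  have c: "cont (\<lambda>y. cnj (k (x \<otimes> inv y)))" using k x by (auto intro!: cont_intros cont_kernel)
  have B0: "0 \<le> B" using B[OF x] norm_ge_zero order_trans by blast
  have "nsq (\<lambda>y. cnj (k (x \<otimes> inv y))) \<le> B\<^sup>2" by (rule nsq_le[OF c]) (use B x in simp)
  with Cauchy_Schwarz[OF g c] have "(norm (conv k g x))\<^sup>2 \<le> nsq g * B\<^sup>2"
    unfolding conv_eq_ip using nsq_nonneg[OF g] by (meson mult_left_mono order_trans)
  then have "norm (conv k g x) \<le> sqrt (nsq g * B\<^sup>2)" by (rule real_le_rsqrt)
  also have "\<dots> = B * sqrt (nsq g)" using B0 by (simp add: real_sqrt_mult)
  finally show ?thesis .
qed

lemma conv_translate_kernel:
  assumes "cont k" "cont g" "x \<in> carrier H" "t \<in> carrier H"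
  shows "conv (\<lambda>x. k (x \<otimes> t)) g x = conv k g (x \<otimes> t)"
  unfolding conv_def
  by (rule mean_cong) (use assms in \<open>auto intro!: cont_intros cont_kernel simp: m_ac\<close>)

lemma conv_translate:
  assumes k: "cont k" and g: "cont g" and x: "x \<in> carrier H" and t: "t \<in> carrier H"
  shows "conv k (\<lambda>x. g (x \<otimes> t)) x = conv k g (x \<otimes> t)"
proof -
  have xt: "x \<otimes> t \<in> carrier H" using x t by simp
  have c: "cont (\<lambda>y. k (x \<otimes> t \<otimes> inv y) * g y)" using k g xt by (auto intro!: cont_intros cont_kernel)
  have "mean (\<lambda>y. k (x \<otimes> t \<otimes> inv y) * g y) = mean (\<lambda>y. k (x \<otimes> t \<otimes> inv (y \<otimes> t)) * g (y \<otimes> t))"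
    using mean_translate[OF c t] by simp
  also have "\<dots> = mean (\<lambda>y. k (x \<otimes> inv y) * g (y \<otimes> t))"
  proof (rule mean_cong[symmetric])
    show "cont (\<lambda>y. k (x \<otimes> t \<otimes> inv (y \<otimes> t)) * g (y \<otimes> t))" using cont_translate[OF t c] .
    fix y assume y: "y \<in> carrier H"
    have "x \<otimes> t \<otimes> inv (y \<otimes> t) = x \<otimes> inv y \<otimes> (t \<otimes> inv t)"
      using x y t by (simp only: inv_mult m_ac m_closed inv_closed)
    then show "k (x \<otimes> t \<otimes> inv (y \<otimes> t)) * g (y \<otimes> t) = k (x \<otimes> inv y) * g (y \<otimes> t)" using x y t by simp
  qed
  finally show ?thesis by (simp add: conv_def)
qed

text \<open>The substitution puts the moving variable into \<open>g\<close>: approximating this mean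
  by an average then exhibits \<open>conv k g\<close> as a limit of combinations of translates of
  \<open>g\<close>.\<close>

lemma conv_alt:
  assumes k: "cont k" and g: "cont g" and x: "x \<in> carrier H"
  shows "conv k g x = mean (\<lambda>y. k (inv y) * g (x \<otimes> y))"
proof -
  have c: "cont (\<lambda>y. k (\<one> \<otimes> inv y) * g (y \<otimes> x))"
    using k g x by (intro continuous_map_mult cont_kernel cont_translate) auto
  have "conv k g x = conv k (\<lambda>y. g (y \<otimes> x)) \<one>" using conv_translate[OF k g one_closed x] x by simp
  also have "\<dots> = mean (\<lambda>y. k (inv y) * g (x \<otimes> y))"
    unfolding conv_def by (rule mean_cong[OF c, symmetric]) (use x in \<open>simp add: m_comm\<close>)
  finally show ?thesis .
qed

definition hermitian :: "('a \<Rightarrow> complex) \<Rightarrow> bool" where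
  "hermitian k \<longleftrightarrow> (\<forall>x\<in>carrier H. k (inv x) = cnj (k x))"

text \<open>\<open>hermitian k\<close> makes the kernel \<open>k (x \<otimes> inv y)\<close>
  conjugate symmetric in \<open>x\<close> and \<open>y\<close>, and the order of the two means may
  be exchanged.\<close>

lemma conv_selfadjoint:
  assumes k: "cont k" "hermitian k" and g: "cont g" and h: "cont h"
  shows "ip (conv k g) h = ip g (conv k h)"
proof -
  let ?F = "\<lambda>x y. k (x \<otimes> inv y) * g y * cnj (h x)"
  have F: "cont2 ?F"
    by (rule continuous_map_mult[OF cont2_conv[OF k(1) g]])
       (rule cont_compT[OF continuous_map_fst continuous_map_cnj[OF h]])
  have "ip (conv k g) h = mean (\<lambda>x. mean (?F x))"
    unfolding ip_def
  proof (rule mean_cong[OF mean_cont[OF F]])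
    fix x assume x: "x \<in> carrier H"
    have c: "cont (\<lambda>y. k (x \<otimes> inv y) * g y)" using k g x by (auto intro!: cont_intros cont_kernel)
    show "mean (?F x) = conv k g x * cnj (h x)"
      unfolding conv_def using mean_scale[OF c, of "cnj (h x)"] by (simp add: mult.commute)
  qed
  also have "\<dots> = mean (\<lambda>y. mean (\<lambda>x. ?F x y))" by (rule mean_Fubini[OF F])
  also have "\<dots> = ip g (conv k h)"
    unfolding ip_def
  proof (rule mean_cong[symmetric])
    show "cont (\<lambda>y. mean (\<lambda>x. ?F x y))" by (rule mean_cont[OF cont2_swap[OF F]])
    fix y assume y: "y \<in> carrier H"
    have c: "cont (\<lambda>x. k (y \<otimes> inv x) * h x)" using k h y by (auto intro!: cont_intros cont_kernel)
    have "g y * cnj (conv k h y) = mean (\<lambda>x. g y * cnj (k (y \<otimes> inv x) * h x))"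
      unfolding conv_def using mean_scale[OF continuous_map_cnj[OF c], of "g y"] mean_cnj[OF c] by simp
    also have "\<dots> = mean (\<lambda>x. ?F x y)"
    proof (rule mean_cong[symmetric])
      show "cont (\<lambda>x. g y * cnj (k (y \<otimes> inv x) * h x))" by (rule continuous_map_scale[OF continuous_map_cnj[OF c]])
      fix x assume x: "x \<in> carrier H"
      have "inv (y \<otimes> inv x) = x \<otimes> inv y" using x y by (simp add: inv_mult m_comm)
      moreover have "k (inv (y \<otimes> inv x)) = cnj (k (y \<otimes> inv x))" using k(2) x y by (simp add: hermitian_def)
      ultimately show "g y * cnj (k (y \<otimes> inv x) * h x) = ?F x y" by simp
    qed
    finally show "mean (\<lambda>x. ?F x y) = g y * cnj (conv k h y)" by simp
  qed
  finally show ?thesis .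
qed

text \<open>Translating \<open>conv k g\<close> by \<open>u\<close> amounts to translating
  \<open>k\<close>, whose change is uniformly small; the smoothing estimate makes this uniform over
  the L2 unit ball. Together with \<open>Arzela_Ascoli_sequence\<close> this is compactness of the
  operator.\<close>

lemma conv_equicont:
  assumes k: "cont k" and g: "\<And>i. cont (g i)" "\<And>i. nsq (g i) \<le> 1"
  shows "equicont (\<lambda>i. conv k (g i))"
  unfolding equicont_def
proof (intro allI impI)
  fix e :: real assume e: "e > 0"
  obtain U where U: "openin T U" "\<one> \<in> U"
    and near: "\<And>u y. u \<in> U \<Longrightarrow> y \<in> carrier H \<Longrightarrow> norm (k (y \<otimes> u) - k y) < e"
    by (rule uniformly_cont[OF k e]) auto
  have "norm (conv k (g i) (y \<otimes> u) - conv k (g i) y) \<le> e" if u: "u \<in> U" and y: "y \<in> carrier H" for i u y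
  proof -
    have u': "u \<in> carrier H" using U(1) u openin_carrier by blast
    let ?k = "\<lambda>x. k (x \<otimes> u) + (-1) * k x"
    have c: "cont (\<lambda>x. k (x \<otimes> u))" by (rule cont_translate[OF u' k])
    have c': "cont (\<lambda>x. -1 * k x)" by (rule continuous_map_scale[OF k])
    have "conv ?k (g i) y = conv (\<lambda>x. k (x \<otimes> u)) (g i) y + (-1) * conv k (g i) y"
      using conv_add_kernel[OF c c' g(1) y] conv_scale_kernel[OF k g(1) y, of "-1"] by simp
    then have "conv k (g i) (y \<otimes> u) - conv k (g i) y = conv ?k (g i) y"
      using conv_translate_kernel[OF k g(1) y u'] by simp
    moreover have "norm (conv ?k (g i) y) \<le> e * sqrt (nsq (g i))"
      by (rule conv_norm_le_nsq[OF continuous_map_add[OF c c'] g(1) y]) (use near[OF u] in \<open>simp add: less_imp_le\<close>)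
    moreover have "e * sqrt (nsq (g i)) \<le> e" using g(2)[of i] e nsq_nonneg[OF g(1), of i] by simp
    ultimately show ?thesis by simp
  qed
  with U show "\<exists>U. openin T U \<and> \<one> \<in> U \<and>
      (\<forall>i. \<forall>u\<in>U. \<forall>y\<in>carrier H. norm (conv k (g i) (y \<otimes> u) - conv k (g i) y) \<le> e)"
    by (intro exI[of _ U]) simp
qed

lemma nsq_cong: "cont g \<Longrightarrow> (\<And>x. x \<in> carrier H \<Longrightarrow> g x = g' x) \<Longrightarrow> nsq g' = nsq g"
  unfolding nsq_def by (rule arg_cong[of _ _ Re], rule ip_cong)

section \<open>Closed translation-invariant spaces of continuous functions\<close>

definition inv_space :: "('a \<Rightarrow> complex) set \<Rightarrow> bool" where
  "inv_space V \<longleftrightarrow>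
     (\<forall>g\<in>V. cont g) \<and>
     (\<forall>g\<in>V. \<forall>h\<in>V. (\<lambda>x. g x + h x) \<in> V) \<and>
     (\<forall>g\<in>V. \<forall>c. (\<lambda>x. c * g x) \<in> V) \<and>
     (\<forall>g\<in>V. \<forall>t\<in>carrier H. (\<lambda>x. g (x \<otimes> t)) \<in> V) \<and>
     (\<forall>g. cont g \<longrightarrow> (\<forall>e>0. \<exists>h\<in>V. \<forall>x\<in>carrier H. norm (h x - g x) \<le> e) \<longrightarrow> g \<in> V)"

lemma
  assumes "inv_space V"
  shows inv_space_cont: "g \<in> V \<Longrightarrow> cont g"
    and inv_space_add: "g \<in> V \<Longrightarrow> h \<in> V \<Longrightarrow> (\<lambda>x. g x + h x) \<in> V"
    and inv_space_scale: "g \<in> V \<Longrightarrow> (\<lambda>x. c * g x) \<in> V"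
    and inv_space_translate: "g \<in> V \<Longrightarrow> t \<in> carrier H \<Longrightarrow> (\<lambda>x. g (x \<otimes> t)) \<in> V"
    and inv_space_closed: "cont g \<Longrightarrow> (\<And>e. e > 0 \<Longrightarrow> \<exists>h\<in>V. \<forall>x\<in>carrier H. norm (h x - g x) \<le> e) \<Longrightarrow> g \<in> V"
  using assms by (auto simp: inv_space_def)

lemma inv_space_diff: "inv_space V \<Longrightarrow> g \<in> V \<Longrightarrow> h \<in> V \<Longrightarrow> (\<lambda>x. g x - h x) \<in> V"
  using inv_space_add[of V g "\<lambda>x. -1 * h x"] inv_space_scale[of V h "-1"] by simp

text \<open>Closure under uniform limits makes membership of continuous functions depend only on the
  values on the carrier.\<close>

lemma inv_space_cong:
  "inv_space V \<Longrightarrow> g \<in> V \<Longrightarrow> cont h \<Longrightarrow> (\<And>x. x \<in> carrier H \<Longrightarrow> h x = g x) \<Longrightarrow> h \<in> V"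
  by (rule inv_space_closed) (auto intro!: bexI[of _ g])

text \<open>\<open>V \<noteq> {}\<close> serves the empty sum: the conditions of
  \<open>inv_space\<close> hold for the empty set too.\<close>

lemma inv_space_sum:
  "inv_space V \<Longrightarrow> V \<noteq> {} \<Longrightarrow> finite I \<Longrightarrow> (\<And>i. i \<in> I \<Longrightarrow> f i \<in> V) \<Longrightarrow> (\<lambda>x. \<Sum>i\<in>I. f i x) \<in> V"
proof (induction I rule: infinite_finite_induct)
  case empty
  then obtain g where "g \<in> V" by auto
  from inv_space_scale[OF empty.prems(1) this, of 0] show ?case by simp
next
  case (insert i I)
  then show ?case using inv_space_add[of V "f i" "\<lambda>x. \<Sum>i\<in>I. f i x"] by simp
qed simp

lemma inv_space_avg:
  "A \<in> avg \<Longrightarrow> inv_space V \<Longrightarrow> (\<And>y. y \<in> carrier H \<Longrightarrow> (\<lambda>x. F x y) \<in> V) \<Longrightarrow> y \<in> carrier H \<Longrightarrow>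
    (\<lambda>x. A (F x) y) \<in> V"
proof (induction arbitrary: F y rule: avg.induct)
  case (midpoint A B)
  have "(\<lambda>x. A (F x) y) \<in> V" "(\<lambda>x. B (F x) y) \<in> V"
    by (rule midpoint.IH; use midpoint.prems in simp)+
  from inv_space_scale[OF midpoint.prems(1) inv_space_add[OF midpoint.prems(1) this], of "1/2"]
  show ?case by (simp add: mid_def)
next
  case (comp A B)
  have "(\<lambda>x. B (F x) y) \<in> V" if "y \<in> carrier H" for y
    by (rule comp.IH(2)) (use comp.prems that in simp_all)
  from comp.IH(1)[OF comp.prems(1) this comp.prems(3)] show ?case by simp
qed (simp add: shift_def)

text \<open>After \<open>conv_alt\<close> an average of the integrand, evaluated at the identity, is
  a combination of translates of \<open>g\<close>; it lies in \<open>V\<close> and approximates the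
  convolution uniformly.\<close>

lemma inv_space_conv:
  assumes V: "inv_space V" and g: "g \<in> V" and k: "cont k"
  shows "conv k g \<in> V"
proof (rule inv_space_closed[OF V cont_conv[OF k inv_space_cont[OF V g]]])
  fix e :: real assume e: "e > 0"
  let ?F = "\<lambda>x y. k (inv y) * g (x \<otimes> y)"
  have "cont2 ?F"
  proof (rule continuous_map_mult)
    show "continuous_map (prod_topology T T) euclidean (\<lambda>p. k (inv (snd p)))"
      by (rule cont_compT[OF _ k]) (intro cont_inv2 continuous_map_snd)
    show "continuous_map (prod_topology T T) euclidean (\<lambda>p. g (fst p \<otimes> snd p))"
      by (rule cont_compT[OF _ inv_space_cont[OF V g]]) (intro cont_mult2 continuous_map_snd continuous_map_fst)
  qed
  from mean_approx_uniform[OF this e] obtain A where A: "A \<in> avg"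
    "\<And>x y. x \<in> carrier H \<Longrightarrow> y \<in> carrier H \<Longrightarrow> norm (A (?F x) y - mean (?F x)) \<le> e" by auto
  have "(\<lambda>x. ?F x y) \<in> V" if "y \<in> carrier H" for y
    using inv_space_scale[OF V inv_space_translate[OF V g that]] .
  from inv_space_avg[OF A(1) V this one_closed] have "(\<lambda>x. A (?F x) \<one>) \<in> V" .
  moreover have "\<forall>x\<in>carrier H. norm (A (?F x) \<one> - conv k g x) \<le> e"
    using A(2) conv_alt[OF k inv_space_cont[OF V g]] by simp
  ultimately show "\<exists>h\<in>V. \<forall>x\<in>carrier H. norm (h x - conv k g x) \<le> e" by (intro bexI)
qed

definition eigenspace :: "('a \<Rightarrow> complex) set \<Rightarrow> ('a \<Rightarrow> complex) \<Rightarrow> complex \<Rightarrow> ('a \<Rightarrow> complex) set" where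
  "eigenspace V k c = {h \<in> V. \<forall>x\<in>carrier H. conv k h x = c * h x}"

lemma inv_space_eigenspace:
  assumes V: "inv_space V" and k: "cont k"
  shows "inv_space (eigenspace V k c)"
  unfolding inv_space_def
proof (intro conjI ballI allI impI)
  fix g h assume g: "g \<in> eigenspace V k c" and h: "h \<in> eigenspace V k c"
  then show "(\<lambda>x. g x + h x) \<in> eigenspace V k c"
    by (auto simp: eigenspace_def inv_space_add[OF V] conv_add[OF k] inv_space_cont[OF V] distrib_left)
next
  fix g d assume g: "g \<in> eigenspace V k c"
  then show "(\<lambda>x. d * g x) \<in> eigenspace V k c"
    by (auto simp: eigenspace_def inv_space_scale[OF V] conv_scale[OF k] inv_space_cont[OF V])
next
  fix g t assume g: "g \<in> eigenspace V k c" and t: "t \<in> carrier H"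
  then show "(\<lambda>x. g (x \<otimes> t)) \<in> eigenspace V k c"
    by (auto simp: eigenspace_def inv_space_translate[OF V] conv_translate[OF k] inv_space_cont[OF V])
next
  fix g assume g: "cont g"
    and *: "\<forall>e>0. \<exists>h\<in>eigenspace V k c. \<forall>x\<in>carrier H. norm (h x - g x) \<le> e"
  have gV: "g \<in> V"
  proof (rule inv_space_closed[OF V g])
    fix e :: real assume "e > 0"
    then show "\<exists>h\<in>V. \<forall>x\<in>carrier H. norm (h x - g x) \<le> e"
      using * unfolding eigenspace_def by blast
  qed
  obtain B where B: "B > 0" "\<And>x. x \<in> carrier H \<Longrightarrow> norm (k x) \<le> B" by (rule cont_bounded[OF k]) auto
  have "conv k g x = c * g x" if x: "x \<in> carrier H" for x
  proof -
    have "norm (conv k g x - c * g x) \<le> 0"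
    proof (rule field_le_epsilon)
      fix e :: real assume e: "e > 0"
      \<comment> \<open>An approximation error for \<open>g\<close> is amplified by at most
        \<open>B\<close> under the convolution and by \<open>norm c\<close> under the scalar, so the
        tolerance is divided by their sum.\<close>
      have Bc: "B + norm c > 0" using B(1) by (simp add: add_pos_nonneg)
      with e have "e / (B + norm c) > 0" by simp
      with * obtain h where h: "h \<in> eigenspace V k c"
        and hg: "\<And>x. x \<in> carrier H \<Longrightarrow> norm (h x - g x) \<le> e / (B + norm c)" by blast
      have hV: "cont h" using h inv_space_cont[OF V] by (simp add: eigenspace_def)
      have "norm (conv k (\<lambda>x. h x - g x) x) \<le> B * (e / (B + norm c))"
        by (rule conv_norm_le[OF k continuous_map_diff[OF hV g] x B(2) hg])
      then have 1: "norm (conv k h x - conv k g x) \<le> B * (e / (B + norm c))"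
        by (simp add: conv_diff[OF k hV g x])
      have "norm c * norm (h x - g x) \<le> norm c * (e / (B + norm c))"
        by (rule mult_left_mono[OF hg[OF x]]) simp
      then have 2: "norm (c * h x - c * g x) \<le> norm c * (e / (B + norm c))"
        by (simp add: right_diff_distrib[symmetric] norm_mult)
      have "conv k g x - c * g x = (c * h x - c * g x) - (conv k h x - conv k g x)"
        using h x by (simp add: eigenspace_def)
      then have "norm (conv k g x - c * g x) \<le> norm c * (e / (B + norm c)) + B * (e / (B + norm c))"
        using 1 2 norm_triangle_ineq4[of "c * h x - c * g x" "conv k h x - conv k g x"] by simp
      also have "\<dots> = (B + norm c) * (e / (B + norm c))" by (simp only: distrib_right add.commute)
      also have "\<dots> = e" using Bc by simp
      finally show "norm (conv k g x - c * g x) \<le> 0 + e" by simp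
    qed
    then show ?thesis by simp
  qed
  with gV show "g \<in> eigenspace V k c" by (simp add: eigenspace_def)
qed (simp add: eigenspace_def inv_space_cont[OF V])

text \<open>The eigenvector is a uniform limit of images of a maximizing sequence for the \<open>L\<^sup>2\<close> operator norm.\<close>
lemma hermitian_eigenvalue:
  assumes V: "inv_space V" and k: "cont k" "hermitian k"
    and g0: "g0 \<in> V" "z \<in> carrier H" "conv k g0 z \<noteq> 0"
  shows "\<exists>c. c \<noteq> 0 \<and> (\<exists>h\<in>eigenspace V k c. \<exists>x\<in>carrier H. h x \<noteq> 0)"
proof -
  note cV = inv_space_cont[OF V] and kV = inv_space_conv[OF V _ k(1)]
  obtain B where B: "B > 0" "\<And>x. x \<in> carrier H \<Longrightarrow> norm (k x) \<le> B" by (rule cont_bounded[OF k(1)]) auto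
  \<comment> \<open>\<open>L\<close> will be the square of the L2 operator norm of convolution by
    \<open>k\<close> on \<open>V\<close>.\<close>
  define S where "S = {nsq (conv k g) | g. g \<in> V \<and> nsq g \<le> 1}"
  define L where "L = Sup S"
  have bound: "nsq (conv k g) \<le> B\<^sup>2" if "g \<in> V" "nsq g \<le> 1" for g
  proof (rule nsq_le[OF cV[OF kV[OF that(1)]]])
    fix x assume x: "x \<in> carrier H"
    have "norm (conv k g x) \<le> B * sqrt (nsq g)" by (rule conv_norm_le_nsq[OF k(1) cV[OF that(1)] x B(2)])
    also have "\<dots> \<le> B" using that(2) B(1) nsq_nonneg[OF cV[OF that(1)]] by simp
    finally show "norm (conv k g x) \<le> B" .
  qed
  have bdd: "bdd_above S" by (rule bdd_aboveI[of _ "B\<^sup>2"]) (auto simp: S_def bound)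
  have LS: "c \<le> L" if "c \<in> S" for c unfolding L_def using bdd that by (rule cSup_upper[rotated])
  have normalize: "nsq (\<lambda>x. complex_of_real (1 / sqrt (nsq g)) * g x) = 1" if "g \<in> V" "nsq g > 0" for g
  proof -
    have "(norm (complex_of_real (1 / sqrt (nsq g))))\<^sup>2 * nsq g = 1"
      using that(2) by (simp add: norm_divide power_divide)
    then show ?thesis unfolding nsq_scale[OF cV[OF that(1)]] .
  qed
  have L: "nsq (conv k g) \<le> L * nsq g" if g: "g \<in> V" for g
  proof (cases "nsq g > 0")
    case True
    let ?c = "complex_of_real (1 / sqrt (nsq g))"
    have "nsq (conv k (\<lambda>x. ?c * g x)) \<le> L"
      by (rule LS) (auto simp: S_def intro!: exI[of _ "\<lambda>x. ?c * g x"] inv_space_scale[OF V g] eq_refl[OF normalize[OF g True]])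
    moreover have "nsq (conv k (\<lambda>x. ?c * g x)) = nsq (\<lambda>x. ?c * conv k g x)"
      by (rule nsq_cong[OF continuous_map_scale[OF cV[OF kV[OF g]]]])
         (rule conv_scale[OF k(1) cV[OF g], symmetric])
    ultimately have "(norm ?c)\<^sup>2 * nsq (conv k g) \<le> L"
      by (simp only: nsq_scale[OF cV[OF kV[OF g]]])
    moreover have "(norm ?c)\<^sup>2 = 1 / nsq g" using True by (simp add: norm_divide power_divide)
    ultimately show ?thesis using True by (simp add: pos_divide_le_eq)
  next
    case False
    with nsq_nonneg[OF cV[OF g]] have 0: "nsq g = 0" by simp
    have "nsq (conv k g) \<le> 0\<^sup>2"
      by (rule nsq_le[OF cV[OF kV[OF g]]]) (use conv_norm_le_nsq[OF k(1) cV[OF g] _ B(2)] 0 in simp)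
    then show ?thesis using 0 by simp
  qed
  have "0 < nsq (conv k g0)" by (rule nsq_pos[OF cV[OF kV[OF g0(1)]] g0(2,3)])
  with L[OF g0(1)] nsq_nonneg[OF cV[OF g0(1)]] have Lpos: "L > 0"
    by (metis le_less_trans linorder_not_less mult_nonpos_nonneg order_less_le_trans)
  have "S \<noteq> {}"
  proof -
    have "nsq (\<lambda>x. 0 * g0 x) \<le> 1" using nsq_scale[OF cV[OF g0(1)], of 0] by simp
    then show ?thesis using inv_space_scale[OF V g0(1), of 0] by (auto simp: S_def)
  qed
  have "\<exists>g. g \<in> V \<and> nsq g \<le> 1 \<and> L - 1 / real (Suc n) < nsq (conv k g)" for n
  proof -
    have "L - 1 / real (Suc n) < Sup S" by (simp add: L_def)
    from less_cSupD[OF \<open>S \<noteq> {}\<close> this] show ?thesis by (auto simp: S_def)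
  qed
  then obtain g where gV: "\<And>n. g n \<in> V" and g1: "\<And>n. nsq (g n) \<le> 1"
    and gL: "\<And>n. L - 1 / real (Suc n) < nsq (conv k (g n))" by metis
  let ?f = "\<lambda>n. conv k (g n)"
  note fV = kV[OF gV]
  have fB: "norm (?f n x) \<le> B" if "x \<in> carrier H" for n x
  proof -
    have "norm (?f n x) \<le> B * sqrt (nsq (g n))" by (rule conv_norm_le_nsq[OF k(1) cV[OF gV] that B(2)])
    also have "\<dots> \<le> B" using g1[of n] B(1) nsq_nonneg[OF cV[OF gV]] by simp
    finally show ?thesis .
  qed
  obtain r h where r: "strict_mono (r :: nat \<Rightarrow> nat)" and h: "cont h"
    and lim: "uniform_limit (carrier H) (\<lambda>n. ?f (r n)) h sequentially"
    by (rule Arzela_Ascoli_sequence[OF conv_equicont[OF k(1) cV[OF gV] g1] fB]) auto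
  have lim': "\<exists>N. \<forall>n\<ge>N. \<forall>x\<in>carrier H. norm (?f (r n) x - h x) < e" if "e > 0" for e
    using lim that unfolding uniform_limit_sequentially_iff dist_norm by blast
  have hV: "h \<in> V"
  proof (rule inv_space_closed[OF V h])
    fix e :: real assume "e > 0"
    from lim'[OF this] obtain n where "\<forall>x\<in>carrier H. norm (?f (r n) x - h x) < e" by blast
    then show "\<exists>h'\<in>V. \<forall>x\<in>carrier H. norm (h' x - h x) \<le> e"
      using fV by (intro bexI[of _ "?f (r n)"]) (auto simp: less_imp_le)
  qed
  have conv_lim: "(\<lambda>n. conv k (F n) x) \<longlonglongrightarrow> conv k u x"
    if F: "\<And>n. cont (F n)" and u: "cont u" and Fu: "uniform_limit (carrier H) F u sequentially" and x: "x \<in> carrier H"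
    for F u x
  proof (rule LIMSEQ_I)
    fix e :: real assume e: "e > 0"
    then have "e / (2 * B) > 0" using B(1) by simp
    then obtain N where N: "\<And>n x. n \<ge> N \<Longrightarrow> x \<in> carrier H \<Longrightarrow> norm (F n x - u x) < e / (2 * B)"
      using Fu unfolding uniform_limit_sequentially_iff dist_norm by blast
    have "norm (conv k (F n) x - conv k u x) < e" if "n \<ge> N" for n
    proof -
      have "norm (conv k (\<lambda>x. F n x - u x) x) \<le> B * (e / (2 * B))"
        by (rule conv_norm_le[OF k(1) continuous_map_diff[OF F u] x B(2)]) (use N that in \<open>auto intro: less_imp_le\<close>)
      also have "\<dots> < e" using e B(1) by simp
      finally show ?thesis by (simp add: conv_diff[OF k(1) F u x])
    qed
    then show "\<exists>N. \<forall>n\<ge>N. norm (conv k (F n) x - conv k u x) < e" by blast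
  qed
  \<comment> \<open>For a self-adjoint operator \<open>T\<close> of norm \<open>sqrt L\<close> and
    \<open>nsq g \<le> 1\<close>, the residual \<open>T (T g) - L g\<close> has squared norm at most
    \<open>L * (L - nsq (T g))\<close>, which tends to zero along the maximizing sequence.\<close>
  let ?w = "\<lambda>n x. conv k (?f n) x - complex_of_real L * g n x"
  have wV: "?w n \<in> V" for n
    by (intro inv_space_diff[OF V] inv_space_scale[OF V] kV gV)
  have w_small: "nsq (?w n) \<le> L / real (Suc n)" for n
  proof -
    have "ip (conv k (?f n)) (g n) = complex_of_real (nsq (?f n))"
      using conv_selfadjoint[OF k cV[OF fV] cV[OF gV]] ip_self[OF cV[OF fV]] by simp
    then have "nsq (?w n) = nsq (conv k (?f n)) - 2 * L * nsq (?f n) + L\<^sup>2 * nsq (g n)"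
      using nsq_diff[OF cV[OF kV[OF fV]] cV[OF gV], of n "complex_of_real L" n] by simp
    also have "\<dots> \<le> L * nsq (?f n) - 2 * L * nsq (?f n) + L\<^sup>2 * 1"
      using L[OF fV] g1 Lpos by (intro add_mono diff_mono mult_left_mono) auto
    also have "\<dots> = L * (L - nsq (?f n))" by (simp add: algebra_simps power2_eq_square)
    also have "\<dots> \<le> L * (1 / real (Suc n))"
      using gL[of n] Lpos by (intro mult_left_mono) auto
    finally show ?thesis by simp
  qed
  \<comment> \<open>One more convolution turns the L2 smallness of the residual into smallness at
    every point, which survives in the limit \<open>h\<close>.\<close>
  have TTh: "conv k (conv k h) x = complex_of_real L * h x" if x: "x \<in> carrier H" for x
  proof -
    have lim1: "uniform_limit (carrier H) (\<lambda>n. conv k (?f (r n))) (conv k h) sequentially"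
      unfolding uniform_limit_sequentially_iff dist_norm
    proof (intro allI impI)
      fix e :: real assume e: "e > 0"
      then have "e / (2 * B) > 0" using B(1) by simp
      from lim'[OF this] obtain N where N: "\<And>n x. n \<ge> N \<Longrightarrow> x \<in> carrier H \<Longrightarrow> norm (?f (r n) x - h x) < e / (2 * B)"
        by blast
      have "norm (conv k (?f (r n)) x - conv k h x) < e" if "n \<ge> N" and x: "x \<in> carrier H" for n x
      proof -
        have "norm (conv k (\<lambda>x. ?f (r n) x - h x) x) \<le> B * (e / (2 * B))"
          by (rule conv_norm_le[OF k(1) continuous_map_diff[OF cV[OF fV] h] x B(2)])
             (use N that in \<open>auto intro: less_imp_le\<close>)
        also have "\<dots> < e" using e B(1) by simp
        finally show ?thesis by (simp add: conv_diff[OF k(1) cV[OF fV] h x])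
      qed
      then show "\<exists>N. \<forall>n\<ge>N. \<forall>x\<in>carrier H. norm (conv k (?f (r n)) x - conv k h x) < e" by blast
    qed
    have "(\<lambda>n. conv k (conv k (?f (r n))) x - complex_of_real L * ?f (r n) x) \<longlonglongrightarrow>
        conv k (conv k h) x - complex_of_real L * h x"
      by (intro tendsto_diff tendsto_mult tendsto_const tendsto_uniform_limitI[OF lim x]
          conv_lim[OF cV[OF kV[OF fV]] cV[OF kV[OF hV]] lim1 x])
    moreover have "(\<lambda>n. conv k (conv k (?f (r n))) x - complex_of_real L * ?f (r n) x) \<longlonglongrightarrow> 0"
    proof (rule Lim_null_comparison)
      show "\<forall>\<^sub>F n in sequentially. norm (conv k (conv k (?f (r n))) x - complex_of_real L * ?f (r n) x)
          \<le> B * sqrt (L / real (Suc (r n)))"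
      proof (intro always_eventually allI)
        fix n
        have "conv k (?w (r n)) x = conv k (conv k (?f (r n))) x - complex_of_real L * ?f (r n) x"
          using conv_diff[OF k(1) cV[OF kV[OF fV]] continuous_map_scale[OF cV[OF gV]] x]
            conv_scale[OF k(1) cV[OF gV] x] by simp
        moreover have "norm (conv k (?w (r n)) x) \<le> B * sqrt (nsq (?w (r n)))"
          by (rule conv_norm_le_nsq[OF k(1) cV[OF wV] x B(2)])
        moreover have "B * sqrt (nsq (?w (r n))) \<le> B * sqrt (L / real (Suc (r n)))"
          using w_small[of "r n"] B(1) by simp
        ultimately show "norm (conv k (conv k (?f (r n))) x - complex_of_real L * ?f (r n) x)
          \<le> B * sqrt (L / real (Suc (r n)))" by simp
      qed
      have "(\<lambda>n. B * sqrt (L * (1 / real (Suc n)))) \<longlonglongrightarrow> B * sqrt (L * 0)"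
        by (intro tendsto_mult tendsto_const tendsto_real_sqrt LIMSEQ_Suc[OF lim_1_over_n])
      from LIMSEQ_subseq_LIMSEQ[OF this r]
      show "(\<lambda>n. B * sqrt (L / real (Suc (r n)))) \<longlonglongrightarrow> 0" by (simp add: o_def)
    qed
    ultimately show ?thesis using LIMSEQ_unique by fastforce
  qed
  \<comment> \<open>If \<open>h\<close> vanished, uniform convergence would force
    \<open>nsq (?f (r n))\<close> down to \<open>L / 2\<close>, against its approach to
    \<open>L\<close>.\<close>
  have h0: "\<exists>x\<in>carrier H. h x \<noteq> 0"
  proof (rule ccontr)
    assume "\<not> ?thesis"
    then have z: "\<And>x. x \<in> carrier H \<Longrightarrow> h x = 0" by blast
    have "sqrt (L / 2) > 0" using Lpos by simp
    from lim'[OF this] obtain N where N: "\<And>n x. n \<ge> N \<Longrightarrow> x \<in> carrier H \<Longrightarrow> norm (?f (r n) x - h x) < sqrt (L / 2)"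
      by blast
    obtain M where M: "1 / real (Suc M) < L / 2"
      using reals_Archimedean[of "L/2"] Lpos by (auto simp: inverse_eq_divide)
    define n where "n = max N M"
    have "nsq (?f (r n)) \<le> (sqrt (L / 2))\<^sup>2"
      by (rule nsq_le[OF cV[OF fV]]) (use N[of n] z in \<open>fastforce simp: n_def intro: less_imp_le\<close>)
    then have "nsq (?f (r n)) \<le> L / 2" using Lpos by simp
    moreover have "M \<le> r n" using seq_suble[OF r, of n] by (simp add: n_def)
    then have "1 / real (Suc (r n)) \<le> 1 / real (Suc M)" by (simp add: frac_le)
    ultimately show False using gL[of "r n"] M by simp
  qed
  define s where "s = sqrt L"
  have s: "s > 0" "complex_of_real s * complex_of_real s = complex_of_real L"
    using Lpos by (simp_all add: s_def flip: of_real_mult)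
  \<comment> \<open>With \<open>T\<close> for the convolution, \<open>T^2 - L\<close> factors as
    \<open>(T - s) (T + s)\<close>: either \<open>(T + s) h\<close> is a nonzero eigenvector for
    \<open>s\<close>, or it vanishes and \<open>h\<close> is an eigenvector for
    \<open>- s\<close>.\<close>
  let ?u = "\<lambda>x. conv k h x + complex_of_real s * h x"
  have uV: "?u \<in> V" by (intro inv_space_add[OF V] inv_space_scale[OF V] kV hV)
  have Tu: "conv k ?u x = complex_of_real s * ?u x" if x: "x \<in> carrier H" for x
  proof -
    have "conv k ?u x = conv k (conv k h) x + conv k (\<lambda>x. complex_of_real s * h x) x"
      by (rule conv_add[OF k(1) cV[OF kV[OF hV]] continuous_map_scale[OF h] x])
    also have "\<dots> = complex_of_real s * (complex_of_real s * h x) + complex_of_real s * conv k h x"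
      unfolding TTh[OF x] conv_scale[OF k(1) h x] s(2)[symmetric] by (simp only: mult.assoc)
    finally show ?thesis by (simp only: distrib_left add.commute)
  qed
  show ?thesis
  proof (cases "\<exists>x\<in>carrier H. ?u x \<noteq> 0")
    case True
    then show ?thesis using uV Tu s(1)
      by (intro exI[of _ "complex_of_real s"] conjI bexI[of _ ?u]) (auto simp: eigenspace_def)
  next
    case False
    then have "\<forall>x\<in>carrier H. conv k h x = - complex_of_real s * h x" by (simp add: eq_neg_iff_add_eq_0)
    then show ?thesis using hV h0 s(1)
      by (intro exI[of _ "- complex_of_real s"] conjI bexI[of _ h]) (auto simp: eigenspace_def)
  qed
qed

section \<open>Characters separate points\<close>

definition ortho :: "nat \<Rightarrow> (nat \<Rightarrow> 'a \<Rightarrow> complex) \<Rightarrow> bool" where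
  "ortho m e \<longleftrightarrow> (\<forall>i<m. cont (e i)) \<and> (\<forall>i<m. \<forall>j<m. ip (e i) (e j) = (if i = j then 1 else 0))"

lemma ortho_projection:
  assumes e: "ortho m e" and f: "cont f"
  defines "p \<equiv> \<lambda>x. \<Sum>i<m. ip f (e i) * e i x"
  shows "cont p" and "j < m \<Longrightarrow> ip p (e j) = ip f (e j)"
    and "ip f p = of_real (\<Sum>i<m. (norm (ip f (e i)))\<^sup>2)"
proof -
  have ce: "i < m \<Longrightarrow> cont (e i)" for i using e by (simp add: ortho_def)
  then have ce': "i < m \<Longrightarrow> cont (\<lambda>x. c * e i x)" for i c by (simp add: continuous_map_scale)
  show "cont p" unfolding p_def by (intro continuous_map_sum) (auto intro: ce')
  show "ip p (e j) = ip f (e j)" if j: "j < m"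
  proof -
    have "ip p (e j) = (\<Sum>i<m. ip (\<lambda>x. ip f (e i) * e i x) (e j))"
      unfolding p_def by (rule ip_sum) (auto intro: ce' ce j)
    also have "\<dots> = (\<Sum>i<m. if i = j then ip f (e i) else 0)"
      using e j by (intro sum.cong) (auto simp: ip_scale ce ortho_def)
    also have "\<dots> = ip f (e j)" using j by simp
    finally show ?thesis .
  qed
  have "ip f p = (\<Sum>i<m. ip f (\<lambda>x. ip f (e i) * e i x))"
    unfolding p_def by (rule ip_sum_right) (auto intro: ce' f)
  also have "\<dots> = (\<Sum>i<m. of_real ((norm (ip f (e i)))\<^sup>2))"
  proof (rule sum.cong)
    fix i assume "i \<in> {..<m}"
    then have "ip f (\<lambda>x. ip f (e i) * e i x) = cnj (ip f (e i)) * ip f (e i)"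
      by (intro ip_scale_right) (auto intro: ce f)
    also have "\<dots> = of_real ((norm (ip f (e i)))\<^sup>2)" using complex_norm_square[of "ip f (e i)"] by (simp add: mult.commute)
    finally show "ip f (\<lambda>x. ip f (e i) * e i x) = of_real ((norm (ip f (e i)))\<^sup>2)" .
  qed simp
  finally show "ip f p = of_real (\<Sum>i<m. (norm (ip f (e i)))\<^sup>2)" by simp
qed

lemma Bessel:
  assumes e: "ortho m e" and f: "cont f"
  shows "(\<Sum>i<m. (norm (ip f (e i)))\<^sup>2) \<le> nsq f"
proof -
  let ?p = "\<lambda>x. \<Sum>i<m. ip f (e i) * e i x"
  note p = ortho_projection[OF e f]
  have eq: "ip f (e i) = ip ?p (e i)" if "i < m" for i using p(2)[OF that] by simp
  have "ip ?p (\<lambda>x. \<Sum>i<m. ip ?p (e i) * e i x) = of_real (\<Sum>i<m. (norm (ip ?p (e i)))\<^sup>2)"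
    by (rule ortho_projection(3)[OF e p(1)])
  also have "(\<lambda>x. \<Sum>i<m. ip ?p (e i) * e i x) = ?p" by (intro ext sum.cong) (auto simp: p(2))
  also have "(\<Sum>i<m. (norm (ip ?p (e i)))\<^sup>2) = (\<Sum>i<m. (norm (ip f (e i)))\<^sup>2)"
    by (rule sum.cong) (auto simp: p(2))
  finally have pp: "nsq ?p = (\<Sum>i<m. (norm (ip f (e i)))\<^sup>2)" by (simp add: nsq_def)
  have "0 \<le> nsq (\<lambda>x. f x - 1 * ?p x)"
    by (rule nsq_nonneg) (use f p(1) in \<open>simp add: continuous_map_diff\<close>)
  also have "\<dots> = nsq f - 2 * Re (cnj 1 * ip f ?p) + (norm (1::complex))\<^sup>2 * nsq ?p" by (rule nsq_diff[OF f p(1)])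
  finally show ?thesis using pp p(3) by simp
qed

text \<open>The Hilbert-Schmidt bound: for fixed \<open>x\<close>, Bessel's inequality for the
  conjugated kernel at \<open>x\<close> bounds the sum of
  \<open>(norm c)\<^sup>2 * (norm (e i x))\<^sup>2\<close> by \<open>B\<^sup>2\<close>; taking the
  mean over \<open>x\<close> then counts the vectors.\<close>

lemma ortho_eigenspace_bound:
  assumes V: "inv_space V" and k: "cont k" and B: "\<And>x. x \<in> carrier H \<Longrightarrow> norm (k x) \<le> B"
    and e: "ortho m e" "\<And>i. i < m \<Longrightarrow> e i \<in> eigenspace V k c"
  shows "real m * (norm c)\<^sup>2 \<le> B\<^sup>2"
proof -
  have ce: "i < m \<Longrightarrow> cont (e i)" for i using e by (simp add: ortho_def)
  let ?F = "\<lambda>x. \<Sum>i<m. of_real ((norm c)\<^sup>2) * (e i x * cnj (e i x))"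
  have F: "?F x = of_real (\<Sum>i<m. (norm c)\<^sup>2 * (norm (e i x))\<^sup>2)" for x
    by (simp add: complex_norm_square[symmetric])
  have cF: "cont ?F" using ce by (intro continuous_map_sum cont_intros) auto
  have "mean ?F = (\<Sum>i<m. of_real ((norm c)\<^sup>2) * ip (e i) (e i))"
    unfolding ip_def using ce
    by (subst mean_sum, auto intro!: cont_intros sum.cong mean_scale)
  also have "\<dots> = (\<Sum>i<m. of_real ((norm c)\<^sup>2))"
    using e(1) by (intro sum.cong) (auto simp: ortho_def)
  finally have mF: "mean ?F = of_real (real m * (norm c)\<^sup>2)" by simp
  have "norm (mean ?F) \<le> B\<^sup>2"
  proof (rule mean_norm_le[OF cF])
    fix x assume x: "x \<in> carrier H"
    let ?K = "\<lambda>y. cnj (k (x \<otimes> inv y))"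
    have cK: "cont ?K" by (rule continuous_map_cnj[OF cont_kernel[OF k x]])
    have "norm (ip ?K (e i)) = norm c * norm (e i x)" if "i < m" for i
    proof -
      have "norm (ip ?K (e i)) = norm (conv k (e i) x)"
        unfolding conv_eq_ip ip_cnj[OF ce[OF that] cK] by simp
      also have "\<dots> = norm c * norm (e i x)" using e(2)[OF that] x by (simp add: eigenspace_def norm_mult)
      finally show ?thesis .
    qed
    then have "(\<Sum>i<m. (norm c)\<^sup>2 * (norm (e i x))\<^sup>2) = (\<Sum>i<m. (norm (ip ?K (e i)))\<^sup>2)"
      by (intro sum.cong) (auto simp: power_mult_distrib)
    also have "\<dots> \<le> nsq ?K" by (rule Bessel[OF e(1) cK])
    also have "\<dots> \<le> B\<^sup>2" by (rule nsq_le[OF cK]) (use B x in simp)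
    finally show "norm (?F x) \<le> B\<^sup>2" unfolding F norm_of_real
      by (subst abs_of_nonneg) (auto intro!: sum_nonneg)
  qed
  then show ?thesis unfolding mF norm_of_real by simp
qed

definition nonzero_space :: "('a \<Rightarrow> complex) set \<Rightarrow> bool" where
  "nonzero_space V \<longleftrightarrow> (\<exists>h\<in>V. \<exists>x\<in>carrier H. h x \<noteq> 0)"

text \<open>By Bessel's inequality orthonormal systems in an eigenspace have bounded length; a subspace
  with the shortest maximal system is minimal.\<close>
lemma minimal_subspace:
  assumes V: "inv_space V" and k: "cont k" and c: "c \<noteq> 0" and E: "nonzero_space (eigenspace V k c)"
  obtains M where "inv_space M" "M \<subseteq> eigenspace V k c" "nonzero_space M"
    "\<And>M'. inv_space M' \<Longrightarrow> M' \<subseteq> M \<Longrightarrow> nonzero_space M' \<Longrightarrow> M' = M"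
proof -
  \<comment> \<open>\<open>d\<close> bounds the length of orthonormal systems in some nonzero
    invariant subspace; \<open>Suc d\<close> is the first forbidden length.\<close>
  define P where "P d \<longleftrightarrow> (\<exists>M. inv_space M \<and> M \<subseteq> eigenspace V k c \<and> nonzero_space M \<and>
    \<not> (\<exists>e. ortho (Suc d) e \<and> (\<forall>i<Suc d. e i \<in> M)))" for d
  obtain B where B: "B > 0" "\<And>x. x \<in> carrier H \<Longrightarrow> norm (k x) \<le> B" by (rule cont_bounded[OF k]) auto
  obtain d where d: "real d > B\<^sup>2 / (norm c)\<^sup>2" using reals_Archimedean2 by blast
  have "P d" unfolding P_def
  proof (intro exI[of _ "eigenspace V k c"] conjI notI inv_space_eigenspace[OF V k] E subset_refl)
    assume "\<exists>e. ortho (Suc d) e \<and> (\<forall>i<Suc d. e i \<in> eigenspace V k c)"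
    then obtain e where "ortho (Suc d) e" "\<And>i. i < Suc d \<Longrightarrow> e i \<in> eigenspace V k c" by blast
    from ortho_eigenspace_bound[OF V k B(2) this] have "real (Suc d) * (norm c)\<^sup>2 \<le> B\<^sup>2" .
    moreover have "B\<^sup>2 < real d * (norm c)\<^sup>2" using d c by (simp add: pos_divide_less_eq)
    ultimately show False using zero_le_power2[of "norm c"] by (simp add: algebra_simps)
  qed
  define d0 where "d0 = (LEAST d. P d)"
  have "P d0" unfolding d0_def using \<open>P d\<close> by (rule LeastI)
  then obtain M where M: "inv_space M" "M \<subseteq> eigenspace V k c" "nonzero_space M"
    and no: "\<not> (\<exists>e. ortho (Suc d0) e \<and> (\<forall>i<Suc d0. e i \<in> M))" unfolding P_def by blast
  show ?thesis
  proof (rule that[OF M])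
    fix M' assume M': "inv_space M'" "M' \<subseteq> M" "nonzero_space M'"
    \<comment> \<open>Leastness of \<open>d0\<close> gives the smaller space \<open>M'\<close> a
      system of length \<open>d0\<close> as well; for \<open>d0 = 0\<close> the empty system
      serves.\<close>
    have "\<exists>e. ortho d0 e \<and> (\<forall>i<d0. e i \<in> M')"
    proof (cases d0)
      case 0
      then show ?thesis by (simp add: ortho_def)
    next
      case (Suc d')
      then have "\<not> P d'" using not_less_Least[of d' P] by (simp add: d0_def)
      then show ?thesis using M' M(2) Suc unfolding P_def by blast
    qed
    then obtain e where e: "ortho d0 e" "\<And>i. i < d0 \<Longrightarrow> e i \<in> M'" by blast
    show "M' = M"
    proof (rule ccontr)
      assume "M' \<noteq> M"
      then obtain h where h: "h \<in> M" "h \<notin> M'" using M'(2) by blast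
      have ch: "cont h" by (rule inv_space_cont[OF M(1) h(1)])
      let ?p = "\<lambda>x. \<Sum>i<d0. ip h (e i) * e i x"
      note p = ortho_projection[OF e(1) ch]
      have "M' \<noteq> {}" using M'(3) by (auto simp: nonzero_space_def)
      then have pM': "?p \<in> M'" by (rule inv_space_sum[OF M'(1)]) (auto intro: inv_space_scale[OF M'(1)] e(2))
      \<comment> \<open>The part of \<open>h\<close> orthogonal to that system is nonzero, since the
        projection lies in \<open>M'\<close> and \<open>h\<close> does not; normalized, it extends
        the system to the forbidden length \<open>Suc d0\<close> inside \<open>M\<close>.\<close>
      let ?h = "\<lambda>x. h x - ?p x"
      have hM: "?h \<in> M" using M'(2) pM' by (intro inv_space_diff[OF M(1) h(1)]) auto
      have ch': "cont ?h" by (rule inv_space_cont[OF M(1) hM])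
      have "\<exists>x\<in>carrier H. ?h x \<noteq> 0"
      proof (rule ccontr)
        assume "\<not> ?thesis"
        then have "h \<in> M'" by (intro inv_space_cong[OF M'(1) pM' ch]) auto
        with h show False by simp
      qed
      then have pos: "nsq ?h > 0" using nsq_pos[OF ch'] by blast
      let ?s = "complex_of_real (1 / sqrt (nsq ?h))"
      let ?n = "\<lambda>x. ?s * ?h x"
      have ce: "cont (e i)" if "i < d0" for i using e(1) that by (simp add: ortho_def)
      have cn: "cont ?n" by (rule continuous_map_scale[OF ch'])
      have ne: "ip ?n (e i) = 0" if "i < d0" for i
        unfolding ip_scale[OF ch' ce[OF that]] ip_diff[OF ch p(1) ce[OF that]] using p(2)[OF that] by simp
      have en: "ip (e i) ?n = 0" if "i < d0" for i
        unfolding ip_cnj[OF cn ce[OF that]] ne[OF that] by simp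
      have nn: "ip ?n ?n = 1"
      proof -
        have "(norm ?s)\<^sup>2 * nsq ?h = 1" using pos by (simp add: norm_divide power_divide)
        then show ?thesis unfolding ip_self[OF cn] nsq_scale[OF ch'] by simp
      qed
      let ?e = "\<lambda>i. if i < d0 then e i else ?n"
      have "ortho (Suc d0) ?e"
        using e(1) cn ne en nn unfolding ortho_def by (auto simp: less_Suc_eq)
      moreover have "\<forall>i<Suc d0. ?e i \<in> M"
      proof (intro allI impI)
        fix i
        show "?e i \<in> M"
          by (simp only: split: if_split) (use e(2) M'(2) inv_space_scale[OF M(1) hM, of ?s] in blast)
      qed
      ultimately show False using no by blast
    qed
  qed
qed

text \<open>A nonzero self-adjoint convolution operator has an eigenvector in \<open>M\<close>, and
  its eigenspace is again closed and invariant, so minimality makes it all of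
  \<open>M\<close>.\<close>

lemma minimal_conv_scalar:
  assumes M: "inv_space M" "nonzero_space M"
    and min: "\<And>M'. inv_space M' \<Longrightarrow> M' \<subseteq> M \<Longrightarrow> nonzero_space M' \<Longrightarrow> M' = M"
    and u: "cont u" "hermitian u"
  shows "\<exists>c. \<forall>h\<in>M. \<forall>x\<in>carrier H. conv u h x = c * h x"
proof (cases "\<exists>h\<in>M. \<exists>x\<in>carrier H. conv u h x \<noteq> 0")
  case True
  then obtain g z where g: "g \<in> M" "z \<in> carrier H" "conv u g z \<noteq> 0" by blast
  from hermitian_eigenvalue[OF M(1) u g] obtain c where "nonzero_space (eigenspace M u c)"
    unfolding nonzero_space_def by blast
  then have "eigenspace M u c = M"
    by (intro min inv_space_eigenspace[OF M(1) u(1)]) (auto simp: eigenspace_def)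
  then show ?thesis by (intro exI[of _ c]) (auto simp: eigenspace_def)
next
  case False
  then show ?thesis by (intro exI[of _ 0]) auto
qed

text \<open>Real and imaginary part with respect to the involution that sends \<open>u\<close> to
  \<open>\<lambda>x. cnj (u (inv x))\<close>; it carries statements about self-adjoint convolution
  operators over to all kernels.\<close>

lemma hermitian_decomposition:
  assumes u: "cont u"
  obtains u1 u2 where "cont u1" "hermitian u1" "cont u2" "hermitian u2" "u = (\<lambda>x. u1 x + \<i> * u2 x)"
proof -
  have c: "cont (\<lambda>x. cnj (u (inv x)))"
    by (rule continuous_map_cnj[OF cont_compT[OF cont_inv u]])
  show ?thesis
  proof (rule that[of "\<lambda>x. (1/2) * (u x + cnj (u (inv x)))" "\<lambda>x. (- \<i> / 2) * (u x - cnj (u (inv x)))"])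
    show "cont (\<lambda>x. (1/2) * (u x + cnj (u (inv x))))" "cont (\<lambda>x. (- \<i> / 2) * (u x - cnj (u (inv x))))"
      by (intro continuous_map_scale continuous_map_add continuous_map_diff u c)+
    show "hermitian (\<lambda>x. (1/2) * (u x + cnj (u (inv x))))" by (simp add: hermitian_def add.commute)
    show "hermitian (\<lambda>x. (- \<i> / 2) * (u x - cnj (u (inv x))))" by (simp add: hermitian_def algebra_simps)
    show "u = (\<lambda>x. (1/2) * (u x + cnj (u (inv x))) + \<i> * ((- \<i> / 2) * (u x - cnj (u (inv x)))))"
      by (rule ext) (simp add: algebra_simps)
  qed
qed

lemma conv_decomposition:
  assumes "cont u1" "cont u2" "cont g" "x \<in> carrier H"
  shows "conv (\<lambda>x. u1 x + \<i> * u2 x) g x = conv u1 g x + \<i> * conv u2 g x"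
  using conv_add_kernel[OF assms(1) continuous_map_scale[OF assms(2)] assms(3,4)]
    conv_scale_kernel[OF assms(2-4)] by simp

definition character :: "('a \<Rightarrow> complex) \<Rightarrow> bool" where
  "character f \<longleftrightarrow> cont f \<and> (\<forall>x\<in>carrier H. norm (f x) = 1) \<and>
     (\<forall>x\<in>carrier H. \<forall>y\<in>carrier H. f (x \<otimes> y) = f x * f y)"

text \<open>Convolution operators are scalar on a minimal subspace. Translating the kernel translates the
  convolution, so translations are scalar there as well, and a nonzero element is a multiple of a
  character.\<close>
lemma character_in_inv_space:
  assumes V: "inv_space V" "nonzero_space V"
  obtains f where "f \<in> V" "character f"
proof -
  obtain g z where g: "g \<in> V" "z \<in> carrier H" "g z \<noteq> 0" using V(2) by (auto simp: nonzero_space_def)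
  have cg: "cont g" by (rule inv_space_cont[OF V(1) g(1)])
  have "\<exists>k. cont k \<and> hermitian k \<and> conv k g \<one> \<noteq> 0"
  proof -
    \<comment> \<open>Convolving \<open>g\<close> with its adjoint gives \<open>nsq g\<close> at the
      identity, which is positive; one of the two hermitian parts of this kernel must then act
      nontrivially on \<open>g\<close>.\<close>
    let ?u = "\<lambda>x. cnj (g (inv x))"
    have u: "cont ?u" by (rule continuous_map_cnj[OF cont_compT[OF cont_inv cg]])
    have "conv ?u g \<one> = ip g g"
      unfolding conv_alt[OF u cg one_closed] ip_def
      by (rule mean_cong) (use cg in \<open>auto intro!: cont_intros\<close>)
    then have ne: "conv ?u g \<one> \<noteq> 0" using nsq_pos[OF cg g(2,3)] ip_self[OF cg] by simp
    obtain u1 u2 where u12: "cont u1" "hermitian u1" "cont u2" "hermitian u2" "?u = (\<lambda>x. u1 x + \<i> * u2 x)"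
      by (rule hermitian_decomposition[OF u])
    from ne have "conv u1 g \<one> + \<i> * conv u2 g \<one> \<noteq> 0"
      unfolding u12(5) conv_decomposition[OF u12(1,3) cg one_closed] .
    then have "conv u1 g \<one> \<noteq> 0 \<or> conv u2 g \<one> \<noteq> 0" by auto
    with u12 show ?thesis by blast
  qed
  then obtain k where k: "cont k" "hermitian k" "conv k g \<one> \<noteq> 0" by blast
  from hermitian_eigenvalue[OF V(1) k(1,2) g(1) one_closed k(3)] obtain c
    where c: "c \<noteq> 0" "nonzero_space (eigenspace V k c)" unfolding nonzero_space_def by blast
  obtain M where M: "inv_space M" "M \<subseteq> eigenspace V k c" "nonzero_space M"
    and min: "\<And>M'. inv_space M' \<Longrightarrow> M' \<subseteq> M \<Longrightarrow> nonzero_space M' \<Longrightarrow> M' = M"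
    by (rule minimal_subspace[OF V(1) k(1) c]) auto
  have scalar: "\<exists>a. \<forall>h\<in>M. \<forall>x\<in>carrier H. conv u h x = a * h x" if u: "cont u" for u
  proof -
    obtain u1 u2 where u12: "cont u1" "hermitian u1" "cont u2" "hermitian u2" "u = (\<lambda>x. u1 x + \<i> * u2 x)"
      by (rule hermitian_decomposition[OF u])
    obtain a b where "\<forall>h\<in>M. \<forall>x\<in>carrier H. conv u1 h x = a * h x" "\<forall>h\<in>M. \<forall>x\<in>carrier H. conv u2 h x = b * h x"
      using minimal_conv_scalar[OF M(1,3) min u12(1,2)] minimal_conv_scalar[OF M(1,3) min u12(3,4)] by blast
    then have "\<forall>h\<in>M. \<forall>x\<in>carrier H. conv u h x = (a + \<i> * b) * h x"
      unfolding u12(5) using conv_decomposition[OF u12(1,3) inv_space_cont[OF M(1)]]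
      by (simp add: distrib_right mult.assoc)
    then show ?thesis by blast
  qed
  obtain h z where h: "h \<in> M" "z \<in> carrier H" "h z \<noteq> 0" using M(3) by (auto simp: nonzero_space_def)
  have ch: "cont h" by (rule inv_space_cont[OF M(1) h(1)])
  have "\<exists>b. \<forall>x\<in>carrier H. h (x \<otimes> t) = b * h x" if t: "t \<in> carrier H" for t
  proof -
    obtain a where a: "\<forall>h\<in>M. \<forall>x\<in>carrier H. conv (\<lambda>x. k (x \<otimes> t)) h x = a * h x"
      using scalar[OF cont_translate[OF t k(1)]] by blast
    have "h (x \<otimes> t) = (a / c) * h x" if x: "x \<in> carrier H" for x
    proof -
      have "conv k h (x \<otimes> t) = c * h (x \<otimes> t)" using M(2) h(1) x t by (auto simp: eigenspace_def)
      then show ?thesis using a h(1) x c(1) conv_translate_kernel[OF k(1) ch x t] by (simp add: field_simps)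
    qed
    then show ?thesis by blast
  qed
  then obtain b where b: "\<And>t x. t \<in> carrier H \<Longrightarrow> x \<in> carrier H \<Longrightarrow> h (x \<otimes> t) = b t * h x" by metis
  have h1: "h \<one> \<noteq> 0" using b[of z \<one>] h by auto
  let ?f = "\<lambda>x. (1 / h \<one>) * h x"
  have fb: "?f x = b x" if "x \<in> carrier H" for x using b[OF that one_closed] h1 that by simp
  have mult: "?f (x \<otimes> y) = ?f x * ?f y" if "x \<in> carrier H" "y \<in> carrier H" for x y
    using fb[OF that(2)] b[OF that(2,1)] by simp
  \<comment> \<open>Translation by \<open>t\<close> preserves \<open>nsq h\<close>, but it also
    multiplies it by \<open>(norm (b t))\<^sup>2\<close>.\<close>
  have norm: "norm (?f t) = 1" if t: "t \<in> carrier H" for t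
  proof -
    have "nsq h = nsq (\<lambda>x. h (x \<otimes> t))"
      unfolding nsq_def ip_def using mean_translate[of "\<lambda>x. h x * cnj (h x)" t] ch t by (simp add: cont_intros)
    also have "\<dots> = nsq (\<lambda>x. b t * h x)"
      by (rule nsq_cong[OF continuous_map_scale[OF ch]]) (simp add: b t)
    also have "\<dots> = (norm (b t))\<^sup>2 * nsq h" by (rule nsq_scale[OF ch])
    finally have "(norm (b t))\<^sup>2 = 1" using nsq_pos[OF ch h(2,3)] by simp
    then show ?thesis unfolding fb[OF t] by (simp add: power2_eq_1_iff) (use norm_ge_zero[of "b t"] in linarith)
  qed
  show ?thesis
  proof (rule that)
    show "?f \<in> V" by (rule inv_space_scale[OF V(1)]) (use M(2) h(1) in \<open>auto simp: eigenspace_def\<close>)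
    show "character ?f" unfolding character_def using mult norm continuous_map_scale[OF ch] by blast
  qed
qed

text \<open>The orthogonal complement of the functions invariant under \<open>a\<close> contains all \<open>f (x \<otimes> a) - f x\<close>,
  so that it is nonzero when \<open>a \<noteq> \<one>\<close>. A character in it is not invariant under \<open>a\<close>.\<close>
theorem characters_separate_points:
  assumes a: "a \<in> carrier H" "a \<noteq> \<one>"
  obtains f where "character f" "f a \<noteq> 1"
proof -
  let ?inv = "\<lambda>h. cont h \<and> (\<forall>x\<in>carrier H. h (x \<otimes> a) = h x)"
  define V where "V = {g. cont g \<and> (\<forall>h. ?inv h \<longrightarrow> ip g h = 0)}"
  have V: "inv_space V"
    unfolding inv_space_def
  proof (intro conjI ballI allI impI)
    fix g t assume g: "g \<in> V" and t: "t \<in> carrier H"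
    have cg: "cont g" using g by (simp add: V_def)
    have "ip (\<lambda>x. g (x \<otimes> t)) h = 0" if h: "?inv h" for h
    proof -
      let ?h = "\<lambda>x. h (x \<otimes> inv t)"
      have t': "inv t \<in> carrier H" using t by simp
      have ch: "cont ?h" using cont_translate[OF t'] h by blast
      have "?h (x \<otimes> a) = ?h x" if x: "x \<in> carrier H" for x
      proof -
        have "h (x \<otimes> a \<otimes> inv t) = h (x \<otimes> inv t \<otimes> a)" using x t a by (simp add: m_ac)
        also have "\<dots> = h (x \<otimes> inv t)" using h x t by simp
        finally show ?thesis .
      qed
      with ch g have 0: "ip g ?h = 0" by (auto simp: V_def)
      have c: "cont (\<lambda>x. g x * cnj (?h x))" by (intro cont_intros cg ch)
      have "ip g ?h = mean (\<lambda>x. g (x \<otimes> t) * cnj (?h (x \<otimes> t)))"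
        unfolding ip_def using mean_translate[OF c t] by simp
      also have "\<dots> = ip (\<lambda>x. g (x \<otimes> t)) h"
        unfolding ip_def
      proof (rule mean_cong[symmetric, OF cont_translate[OF t c]])
        fix x assume "x \<in> carrier H"
        then show "g (x \<otimes> t) * cnj (h (x \<otimes> t \<otimes> inv t)) = g (x \<otimes> t) * cnj (h x)" using t by (simp add: m_assoc)
      qed
      finally show ?thesis using 0 by simp
    qed
    then show "(\<lambda>x. g (x \<otimes> t)) \<in> V" using cont_translate[OF t cg] by (simp add: V_def)
  next
    fix g assume g: "cont g" and *: "\<forall>e>0. \<exists>h\<in>V. \<forall>x\<in>carrier H. norm (h x - g x) \<le> e"
    have "ip g h = 0" if h: "?inv h" for h
    proof -
      have ch: "cont h" using h by blast
      obtain B where B: "B > 0" "\<And>x. x \<in> carrier H \<Longrightarrow> norm (h x) \<le> B" by (rule cont_bounded[OF ch]) auto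
      have "norm (ip g h) \<le> 0"
      proof (rule field_le_epsilon)
        fix e :: real assume "e > 0"
        then have "e / B > 0" using B(1) by simp
        with * obtain g' where g': "g' \<in> V" "\<And>x. x \<in> carrier H \<Longrightarrow> norm (g' x - g x) \<le> e / B" by blast
        have cg': "cont g'" using g' by (simp add: V_def)
        have "norm (ip (\<lambda>x. g' x - g x) h) \<le> e"
          unfolding ip_def
        proof (rule mean_norm_le)
          fix x assume x: "x \<in> carrier H"
          have "norm (g' x - g x) * norm (h x) \<le> e / B * B"
            using g'(2)[OF x] B(2)[OF x] \<open>e / B > 0\<close> by (intro mult_mono) auto
          then show "norm ((g' x - g x) * cnj (h x)) \<le> e" using B(1) by (simp add: norm_mult)
        qed (intro cont_intros cg' g ch)
        moreover have "ip g' h = 0" using g'(1) h by (simp add: V_def)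
        ultimately show "norm (ip g h) \<le> 0 + e" by (simp add: ip_diff[OF cg' g ch])
      qed
      then show ?thesis by simp
    qed
    with g show "g \<in> V" by (simp add: V_def)
  qed (auto simp: V_def ip_add ip_scale intro!: cont_intros)
  \<comment> \<open>A function with value 0 at \<open>\<one>\<close> and 1 at \<open>a\<close> makes
    \<open>f (x \<otimes> a) - f x\<close> nonzero at \<open>\<one>\<close>.\<close>
  have "completely_regular_space T"
    using compact_T Hausdorff_T by (simp add: compact_Hausdorff_or_regular_imp_normal_space
      normal_imp_completely_regular_space compact_Hausdorff_imp_regular_space)
  moreover have "closedin T {a}" using Hausdorff_T a(1) closedin_Hausdorff_singleton by (metis topspace_T)
  ultimately obtain f0 :: "'a \<Rightarrow> real" where f0: "continuous_map T (top_of_set {0..1}) f0" "f0 \<one> = 0" "f0 ` {a} \<subseteq> {1}"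
    using a unfolding completely_regular_space_def topspace_T by (metis Diff_iff one_closed singletonD)
  define f where "f = (\<lambda>x. complex_of_real (f0 x))"
  have cf: "cont f" unfolding f_def
    by (rule continuous_map_of_real) (use f0(1) in \<open>simp add: continuous_map_in_subtopology\<close>)
  have cfa: "cont (\<lambda>x. f (x \<otimes> a))" by (rule cont_translate[OF a(1) cf])
  let ?g = "\<lambda>x. f (x \<otimes> a) - f x"
  have "ip ?g h = 0" if h: "?inv h" for h
  proof -
    have ch: "cont h" using h by blast
    have c: "cont (\<lambda>x. f x * cnj (h x))" by (intro cont_intros cf ch)
    have "ip (\<lambda>x. f (x \<otimes> a)) h = mean (\<lambda>x. f (x \<otimes> a) * cnj (h (x \<otimes> a)))"
      unfolding ip_def by (rule mean_cong[OF cont_translate[OF a(1) c]]) (use h in simp)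
    also have "\<dots> = ip f h" unfolding ip_def by (rule mean_translate[OF c a(1)])
    finally show ?thesis by (simp add: ip_diff[OF cfa cf ch])
  qed
  then have "?g \<in> V" using continuous_map_diff[OF cfa cf] by (simp add: V_def)
  moreover have "?g \<one> \<noteq> 0" using a f0 by (simp add: f_def)
  ultimately have "nonzero_space V" unfolding nonzero_space_def by (intro bexI[of _ ?g] bexI[of _ \<one>]) auto
  from character_in_inv_space[OF V this] obtain f where f: "f \<in> V" "character f" by blast
  have cf: "cont f" using f by (simp add: character_def)
  have "f a \<noteq> 1"
  proof
    assume "f a = 1"
    then have "?inv f" using f(2) a by (simp add: character_def)
    then have "ip f f = 0" using f(1) by (simp add: V_def)
    moreover have "norm (f \<one>) = 1" using f(2) by (simp add: character_def)
    then have "f \<one> \<noteq> 0" by auto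
    then have "nsq f > 0" by (rule nsq_pos[OF cf one_closed])
    ultimately show False by (simp add: nsq_def)
  qed
  with f(2) that show ?thesis by blast
qed

end

section \<open>Complex matrices\<close>

unbundle no vec_syntax
unbundle no inner_syntax

definition mtrace :: "complex mat \<Rightarrow> complex" where
  "mtrace A = (\<Sum>i<dim_row A. A $$ (i, i))"

lemma index_mult_mat_sum:
  "A \<in> carrier_mat n m \<Longrightarrow> B \<in> carrier_mat m k \<Longrightarrow> i < n \<Longrightarrow> j < k \<Longrightarrow>
    (A * B) $$ (i, j) = (\<Sum>l<m. A $$ (i, l) * B $$ (l, j))"
  by (auto simp: scalar_prod_def atLeast0LessThan intro!: sum.cong)

lemma index_mult_mat_vec_sum:
  "A \<in> carrier_mat n m \<Longrightarrow> v \<in> carrier_vec m \<Longrightarrow> i < n \<Longrightarrow> (A *\<^sub>v v) $ i = (\<Sum>l<m. A $$ (i, l) * v $ l)"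
  by (auto simp: scalar_prod_def atLeast0LessThan intro!: sum.cong)

lemma mtrace_comm:
  assumes "A \<in> carrier_mat n m" "B \<in> carrier_mat m n"
  shows "mtrace (A * B) = mtrace (B * A)"
proof -
  have "mtrace (A * B) = (\<Sum>i<n. \<Sum>l<m. A $$ (i, l) * B $$ (l, i))"
    unfolding mtrace_def using assms by (auto simp: index_mult_mat_sum intro!: sum.cong simp del: index_mult_mat(1))
  also have "\<dots> = (\<Sum>l<m. \<Sum>i<n. B $$ (l, i) * A $$ (i, l))"
    by (subst sum.swap) (simp add: mult.commute)
  also have "\<dots> = mtrace (B * A)"
    unfolding mtrace_def using assms by (auto simp: index_mult_mat_sum intro!: sum.cong simp del: index_mult_mat(1))
  finally show ?thesis .
qed

lemma mtrace_one: "mtrace (1\<^sub>m n) = of_nat n"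
  by (simp add: mtrace_def)

lemma mtrace_add: "A \<in> carrier_mat n n \<Longrightarrow> B \<in> carrier_mat n n \<Longrightarrow> mtrace (A + B) = mtrace A + mtrace B"
  by (simp add: mtrace_def sum.distrib)

lemma mtrace_similar: "similar_mat_wit A B P Q \<Longrightarrow> mtrace A = mtrace B"
proof -
  assume "similar_mat_wit A B P Q"
  note s = similar_mat_witD[OF refl this]
  define n where "n = dim_row A"
  note s = s[folded n_def]
  have "mtrace A = mtrace (P * (B * Q))"
    using assoc_mult_mat[OF s(6,5,7)] s(3) by (rule_tac arg_cong[of _ _ mtrace]) simp
  also have "\<dots> = mtrace (B * Q * P)" by (rule mtrace_comm) (use s in auto)
  also have "B * Q * P = B" using s by (simp add: assoc_mult_mat[of B n n Q n P n])
  finally show ?thesis .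
qed

lemma invertible_mat_obtain:
  fixes A :: "complex mat"
  assumes A: "A \<in> carrier_mat n n" and "det A \<noteq> 0"
  obtains B where "B \<in> carrier_mat n n" "A * B = 1\<^sub>m n" "B * A = 1\<^sub>m n"
  using det_non_zero_imp_unit[OF assms, of "TYPE(complex)"] that by (auto simp: Units_def ring_mat_simps)

definition inj_mat :: "complex mat \<Rightarrow> bool" where
  "inj_mat A \<longleftrightarrow> (\<forall>v\<in>carrier_vec (dim_col A). A *\<^sub>v v = 0\<^sub>v (dim_row A) \<longrightarrow> v = 0\<^sub>v (dim_col A))"

lemma inj_matD:
  "inj_mat A \<Longrightarrow> A \<in> carrier_mat n k \<Longrightarrow> v \<in> carrier_vec k \<Longrightarrow> A *\<^sub>v v = 0\<^sub>v n \<Longrightarrow> v = 0\<^sub>v k"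
  by (auto simp: inj_mat_def)

text \<open>Padding a matrix that is too wide with zero rows yields a singular square matrix, and a
  vector in its kernel is also killed by \<open>A\<close>.\<close>

lemma inj_mat_dim_le:
  assumes A: "A \<in> carrier_mat n k" and inj: "inj_mat A"
  shows "k \<le> n"
proof (rule ccontr)
  assume "\<not> k \<le> n"
  then have nk: "n < k" by simp
  let ?A = "mat k k (\<lambda>(i, j). if i < n then A $$ (i, j) else 0)"
  have A': "?A \<in> carrier_mat k k" by simp
  have "det ?A = 0"
  proof (rule ccontr)
    assume "det ?A \<noteq> 0"
    from invertible_mat_obtain[OF A' this] obtain B where B: "B \<in> carrier_mat k k" "?A * B = 1\<^sub>m k" by auto
    have "(?A * B) $$ (n, n) = 0" using nk unfolding index_mult_mat_sum[OF A' B(1) nk nk] by simp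
    then show False using B nk by simp
  qed
  then obtain v where v: "v \<in> carrier_vec k" "v \<noteq> 0\<^sub>v k" "?A *\<^sub>v v = 0\<^sub>v k"
    using det_0_iff_vec_prod_zero_field[OF A'] by auto
  have "A *\<^sub>v v = 0\<^sub>v n"
  proof (rule eq_vecI)
    fix i assume "i < dim_vec (0\<^sub>v n :: complex vec)"
    then have i: "i < n" "i < k" using nk by auto
    have "(A *\<^sub>v v) $ i = (?A *\<^sub>v v) $ i"
      unfolding index_mult_mat_vec_sum[OF A v(1) i(1)] index_mult_mat_vec_sum[OF A' v(1) i(2)] using i by simp
    then show "(A *\<^sub>v v) $ i = 0\<^sub>v n $ i" using v i by simp
  qed (use A in auto)
  from inj_matD[OF inj A v(1) this] v(2) show False by simp
qed

text \<open>The left inverse is built from the Gram matrix, which is invertible.\<close>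
lemma inj_mat_left_inverse:
  assumes A: "A \<in> carrier_mat n k" and inj: "inj_mat A"
  obtains C where "C \<in> carrier_mat k n" "C * A = 1\<^sub>m k"
proof -
  let ?B = "mat k n (\<lambda>(i, j). cnj (A $$ (j, i)))"
  have B: "?B \<in> carrier_mat k n" by simp
  have G: "?B * A \<in> carrier_mat k k" by (rule mult_carrier_mat[OF B A])
  have "det (?B * A) \<noteq> 0"
  proof
    assume "det (?B * A) = 0"
    then obtain v where v: "v \<in> carrier_vec k" "v \<noteq> 0\<^sub>v k" "(?B * A) *\<^sub>v v = 0\<^sub>v k"
      using det_0_iff_vec_prod_zero_field[OF G] by auto
    define u where "u = A *\<^sub>v v"
    have u: "u \<in> carrier_vec n" using A v by (simp add: u_def)
    have Bu: "?B *\<^sub>v u = 0\<^sub>v k" using v(3) assoc_mult_mat_vec[OF B A v(1)] by (simp add: u_def)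
    \<comment> \<open>The squared length of \<open>u\<close> is the pairing of \<open>v\<close> with
      the Gram matrix applied to \<open>v\<close>, which is zero.\<close>
    have "(\<Sum>i<n. u $ i * cnj (u $ i)) = (\<Sum>i<n. \<Sum>j<k. cnj (v $ j) * (cnj (A $$ (i, j)) * u $ i))"
      using index_mult_mat_vec_sum[OF A v(1)]
      by (intro sum.cong) (auto simp: u_def sum_distrib_left mult_ac simp del: index_mult_mat_vec)
    also have "\<dots> = (\<Sum>j<k. cnj (v $ j) * (\<Sum>i<n. cnj (A $$ (i, j)) * u $ i))"
      by (subst sum.swap) (simp add: sum_distrib_left)
    also have "\<dots> = (\<Sum>j<k. cnj (v $ j) * (?B *\<^sub>v u) $ j)"
    proof (rule sum.cong)
      fix j assume "j \<in> {..<k}"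
      then have j: "j < k" by simp
      show "cnj (v $ j) * (\<Sum>i<n. cnj (A $$ (i, j)) * u $ i) = cnj (v $ j) * (?B *\<^sub>v u) $ j"
        unfolding index_mult_mat_vec_sum[OF B u j] using j by simp
    qed simp
    also have "\<dots> = 0" unfolding Bu by simp
    finally have "(\<Sum>i<n. complex_of_real ((norm (u $ i))\<^sup>2)) = 0" by (simp only: complex_norm_square)
    then have "(\<Sum>i<n. (norm (u $ i))\<^sup>2) = 0" by (simp only: of_real_sum[symmetric] of_real_eq_0_iff)
    then have "\<And>i. i < n \<Longrightarrow> u $ i = 0" by (subst (asm) sum_nonneg_eq_0_iff) auto
    then have "A *\<^sub>v v = 0\<^sub>v n" using A by (intro eq_vecI) (auto simp: u_def)
    from inj_matD[OF inj A v(1) this] v(2) show False by simp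
  qed
  from invertible_mat_obtain[OF G this] obtain X where X: "X \<in> carrier_mat k k" "X * (?B * A) = 1\<^sub>m k" by blast
  show ?thesis
    by (rule that[of "X * ?B"]) (use X A assoc_mult_mat[OF X(1) B A] in auto)
qed

lemma mult_mat_zero_vec:
  fixes A :: "complex mat"
  shows "A \<in> carrier_mat n k \<Longrightarrow> A *\<^sub>v 0\<^sub>v k = 0\<^sub>v n"
  by (rule eq_vecI) (auto simp: scalar_prod_def)

lemma mat_eq_by_vec:
  assumes A: "A \<in> carrier_mat n m" and B: "B \<in> carrier_mat n m"
    and eq: "\<And>v. v \<in> carrier_vec m \<Longrightarrow> A *\<^sub>v v = B *\<^sub>v (v :: complex vec)"
  shows "A = B"
proof (rule eq_matI)
  fix i j assume "i < dim_row B" "j < dim_col B"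
  then have ij: "i < n" "j < m" using B by auto
  have "(A *\<^sub>v unit_vec m j) $ i = (B *\<^sub>v unit_vec m j) $ i" using eq by simp
  then show "A $$ (i, j) = B $$ (i, j)" using A B ij by simp
qed (use A B in auto)

lemma surj_mat_right_inverse:
  assumes B: "B \<in> carrier_mat n m" and surj: "\<And>v. v \<in> carrier_vec n \<Longrightarrow> \<exists>w\<in>carrier_vec m. B *\<^sub>v w = (v :: complex vec)"
  obtains C where "C \<in> carrier_mat m n" "B * C = 1\<^sub>m n"
proof -
  have "\<forall>j. \<exists>w\<in>carrier_vec m. B *\<^sub>v w = (unit_vec n j :: complex vec)" using surj by simp
  then obtain w where w: "\<And>j. w j \<in> carrier_vec m" "\<And>j. B *\<^sub>v w j = (unit_vec n j :: complex vec)" by metis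
  let ?C = "mat m n (\<lambda>(i, j). w j $ i)"
  have C: "?C \<in> carrier_mat m n" by simp
  have "B * ?C = 1\<^sub>m n"
  proof (rule eq_matI)
    fix i j assume "i < dim_row (1\<^sub>m n :: complex mat)" "j < dim_col (1\<^sub>m n :: complex mat)"
    then have ij: "i < n" "j < n" by auto
    have "(B * ?C) $$ (i, j) = (B *\<^sub>v w j) $ i"
      unfolding index_mult_mat_sum[OF B C ij] index_mult_mat_vec_sum[OF B w(1) ij(1)] using ij by simp
    then show "(B * ?C) $$ (i, j) = 1\<^sub>m n $$ (i, j)" using w(2) ij by simp
  qed (use B in auto)
  with C that show ?thesis by blast
qed

section \<open>Linear subspaces as images of injective matrices\<close>

definition linear_subspace :: "nat \<Rightarrow> complex vec set \<Rightarrow> bool" where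
  "linear_subspace n W \<longleftrightarrow> W \<subseteq> carrier_vec n \<and> 0\<^sub>v n \<in> W \<and> (\<forall>v\<in>W. \<forall>w\<in>W. v + w \<in> W) \<and> (\<forall>c. \<forall>v\<in>W. c \<cdot>\<^sub>v v \<in> W)"

lemma subspace_iff_linear_subspace:
  "VectorSpace.subspace class_ring W (module_vec TYPE(complex) n) \<longleftrightarrow> linear_subspace n W"
proof -
  have vs: "vectorspace (class_ring :: complex ring) (module_vec TYPE(complex) n)" by (rule vec_vs)
  then have "module (class_ring :: complex ring) (module_vec TYPE(complex) n)" by (simp add: vectorspace_def)
  with vs show ?thesis
    unfolding VectorSpace.subspace_def submodule_def linear_subspace_def
    by (auto simp: module_vec_simps)
qed

lemma linear_subspace_image:
  assumes A: "A \<in> carrier_mat n k" and W: "linear_subspace k W"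
  shows "linear_subspace n ((\<lambda>v. A *\<^sub>v v) ` W)"
proof -
  have sub: "W \<subseteq> carrier_vec k" using W by (simp add: linear_subspace_def)
  have "A *\<^sub>v v + A *\<^sub>v w \<in> (\<lambda>v. A *\<^sub>v v) ` W" if vw: "v \<in> W" "w \<in> W" for v w
  proof -
    have "A *\<^sub>v v + A *\<^sub>v w = A *\<^sub>v (v + w)"
      by (rule mult_add_distrib_mat_vec[OF A, symmetric]) (use sub vw in auto)
    moreover have "v + w \<in> W" using W vw by (simp add: linear_subspace_def)
    ultimately show ?thesis by simp
  qed
  moreover have "c \<cdot>\<^sub>v (A *\<^sub>v v) \<in> (\<lambda>v. A *\<^sub>v v) ` W" if v: "v \<in> W" for c v
  proof -
    have "c \<cdot>\<^sub>v (A *\<^sub>v v) = A *\<^sub>v (c \<cdot>\<^sub>v v)"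
      by (rule mult_mat_vec[OF A, symmetric]) (use sub v in auto)
    moreover have "c \<cdot>\<^sub>v v \<in> W" using W v by (simp add: linear_subspace_def)
    ultimately show ?thesis by simp
  qed
  moreover have "0\<^sub>v n \<in> (\<lambda>v. A *\<^sub>v v) ` W"
    using W mult_mat_zero_vec[OF A] by (intro image_eqI[of _ _ "0\<^sub>v k"]) (auto simp: linear_subspace_def)
  ultimately show ?thesis using A sub unfolding linear_subspace_def by auto
qed

lemma linear_subspace_kernel:
  assumes A: "A \<in> carrier_mat n k"
  shows "linear_subspace k {v \<in> carrier_vec k. A *\<^sub>v v = 0\<^sub>v n}"
  by (auto simp: linear_subspace_def mult_add_distrib_mat_vec[OF A] mult_mat_vec[OF A] mult_mat_zero_vec[OF A])

lemma linear_subspace_carrier: "linear_subspace n (carrier_vec n)"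
  by (auto simp: linear_subspace_def)

text \<open>The columns of \<open>A\<close> form a basis of \<open>W\<close>: among the injective
  matrices with image inside \<open>W\<close>, \<open>A\<close> has the greatest number of columns,
  which is at most \<open>n\<close>. A vector of \<open>W\<close> outside the image could be
  appended as a further column.\<close>

lemma linear_subspace_eq_image:
  assumes W: "linear_subspace n W"
  obtains k A where "A \<in> carrier_mat n k" "inj_mat A" "W = (\<lambda>v. A *\<^sub>v v) ` carrier_vec k"
proof -
  define P where "P k \<longleftrightarrow> (\<exists>A\<in>carrier_mat n k. inj_mat A \<and> (\<lambda>v. A *\<^sub>v v) ` carrier_vec k \<subseteq> W)" for k
  have "P 0" unfolding P_def
  proof (intro bexI conjI)
    show "inj_mat (0\<^sub>m n 0)" by (auto simp: inj_mat_def)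
    have "0\<^sub>m n 0 *\<^sub>v v = 0\<^sub>v n" if "v \<in> carrier_vec 0" for v :: "complex vec"
      by (rule eq_vecI) (use that in \<open>auto simp: scalar_prod_def\<close>)
    then show "(\<lambda>v. 0\<^sub>m n 0 *\<^sub>v v) ` carrier_vec 0 \<subseteq> W" using W by (auto simp: linear_subspace_def)
  qed simp
  moreover have "\<forall>k. P k \<longrightarrow> k < Suc n" unfolding P_def using inj_mat_dim_le by (auto simp: less_Suc_eq_le)
  ultimately obtain k where k: "P k" "\<And>l. P l \<Longrightarrow> l \<le> k"
    using ex_has_greatest_nat[of P 0 "\<lambda>k. k" "Suc n"] by auto
  then obtain A where A: "A \<in> carrier_mat n k" "inj_mat A" "(\<lambda>v. A *\<^sub>v v) ` carrier_vec k \<subseteq> W" unfolding P_def by blast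
  have "w \<in> (\<lambda>v. A *\<^sub>v v) ` carrier_vec k" if w: "w \<in> W" for w
  proof (rule ccontr)
    assume nw: "w \<notin> (\<lambda>v. A *\<^sub>v v) ` carrier_vec k"
    have wc: "w \<in> carrier_vec n" using W w by (auto simp: linear_subspace_def)
    let ?B = "mat n (Suc k) (\<lambda>(i, j). if j < k then A $$ (i, j) else w $ i)"
    have B: "?B \<in> carrier_mat n (Suc k)" by simp
    have Bv: "?B *\<^sub>v v = A *\<^sub>v vec k (\<lambda>j. v $ j) + v $ k \<cdot>\<^sub>v w" if v: "v \<in> carrier_vec (Suc k)" for v
    proof (rule eq_vecI)
      fix i assume "i < dim_vec (A *\<^sub>v vec k (\<lambda>j. v $ j) + v $ k \<cdot>\<^sub>v w)"
      then have i: "i < n" using wc by simp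
      have "(?B *\<^sub>v v) $ i = (\<Sum>l<k. A $$ (i, l) * v $ l) + w $ i * v $ k"
        unfolding index_mult_mat_vec_sum[OF B v i] using i by simp
      also have "\<dots> = (A *\<^sub>v vec k (\<lambda>j. v $ j) + v $ k \<cdot>\<^sub>v w) $ i"
        using i wc A index_mult_mat_vec_sum[OF A(1) vec_carrier i, of "\<lambda>j. v $ j"] by (simp del: index_mult_mat_vec)
      finally show "(?B *\<^sub>v v) $ i = (A *\<^sub>v vec k (\<lambda>j. v $ j) + v $ k \<cdot>\<^sub>v w) $ i" .
    qed (use wc in auto)
    have "inj_mat ?B"
      unfolding inj_mat_def
    proof (intro ballI impI)
      fix v assume "v \<in> carrier_vec (dim_col ?B)" and z: "?B *\<^sub>v v = 0\<^sub>v (dim_row ?B)"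
      then have v: "v \<in> carrier_vec (Suc k)" by simp
      let ?v = "vec k (\<lambda>j. v $ j)"
      have z: "A *\<^sub>v ?v + v $ k \<cdot>\<^sub>v w = 0\<^sub>v n" using z Bv[OF v] by simp
      \<comment> \<open>Otherwise the relation could be solved for \<open>w\<close>, placing it in
        the image of \<open>A\<close>.\<close>
      have vk: "v $ k = 0"
      proof (rule ccontr)
        assume ne: "v $ k \<noteq> 0"
        have "w = A *\<^sub>v ((- 1 / v $ k) \<cdot>\<^sub>v ?v)"
        proof (rule eq_vecI)
          fix i assume "i < dim_vec (A *\<^sub>v ((- 1 / v $ k) \<cdot>\<^sub>v ?v))"
          then have i: "i < n" using A by simp
          have "(A *\<^sub>v ?v + v $ k \<cdot>\<^sub>v w) $ i = 0" using z i by simp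
          then have "(A *\<^sub>v ?v) $ i + v $ k * w $ i = 0" using i wc A by simp
          then have "(A *\<^sub>v ?v) $ i = - (v $ k * w $ i)" by (simp add: eq_neg_iff_add_eq_0)
          moreover have "(A *\<^sub>v ((- 1 / v $ k) \<cdot>\<^sub>v ?v)) $ i = (- 1 / v $ k) * (A *\<^sub>v ?v) $ i"
            unfolding mult_mat_vec[OF A(1) vec_carrier] using i A by simp
          ultimately show "w $ i = (A *\<^sub>v ((- 1 / v $ k) \<cdot>\<^sub>v ?v)) $ i"
            using ne by simp
        qed (use wc A in auto)
        then show False using nw by auto
      qed
      have "A *\<^sub>v ?v = 0\<^sub>v n"
      proof (rule eq_vecI)
        fix i assume "i < dim_vec (0\<^sub>v n :: complex vec)"
        then have i: "i < n" by simp
        have "(A *\<^sub>v ?v + v $ k \<cdot>\<^sub>v w) $ i = 0" using z i by simp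
        then show "(A *\<^sub>v ?v) $ i = 0\<^sub>v n $ i" using i wc A vk by simp
      qed (use A in auto)
      from inj_matD[OF A(2,1) vec_carrier this] have 0: "?v = 0\<^sub>v k" .
      show "v = 0\<^sub>v (dim_col ?B)"
      proof (rule eq_vecI)
        fix i assume "i < dim_vec (0\<^sub>v (dim_col ?B) :: complex vec)"
        then have "i < k \<or> i = k" by auto
        then show "v $ i = 0\<^sub>v (dim_col ?B) $ i"
          using vk arg_cong[OF 0, of "\<lambda>u. u $ i"] by auto
      qed (use v in auto)
    qed
    moreover have "(\<lambda>v. ?B *\<^sub>v v) ` carrier_vec (Suc k) \<subseteq> W"
    proof
      fix x assume "x \<in> (\<lambda>v. ?B *\<^sub>v v) ` carrier_vec (Suc k)"
      then obtain v where v: "v \<in> carrier_vec (Suc k)" "x = ?B *\<^sub>v v" by blast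
      have "A *\<^sub>v vec k (\<lambda>j. v $ j) \<in> W" using A(3) by auto
      then show "x \<in> W" using W w v(2) Bv[OF v(1)] by (auto simp: linear_subspace_def)
    qed
    ultimately have "P (Suc k)" unfolding P_def using B by blast
    from k(2)[OF this] show False by simp
  qed
  with A that show ?thesis by blast
qed

text \<open>\<open>A * D\<close> fixes every vector in the image of \<open>A\<close>, because
  \<open>D\<close> is a left inverse of \<open>A\<close>.\<close>

lemma factor_through_image:
  fixes A X D :: "complex mat"
  assumes A: "A \<in> carrier_mat n k" and D: "D \<in> carrier_mat k n" "D * A = 1\<^sub>m k" and X: "X \<in> carrier_mat n m"
    and im: "\<And>v. v \<in> carrier_vec m \<Longrightarrow> X *\<^sub>v v \<in> (\<lambda>v. A *\<^sub>v v) ` carrier_vec k"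
  shows "A * (D * X) = X"
proof (rule mat_eq_by_vec)
  fix v :: "complex vec" assume v: "v \<in> carrier_vec m"
  obtain w where w: "w \<in> carrier_vec k" "X *\<^sub>v v = A *\<^sub>v w" using im[OF v] by blast
  have "(A * (D * X)) *\<^sub>v v = A *\<^sub>v ((D * X) *\<^sub>v v)"
    by (rule assoc_mult_mat_vec[OF A _ v]) (use D X in auto)
  also have "(D * X) *\<^sub>v v = D *\<^sub>v (A *\<^sub>v w)" using assoc_mult_mat_vec[OF D(1) X v] w(2) by simp
  also have "\<dots> = (D * A) *\<^sub>v w" using assoc_mult_mat_vec[OF D(1) A w(1)] by simp
  finally show "(A * (D * X)) *\<^sub>v v = X *\<^sub>v v" using D w by simp
qed (use A D X in auto)

section \<open>Representations and Schur's lemma\<close>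

lemma representationD:
  assumes "representation G T \<pi>"
  shows rep_carrier: "g \<in> carrier G \<Longrightarrow> \<pi> g \<in> carrier_mat (degree_rep G \<pi>) (degree_rep G \<pi>)"
    and rep_one: "\<pi> \<one>\<^bsub>G\<^esub> = 1\<^sub>m (degree_rep G \<pi>)"
    and rep_mult: "g \<in> carrier G \<Longrightarrow> h \<in> carrier G \<Longrightarrow> \<pi> (g \<otimes>\<^bsub>G\<^esub> h) = \<pi> g * \<pi> h"
    and rep_cont: "i < degree_rep G \<pi> \<Longrightarrow> j < degree_rep G \<pi> \<Longrightarrow> continuous_map T euclidean (\<lambda>g. \<pi> g $$ (i, j))"
  using assms by (auto simp: representation_def Let_def)

lemma representationI:
  assumes "\<pi> \<one>\<^bsub>G\<^esub> = 1\<^sub>m n"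
    and "\<And>g. g \<in> carrier G \<Longrightarrow> \<pi> g \<in> carrier_mat n n"
    and "\<And>g h. g \<in> carrier G \<Longrightarrow> h \<in> carrier G \<Longrightarrow> \<pi> (g \<otimes>\<^bsub>G\<^esub> h) = \<pi> g * \<pi> h"
    and "\<And>i j. i < n \<Longrightarrow> j < n \<Longrightarrow> continuous_map T euclidean (\<lambda>g. \<pi> g $$ (i, j))"
  shows "representation G T \<pi>" "degree_rep G \<pi> = n"
proof -
  show "degree_rep G \<pi> = n" by (simp add: degree_rep_def assms(1))
  then show "representation G T \<pi>" using assms by (simp add: representation_def)
qed

lemma irreducible_repD:
  assumes "irreducible_rep G T \<pi>"
  shows "representation G T \<pi>" "0 < degree_rep G \<pi>"
    and "linear_subspace (degree_rep G \<pi>) W \<Longrightarrow> (\<And>g w. g \<in> carrier G \<Longrightarrow> w \<in> W \<Longrightarrow> \<pi> g *\<^sub>v w \<in> W) \<Longrightarrow>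
      W = {0\<^sub>v (degree_rep G \<pi>)} \<or> W = carrier_vec (degree_rep G \<pi>)"
  using assms unfolding irreducible_rep_def Let_def subspace_iff_linear_subspace by blast+

lemma irreducible_repI:
  assumes "representation G T \<pi>" "degree_rep G \<pi> = n" "0 < n"
    and "\<And>W. linear_subspace n W \<Longrightarrow> (\<And>g w. g \<in> carrier G \<Longrightarrow> w \<in> W \<Longrightarrow> \<pi> g *\<^sub>v w \<in> W) \<Longrightarrow>
      W = {0\<^sub>v n} \<or> W = carrier_vec n"
  shows "irreducible_rep G T \<pi>"
  using assms unfolding irreducible_rep_def Let_def subspace_iff_linear_subspace by simp

lemma not_irreducible_repE:
  assumes "representation G T \<pi>" "degree_rep G \<pi> = n" "0 < n" "\<not> irreducible_rep G T \<pi>"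
  obtains W where "linear_subspace n W" "\<And>g w. g \<in> carrier G \<Longrightarrow> w \<in> W \<Longrightarrow> \<pi> g *\<^sub>v w \<in> W"
    "W \<noteq> {0\<^sub>v n}" "W \<noteq> carrier_vec n"
  using irreducible_repI[OF assms(1-3)] assms(4) by blast

lemma ch_eq: "representation G T \<pi> \<Longrightarrow> g \<in> carrier G \<Longrightarrow> ch G \<pi> g = mtrace (\<pi> g) / of_nat (degree_rep G \<pi>)"
  by (simp add: ch_def mtrace_def)

lemma ch_undefined: "g \<notin> carrier G \<Longrightarrow> ch G \<pi> g = undefined"
  by (simp add: ch_def)

lemma ch_cong:
  "representation G T \<pi> \<Longrightarrow> (\<And>g. g \<in> carrier G \<Longrightarrow> ch G \<pi> g = ch G \<rho> g) \<Longrightarrow> ch G \<pi> = ch G \<rho>"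
  by (rule ext) (metis ch_undefined)

lemma zero_mat_mult_vec:
  fixes v :: "complex vec"
  shows "v \<in> carrier_vec m \<Longrightarrow> 0\<^sub>m n m *\<^sub>v v = 0\<^sub>v n"
  by (rule eq_vecI) auto

text \<open>The kernel of \<open>B\<close> is invariant under \<open>\<rho>\<close>, so
  irreducibility leaves only zero or everything, and \<open>B\<close> is nonzero.\<close>

lemma intertwiner_inj_mat:
  assumes \<rho>: "irreducible_rep G T \<rho>" "degree_rep G \<rho> = m"
    and B: "B \<in> carrier_mat n m" "B \<noteq> 0\<^sub>m n m"
    and X: "\<And>g. g \<in> carrier G \<Longrightarrow> X g \<in> carrier_mat n n" "\<And>g. g \<in> carrier G \<Longrightarrow> B * \<rho> g = X g * B"
  shows "inj_mat B"
proof -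
  note r = irreducible_repD[OF \<rho>(1), unfolded \<rho>(2)]
  let ?W = "{v \<in> carrier_vec m. B *\<^sub>v v = 0\<^sub>v n}"
  have "\<rho> g *\<^sub>v v \<in> ?W" if g: "g \<in> carrier G" and v: "v \<in> ?W" for g v
  proof -
    have c: "\<rho> g \<in> carrier_mat m m" using rep_carrier[OF r(1) g] \<rho>(2) by simp
    have v': "v \<in> carrier_vec m" using v by simp
    have "B *\<^sub>v (\<rho> g *\<^sub>v v) = (X g * B) *\<^sub>v v" using assoc_mult_mat_vec[OF B(1) c v'] X(2)[OF g] by simp
    also have "\<dots> = X g *\<^sub>v (B *\<^sub>v v)" by (rule assoc_mult_mat_vec[OF X(1)[OF g] B(1) v'])
    also have "\<dots> = 0\<^sub>v n" using v mult_mat_zero_vec[OF X(1)[OF g]] by simp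
    finally show ?thesis using c v' by simp
  qed
  from r(3)[OF linear_subspace_kernel[OF B(1)] this] have "?W = {0\<^sub>v m} \<or> ?W = carrier_vec m" .
  then show ?thesis
  proof
    assume "?W = {0\<^sub>v m}"
    then show ?thesis using B(1) by (auto simp: inj_mat_def)
  next
    assume W: "?W = carrier_vec m"
    have "B = 0\<^sub>m n m"
    proof (rule mat_eq_by_vec[OF B(1)])
      fix v :: "complex vec" assume "v \<in> carrier_vec m"
      with W have "B *\<^sub>v v = 0\<^sub>v n" by blast
      then show "B *\<^sub>v v = 0\<^sub>m n m *\<^sub>v v" using \<open>v \<in> carrier_vec m\<close> by (simp add: zero_mat_mult_vec)
    qed simp
    with B(2) show ?thesis by simp
  qed
qed

lemma intertwiner_surj:
  assumes \<pi>: "irreducible_rep G T \<pi>" "degree_rep G \<pi> = n"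
    and B: "B \<in> carrier_mat n m" "B \<noteq> 0\<^sub>m n m"
    and X: "\<And>g. g \<in> carrier G \<Longrightarrow> X g \<in> carrier_mat m m" "\<And>g. g \<in> carrier G \<Longrightarrow> \<pi> g * B = B * X g"
  shows "(\<lambda>v. B *\<^sub>v v) ` carrier_vec m = carrier_vec n"
proof -
  note r = irreducible_repD[OF \<pi>(1), unfolded \<pi>(2)]
  let ?W = "(\<lambda>v. B *\<^sub>v v) ` carrier_vec m"
  have "\<pi> g *\<^sub>v w \<in> ?W" if g: "g \<in> carrier G" and w: "w \<in> ?W" for g w
  proof -
    obtain v where v: "v \<in> carrier_vec m" "w = B *\<^sub>v v" using w by blast
    have c: "\<pi> g \<in> carrier_mat n n" using rep_carrier[OF r(1) g] \<pi>(2) by simp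
    have "\<pi> g *\<^sub>v w = B *\<^sub>v (X g *\<^sub>v v)"
      using assoc_mult_mat_vec[OF c B(1) v(1)] assoc_mult_mat_vec[OF B(1) X(1)[OF g] v(1)] X(2)[OF g] v(2) by simp
    then show ?thesis using X(1)[OF g] v(1) by (intro image_eqI[of _ _ "X g *\<^sub>v v"]) auto
  qed
  from r(3)[OF linear_subspace_image[OF B(1) linear_subspace_carrier] this]
  have "?W = {0\<^sub>v n} \<or> ?W = carrier_vec n" .
  moreover have "?W \<noteq> {0\<^sub>v n}"
  proof
    assume W: "?W = {0\<^sub>v n}"
    have "B = 0\<^sub>m n m"
    proof (rule mat_eq_by_vec[OF B(1)])
      fix v :: "complex vec" assume "v \<in> carrier_vec m"
      with W have "B *\<^sub>v v = 0\<^sub>v n" by blast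
      then show "B *\<^sub>v v = 0\<^sub>m n m *\<^sub>v v" using \<open>v \<in> carrier_vec m\<close> by (simp add: zero_mat_mult_vec)
    qed simp
    with B(2) show False by simp
  qed
  ultimately show ?thesis by blast
qed

text \<open>A nonzero intertwiner between irreducible representations is injective and surjective,
  so it is invertible and preserves traces. The conclusion is about characters since the points of
  the dual are characters.\<close>

lemma Schur_ch_eq:
  assumes \<pi>: "irreducible_rep G T \<pi>" and \<rho>: "irreducible_rep G T \<rho>" and one: "\<one>\<^bsub>G\<^esub> \<in> carrier G"
    and B: "B \<in> carrier_mat (degree_rep G \<pi>) (degree_rep G \<rho>)" "B \<noteq> 0\<^sub>m (degree_rep G \<pi>) (degree_rep G \<rho>)"
    and eq: "\<And>g. g \<in> carrier G \<Longrightarrow> \<pi> g * B = B * \<rho> g"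
  shows "ch G \<pi> = ch G \<rho>"
proof -
  define n m where "n = degree_rep G \<pi>" "m = degree_rep G \<rho>"
  note d = n_m_def[symmetric]
  note rp = irreducible_repD(1)[OF \<pi>] and rr = irreducible_repD(1)[OF \<rho>]
  have cp: "\<pi> g \<in> carrier_mat n n" and cr: "\<rho> g \<in> carrier_mat m m" if "g \<in> carrier G" for g
    using rep_carrier[OF rp that] rep_carrier[OF rr that] by (simp_all add: d)
  have B': "B \<in> carrier_mat n m" using B(1) by (simp add: d)
  have inj: "inj_mat B"
    by (rule intertwiner_inj_mat[OF \<rho> refl B, of \<pi>]) (use eq cp in \<open>auto simp: d\<close>)
  have surj: "(\<lambda>v. B *\<^sub>v v) ` carrier_vec m = carrier_vec n"
    unfolding n_m_def by (rule intertwiner_surj[OF \<pi> refl B, of \<rho>]) (use eq cr in \<open>auto simp: d\<close>)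
  obtain C where C: "C \<in> carrier_mat m n" "B * C = 1\<^sub>m n"
  proof (rule surj_mat_right_inverse[OF B'])
    fix v :: "complex vec" assume "v \<in> carrier_vec n"
    then have "v \<in> (\<lambda>v. B *\<^sub>v v) ` carrier_vec m" using surj by simp
    then show "\<exists>w\<in>carrier_vec m. B *\<^sub>v w = v" by blast
  qed
  obtain D where D: "D \<in> carrier_mat m n" "D * B = 1\<^sub>m m"
    by (rule inj_mat_left_inverse[OF B' inj])
  have "D = D * (B * C)" using C D by simp
  also have "\<dots> = C" using assoc_mult_mat[OF D(1) B' C(1)] D(2) C(1) by simp
  finally have CB: "C * B = 1\<^sub>m m" using D(2) by simp
  have tr: "mtrace (\<pi> g) = mtrace (\<rho> g)" if g: "g \<in> carrier G" for g
  proof -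
    have "mtrace (\<pi> g) = mtrace (\<pi> g * (B * C))" using C cp[OF g] by simp
    also have "\<pi> g * (B * C) = B * \<rho> g * C" using assoc_mult_mat[OF cp[OF g] B' C(1)] eq[OF g] by simp
    also have "\<dots> = B * (\<rho> g * C)" by (rule assoc_mult_mat[OF B' cr[OF g] C(1)])
    also have "mtrace \<dots> = mtrace (\<rho> g * C * B)"
      by (rule mtrace_comm[OF B']) (use cr[OF g] C in auto)
    also have "\<rho> g * C * B = \<rho> g" using assoc_mult_mat[OF cr[OF g] C(1) B'] CB cr[OF g] by simp
    finally show ?thesis .
  qed
  have "(of_nat n :: complex) = of_nat m"
    using tr[OF one] rep_one[OF rp] rep_one[OF rr] by (simp add: d mtrace_one)
  then have "n = m" by simp
  then show ?thesis using tr ch_eq[OF rp] ch_eq[OF rr] by (intro ch_cong[OF rp]) (simp add: d)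
qed

text \<open>Subtracting an eigenvalue leaves an intertwiner with nontrivial kernel, which must
  vanish.\<close>

lemma Schur_scalar:
  assumes \<pi>: "irreducible_rep G T \<pi>" "degree_rep G \<pi> = n" and B: "B \<in> carrier_mat n n"
    and eq: "\<And>g. g \<in> carrier G \<Longrightarrow> \<pi> g * B = B * \<pi> g"
  obtains c where "B = c \<cdot>\<^sub>m 1\<^sub>m n"
proof -
  note r = irreducible_repD[OF \<pi>(1), unfolded \<pi>(2)]
  have cp: "\<pi> g \<in> carrier_mat n n" if "g \<in> carrier G" for g using rep_carrier[OF r(1) that] \<pi>(2) by simp
  obtain c where "c \<in> spectrum B" using spectrum_non_empty[OF B r(2)] by blast
  then obtain v where v: "v \<in> carrier_vec n" "v \<noteq> 0\<^sub>v n" "B *\<^sub>v v = c \<cdot>\<^sub>v v"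
    using B by (auto simp: spectrum_def eigenvalue_def eigenvector_def)
  let ?C = "B - c \<cdot>\<^sub>m 1\<^sub>m n"
  have C: "?C \<in> carrier_mat n n" by (rule minus_carrier_mat) simp
  have "?C = 0\<^sub>m n n"
  proof (rule ccontr)
    assume "?C \<noteq> 0\<^sub>m n n"
    have "inj_mat ?C"
    proof (rule intertwiner_inj_mat[OF \<pi> C \<open>?C \<noteq> 0\<^sub>m n n\<close> cp])
      fix g assume g: "g \<in> carrier G"
      have "?C * \<pi> g = B * \<pi> g - c \<cdot>\<^sub>m \<pi> g"
        using B cp[OF g] by (subst minus_mult_distrib_mat[of _ n n]) auto
      also have "\<dots> = \<pi> g * ?C"
        using B cp[OF g] eq[OF g] by (subst mult_minus_distrib_mat[of _ n n]) auto
      finally show "?C * \<pi> g = \<pi> g * ?C" .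
    qed
    moreover have "?C *\<^sub>v v = 0\<^sub>v n"
      using B v by (subst minus_mult_distrib_mat_vec[of _ n n]) auto
    ultimately show False using inj_matD[OF _ C v(1)] v(2) by blast
  qed
  note C0 = this
  have "B = c \<cdot>\<^sub>m 1\<^sub>m n"
  proof (rule eq_matI)
    fix i j assume "i < dim_row (c \<cdot>\<^sub>m 1\<^sub>m n)" "j < dim_col (c \<cdot>\<^sub>m 1\<^sub>m n)"
    then have ij: "i < n" "j < n" by auto
    have "?C $$ (i, j) = 0" using C0 ij by simp
    then show "B $$ (i, j) = (c \<cdot>\<^sub>m 1\<^sub>m n) $$ (i, j)" using B ij by simp
  qed (use B in auto)
  with that show ?thesis by blast
qed

section \<open>Complete reducibility and orthogonality\<close>

text \<open>An abstract Haar integral. It is kept separate from the mean on the abelian group so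
  that Schur orthogonality applies both to the semidirect product and to its normal
  subgroup.\<close>

locale invariant_mean = group G for G :: "'a monoid" (structure) +
  fixes T :: "'a topology" and M :: "('a \<Rightarrow> complex) \<Rightarrow> complex"
  assumes topspace_eq: "topspace T = carrier G"
    and continuous_inv: "continuous_map T T (\<lambda>x. inv x)"
    and M_cong: "continuous_map T euclidean f \<Longrightarrow> (\<And>x. x \<in> carrier G \<Longrightarrow> f x = g x) \<Longrightarrow> M g = M f"
    and M_add: "continuous_map T euclidean f \<Longrightarrow> continuous_map T euclidean g \<Longrightarrow> M (\<lambda>x. f x + g x) = M f + M g"
    and M_scale: "continuous_map T euclidean f \<Longrightarrow> M (\<lambda>x. c * f x) = c * M f"
    and M_one: "M (\<lambda>x. 1) = 1"
    and M_translate: "continuous_map T euclidean f \<Longrightarrow> y \<in> carrier G \<Longrightarrow> M (\<lambda>x. f (x \<otimes> y)) = M f"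
begin

abbreviation contf :: "('a \<Rightarrow> complex) \<Rightarrow> bool" where
  "contf f \<equiv> continuous_map T euclidean f"

lemma contf_cong: "contf f \<Longrightarrow> (\<And>x. x \<in> carrier G \<Longrightarrow> f x = g x) \<Longrightarrow> contf g"
  using continuous_map_eq[of T euclidean f g] by (simp add: topspace_eq)

lemma contf_compose: "continuous_map T T h \<Longrightarrow> contf f \<Longrightarrow> contf (\<lambda>x. f (h x))"
  using continuous_map_compose[of T T h euclidean f] by (simp add: o_def)

lemma M_const: "M (\<lambda>x. c) = c"
  using M_scale[of "\<lambda>x. 1" c] M_one by simp

lemma M_sum:
  "finite I \<Longrightarrow> (\<And>i. i \<in> I \<Longrightarrow> contf (f i)) \<Longrightarrow> M (\<lambda>x. \<Sum>i\<in>I. f i x) = (\<Sum>i\<in>I. M (f i))"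
proof (induction I rule: finite_induct)
  case (insert i I)
  then show ?case using M_add[of "f i" "\<lambda>x. \<Sum>i\<in>I. f i x"] by (simp add: continuous_map_sum)
qed (simp add: M_const)

definition cmat :: "nat \<Rightarrow> nat \<Rightarrow> ('a \<Rightarrow> complex mat) \<Rightarrow> bool" where
  "cmat n m F \<longleftrightarrow> (\<forall>x\<in>carrier G. F x \<in> carrier_mat n m) \<and> (\<forall>i<n. \<forall>j<m. contf (\<lambda>x. F x $$ (i, j)))"

definition mmean :: "nat \<Rightarrow> nat \<Rightarrow> ('a \<Rightarrow> complex mat) \<Rightarrow> complex mat" where
  "mmean n m F = mat n m (\<lambda>(i, j). M (\<lambda>x. F x $$ (i, j)))"

lemma mmean_carrier: "mmean n m F \<in> carrier_mat n m"
  by (simp add: mmean_def)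

lemma cmatD: "cmat n m F \<Longrightarrow> x \<in> carrier G \<Longrightarrow> F x \<in> carrier_mat n m"
  by (simp add: cmat_def)

lemma cmat_cont: "cmat n m F \<Longrightarrow> i < n \<Longrightarrow> j < m \<Longrightarrow> contf (\<lambda>x. F x $$ (i, j))"
  by (simp add: cmat_def)

lemma cmat_const: "A \<in> carrier_mat n m \<Longrightarrow> cmat n m (\<lambda>x. A)"
  by (simp add: cmat_def)

lemma cmat_mult:
  assumes A: "cmat n m A" and B: "cmat m k B"
  shows "cmat n k (\<lambda>x. A x * B x)"
  unfolding cmat_def
proof (intro conjI ballI allI impI)
  show "A x * B x \<in> carrier_mat n k" if "x \<in> carrier G" for x
    by (rule mult_carrier_mat[OF cmatD[OF A that] cmatD[OF B that]])
  fix i j assume ij: "i < n" "j < k"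
  have "contf (\<lambda>x. \<Sum>l<m. A x $$ (i, l) * B x $$ (l, j))"
    using ij by (intro continuous_map_sum continuous_map_mult cmat_cont[OF A] cmat_cont[OF B]) auto
  then show "contf (\<lambda>x. (A x * B x) $$ (i, j))"
    by (rule contf_cong) (use index_mult_mat_sum[OF cmatD[OF A] cmatD[OF B] ij] in auto)
qed

lemma cmat_rep: "representation G T \<pi> \<Longrightarrow> degree_rep G \<pi> = n \<Longrightarrow> cmat n n \<pi>"
  by (auto simp: cmat_def rep_carrier rep_cont)

lemma cmat_inv: "cmat n m F \<Longrightarrow> cmat n m (\<lambda>x. F (inv x))"
  by (auto simp: cmat_def intro!: contf_compose[OF continuous_inv])

lemma mmean_cong:
  assumes "cmat n m F" "\<And>x. x \<in> carrier G \<Longrightarrow> F x = F' x"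
  shows "mmean n m F' = mmean n m F"
  unfolding mmean_def
  by (rule cong_mat) (auto intro!: M_cong cmat_cont[OF assms(1)] simp: assms(2))

lemma mmean_mult_left:
  assumes A: "A \<in> carrier_mat n m" and F: "cmat m k F"
  shows "mmean n k (\<lambda>x. A * F x) = A * mmean m k F"
proof (rule eq_matI)
  fix i j assume "i < dim_row (A * mmean m k F)" "j < dim_col (A * mmean m k F)"
  then have ij: "i < n" "j < k" using A by (auto simp: mmean_def)
  have c: "contf (\<lambda>x. A $$ (i, l) * F x $$ (l, j))" if "l < m" for l
    using continuous_map_scale[OF cmat_cont[OF F that ij(2)]] .
  have "mmean n k (\<lambda>x. A * F x) $$ (i, j) = M (\<lambda>x. (A * F x) $$ (i, j))" using ij by (simp add: mmean_def)
  also have "\<dots> = M (\<lambda>x. \<Sum>l<m. A $$ (i, l) * F x $$ (l, j))"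
    by (rule M_cong) (use c index_mult_mat_sum[OF A cmatD[OF F] ij] in \<open>auto intro!: continuous_map_sum\<close>)
  also have "\<dots> = (\<Sum>l<m. M (\<lambda>x. A $$ (i, l) * F x $$ (l, j)))"
    by (rule M_sum) (use c in auto)
  also have "\<dots> = (\<Sum>l<m. A $$ (i, l) * M (\<lambda>x. F x $$ (l, j)))"
    by (rule sum.cong) (auto intro!: M_scale cmat_cont[OF F _ ij(2)])
  also have "\<dots> = (A * mmean m k F) $$ (i, j)"
    unfolding index_mult_mat_sum[OF A mmean_carrier ij] using ij by (simp add: mmean_def)
  finally show "mmean n k (\<lambda>x. A * F x) $$ (i, j) = (A * mmean m k F) $$ (i, j)" .
qed (use A in \<open>auto simp: mmean_def\<close>)

lemma mmean_mult_right:
  assumes F: "cmat n m F" and A: "A \<in> carrier_mat m k"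
  shows "mmean n k (\<lambda>x. F x * A) = mmean n m F * A"
proof (rule eq_matI)
  fix i j assume "i < dim_row (mmean n m F * A)" "j < dim_col (mmean n m F * A)"
  then have ij: "i < n" "j < k" using A by (auto simp: mmean_def)
  have c: "contf (\<lambda>x. A $$ (l, j) * F x $$ (i, l))" if "l < m" for l
    using continuous_map_scale[OF cmat_cont[OF F ij(1) that]] .
  have "mmean n k (\<lambda>x. F x * A) $$ (i, j) = M (\<lambda>x. (F x * A) $$ (i, j))" using ij by (simp add: mmean_def)
  also have "\<dots> = M (\<lambda>x. \<Sum>l<m. A $$ (l, j) * F x $$ (i, l))"
    by (rule M_cong) (use c index_mult_mat_sum[OF cmatD[OF F] A ij] in \<open>auto intro!: continuous_map_sum simp: mult.commute\<close>)
  also have "\<dots> = (\<Sum>l<m. M (\<lambda>x. A $$ (l, j) * F x $$ (i, l)))"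
    by (rule M_sum) (use c in auto)
  also have "\<dots> = (\<Sum>l<m. M (\<lambda>x. F x $$ (i, l)) * A $$ (l, j))"
    by (rule sum.cong) (auto simp: M_scale cmat_cont[OF F ij(1)])
  also have "\<dots> = (mmean n m F * A) $$ (i, j)"
    unfolding index_mult_mat_sum[OF mmean_carrier A ij] using ij by (simp add: mmean_def)
  finally show "mmean n k (\<lambda>x. F x * A) $$ (i, j) = (mmean n m F * A) $$ (i, j)" .
qed (use A in \<open>auto simp: mmean_def\<close>)

lemma mmean_const: "A \<in> carrier_mat n m \<Longrightarrow> mmean n m (\<lambda>x. A) = A"
  by (rule eq_matI) (auto simp: mmean_def M_const)

lemma mmean_translate: "cmat n m F \<Longrightarrow> y \<in> carrier G \<Longrightarrow> mmean n m (\<lambda>x. F (x \<otimes> y)) = mmean n m F"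
  unfolding mmean_def by (rule cong_mat) (auto intro!: M_translate[of "\<lambda>x. F x $$ (_, _)"] cmat_cont)

text \<open>The substitution of \<open>x \<otimes> y\<close> for \<open>x\<close> in the mean of
  \<open>\<rho> (inv x) * (X * \<pi> x)\<close> turns a factor \<open>\<pi> y\<close> on the right
  into a factor \<open>\<rho> y\<close> on the left.\<close>

lemma intertwiner_mean:
  assumes \<rho>: "representation G T \<rho>" "degree_rep G \<rho> = k" and \<pi>: "representation G T \<pi>" "degree_rep G \<pi> = n"
    and X: "X \<in> carrier_mat k n" and y: "y \<in> carrier G"
  defines "C \<equiv> mmean k n (\<lambda>x. \<rho> (inv x) * (X * \<pi> x))"
  shows "C * \<pi> y = \<rho> y * C"
proof -
  note c\<rho> = cmat_rep[OF \<rho>] and c\<pi> = cmat_rep[OF \<pi>]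
  have cX: "cmat k n (\<lambda>x. X * \<pi> x)" by (rule cmat_mult[OF cmat_const[OF X] c\<pi>])
  have cF: "cmat k n (\<lambda>x. \<rho> (inv x) * (X * \<pi> x))" by (rule cmat_mult[OF cmat_inv[OF c\<rho>] cX])
  have c: "cmat k n (\<lambda>x. \<rho> (inv x) * (X * \<pi> x) * \<pi> y)"
    by (rule cmat_mult[OF cF cmat_const[OF cmatD[OF c\<pi> y]]])
  have cy: "cmat k n (\<lambda>x. \<rho> y * (\<rho> (inv x) * (X * \<pi> x)))"
    by (rule cmat_mult[OF cmat_const[OF cmatD[OF c\<rho> y]] cF])
  have "C * \<pi> y = mmean k n (\<lambda>x. \<rho> (inv x) * (X * \<pi> x) * \<pi> y)"
    unfolding C_def by (rule mmean_mult_right[OF cF cmatD[OF c\<pi> y], symmetric])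
  also have "\<dots> = mmean k n (\<lambda>x. \<rho> y * (\<rho> (inv (x \<otimes> y)) * (X * \<pi> (x \<otimes> y))))"
  proof (rule mmean_cong[OF c, symmetric])
    fix x assume x: "x \<in> carrier G"
    have i: "inv x \<in> carrier G" "inv (x \<otimes> y) \<in> carrier G" using x y by auto
    have 1: "\<rho> (inv x) = \<rho> y * \<rho> (inv (x \<otimes> y))"
    proof -
      have "y \<otimes> inv (x \<otimes> y) = inv x" using x y by (simp add: inv_mult_group m_assoc[symmetric])
      then show ?thesis using rep_mult[OF \<rho>(1) y i(2)] by simp
    qed
    note d = cmatD[OF c\<rho> y] cmatD[OF c\<rho> i(2)] cmatD[OF c\<rho> i(1)] cmatD[OF c\<pi> x] cmatD[OF c\<pi> y] X
    have "\<rho> (inv x) * (X * \<pi> x) * \<pi> y = \<rho> (inv x) * ((X * \<pi> x) * \<pi> y)"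
      by (rule assoc_mult_mat[OF d(3) _ d(5)]) (use d in auto)
    also have "(X * \<pi> x) * \<pi> y = X * \<pi> (x \<otimes> y)"
      unfolding rep_mult[OF \<pi>(1) x y] by (rule assoc_mult_mat[OF d(6,4,5)])
    also have "\<rho> (inv x) * (X * \<pi> (x \<otimes> y)) = \<rho> y * (\<rho> (inv (x \<otimes> y)) * (X * \<pi> (x \<otimes> y)))"
      unfolding 1 by (rule assoc_mult_mat[OF d(1,2)]) (use d cmatD[OF c\<pi>, of "x \<otimes> y"] x y in auto)
    finally show "\<rho> (inv x) * (X * \<pi> x) * \<pi> y = \<rho> y * (\<rho> (inv (x \<otimes> y)) * (X * \<pi> (x \<otimes> y)))" .
  qed
  also have "\<dots> = mmean k n (\<lambda>x. \<rho> y * (\<rho> (inv x) * (X * \<pi> x)))"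
    by (rule mmean_translate[OF cy y])
  also have "\<dots> = \<rho> y * C" unfolding C_def by (rule mmean_mult_left[OF cmatD[OF c\<rho> y] cF])
  finally show ?thesis .
qed

text \<open>The columns of \<open>A\<close> are a basis of a subspace and \<open>C\<close> reads off
  coordinates; the hypothesis \<open>inv\<close> says that \<open>\<pi> g\<close> maps the column
  space into itself.\<close>

lemma subrepresentation:
  assumes \<pi>: "representation G T \<pi>" "degree_rep G \<pi> = n"
    and A: "A \<in> carrier_mat n k" and C: "C \<in> carrier_mat k n" "C * A = 1\<^sub>m k"
    and inv: "\<And>g. g \<in> carrier G \<Longrightarrow> A * (C * (\<pi> g * A)) = \<pi> g * A"
  defines "\<rho> \<equiv> \<lambda>g. C * (\<pi> g * A)"
  shows "representation G T \<rho>" "degree_rep G \<rho> = k"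
proof -
  note c\<pi> = cmat_rep[OF \<pi>]
  have c\<rho>: "cmat k k \<rho>"
    unfolding \<rho>_def by (intro cmat_mult[OF cmat_const[OF C(1)]] cmat_mult[OF c\<pi>] cmat_const A)
  have one: "\<rho> \<one> = 1\<^sub>m k" using rep_one[OF \<pi>(1)] A C by (simp add: \<rho>_def \<pi>(2))
  have mult: "\<rho> (g \<otimes> h) = \<rho> g * \<rho> h" if g: "g \<in> carrier G" and h: "h \<in> carrier G" for g h
  proof -
    note d = cmatD[OF c\<pi> g] cmatD[OF c\<pi> h] cmatD[OF c\<rho> g] cmatD[OF c\<rho> h]
    have pA: "\<pi> g * A \<in> carrier_mat n k" by (rule mult_carrier_mat[OF d(1) A])
    have "\<rho> (g \<otimes> h) = C * (\<pi> g * (\<pi> h * A))"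
      unfolding \<rho>_def rep_mult[OF \<pi>(1) g h] using assoc_mult_mat[OF d(1,2) A] by simp
    also have "\<pi> h * A = A * \<rho> h" using inv[OF h] by (simp add: \<rho>_def)
    also have "\<pi> g * (A * \<rho> h) = \<pi> g * A * \<rho> h" by (rule assoc_mult_mat[OF d(1) A d(4), symmetric])
    also have "C * (\<pi> g * A * \<rho> h) = \<rho> g * \<rho> h"
      unfolding \<rho>_def[of ] by (rule assoc_mult_mat[OF C(1) pA d(4), unfolded \<rho>_def, symmetric])
    finally show ?thesis .
  qed
  show "representation G T \<rho>" "degree_rep G \<rho> = k"
    using representationI[OF one cmatD[OF c\<rho>] mult cmat_cont[OF c\<rho>]] by auto
qed

text \<open>An arbitrary left inverse \<open>D\<close> of \<open>A\<close> is averaged to an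
  equivariant one. The last two conclusions express that the image of \<open>A\<close> and the
  kernel of \<open>C\<close> are both invariant.\<close>

lemma Maschke:
  assumes \<pi>: "representation G T \<pi>" "degree_rep G \<pi> = n"
    and A: "A \<in> carrier_mat n k" "inj_mat A"
    and inv: "\<And>g w. g \<in> carrier G \<Longrightarrow> w \<in> carrier_vec k \<Longrightarrow> \<pi> g *\<^sub>v (A *\<^sub>v w) \<in> (\<lambda>v. A *\<^sub>v v) ` carrier_vec k"
  obtains C where "C \<in> carrier_mat k n" "C * A = 1\<^sub>m k"
    "\<And>g. g \<in> carrier G \<Longrightarrow> A * (C * (\<pi> g * A)) = \<pi> g * A"
    "\<And>g. g \<in> carrier G \<Longrightarrow> C * \<pi> g = C * (\<pi> g * A) * C"
proof -
  note c\<pi> = cmat_rep[OF \<pi>]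
  obtain D where D: "D \<in> carrier_mat k n" "D * A = 1\<^sub>m k" by (rule inj_mat_left_inverse[OF A])
  have fac: "A * (E * (\<pi> g * A)) = \<pi> g * A" if E: "E \<in> carrier_mat k n" "E * A = 1\<^sub>m k" and g: "g \<in> carrier G" for E g
  proof (rule factor_through_image[OF A(1) E mult_carrier_mat[OF cmatD[OF c\<pi> g] A(1)]])
    fix v :: "complex vec" assume v: "v \<in> carrier_vec k"
    show "(\<pi> g * A) *\<^sub>v v \<in> (\<lambda>v. A *\<^sub>v v) ` carrier_vec k"
      unfolding assoc_mult_mat_vec[OF cmatD[OF c\<pi> g] A(1) v] by (rule inv[OF g v])
  qed
  define \<rho> where "\<rho> = (\<lambda>g. D * (\<pi> g * A))"
  have \<rho>: "representation G T \<rho>" "degree_rep G \<rho> = k"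
    unfolding \<rho>_def using subrepresentation[OF \<pi> A(1) D fac[OF D]] by auto
  note c\<rho> = cmat_rep[OF \<rho>]
  define C where "C = mmean k n (\<lambda>x. \<rho> (inv x) * (D * \<pi> x))"
  have C: "C \<in> carrier_mat k n" unfolding C_def by (rule mmean_carrier)
  have cF: "cmat k n (\<lambda>x. \<rho> (inv x) * (D * \<pi> x))"
    by (intro cmat_mult[OF cmat_inv[OF c\<rho>]] cmat_mult[OF _ c\<pi>] cmat_const D)
  \<comment> \<open>\<open>D * \<pi> x * A\<close> is \<open>\<rho> x\<close>, so every term of the
    average is a left inverse of \<open>A\<close>, and averaging keeps this property.\<close>
  have CA: "C * A = 1\<^sub>m k"
  proof -
    have "C * A = mmean k k (\<lambda>x. \<rho> (inv x) * (D * \<pi> x) * A)"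
      unfolding C_def by (rule mmean_mult_right[OF cF A(1), symmetric])
    also have "\<dots> = mmean k k (\<lambda>x. 1\<^sub>m k)"
    proof (rule mmean_cong[OF cmat_const])
      fix x assume x: "x \<in> carrier G"
      have ix: "inv x \<in> carrier G" using x by simp
      have "\<rho> (inv x) * (D * \<pi> x) * A = \<rho> (inv x) * ((D * \<pi> x) * A)"
        by (rule assoc_mult_mat[OF cmatD[OF c\<rho> ix] mult_carrier_mat[OF D(1) cmatD[OF c\<pi> x]] A(1)])
      also have "(D * \<pi> x) * A = \<rho> x"
        unfolding \<rho>_def by (rule assoc_mult_mat[OF D(1) cmatD[OF c\<pi> x] A(1)])
      also have "\<rho> (inv x) * \<rho> x = 1\<^sub>m k"
        using rep_mult[OF \<rho>(1) ix x] rep_one[OF \<rho>(1)] x \<rho>(2) by simp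
      finally show "1\<^sub>m k = \<rho> (inv x) * (D * \<pi> x) * A" by simp
    qed simp
    also have "\<dots> = 1\<^sub>m k" by (rule mmean_const) simp
    finally show ?thesis .
  qed
  have "C * \<pi> g = C * (\<pi> g * A) * C" if g: "g \<in> carrier G" for g
  proof -
    have "C * \<pi> g = \<rho> g * C" unfolding C_def by (rule intertwiner_mean[OF \<rho> \<pi> D(1) g])
    moreover have "\<rho> g = C * (\<pi> g * A)"
    proof -
      have "\<rho> g = (C * A) * \<rho> g" using CA cmatD[OF c\<rho> g] by simp
      also have "\<dots> = C * (A * \<rho> g)" by (rule assoc_mult_mat[OF C A(1) cmatD[OF c\<rho> g]])
      also have "A * \<rho> g = \<pi> g * A" unfolding \<rho>_def by (rule fac[OF D g])
      finally show ?thesis .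
    qed
    ultimately show ?thesis by simp
  qed
  with C CA fac[OF C CA] that show ?thesis by blast
qed

end

lemma equivalent_repE:
  assumes "equivalent_rep G \<sigma> \<tau>"
  obtains P Q where "\<And>g. g \<in> carrier G \<Longrightarrow> similar_mat_wit (\<sigma> g) (\<tau> g) P Q"
  using assms by (auto simp: equivalent_rep_def)

lemma equivalent_rep_trans:
  assumes "equivalent_rep G \<rho> \<sigma>" "equivalent_rep G \<sigma> \<tau>"
  shows "equivalent_rep G \<rho> \<tau>"
proof -
  obtain P Q where 1: "\<And>g. g \<in> carrier G \<Longrightarrow> similar_mat_wit (\<rho> g) (\<sigma> g) P Q"
    using assms(1) by (rule equivalent_repE) auto
  obtain P' Q' where 2: "\<And>g. g \<in> carrier G \<Longrightarrow> similar_mat_wit (\<sigma> g) (\<tau> g) P' Q'"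
    using assms(2) by (rule equivalent_repE) auto
  show ?thesis unfolding equivalent_rep_def
    by (intro exI ballI) (rule similar_mat_wit_trans[OF 1 2])
qed

lemma equivalent_rep_direct_sum_append:
  assumes one: "\<one>\<^bsub>G\<^esub> \<in> carrier G"
    and \<rho>: "\<And>g. g \<in> carrier G \<Longrightarrow> \<rho> g \<in> carrier_mat k k" "\<And>g. g \<in> carrier G \<Longrightarrow> \<rho>' g \<in> carrier_mat l l"
    and eq: "equivalent_rep G \<rho> (direct_sum_rep \<rho>s)" "equivalent_rep G \<rho>' (direct_sum_rep \<rho>s')"
  shows "equivalent_rep G (\<lambda>g. four_block_mat (\<rho> g) (0\<^sub>m k l) (0\<^sub>m l k) (\<rho>' g)) (direct_sum_rep (\<rho>s @ \<rho>s'))"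
proof -
  obtain P Q where 1: "\<And>g. g \<in> carrier G \<Longrightarrow> similar_mat_wit (\<rho> g) (direct_sum_rep \<rho>s g) P Q"
    using eq(1) by (rule equivalent_repE) auto
  obtain P' Q' where 2: "\<And>g. g \<in> carrier G \<Longrightarrow> similar_mat_wit (\<rho>' g) (direct_sum_rep \<rho>s' g) P' Q'"
    using eq(2) by (rule equivalent_repE) auto
  show ?thesis unfolding equivalent_rep_def
  proof (intro exI ballI)
    fix g assume g: "g \<in> carrier G"
    note s1 = similar_mat_witD2[OF \<rho>(1)[OF g] 1[OF g]] and s2 = similar_mat_witD2[OF \<rho>(2)[OF g] 2[OF g]]
    have eq: "direct_sum_rep (\<rho>s @ \<rho>s') g = four_block_mat (direct_sum_rep \<rho>s g) (0\<^sub>m k l) (0\<^sub>m l k) (direct_sum_rep \<rho>s' g)"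
      using s1(5) s2(5) unfolding direct_sum_rep_def by (simp add: diag_block_mat_append Let_def)
    show "similar_mat_wit (four_block_mat (\<rho> g) (0\<^sub>m k l) (0\<^sub>m l k) (\<rho>' g)) (direct_sum_rep (\<rho>s @ \<rho>s') g)
        (four_block_mat P (0\<^sub>m k l) (0\<^sub>m l k) P') (four_block_mat Q (0\<^sub>m k l) (0\<^sub>m l k) Q')"
      unfolding eq
      by (rule similar_mat_wit_four_block[OF 1[OF g] 2[OF g] _ _ \<rho>(1)[OF g] \<rho>(2)[OF g]]) (use s1 s2 in auto)
  qed
qed

lemma mtrace_four_block:
  "A \<in> carrier_mat n n \<Longrightarrow> D \<in> carrier_mat m m \<Longrightarrow> mtrace (four_block_mat A B C D) = mtrace A + mtrace D"
proof -
  assume A: "A \<in> carrier_mat n n" and D: "D \<in> carrier_mat m m"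
  have split: "(\<Sum>i<n + m. f i) = (\<Sum>i<n. f i) + (\<Sum>i<m. f (n + i))" for f :: "nat \<Rightarrow> complex"
    by (induction m) (auto simp: add.assoc)
  have "mtrace (four_block_mat A B C D) = (\<Sum>i<n + m. if i < n then A $$ (i, i) else D $$ (i - n, i - n))"
    unfolding mtrace_def using A D by (intro sum.cong) auto
  also have "\<dots> = (\<Sum>i<n. A $$ (i, i)) + (\<Sum>i<m. D $$ (i, i))"
    unfolding split by simp
  finally show ?thesis using A D by (simp add: mtrace_def)
qed

lemma mtrace_diag_block_mat:
  "(\<And>A. A \<in> set As \<Longrightarrow> square_mat A) \<Longrightarrow> mtrace (diag_block_mat As) = (\<Sum>A\<leftarrow>As. mtrace A)"
proof (induction As)
  case Nil
  then show ?case by (simp add: mtrace_def)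
next
  case (Cons A As)
  let ?D = "diag_block_mat As"
  have "square_mat ?D" using diag_block_mat_square Cons by auto
  then have "mtrace (diag_block_mat (A # As)) = mtrace A + mtrace ?D"
    unfolding diag_block_mat.simps Let_def using Cons.prems
    by (intro mtrace_four_block[of _ "dim_row A" _ "dim_row ?D"]) (auto simp: square_mat.simps intro!: carrier_matI)
  with Cons show ?case by simp
qed

lemma irreducible_decompositionD:
  assumes \<sigma>: "representation G T \<sigma>" and one: "\<one>\<^bsub>G\<^esub> \<in> carrier G"
    and dec: "irreducible_decomposition G T \<sigma> \<rho>s"
  shows decomposition_mtrace: "g \<in> carrier G \<Longrightarrow> mtrace (\<sigma> g) = (\<Sum>\<rho>\<leftarrow>\<rho>s. mtrace (\<rho> g))"
    and decomposition_degree: "degree_rep G \<sigma> = (\<Sum>\<rho>\<leftarrow>\<rho>s. degree_rep G \<rho>)"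
proof -
  have irr: "\<And>\<rho>. \<rho> \<in> set \<rho>s \<Longrightarrow> irreducible_rep G T \<rho>" using dec by (simp add: irreducible_decomposition_def)
  show tr: "mtrace (\<sigma> g) = (\<Sum>\<rho>\<leftarrow>\<rho>s. mtrace (\<rho> g))" if g: "g \<in> carrier G" for g
  proof -
    have "equivalent_rep G \<sigma> (direct_sum_rep \<rho>s)" using dec by (simp add: irreducible_decomposition_def)
    then obtain P Q where "\<And>g. g \<in> carrier G \<Longrightarrow> similar_mat_wit (\<sigma> g) (direct_sum_rep \<rho>s g) P Q"
      by (rule equivalent_repE) auto
    from mtrace_similar[OF this[OF g]] have "mtrace (\<sigma> g) = mtrace (diag_block_mat (map (\<lambda>\<rho>. \<rho> g) \<rho>s))"
      by (simp add: direct_sum_rep_def)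
    also have "\<dots> = (\<Sum>A\<leftarrow>map (\<lambda>\<rho>. \<rho> g) \<rho>s. mtrace A)"
    proof (rule mtrace_diag_block_mat)
      fix A assume "A \<in> set (map (\<lambda>\<rho>. \<rho> g) \<rho>s)"
      then obtain \<rho> where \<rho>: "\<rho> \<in> set \<rho>s" "A = \<rho> g" by auto
      show "square_mat A"
        using carrier_matD[OF rep_carrier[OF irreducible_repD(1)[OF irr[OF \<rho>(1)]] g]] \<rho>(2) by simp
    qed
    finally show ?thesis by (simp add: o_def)
  qed
  have "of_nat (degree_rep G \<sigma>) = (\<Sum>\<rho>\<leftarrow>\<rho>s. mtrace (\<rho> \<one>\<^bsub>G\<^esub>))"
    using tr[OF one] rep_one[OF \<sigma>] by (simp add: mtrace_one)
  also have "\<dots> = (\<Sum>\<rho>\<leftarrow>\<rho>s. of_nat (degree_rep G \<rho>))"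
    by (rule arg_cong[of _ _ sum_list], rule map_cong) (auto simp: rep_one[OF irreducible_repD(1)[OF irr]] mtrace_one)
  also have "\<dots> = of_nat (\<Sum>\<rho>\<leftarrow>\<rho>s. degree_rep G \<rho>)" by (induction \<rho>s) auto
  finally show "degree_rep G \<sigma> = (\<Sum>\<rho>\<leftarrow>\<rho>s. degree_rep G \<rho>)" by (simp only: of_nat_eq_iff)
qed

lemma four_block_mat_empty:
  "A \<in> carrier_mat n m \<Longrightarrow> B \<in> carrier_mat n 0 \<Longrightarrow> C \<in> carrier_mat 0 m \<Longrightarrow> D \<in> carrier_mat 0 0 \<Longrightarrow>
    four_block_mat A B C D = A"
  by (rule eq_matI) auto

lemma minus_zero_mat:
  fixes A :: "complex mat"
  shows "A \<in> carrier_mat n m \<Longrightarrow> A - 0\<^sub>m n m = A"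
  by (rule eq_matI) auto

lemma add_minus_cancel_mat:
  fixes A B :: "complex mat"
  shows "A \<in> carrier_mat n m \<Longrightarrow> B \<in> carrier_mat n m \<Longrightarrow> A + (B - A) = B"
  by (rule eq_matI) auto

context invariant_mean
begin

text \<open>With \<open>C\<close> as in Maschke's lemma, the kernel of \<open>C\<close> is an invariant complement of the image of \<open>A\<close>.\<close>
lemma reducible_split:
  assumes \<pi>: "representation G T \<pi>" "degree_rep G \<pi> = n" and n: "0 < n" and red: "\<not> irreducible_rep G T \<pi>"
  obtains k l \<rho> \<rho>' where "k < n" "l < n"
    "representation G T \<rho>" "degree_rep G \<rho> = k" "representation G T \<rho>'" "degree_rep G \<rho>' = l"
    "equivalent_rep G \<pi> (\<lambda>g. four_block_mat (\<rho> g) (0\<^sub>m k l) (0\<^sub>m l k) (\<rho>' g))"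
proof -
  note c\<pi> = cmatD[OF cmat_rep[OF \<pi>]]
  obtain W where W: "linear_subspace n W" "\<And>g w. g \<in> carrier G \<Longrightarrow> w \<in> W \<Longrightarrow> \<pi> g *\<^sub>v w \<in> W"
    "W \<noteq> {0\<^sub>v n}" "W \<noteq> carrier_vec n"
    using not_irreducible_repE[OF \<pi> n red] by blast
  obtain k A where A: "A \<in> carrier_mat n k" "inj_mat A" and WA: "W = (\<lambda>v. A *\<^sub>v v) ` carrier_vec k"
    by (rule linear_subspace_eq_image[OF W(1)])
  obtain C where C: "C \<in> carrier_mat k n" "C * A = 1\<^sub>m k"
    and inv1: "\<And>g. g \<in> carrier G \<Longrightarrow> A * (C * (\<pi> g * A)) = \<pi> g * A"
    and C\<pi>: "\<And>g. g \<in> carrier G \<Longrightarrow> C * \<pi> g = C * (\<pi> g * A) * C"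
    by (rule Maschke[OF \<pi> A]) (use W(2) WA in auto)
  obtain l B where B: "B \<in> carrier_mat n l" "inj_mat B"
    and WB: "{v \<in> carrier_vec n. C *\<^sub>v v = 0\<^sub>v k} = (\<lambda>v. B *\<^sub>v v) ` carrier_vec l"
    by (rule linear_subspace_eq_image[OF linear_subspace_kernel[OF C(1)]])
  obtain D0 where D0: "D0 \<in> carrier_mat l n" "D0 * B = 1\<^sub>m l" by (rule inj_mat_left_inverse[OF B])
  \<comment> \<open>The projection onto the kernel of \<open>C\<close> along the image of
    \<open>A\<close>. Composing \<open>D0\<close> with it makes \<open>D\<close> vanish on the image
    of \<open>A\<close>, so that \<open>C\<close> and \<open>D\<close> together read off coordinates
    in the direct sum.\<close>
  define E where "E = 1\<^sub>m n - A * C"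
  define D where "D = D0 * E"
  have AC: "A * C \<in> carrier_mat n n" using A C by auto
  have E: "E \<in> carrier_mat n n" unfolding E_def by (rule minus_carrier_mat[OF AC])
  have D: "D \<in> carrier_mat l n" unfolding D_def by (rule mult_carrier_mat[OF D0(1) E])
  have CE: "C * E = 0\<^sub>m k n"
  proof -
    have "C * E = C * 1\<^sub>m n - C * (A * C)" unfolding E_def by (rule mult_minus_distrib_mat[OF C(1) _ AC]) simp
    also have "C * (A * C) = C" using assoc_mult_mat[OF C(1) A(1) C(1)] C by simp
    finally show ?thesis using C(1) by simp
  qed
  have CB: "C * B = 0\<^sub>m k l"
  proof (rule mat_eq_by_vec)
    fix v :: "complex vec" assume v: "v \<in> carrier_vec l"
    then have "B *\<^sub>v v \<in> {v \<in> carrier_vec n. C *\<^sub>v v = 0\<^sub>v k}" unfolding WB by blast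
    then show "(C * B) *\<^sub>v v = 0\<^sub>m k l *\<^sub>v v" using assoc_mult_mat_vec[OF C(1) B(1) v] v by (simp add: zero_mat_mult_vec)
  qed (use B C in auto)
  have BD: "B * D = E"
    unfolding D_def
  proof (rule factor_through_image[OF B(1) D0 E])
    fix v :: "complex vec" assume v: "v \<in> carrier_vec n"
    have "C *\<^sub>v (E *\<^sub>v v) = 0\<^sub>v k" using assoc_mult_mat_vec[OF C(1) E v] v by (simp add: CE zero_mat_mult_vec)
    then show "E *\<^sub>v v \<in> (\<lambda>v. B *\<^sub>v v) ` carrier_vec l" unfolding WB[symmetric] using E v by auto
  qed
  have E_mult: "E * X = X - A * (C * X)" if X: "X \<in> carrier_mat n m" for X m
  proof -
    have "E * X = 1\<^sub>m n * X - A * C * X" unfolding E_def by (rule minus_mult_distrib_mat[OF _ AC X]) simp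
    then show ?thesis using assoc_mult_mat[OF A(1) C(1) X] X by simp
  qed
  have EB: "E * B = B" using E_mult[OF B(1)] A B by (simp add: CB minus_zero_mat)
  have EA: "E * A = 0\<^sub>m n k" using E_mult[OF A(1)] A C by simp
  have DB: "D * B = 1\<^sub>m l" unfolding D_def using assoc_mult_mat[OF D0(1) E B(1)] EB D0 by simp
  have DA: "D * A = 0\<^sub>m l k" unfolding D_def using assoc_mult_mat[OF D0(1) E A(1)] EA D0 by simp
  have ACBD: "A * C + B * D = 1\<^sub>m n" unfolding BD E_def by (rule add_minus_cancel_mat[OF AC]) simp
  have inv2: "B * (D * (\<pi> g * B)) = \<pi> g * B" if g: "g \<in> carrier G" for g
  proof -
    have pB: "\<pi> g * B \<in> carrier_mat n l" by (rule mult_carrier_mat[OF c\<pi>[OF g] B(1)])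
    have pA: "\<pi> g * A \<in> carrier_mat n k" by (rule mult_carrier_mat[OF c\<pi>[OF g] A(1)])
    have "C * (\<pi> g * B) = C * \<pi> g * B" by (rule assoc_mult_mat[OF C(1) c\<pi>[OF g] B(1), symmetric])
    also have "\<dots> = C * (\<pi> g * A) * (C * B)"
      unfolding C\<pi>[OF g] by (rule assoc_mult_mat[OF mult_carrier_mat[OF C(1) pA] C(1) B(1)])
    also have "\<dots> = 0\<^sub>m k l" unfolding CB by (rule right_mult_zero_mat[OF mult_carrier_mat[OF C(1) pA]])
    finally have "E * (\<pi> g * B) = \<pi> g * B" using E_mult[OF pB] pB A by (simp add: minus_zero_mat)
    then show ?thesis using assoc_mult_mat[OF B(1) D pB] BD by simp
  qed
  define \<rho> \<rho>' where "\<rho> = (\<lambda>g. C * (\<pi> g * A))" and "\<rho>' = (\<lambda>g. D * (\<pi> g * B))"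
  have \<rho>: "representation G T \<rho>" "degree_rep G \<rho> = k"
    unfolding \<rho>_def using subrepresentation[OF \<pi> A(1) C inv1] by auto
  have \<rho>': "representation G T \<rho>'" "degree_rep G \<rho>' = l"
    unfolding \<rho>'_def using subrepresentation[OF \<pi> B(1) D DB inv2] by auto
  \<comment> \<open>The dimension count comes from the trace of the resolution
    \<open>A * C + B * D\<close> of the identity.\<close>
  have "(of_nat n :: complex) = mtrace (A * C + B * D)" unfolding ACBD by (simp add: mtrace_one)
  also have "\<dots> = mtrace (A * C) + mtrace (B * D)" by (rule mtrace_add[OF AC]) (use B D in auto)
  also have "\<dots> = mtrace (C * A) + mtrace (D * B)"
    unfolding mtrace_comm[OF A(1) C(1)] mtrace_comm[OF B(1) D] ..
  also have "\<dots> = of_nat (k + l)" unfolding C(2) DB by (simp add: mtrace_one)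
  finally have nkl: "n = k + l" by (simp only: of_nat_eq_iff)
  have "k \<noteq> 0"
  proof
    assume k: "k = 0"
    have "A *\<^sub>v v = 0\<^sub>v n" if "v \<in> carrier_vec k" for v
    proof -
      have "v = 0\<^sub>v k" by (rule eq_vecI) (use that k in auto)
      then show ?thesis using mult_mat_zero_vec[OF A(1)] by simp
    qed
    then have "W \<subseteq> {0\<^sub>v n}" unfolding WA by auto
    then show False using W(1,3) by (auto simp: linear_subspace_def)
  qed
  moreover have "l \<noteq> 0"
  proof
    assume l: "l = 0"
    have "B * D = 0\<^sub>m n n" using B D l by (intro eq_matI) (auto simp: scalar_prod_def)
    then have AC1: "A * C = 1\<^sub>m n" using ACBD AC by simp
    have "v \<in> W" if v: "v \<in> carrier_vec n" for v
    proof -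
      have "v = A *\<^sub>v (C *\<^sub>v v)" using assoc_mult_mat_vec[OF A(1) C(1) v] AC1 v by simp
      then show ?thesis unfolding WA using mult_mat_vec_carrier[OF C(1) v] by (rule image_eqI)
    qed
    then show False using W(1,4) by (auto simp: linear_subspace_def)
  qed
  ultimately have kl: "k < n" "l < n" using nkl by auto
  have "equivalent_rep G \<pi> (\<lambda>g. four_block_mat (\<rho> g) (0\<^sub>m k l) (0\<^sub>m l k) (\<rho>' g))"
    unfolding equivalent_rep_def
  proof (intro exI ballI)
    fix g assume g: "g \<in> carrier G"
    \<comment> \<open>The base change places \<open>A\<close> beside \<open>B\<close>, and its
      inverse places \<open>C\<close> above \<open>D\<close>; both are written as block matrices
      with two empty blocks.\<close>
    let ?P = "four_block_mat A B (0\<^sub>m 0 k) (0\<^sub>m 0 l)" and ?Q = "four_block_mat C (0\<^sub>m k 0) D (0\<^sub>m l 0)"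
    have P: "?P \<in> carrier_mat n n" using A B nkl by (intro carrier_matI) auto
    have Q: "?Q \<in> carrier_mat n n" using C D nkl by (intro carrier_matI) auto
    have c\<rho>: "\<rho> g \<in> carrier_mat k k" "\<rho>' g \<in> carrier_mat l l"
      using cmatD[OF cmat_rep[OF \<rho>] g] cmatD[OF cmat_rep[OF \<rho>'] g] .
    let ?F = "four_block_mat (\<rho> g) (0\<^sub>m k l) (0\<^sub>m l k) (\<rho>' g)"
    show "similar_mat_wit (\<pi> g) ?F ?P ?Q"
    proof (rule similar_mat_witI[OF _ _ _ c\<pi>[OF g] _ P Q])
      show "?P * ?Q = 1\<^sub>m n"
        using A B C D ACBD
        by (subst mult_four_block_mat[of _ n k _ l _ 0 _ _ n _ 0]) (auto intro!: four_block_mat_empty[of _ n n, THEN trans])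
      show "?Q * ?P = 1\<^sub>m n"
        using A B C D CB DA DB nkl
        by (subst mult_four_block_mat[of _ k n _ 0 _ l _ _ k _ l]) (auto simp: four_block_one_mat)
      have "?P * ?F = four_block_mat (A * \<rho> g) (B * \<rho>' g) (0\<^sub>m 0 k) (0\<^sub>m 0 l)"
        using A B c\<rho> by (subst mult_four_block_mat[of _ n k _ l _ 0 _ _ k _ l]) auto
      then have "?P * ?F * ?Q = A * \<rho> g * C + B * \<rho>' g * D"
        using A B C D c\<rho>
        by (simp, subst mult_four_block_mat[of _ n k _ l _ 0 _ _ n _ 0]) (auto intro!: four_block_mat_empty[of _ n n])
      also have "A * \<rho> g = \<pi> g * A" unfolding \<rho>_def by (rule inv1[OF g])
      also have "B * \<rho>' g = \<pi> g * B" unfolding \<rho>'_def by (rule inv2[OF g])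
      also have "\<pi> g * A * C + \<pi> g * B * D = \<pi> g * (A * C + B * D)"
        using assoc_mult_mat[OF c\<pi>[OF g] A(1) C(1)] assoc_mult_mat[OF c\<pi>[OF g] B(1) D]
          mult_add_distrib_mat[OF c\<pi>[OF g] AC mult_carrier_mat[OF B(1) D]] by simp
      also have "\<dots> = \<pi> g" unfolding ACBD using c\<pi>[OF g] by simp
      finally show "\<pi> g = ?P * ?F * ?Q" by simp
      show "?F \<in> carrier_mat n n" unfolding nkl by (rule four_block_carrier_mat[OF c\<rho>])
    qed
  qed
  with kl \<rho> \<rho>' that show ?thesis by blast
qed

theorem irreducible_decomposition_exists:
  "representation G T \<pi> \<Longrightarrow> \<exists>\<rho>s. irreducible_decomposition G T \<pi> \<rho>s"
proof (induction "degree_rep G \<pi>" arbitrary: \<pi> rule: less_induct)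
  case less
  define n where "n = degree_rep G \<pi>"
  note \<pi> = less.prems n_def[symmetric]
  note c\<pi> = cmatD[OF cmat_rep[OF \<pi>]]
  consider "n = 0" | "irreducible_rep G T \<pi>" | "0 < n" "\<not> irreducible_rep G T \<pi>" by auto
  then show ?case
  proof cases
    case 1
    have "similar_mat_wit (\<pi> g) (0\<^sub>m 0 0) (1\<^sub>m 0) (1\<^sub>m 0)" if "g \<in> carrier G" for g
      using c\<pi>[OF that] 1 by (auto simp: similar_mat_wit_def intro!: eq_matI)
    then have "irreducible_decomposition G T \<pi> []"
      by (auto simp: irreducible_decomposition_def equivalent_rep_def direct_sum_rep_def)
    then show ?thesis by blast
  next
    case 2
    have "direct_sum_rep [\<pi>] = \<pi>"
      by (rule ext) (simp add: direct_sum_rep_def del: diag_block_mat.simps)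
    then have "irreducible_decomposition G T \<pi> [\<pi>]"
      using 2 similar_mat_wit_refl[OF c\<pi>]
      unfolding irreducible_decomposition_def equivalent_rep_def by auto
    then show ?thesis by blast
  next
    case 3
    obtain k l \<rho> \<rho>' where kl: "k < n" "l < n"
      and \<rho>: "representation G T \<rho>" "degree_rep G \<rho> = k" and \<rho>': "representation G T \<rho>'" "degree_rep G \<rho>' = l"
      and eq: "equivalent_rep G \<pi> (\<lambda>g. four_block_mat (\<rho> g) (0\<^sub>m k l) (0\<^sub>m l k) (\<rho>' g))"
      by (rule reducible_split[OF \<pi> 3])
    obtain \<rho>s where \<rho>s: "irreducible_decomposition G T \<rho> \<rho>s"
      using less.hyps[OF _ \<rho>(1)] \<rho>(2) kl(1) n_def by blast
    obtain \<rho>s' where \<rho>s': "irreducible_decomposition G T \<rho>' \<rho>s'"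
      using less.hyps[OF _ \<rho>'(1)] \<rho>'(2) kl(2) n_def by blast
    have "equivalent_rep G \<pi> (direct_sum_rep (\<rho>s @ \<rho>s'))"
      by (rule equivalent_rep_trans[OF eq equivalent_rep_direct_sum_append[OF one_closed
            cmatD[OF cmat_rep[OF \<rho>]] cmatD[OF cmat_rep[OF \<rho>']]]])
        (use \<rho>s \<rho>s' in \<open>simp_all add: irreducible_decomposition_def\<close>)
    then have "irreducible_decomposition G T \<pi> (\<rho>s @ \<rho>s')"
      using \<rho>s \<rho>s' by (auto simp: irreducible_decomposition_def)
    then show ?thesis by blast
  qed
qed

section \<open>Orthogonality of irreducible characters\<close>

definition matrix_unit :: "nat \<Rightarrow> nat \<Rightarrow> nat \<Rightarrow> nat \<Rightarrow> complex mat" where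
  "matrix_unit n m a b = mat n m (\<lambda>(i, j). if i = a \<and> j = b then 1 else 0)"

lemma mult_matrix_unit:
  assumes A: "A \<in> carrier_mat n n" and B: "B \<in> carrier_mat m m" and ab: "a < n" "b < m" and ij: "i < n" "j < m"
  shows "(A * (matrix_unit n m a b * B)) $$ (i, j) = A $$ (i, a) * B $$ (b, j)"
proof -
  have U: "matrix_unit n m a b \<in> carrier_mat n m" by (simp add: matrix_unit_def)
  have "(matrix_unit n m a b * B) $$ (l, j) = (if l = a then B $$ (b, j) else 0)" if "l < n" for l
  proof -
    have "(matrix_unit n m a b * B) $$ (l, j) = (\<Sum>p<m. if p = b then (if l = a then B $$ (p, j) else 0) else 0)"
      unfolding index_mult_mat_sum[OF U B that ij(2)] using that by (intro sum.cong) (auto simp: matrix_unit_def)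
    then show ?thesis using ab by simp
  qed
  then have "(A * (matrix_unit n m a b * B)) $$ (i, j) = (\<Sum>l<n. if l = a then A $$ (i, l) * B $$ (b, j) else 0)"
    unfolding index_mult_mat_sum[OF A mult_carrier_mat[OF U B] ij] by (intro sum.cong) auto
  then show ?thesis using ab by simp
qed

text \<open>Averaging the matrix unit at \<open>(a, b)\<close> and reading off the entry \<open>(a, b)\<close>.\<close>
lemma mean_coefficients:
  assumes \<pi>: "representation G T \<pi>" "degree_rep G \<pi> = n" and \<rho>: "representation G T \<rho>" "degree_rep G \<rho> = m"
    and ab: "a < n" "b < m"
  defines "C \<equiv> mmean n m (\<lambda>x. \<pi> (inv x) * (matrix_unit n m a b * \<rho> x))"
  shows "M (\<lambda>x. \<pi> (inv x) $$ (a, a) * \<rho> x $$ (b, b)) = C $$ (a, b)"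
    and "g \<in> carrier G \<Longrightarrow> \<pi> g * C = C * \<rho> g"
    and "n = m \<Longrightarrow> mtrace C = M (\<lambda>x. \<Sum>i<n. \<pi> (inv x) $$ (i, a) * \<rho> x $$ (b, i))"
proof -
  note c\<pi> = cmat_rep[OF \<pi>] and c\<rho> = cmat_rep[OF \<rho>]
  have U: "matrix_unit n m a b \<in> carrier_mat n m" by (simp add: matrix_unit_def)
  have eq: "(\<pi> (inv x) * (matrix_unit n m a b * \<rho> x)) $$ (i, j) = \<pi> (inv x) $$ (i, a) * \<rho> x $$ (b, j)"
    if "x \<in> carrier G" "i < n" "j < m" for x i j
    by (rule mult_matrix_unit[OF cmatD[OF cmat_inv[OF c\<pi>] that(1)] cmatD[OF c\<rho> that(1)] ab that(2,3)])
  have ct: "contf (\<lambda>x. \<pi> (inv x) $$ (i, a) * \<rho> x $$ (b, j))" if "i < n" "j < m" for i j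
    using cmat_cont[OF cmat_inv[OF c\<pi>]] cmat_cont[OF c\<rho>] ab that by (intro continuous_map_mult) auto
  have C: "C $$ (i, j) = M (\<lambda>x. \<pi> (inv x) $$ (i, a) * \<rho> x $$ (b, j))" if "i < n" "j < m" for i j
    unfolding C_def mmean_def using that by (simp, intro M_cong[OF ct]) (auto simp: eq simp del: index_mult_mat)
  show "M (\<lambda>x. \<pi> (inv x) $$ (a, a) * \<rho> x $$ (b, b)) = C $$ (a, b)" using C[OF ab] by simp
  show "\<pi> g * C = C * \<rho> g" if "g \<in> carrier G"
    unfolding C_def by (rule intertwiner_mean[OF \<pi> \<rho> U that, symmetric])
  show "mtrace C = M (\<lambda>x. \<Sum>i<n. \<pi> (inv x) $$ (i, a) * \<rho> x $$ (b, i))" if nm: "n = m"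
  proof -
    have "mtrace C = (\<Sum>i<n. M (\<lambda>x. \<pi> (inv x) $$ (i, a) * \<rho> x $$ (b, i)))"
      unfolding mtrace_def using C nm by (simp add: C_def mmean_def)
    also have "\<dots> = M (\<lambda>x. \<Sum>i<n. \<pi> (inv x) $$ (i, a) * \<rho> x $$ (b, i))"
      by (rule M_sum[symmetric]) (use ct nm in auto)
    finally show ?thesis .
  qed
qed

lemma mean_ch_product:
  assumes \<pi>: "irreducible_rep G T \<pi>" and \<rho>: "irreducible_rep G T \<rho>"
  shows "M (\<lambda>x. ch G \<pi> (inv x) * ch G \<rho> x) =
    (\<Sum>a<degree_rep G \<pi>. \<Sum>b<degree_rep G \<rho>. M (\<lambda>x. \<pi> (inv x) $$ (a, a) * \<rho> x $$ (b, b))) /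
      of_nat (degree_rep G \<pi> * degree_rep G \<rho>)"
proof -
  define n m where "n = degree_rep G \<pi>" "m = degree_rep G \<rho>"
  note r\<pi> = irreducible_repD(1)[OF \<pi>] and r\<rho> = irreducible_repD(1)[OF \<rho>]
  note c\<pi> = cmat_rep[OF r\<pi> n_m_def(1)[symmetric]] and c\<rho> = cmat_rep[OF r\<rho> n_m_def(2)[symmetric]]
  have ct: "contf (\<lambda>x. \<pi> (inv x) $$ (a, a) * \<rho> x $$ (b, b))" if "a < n" "b < m" for a b
    using cmat_cont[OF cmat_inv[OF c\<pi>]] cmat_cont[OF c\<rho>] that by (intro continuous_map_mult) auto
  let ?S = "\<lambda>x. \<Sum>a<n. \<Sum>b<m. \<pi> (inv x) $$ (a, a) * \<rho> x $$ (b, b)"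
  have cS: "contf ?S" using ct by (intro continuous_map_sum) auto
  have "M (\<lambda>x. ch G \<pi> (inv x) * ch G \<rho> x) = M (\<lambda>x. (1 / of_nat (n * m)) * ?S x)"
  proof (rule M_cong[OF continuous_map_scale[OF cS]])
    fix x assume x: "x \<in> carrier G"
    then show "(1 / of_nat (n * m)) * ?S x = ch G \<pi> (inv x) * ch G \<rho> x"
      using cmatD[OF c\<pi>, of "inv x"] cmatD[OF c\<rho> x]
      by (simp add: ch_eq[OF r\<pi>] ch_eq[OF r\<rho>] mtrace_def n_m_def[symmetric] sum_product)
  qed
  also have "\<dots> = (1 / of_nat (n * m)) * M ?S" by (rule M_scale[OF cS])
  also have "M ?S = (\<Sum>a<n. \<Sum>b<m. M (\<lambda>x. \<pi> (inv x) $$ (a, a) * \<rho> x $$ (b, b)))"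
    using ct by (subst M_sum, auto intro!: continuous_map_sum sum.cong M_sum)
  finally show ?thesis by (simp add: n_m_def)
qed

text \<open>A nonzero averaged matrix unit would be a nonzero intertwiner, forcing equal characters;
  hence every mean of a product of diagonal coefficients vanishes.\<close>

lemma ch_orthogonal:
  assumes \<pi>: "irreducible_rep G T \<pi>" and \<rho>: "irreducible_rep G T \<rho>" and ne: "ch G \<pi> \<noteq> ch G \<rho>"
  shows "M (\<lambda>x. ch G \<pi> (inv x) * ch G \<rho> x) = 0"
proof -
  note r\<pi> = irreducible_repD(1)[OF \<pi>] and r\<rho> = irreducible_repD(1)[OF \<rho>]
  have "M (\<lambda>x. \<pi> (inv x) $$ (a, a) * \<rho> x $$ (b, b)) = 0" if ab: "a < degree_rep G \<pi>" "b < degree_rep G \<rho>" for a b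
  proof -
    note C = mean_coefficients[OF r\<pi> refl r\<rho> refl ab]
    show ?thesis
    proof (rule ccontr)
      assume "M (\<lambda>x. \<pi> (inv x) $$ (a, a) * \<rho> x $$ (b, b)) \<noteq> 0"
      with C(1) ab have "mmean (degree_rep G \<pi>) (degree_rep G \<rho>)
          (\<lambda>x. \<pi> (inv x) * (matrix_unit (degree_rep G \<pi>) (degree_rep G \<rho>) a b * \<rho> x)) \<noteq> 0\<^sub>m (degree_rep G \<pi>) (degree_rep G \<rho>)"
        by auto
      from Schur_ch_eq[OF \<pi> \<rho> one_closed mmean_carrier this C(2)] ne show False by simp
    qed
  qed
  then show ?thesis unfolding mean_ch_product[OF \<pi> \<rho>] by simp
qed

text \<open>For normalized characters the value is the inverse square of the degree; it is stated as
  nonzero in order to be cancelled later.\<close>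

lemma ch_norm:
  assumes \<pi>: "irreducible_rep G T \<pi>"
  shows "M (\<lambda>x. ch G \<pi> (inv x) * ch G \<pi> x) \<noteq> 0"
proof -
  define n where "n = degree_rep G \<pi>"
  note d = n_def[symmetric]
  note r\<pi> = irreducible_repD(1)[OF \<pi>] and n0 = irreducible_repD(2)[OF \<pi>, folded n_def]
  note c\<pi> = cmat_rep[OF r\<pi> d]
  have "M (\<lambda>x. \<pi> (inv x) $$ (a, a) * \<pi> x $$ (b, b)) = (if a = b then 1 / of_nat n else 0)" if ab: "a < n" "b < n" for a b
  proof -
    note C = mean_coefficients[OF r\<pi> d r\<pi> d ab]
    let ?C = "mmean n n (\<lambda>x. \<pi> (inv x) * (matrix_unit n n a b * \<pi> x))"
    obtain c where c: "?C = c \<cdot>\<^sub>m 1\<^sub>m n" by (rule Schur_scalar[OF \<pi> d mmean_carrier C(2)])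
    \<comment> \<open>The scalar from Schur's lemma is found from its trace, where the products
      \<open>\<pi> x * \<pi> (inv x)\<close> collapse to the identity.\<close>
    have "of_nat n * c = mtrace ?C" unfolding c by (simp add: mtrace_def)
    also have "\<dots> = M (\<lambda>x. \<Sum>i<n. \<pi> (inv x) $$ (i, a) * \<pi> x $$ (b, i))" by (rule C(3)) simp
    also have "\<dots> = M (\<lambda>x. if a = b then 1 else 0)"
    proof (rule M_cong)
      fix x assume x: "x \<in> carrier G"
      have ix: "inv x \<in> carrier G" using x by simp
      have "(\<Sum>i<n. \<pi> (inv x) $$ (i, a) * \<pi> x $$ (b, i)) = (\<pi> x * \<pi> (inv x)) $$ (b, a)"
        unfolding index_mult_mat_sum[OF cmatD[OF c\<pi> x] cmatD[OF c\<pi> ix] ab(2,1)] by (simp add: mult.commute)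
      also have "\<pi> x * \<pi> (inv x) = 1\<^sub>m n"
        using rep_mult[OF r\<pi> x ix] rep_one[OF r\<pi>] x by (simp add: d)
      finally show "(if a = b then 1 else 0) = (\<Sum>i<n. \<pi> (inv x) $$ (i, a) * \<pi> x $$ (b, i))" using ab by auto
    qed simp
    finally have "of_nat n * c = (if a = b then 1 else 0)" by (simp add: M_const)
    then have "c = (if a = b then 1 / of_nat n else 0)" using n0 by (auto simp: field_simps)
    then show ?thesis using C(1) ab unfolding c by (auto split: if_splits)
  qed
  then have "(\<Sum>a<n. \<Sum>b<n. M (\<lambda>x. \<pi> (inv x) $$ (a, a) * \<pi> x $$ (b, b))) = 1" using n0 by simp
  then show ?thesis unfolding mean_ch_product[OF \<pi> \<pi>] d using n0 by simp
qed

end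

section \<open>Measures on the dual\<close>

text \<open>The integral against a measure with finite support. With
  \<open>\<lambda>z. fst z g\<close> as integrand it evaluates at \<open>g\<close> the function that
  a measure on the dual represents.\<close>

definition integ :: "('k \<Rightarrow> real) \<Rightarrow> ('k \<Rightarrow> complex) \<Rightarrow> complex" where
  "integ p f = (\<Sum>z | p z \<noteq> 0. of_real (p z) * f z)"

lemma integ_eq:
  "finite S \<Longrightarrow> {z. p z \<noteq> 0} \<subseteq> S \<Longrightarrow> integ p f = (\<Sum>z\<in>S. of_real (p z) * f z)"
  unfolding integ_def by (rule sum.mono_neutral_left) auto

lemma integ_dirac: "integ (dirac x) f = f x"
  using integ_eq[of "{x}" "dirac x" f] by (auto simp: dirac_def)

lemma list_measure_support:
  "{z. (\<Sum>\<rho>\<leftarrow>\<rho>s. c \<rho> * dirac (k \<rho>) z) \<noteq> 0} \<subseteq> k ` set \<rho>s"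
proof
  fix z assume "z \<in> {z. (\<Sum>\<rho>\<leftarrow>\<rho>s. c \<rho> * dirac (k \<rho>) z) \<noteq> 0}"
  moreover have "(\<Sum>\<rho>\<leftarrow>\<rho>s. c \<rho> * dirac (k \<rho>) z) = 0" if "z \<notin> k ` set \<rho>s"
    using that by (induction \<rho>s) (auto simp: dirac_def)
  ultimately show "z \<in> k ` set \<rho>s" by blast
qed

lemma integ_list_measure:
  "integ (\<lambda>z. \<Sum>\<rho>\<leftarrow>\<rho>s. c \<rho> * dirac (k \<rho>) z) f = (\<Sum>\<rho>\<leftarrow>\<rho>s. of_real (c \<rho>) * f (k \<rho>))"
proof -
  have "(\<Sum>z\<in>S. of_real (\<Sum>\<rho>\<leftarrow>\<rho>s. c \<rho> * dirac (k \<rho>) z) * f z) = (\<Sum>\<rho>\<leftarrow>\<rho>s. of_real (c \<rho>) * f (k \<rho>))"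
    if "finite S" "k ` set \<rho>s \<subseteq> S" for S
    using that(2)
  proof (induction \<rho>s)
    case (Cons \<rho> \<rho>s)
    have "(\<Sum>z\<in>S. of_real (c \<rho> * dirac (k \<rho>) z) * f z) = (\<Sum>z\<in>S. if z = k \<rho> then of_real (c \<rho>) * f (k \<rho>) else 0)"
      by (rule sum.cong) (auto simp: dirac_def)
    also have "\<dots> = of_real (c \<rho>) * f (k \<rho>)" using Cons.prems that(1) by simp
    finally show ?case using Cons by (simp add: distrib_right sum.distrib)
  qed simp
  from this[of "k ` set \<rho>s"] show ?thesis
    using integ_eq[OF _ list_measure_support[of c k \<rho>s], of f] by simp
qed

section \<open>Tensor products and representations of degree one\<close>

lemma sum_div_mod:
  "(\<Sum>l<m * n. f (l div n) (l mod n)) = (\<Sum>a<m. \<Sum>b<(n::nat). f a b :: complex)"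
proof -
  have "(\<Sum>l<m * n. f (l div n) (l mod n)) = (\<Sum>(a, b)\<in>{..<m} \<times> {..<n}. f a b)"
  proof (rule sum.reindex_bij_witness[of _ "\<lambda>(a, b). a * n + b" "\<lambda>l. (l div n, l mod n)"])
    fix l assume l: "l \<in> {..<m * n}"
    then have "n > 0" by (cases n) auto
    with l show "(l div n, l mod n) \<in> {..<m} \<times> {..<n}" by (auto simp: less_mult_imp_div_less)
  next
    fix p assume "p \<in> {..<m} \<times> {..<n}"
    then obtain a b where p: "p = (a, b)" "a < m" "b < n" by auto
    have "a * n + b < Suc a * n" using p by simp
    also have "\<dots> \<le> m * n" using p by (intro mult_le_mono1) simp
    finally show "(\<lambda>(a, b). a * n + b) p \<in> {..<m * n}" using p by simp
  qed auto
  then show ?thesis by (simp add: sum.cartesian_product)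
qed

text \<open>Row and column indices encode pairs by quotient and remainder modulo \<open>n\<close>;
  sums over them split into double sums, so matrix products and traces factor.\<close>

lemma tensor_rep_facts:
  assumes \<sigma>: "representation G T \<sigma>" "degree_rep G \<sigma> = m" and \<tau>: "representation G T \<tau>" "degree_rep G \<tau> = n"
    and one: "\<one>\<^bsub>G\<^esub> \<in> carrier G" and top: "topspace T = carrier G"
  shows "representation G T (tensor_rep \<sigma> \<tau>)" "degree_rep G (tensor_rep \<sigma> \<tau>) = m * n"
    and "g \<in> carrier G \<Longrightarrow> ch G (tensor_rep \<sigma> \<tau>) g = ch G \<sigma> g * ch G \<tau> g"
proof -
  have c\<sigma>: "\<sigma> g \<in> carrier_mat m m" and c\<tau>: "\<tau> g \<in> carrier_mat n n" if "g \<in> carrier G" for g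
    using rep_carrier[OF \<sigma>(1) that] rep_carrier[OF \<tau>(1) that] \<sigma>(2) \<tau>(2) by auto
  have T: "tensor_rep \<sigma> \<tau> g = mat (m * n) (m * n)
      (\<lambda>(i, j). \<sigma> g $$ (i div n, j div n) * \<tau> g $$ (i mod n, j mod n))" if "g \<in> carrier G" for g
    using c\<sigma>[OF that] c\<tau>[OF that] by (simp add: tensor_rep_def Let_def)
  have T_carrier: "tensor_rep \<sigma> \<tau> g \<in> carrier_mat (m * n) (m * n)" if "g \<in> carrier G" for g
    by (simp add: T[OF that])
  have dm: "i div n < m" "i mod n < n" if "i < m * n" for i
  proof -
    have "n > 0" using that by (cases n) auto
    then show "i div n < m" "i mod n < n" using that by (auto simp: less_mult_imp_div_less)
  qed
  have T_one: "tensor_rep \<sigma> \<tau> \<one>\<^bsub>G\<^esub> = 1\<^sub>m (m * n)"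
  proof (rule eq_matI)
    fix i j assume "i < dim_row (1\<^sub>m (m * n) :: complex mat)" "j < dim_col (1\<^sub>m (m * n) :: complex mat)"
    then have ij: "i < m * n" "j < m * n" by auto
    have "i div n = j div n \<and> i mod n = j mod n \<longleftrightarrow> i = j" by (metis div_mult_mod_eq)
    then show "tensor_rep \<sigma> \<tau> \<one>\<^bsub>G\<^esub> $$ (i, j) = 1\<^sub>m (m * n) $$ (i, j)"
      using ij dm[OF ij(1)] dm[OF ij(2)] rep_one[OF \<sigma>(1)] rep_one[OF \<tau>(1)] by (auto simp: T[OF one] \<sigma>(2) \<tau>(2))
  qed (simp_all add: T[OF one])
  have T_mult: "tensor_rep \<sigma> \<tau> (g \<otimes>\<^bsub>G\<^esub> h) = tensor_rep \<sigma> \<tau> g * tensor_rep \<sigma> \<tau> h"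
    if g: "g \<in> carrier G" and h: "h \<in> carrier G" for g h
  proof -
    have c: "\<sigma> g * \<sigma> h \<in> carrier_mat m m" "\<tau> g * \<tau> h \<in> carrier_mat n n"
      using mult_carrier_mat[OF c\<sigma>[OF g] c\<sigma>[OF h]] mult_carrier_mat[OF c\<tau>[OF g] c\<tau>[OF h]] .
    have T': "tensor_rep \<sigma> \<tau> (g \<otimes>\<^bsub>G\<^esub> h) = mat (m * n) (m * n)
      (\<lambda>(i, j). (\<sigma> g * \<sigma> h) $$ (i div n, j div n) * (\<tau> g * \<tau> h) $$ (i mod n, j mod n))"
      using c\<sigma>[OF g] c\<tau>[OF g] unfolding tensor_rep_def Let_def rep_mult[OF \<sigma>(1) g h] rep_mult[OF \<tau>(1) g h] by simp
    show ?thesis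
    proof (rule eq_matI)
      fix i j assume "i < dim_row (tensor_rep \<sigma> \<tau> g * tensor_rep \<sigma> \<tau> h)" "j < dim_col (tensor_rep \<sigma> \<tau> g * tensor_rep \<sigma> \<tau> h)"
      then have ij: "i < m * n" "j < m * n" using T_carrier[OF g] T_carrier[OF h] by auto
      note i = dm[OF ij(1)] and j = dm[OF ij(2)]
      let ?f = "\<lambda>a b. (\<sigma> g $$ (i div n, a) * \<tau> g $$ (i mod n, b)) * (\<sigma> h $$ (a, j div n) * \<tau> h $$ (b, j mod n))"
      have "(tensor_rep \<sigma> \<tau> g * tensor_rep \<sigma> \<tau> h) $$ (i, j) = (\<Sum>l<m * n. ?f (l div n) (l mod n))"
        unfolding index_mult_mat_sum[OF T_carrier[OF g] T_carrier[OF h] ij]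
        by (rule sum.cong) (use ij in \<open>auto simp: T[OF g] T[OF h]\<close>)
      also have "\<dots> = (\<Sum>a<m. \<Sum>b<n. ?f a b)" by (rule sum_div_mod)
      also have "\<dots> = (\<Sum>a<m. \<sigma> g $$ (i div n, a) * \<sigma> h $$ (a, j div n)) * (\<Sum>b<n. \<tau> g $$ (i mod n, b) * \<tau> h $$ (b, j mod n))"
        by (simp add: sum_product mult_ac)
      also have "\<dots> = (\<sigma> g * \<sigma> h) $$ (i div n, j div n) * (\<tau> g * \<tau> h) $$ (i mod n, j mod n)"
        unfolding index_mult_mat_sum[OF c\<sigma>[OF g] c\<sigma>[OF h] i(1) j(1)] index_mult_mat_sum[OF c\<tau>[OF g] c\<tau>[OF h] i(2) j(2)] ..
      also have "\<dots> = tensor_rep \<sigma> \<tau> (g \<otimes>\<^bsub>G\<^esub> h) $$ (i, j)" unfolding T' using ij by simp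
      finally show "tensor_rep \<sigma> \<tau> (g \<otimes>\<^bsub>G\<^esub> h) $$ (i, j) = (tensor_rep \<sigma> \<tau> g * tensor_rep \<sigma> \<tau> h) $$ (i, j)" ..
    qed (use T_carrier[OF g] T_carrier[OF h] in \<open>auto simp: T'\<close>)
  qed
  have T_cont: "continuous_map T euclidean (\<lambda>g. tensor_rep \<sigma> \<tau> g $$ (i, j))" if ij: "i < m * n" "j < m * n" for i j
  proof (rule continuous_map_eq)
    show "continuous_map T euclidean (\<lambda>g. \<sigma> g $$ (i div n, j div n) * \<tau> g $$ (i mod n, j mod n))"
      using dm[OF ij(1)] dm[OF ij(2)] \<sigma>(2) \<tau>(2)
      by (intro continuous_map_mult rep_cont[OF \<sigma>(1)] rep_cont[OF \<tau>(1)]) auto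
  qed (use ij in \<open>auto simp: T top\<close>)
  show R: "representation G T (tensor_rep \<sigma> \<tau>)" "degree_rep G (tensor_rep \<sigma> \<tau>) = m * n"
    using representationI[OF T_one T_carrier T_mult T_cont] by auto
  show "ch G (tensor_rep \<sigma> \<tau>) g = ch G \<sigma> g * ch G \<tau> g" if g: "g \<in> carrier G" for g
  proof -
    have "mtrace (tensor_rep \<sigma> \<tau> g) = (\<Sum>l<m * n. \<sigma> g $$ (l div n, l div n) * \<tau> g $$ (l mod n, l mod n))"
      by (simp add: mtrace_def T[OF g])
    also have "\<dots> = (\<Sum>a<m. \<Sum>b<n. \<sigma> g $$ (a, a) * \<tau> g $$ (b, b))" by (rule sum_div_mod)
    also have "\<dots> = mtrace (\<sigma> g) * mtrace (\<tau> g)"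
      using c\<sigma>[OF g] c\<tau>[OF g] by (simp add: mtrace_def sum_product)
    finally show ?thesis by (simp add: ch_eq[OF R(1) g] ch_eq[OF \<sigma>(1) g] ch_eq[OF \<tau>(1) g] R(2) \<sigma>(2) \<tau>(2))
  qed
qed

lemma degree_one_irreducible:
  assumes \<pi>: "representation G T \<pi>" "degree_rep G \<pi> = 1"
  shows "irreducible_rep G T \<pi>"
proof (rule irreducible_repI[OF \<pi>])
  fix W assume W: "linear_subspace 1 W"
  show "W = {0\<^sub>v 1} \<or> W = carrier_vec 1"
  proof (cases "W \<subseteq> {0\<^sub>v 1}")
    case True
    then show ?thesis using W by (auto simp: linear_subspace_def)
  next
    case False
    then obtain w where w: "w \<in> W" "w \<noteq> 0\<^sub>v 1" by blast
    then have wc: "w \<in> carrier_vec 1" using W by (auto simp: linear_subspace_def)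
    have w0: "w $ 0 \<noteq> 0"
    proof
      assume "w $ 0 = 0"
      then have "w = 0\<^sub>v 1" using wc by (intro eq_vecI) auto
      with w show False by simp
    qed
    have "v \<in> W" if v: "v \<in> carrier_vec 1" for v
    proof -
      have "v = (v $ 0 / w $ 0) \<cdot>\<^sub>v w" using v wc w0 by (intro eq_vecI) auto
      then show ?thesis using W w(1) by (metis linear_subspace_def)
    qed
    then show ?thesis using W by (auto simp: linear_subspace_def)
  qed
qed simp

text \<open>By Schur's lemma every \<open>\<pi> g\<close> is scalar, so the line through the first
  unit vector is invariant and must be the whole space.\<close>

lemma abelian_irreducible_degree:
  assumes \<pi>: "irreducible_rep G T \<pi>"
    and comm: "\<And>g h. g \<in> carrier G \<Longrightarrow> h \<in> carrier G \<Longrightarrow> g \<otimes>\<^bsub>G\<^esub> h = h \<otimes>\<^bsub>G\<^esub> g"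
  shows "degree_rep G \<pi> = 1"
proof -
  define n where "n = degree_rep G \<pi>"
  note d = n_def[symmetric]
  note r = irreducible_repD[OF \<pi>, unfolded d]
  have c: "\<pi> g \<in> carrier_mat n n" if "g \<in> carrier G" for g using rep_carrier[OF r(1) that] by (simp add: d)
  let ?W = "{a \<cdot>\<^sub>v unit_vec n 0 | a :: complex. True}"
  have W: "linear_subspace n ?W"
    unfolding linear_subspace_def
  proof (intro conjI ballI allI)
    show "0\<^sub>v n \<in> ?W" by (auto intro!: exI[of _ 0])
    fix v w assume "v \<in> ?W" "w \<in> ?W"
    then obtain a b where "v = a \<cdot>\<^sub>v unit_vec n 0" "w = b \<cdot>\<^sub>v unit_vec n 0" by blast
    then have "v + w = (a + b) \<cdot>\<^sub>v unit_vec n 0" by (simp add: add_smult_distrib_vec)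
    then show "v + w \<in> ?W" by blast
  next
    fix e v assume "v \<in> ?W"
    then obtain a where "v = a \<cdot>\<^sub>v unit_vec n 0" by blast
    then have "e \<cdot>\<^sub>v v = (e * a) \<cdot>\<^sub>v unit_vec n 0" by (simp add: smult_smult_assoc)
    then show "e \<cdot>\<^sub>v v \<in> ?W" by blast
  qed auto
  have "\<pi> g *\<^sub>v w \<in> ?W" if g: "g \<in> carrier G" and w: "w \<in> ?W" for g w
  proof -
    obtain e where e: "\<pi> g = e \<cdot>\<^sub>m 1\<^sub>m n"
    proof (rule Schur_scalar[OF \<pi> d c[OF g]])
      fix h assume h: "h \<in> carrier G"
      show "\<pi> h * \<pi> g = \<pi> g * \<pi> h" using rep_mult[OF r(1)] g h comm[OF g h] by metis
    qed
    have wc: "w \<in> carrier_vec n" using w by auto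
    have "\<pi> g *\<^sub>v w = e \<cdot>\<^sub>v w"
    proof (rule eq_vecI)
      fix i assume "i < dim_vec (e \<cdot>\<^sub>v w)"
      then have i: "i < n" using wc by simp
      have "(\<pi> g *\<^sub>v w) $ i = (\<Sum>l<n. if l = i then e * w $ l else 0)"
        unfolding index_mult_mat_vec_sum[OF c[OF g] wc i] by (rule sum.cong) (use i in \<open>auto simp: e\<close>)
      then show "(\<pi> g *\<^sub>v w) $ i = (e \<cdot>\<^sub>v w) $ i" using i wc by simp
    qed (use c[OF g] wc in auto)
    then show ?thesis using W w by (simp add: linear_subspace_def)
  qed
  from r(3)[OF W this] have "?W = {0\<^sub>v n} \<or> ?W = carrier_vec n" .
  moreover have "?W \<noteq> {0\<^sub>v n}"
  proof
    assume "?W = {0\<^sub>v n}"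
    moreover have "1 \<cdot>\<^sub>v unit_vec n 0 \<in> ?W" by blast
    ultimately have "unit_vec n 0 = (0\<^sub>v n :: complex vec)" by auto
    then have "unit_vec n 0 $ 0 = (0\<^sub>v n :: complex vec) $ 0" by simp
    then show False using r(2) by simp
  qed
  ultimately have W_all: "?W = carrier_vec n" by blast
  have "n \<le> 1"
  proof (rule ccontr)
    assume "\<not> n \<le> 1"
    then have n: "0 < n" "1 < n" by auto
    have "unit_vec n 1 \<in> ?W" unfolding W_all by simp
    then obtain a where "unit_vec n 1 = a \<cdot>\<^sub>v (unit_vec n 0 :: complex vec)" by blast
    then have "unit_vec n 1 $ 1 = (a \<cdot>\<^sub>v (unit_vec n 0 :: complex vec)) $ 1" by simp
    then show False using n by simp
  qed
  then show ?thesis using r(2) by (simp add: n_def)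
qed

section \<open>Contragredient representations, the source of the involution\<close>

definition contragredient :: "'a monoid \<Rightarrow> ('a \<Rightarrow> complex mat) \<Rightarrow> 'a \<Rightarrow> complex mat" where
  "contragredient G \<pi> = (\<lambda>g. transpose_mat (\<pi> (inv\<^bsub>G\<^esub> g)))"

context invariant_mean
begin

lemma representation_contragredient:
  assumes \<pi>: "representation G T \<pi>" "degree_rep G \<pi> = n"
  shows "representation G T (contragredient G \<pi>)" "degree_rep G (contragredient G \<pi>) = n"
proof -
  note c\<pi> = cmat_rep[OF \<pi>]
  have one: "contragredient G \<pi> \<one> = 1\<^sub>m n" using rep_one[OF \<pi>(1)] \<pi>(2) by (simp add: contragredient_def)
  have mult: "contragredient G \<pi> (g \<otimes> h) = contragredient G \<pi> g * contragredient G \<pi> h"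
    if g: "g \<in> carrier G" and h: "h \<in> carrier G" for g h
  proof -
    have i: "inv g \<in> carrier G" "inv h \<in> carrier G" using g h by auto
    show ?thesis
      unfolding contragredient_def inv_mult_group[OF g h] rep_mult[OF \<pi>(1) i(2,1)]
      by (rule transpose_mult[OF cmatD[OF c\<pi> i(2)] cmatD[OF c\<pi> i(1)]])
  qed
  have c: "contragredient G \<pi> g \<in> carrier_mat n n" if g: "g \<in> carrier G" for g
    using cmatD[OF cmat_inv[OF c\<pi>] g] by (simp add: contragredient_def)
  have cont: "contf (\<lambda>g. contragredient G \<pi> g $$ (i, j))" if "i < n" "j < n" for i j
    by (rule contf_cong[OF cmat_cont[OF cmat_inv[OF c\<pi>] that(2,1)]])
       (use carrier_matD[OF cmatD[OF cmat_inv[OF c\<pi>]]] that in \<open>auto simp: contragredient_def\<close>)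
  show "representation G T (contragredient G \<pi>)" "degree_rep G (contragredient G \<pi>) = n"
    using representationI[OF one c mult cont] by auto
qed

lemma ch_contragredient:
  assumes \<pi>: "representation G T \<pi>" and g: "g \<in> carrier G"
  shows "ch G (contragredient G \<pi>) g = ch G \<pi> (inv g)"
proof -
  have ig: "inv g \<in> carrier G" using g by simp
  have "mtrace (contragredient G \<pi> g) = mtrace (\<pi> (inv g))"
    using rep_carrier[OF \<pi> ig] by (auto simp: mtrace_def contragredient_def intro!: sum.cong)
  then show ?thesis
    using ch_eq[OF representation_contragredient(1)[OF \<pi> refl] g] ch_eq[OF \<pi> ig]
      representation_contragredient(2)[OF \<pi> refl] by simp
qed

text \<open>The annihilator of an invariant subspace of the contragredient is invariant under \<open>\<pi>\<close>.\<close>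
lemma irreducible_contragredient:
  assumes \<pi>: "irreducible_rep G T \<pi>"
  shows "irreducible_rep G T (contragredient G \<pi>)"
proof -
  define n where "n = degree_rep G \<pi>"
  note d = n_def[symmetric]
  note r = irreducible_repD[OF \<pi>, unfolded d]
  note c\<pi> = cmat_rep[OF r(1) d]
  show ?thesis
  proof (rule irreducible_repI[OF representation_contragredient[OF r(1) d] r(2)])
    fix W assume W: "linear_subspace n W"
      and inv: "\<And>g w. g \<in> carrier G \<Longrightarrow> w \<in> W \<Longrightarrow> contragredient G \<pi> g *\<^sub>v w \<in> W"
    obtain k A where A: "A \<in> carrier_mat n k" "inj_mat A" and WA: "W = (\<lambda>v. A *\<^sub>v v) ` carrier_vec k"
      by (rule linear_subspace_eq_image[OF W])
    obtain C where C: "C \<in> carrier_mat k n" "C * A = 1\<^sub>m k" by (rule inj_mat_left_inverse[OF A])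
    let ?A = "transpose_mat A"
    have At: "?A \<in> carrier_mat k n" using A by simp
    let ?V = "{v \<in> carrier_vec n. ?A *\<^sub>v v = 0\<^sub>v k}"
    have "\<pi> g *\<^sub>v v \<in> ?V" if g: "g \<in> carrier G" and v: "v \<in> ?V" for g v
    proof -
      let ?g = "inv g"
      have ig: "?g \<in> carrier G" using g by simp
      have vc: "v \<in> carrier_vec n" using v by simp
      let ?P = "contragredient G \<pi> ?g"
      have P: "?P = transpose_mat (\<pi> g)" using g by (simp add: contragredient_def)
      have Pc: "?P \<in> carrier_mat n n" unfolding P using cmatD[OF c\<pi> g] by simp
      have PA: "?P * A \<in> carrier_mat n k" by (rule mult_carrier_mat[OF Pc A(1)])
      \<comment> \<open>\<open>Y\<close> is the action of the contragredient at \<open>inv g\<close>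
        on \<open>W\<close> in the coordinates given by \<open>A\<close>. Transposing
        \<open>A * Y = ?P * A\<close> shows that \<open>\<pi> g\<close> preserves the kernel of
        \<open>?A\<close>.\<close>
      define Y where "Y = C * (?P * A)"
      have Y: "Y \<in> carrier_mat k k" unfolding Y_def by (rule mult_carrier_mat[OF C(1) PA])
      have "A * Y = ?P * A" unfolding Y_def
      proof (rule factor_through_image[OF A(1) C PA])
        fix v :: "complex vec" assume v: "v \<in> carrier_vec k"
        have "A *\<^sub>v v \<in> W" unfolding WA using v by blast
        from inv[OF ig this] show "(?P * A) *\<^sub>v v \<in> (\<lambda>v. A *\<^sub>v v) ` carrier_vec k"
          unfolding assoc_mult_mat_vec[OF Pc A(1) v] WA .
      qed
      then have "transpose_mat (A * Y) = transpose_mat (?P * A)" by simp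
      moreover have "transpose_mat ?P = \<pi> g" unfolding P by simp
      ultimately have "transpose_mat Y * ?A = ?A * \<pi> g"
        using transpose_mult[OF A(1) Y] transpose_mult[OF Pc A(1)] by simp
      then have "?A *\<^sub>v (\<pi> g *\<^sub>v v) = (transpose_mat Y * ?A) *\<^sub>v v"
        using assoc_mult_mat_vec[OF At cmatD[OF c\<pi> g] vc] by simp
      also have "\<dots> = transpose_mat Y *\<^sub>v (?A *\<^sub>v v)"
        by (rule assoc_mult_mat_vec[OF _ At vc]) (use Y in simp)
      also have "\<dots> = 0\<^sub>v k" using v Y mult_mat_zero_vec[of "transpose_mat Y" k k] by simp
      finally show ?thesis using mult_mat_vec_carrier[OF cmatD[OF c\<pi> g] vc] by simp
    qed
    from r(3)[OF linear_subspace_kernel[OF At] this] have "?V = {0\<^sub>v n} \<or> ?V = carrier_vec n" .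
    then show "W = {0\<^sub>v n} \<or> W = carrier_vec n"
    proof
      assume "?V = {0\<^sub>v n}"
      \<comment> \<open>With \<open>?A\<close> and \<open>A\<close> both injective the two
        dimensions agree, so \<open>A\<close> is square and \<open>W\<close> is everything.\<close>
      then have "inj_mat ?A" using At unfolding inj_mat_def by auto
      then have "n = k" using inj_mat_dim_le[OF At] inj_mat_dim_le[OF A] by simp
      then have AC: "A * C = 1\<^sub>m n" using mat_mult_left_right_inverse[of C n A] A C by simp
      have "v \<in> W" if v: "v \<in> carrier_vec n" for v
      proof -
        have "v = A *\<^sub>v (C *\<^sub>v v)" using assoc_mult_mat_vec[OF A(1) C(1) v] AC v by simp
        then show ?thesis unfolding WA using mult_mat_vec_carrier[OF C(1) v] by (rule image_eqI)
      qed
      then show ?thesis using W by (auto simp: linear_subspace_def)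
    next
      assume V: "?V = carrier_vec n"
      have "?A = 0\<^sub>m k n"
      proof (rule mat_eq_by_vec[OF At])
        fix v :: "complex vec" assume v: "v \<in> carrier_vec n"
        then have "?A *\<^sub>v v = 0\<^sub>v k" using V by blast
        then show "?A *\<^sub>v v = 0\<^sub>m k n *\<^sub>v v" using v by (simp add: zero_mat_mult_vec)
      qed simp
      then have "transpose_mat ?A = 0\<^sub>m n k" by simp
      then have "A = 0\<^sub>m n k" by simp
      then have "W \<subseteq> {0\<^sub>v n}" unfolding WA by (auto simp: zero_mat_mult_vec)
      then show ?thesis using W by (auto simp: linear_subspace_def)
    qed
  qed
qed

lemma ch_contragredient_fun:
  assumes "representation G T \<pi>"
  shows "ch G (contragredient G \<pi>) = restrict (\<lambda>g. ch G \<pi> (inv g)) (carrier G)"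
proof
  fix g
  show "ch G (contragredient G \<pi>) g = restrict (\<lambda>g. ch G \<pi> (inv g)) (carrier G) g"
    using ch_contragredient[OF assms] by (cases "g \<in> carrier G") (auto simp: ch_undefined)
qed

lemma contf_ch:
  assumes \<pi>: "representation G T \<pi>"
  shows "contf (ch G \<pi>)"
proof (rule contf_cong)
  show "contf (\<lambda>g. (1 / of_nat (degree_rep G \<pi>)) * (\<Sum>i<degree_rep G \<pi>. \<pi> g $$ (i, i)))"
    by (intro continuous_map_scale continuous_map_sum rep_cont[OF \<pi>]) auto
  fix g assume g: "g \<in> carrier G"
  show "(1 / of_nat (degree_rep G \<pi>)) * (\<Sum>i<degree_rep G \<pi>. \<pi> g $$ (i, i)) = ch G \<pi> g"
    using rep_carrier[OF \<pi> g] by (simp add: ch_eq[OF \<pi> g] mtrace_def)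
qed

lemma dual_pointsE:
  assumes "z \<in> dual_points G T s"
  obtains \<pi> where "irreducible_rep G T \<pi>" "z = (ch G \<pi>, s)"
  using assms by (auto simp: dual_points_def)

text \<open>The decomposition picked by \<open>SOME\<close> is arbitrary, but total mass and
  represented function involve only degrees and traces, which add up over any decomposition.\<close>

lemma
  assumes \<sigma>: "representation G T \<sigma>" and pos: "0 < degree_rep G \<sigma>"
  shows fin_prob_ch_measure: "fin_prob_measure (dual_points G T s) (ch_measure G T \<sigma> s)"
    and integ_ch_measure: "g \<in> carrier G \<Longrightarrow> integ (ch_measure G T \<sigma> s) (\<lambda>z. fst z g) = ch G \<sigma> g"
proof -
  define \<rho>s where "\<rho>s = (SOME \<rho>s. irreducible_decomposition G T \<sigma> \<rho>s)"
  have dec: "irreducible_decomposition G T \<sigma> \<rho>s"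
    unfolding \<rho>s_def using irreducible_decomposition_exists[OF \<sigma>] by (rule someI_ex)
  have irr: "irreducible_rep G T \<rho>" if "\<rho> \<in> set \<rho>s" for \<rho>
    using dec that by (simp add: irreducible_decomposition_def)
  let ?c = "\<lambda>\<rho>. real (degree_rep G \<rho>) / real (degree_rep G \<sigma>)" and ?k = "\<lambda>\<rho>. (ch G \<rho>, s)"
  define p where "p = ch_measure G T \<sigma> s"
  have p: "p = (\<lambda>z. \<Sum>\<rho>\<leftarrow>\<rho>s. ?c \<rho> * dirac (?k \<rho>) z)" by (simp add: p_def ch_measure_def \<rho>s_def)
  have supp: "{z. p z \<noteq> 0} \<subseteq> ?k ` set \<rho>s" unfolding p by (rule list_measure_support)
  have "complex_of_real (\<Sum>z | p z \<noteq> 0. p z) = integ p (\<lambda>z. 1)" by (simp add: integ_def)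
  also have "\<dots> = (\<Sum>\<rho>\<leftarrow>\<rho>s. complex_of_real (?c \<rho>))" unfolding p integ_list_measure by simp
  also have "\<dots> = of_nat (\<Sum>\<rho>\<leftarrow>\<rho>s. degree_rep G \<rho>) / of_nat (degree_rep G \<sigma>)"
    by (induction \<rho>s) (auto simp: add_divide_distrib)
  also have "\<dots> = 1" using pos by (simp add: decomposition_degree[OF \<sigma> one_closed dec, symmetric])
  finally have sum: "(\<Sum>z | p z \<noteq> 0. p z) = 1" by (simp only: of_real_eq_1_iff)
  have "0 \<le> p z" for z unfolding p by (intro sum_list_nonneg) (auto simp: dirac_def)
  moreover have "finite {z. p z \<noteq> 0}" using supp by (rule finite_subset) simp
  moreover have "{z. p z \<noteq> 0} \<subseteq> dual_points G T s" using supp irr by (auto simp: dual_points_def)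
  ultimately show "fin_prob_measure (dual_points G T s) (ch_measure G T \<sigma> s)"
    using sum unfolding fin_prob_measure_def p_def[symmetric] by blast
  assume g: "g \<in> carrier G"
  have "integ p (\<lambda>z. fst z g) = (\<Sum>\<rho>\<leftarrow>\<rho>s. complex_of_real (?c \<rho>) * ch G \<rho> g)"
    unfolding p integ_list_measure by simp
  also have "\<dots> = (\<Sum>\<rho>\<leftarrow>\<rho>s. mtrace (\<rho> g) / of_nat (degree_rep G \<sigma>))"
  proof (rule arg_cong[of _ _ sum_list], rule map_cong[OF refl])
    fix \<rho> assume "\<rho> \<in> set \<rho>s"
    note i = irreducible_repD[OF irr[OF this]]
    show "complex_of_real (?c \<rho>) * ch G \<rho> g = mtrace (\<rho> g) / of_nat (degree_rep G \<sigma>)"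
      using i(2) by (simp add: ch_eq[OF i(1) g])
  qed
  also have "\<dots> = (\<Sum>\<rho>\<leftarrow>\<rho>s. mtrace (\<rho> g)) / of_nat (degree_rep G \<sigma>)"
    by (induction \<rho>s) (auto simp: add_divide_distrib)
  also have "\<dots> = ch G \<sigma> g" unfolding ch_eq[OF \<sigma> g] decomposition_mtrace[OF \<sigma> one_closed dec g] ..
  finally show "integ (ch_measure G T \<sigma> s) (\<lambda>z. fst z g) = ch G \<sigma> g" by (simp add: p_def)
qed

text \<open>Orthogonality leaves a single term, so the mass at a point is a generalized Fourier
  coefficient of the represented function. All points carry the same tag \<open>s\<close>, hence are
  told apart by their characters.\<close>

lemma mean_integ:
  assumes p: "finite {z. p z \<noteq> 0}" "{z. p z \<noteq> 0} \<subseteq> dual_points G T s" and \<pi>: "irreducible_rep G T \<pi>"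
  shows "M (\<lambda>x. ch G \<pi> (inv x) * integ p (\<lambda>z. fst z x)) =
    of_real (p (ch G \<pi>, s)) * M (\<lambda>x. ch G \<pi> (inv x) * ch G \<pi> x)"
proof -
  note c\<pi> = contf_compose[OF continuous_inv contf_ch[OF irreducible_repD(1)[OF \<pi>]]]
  have c: "contf (\<lambda>x. ch G \<pi> (inv x) * fst z x)" if "p z \<noteq> 0" for z
  proof -
    have "z \<in> dual_points G T s" using p(2) that by blast
    then obtain \<rho> where "irreducible_rep G T \<rho>" "z = (ch G \<rho>, s)" by (rule dual_pointsE)
    then show ?thesis using continuous_map_mult[OF c\<pi> contf_ch[OF irreducible_repD(1)]] by simp
  qed
  have "M (\<lambda>x. ch G \<pi> (inv x) * integ p (\<lambda>z. fst z x)) =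
      M (\<lambda>x. \<Sum>z | p z \<noteq> 0. of_real (p z) * (ch G \<pi> (inv x) * fst z x))"
    by (simp add: integ_def sum_distrib_left mult_ac)
  also have "\<dots> = (\<Sum>z | p z \<noteq> 0. M (\<lambda>x. of_real (p z) * (ch G \<pi> (inv x) * fst z x)))"
    by (rule M_sum[OF p(1)]) (use c in \<open>auto intro: continuous_map_scale\<close>)
  also have "\<dots> = (\<Sum>z | p z \<noteq> 0. of_real (p z) * M (\<lambda>x. ch G \<pi> (inv x) * fst z x))"
    by (rule sum.cong) (use c in \<open>auto intro!: M_scale\<close>)
  also have "\<dots> = (\<Sum>z | p z \<noteq> 0. if z = (ch G \<pi>, s) then of_real (p z) * M (\<lambda>x. ch G \<pi> (inv x) * ch G \<pi> x) else 0)"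
  proof (rule sum.cong)
    fix z assume "z \<in> {z. p z \<noteq> 0}"
    then have "z \<in> dual_points G T s" using p(2) by blast
    then obtain \<rho> where "irreducible_rep G T \<rho>" "z = (ch G \<rho>, s)" by (rule dual_pointsE)
    then show "of_real (p z) * M (\<lambda>x. ch G \<pi> (inv x) * fst z x) =
        (if z = (ch G \<pi>, s) then of_real (p z) * M (\<lambda>x. ch G \<pi> (inv x) * ch G \<pi> x) else 0)"
      using ch_orthogonal[OF \<pi>] by auto
  qed simp
  also have "\<dots> = of_real (p (ch G \<pi>, s)) * M (\<lambda>x. ch G \<pi> (inv x) * ch G \<pi> x)"
    using p(1) by (simp add: sum.delta)
  finally show ?thesis .
qed

lemma measure_eqI:
  assumes p: "finite {z. p z \<noteq> 0}" "{z. p z \<noteq> 0} \<subseteq> dual_points G T s"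
    and q: "finite {z. q z \<noteq> 0}" "{z. q z \<noteq> 0} \<subseteq> dual_points G T s"
    and eq: "\<And>g. g \<in> carrier G \<Longrightarrow> integ p (\<lambda>z. fst z g) = integ q (\<lambda>z. fst z g)"
  shows "p = q"
proof
  fix z
  show "p z = q z"
  proof (cases "z \<in> dual_points G T s")
    case True
    then obtain \<pi> where \<pi>: "irreducible_rep G T \<pi>" "z = (ch G \<pi>, s)" by (rule dual_pointsE)
    note c\<pi> = contf_compose[OF continuous_inv contf_ch[OF irreducible_repD(1)[OF \<pi>(1)]]]
    have "contf (\<lambda>x. integ q (\<lambda>z. fst z x))"
      unfolding integ_def
    proof (intro continuous_map_sum[OF q(1)] continuous_map_scale)
      fix w assume "w \<in> {z. q z \<noteq> 0}"
      then have "w \<in> dual_points G T s" using q(2) by blast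
      then obtain \<rho> where "irreducible_rep G T \<rho>" "w = (ch G \<rho>, s)" by (rule dual_pointsE)
      then show "contf (\<lambda>x. fst w x)" using contf_ch[OF irreducible_repD(1)] by simp
    qed
    then have "M (\<lambda>x. ch G \<pi> (inv x) * integ p (\<lambda>z. fst z x)) = M (\<lambda>x. ch G \<pi> (inv x) * integ q (\<lambda>z. fst z x))"
      using c\<pi> by (intro M_cong continuous_map_mult) (simp_all add: eq)
    then show ?thesis unfolding mean_integ[OF p \<pi>(1)] mean_integ[OF q \<pi>(1)] using ch_norm[OF \<pi>(1)] \<pi>(2) by simp
  next
    case False
    then have "p z = 0" "q z = 0" using p(2) q(2) by blast+
    then show ?thesis by simp
  qed
qed

lemma rep_of_spec:
  assumes "(f, s) \<in> dual_points G T s"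
  shows "irreducible_rep G T (rep_of G T f)" "ch G (rep_of G T f) = f"
proof -
  have "\<exists>\<pi>. irreducible_rep G T \<pi> \<and> ch G \<pi> = f" using assms by (auto simp: dual_points_def)
  from someI_ex[OF this] show "irreducible_rep G T (rep_of G T f)" "ch G (rep_of G T f) = f"
    unfolding rep_of_def by auto
qed

end

section \<open>Convolutions of measures\<close>

no_notation Infinite_Set_Sum.abs_summable_on (infix \<open>abs'_summable'_on\<close> 50)

lemma infsum_finite_support:
  fixes f :: "'k \<Rightarrow> complex"
  assumes "finite S" "S \<subseteq> A" "\<And>x. x \<in> A - S \<Longrightarrow> f x = 0"
  shows "infsum f A = sum f S"
proof -
  have "infsum f A = infsum f S" by (rule infsum_cong_neutral) (use assms in auto)
  then show ?thesis using assms(1) by simp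
qed

lemma convolution_finite:
  assumes S: "finite S" "S \<subseteq> K" "\<And>x. x \<notin> S \<Longrightarrow> \<mu> x = 0"
    and S': "finite S'" "S' \<subseteq> K" "\<And>x. x \<notin> S' \<Longrightarrow> \<nu> x = 0"
  shows "convolution K c \<mu> \<nu> z = (\<Sum>x\<in>S. \<Sum>y\<in>S'. \<mu> x * \<nu> y * of_real (c x y z))"
proof -
  have "convolution K c \<mu> \<nu> z = (\<Sum>(x, y)\<in>S \<times> S'. \<mu> x * \<nu> y * complex_of_real (c x y z))"
    unfolding convolution_def
  proof (rule infsum_finite_support)
    fix p assume "p \<in> K \<times> K - S \<times> S'"
    then have "\<mu> (fst p) = 0 \<or> \<nu> (snd p) = 0" using S(3) S'(3) by (cases p) auto
    then show "(case p of (x, y) \<Rightarrow> \<mu> x * \<nu> y * complex_of_real (c x y z)) = 0" by (auto simp: case_prod_unfold)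
  qed (use S S' in auto)
  then show ?thesis by (simp add: sum.cartesian_product)
qed

definition cdirac :: "'k \<Rightarrow> 'k \<Rightarrow> complex" where
  "cdirac x = (\<lambda>z. if z = x then 1 else 0)"

lemma cdirac_bounded_measure: "x \<in> K \<Longrightarrow> cdirac x \<in> bounded_measures K"
proof -
  assume x: "x \<in> K"
  have "(\<lambda>z. norm (cdirac x z)) summable_on K \<longleftrightarrow> (\<lambda>z. norm (cdirac x z)) summable_on {x}"
    by (rule summable_on_cong_neutral) (use x in \<open>auto simp: cdirac_def\<close>)
  then show ?thesis using x by (auto simp: bounded_measures_def cdirac_def)
qed

lemma fin_prob_measureD:
  assumes "fin_prob_measure K p"
  shows "finite {z. p z \<noteq> 0}" "{z. p z \<noteq> 0} \<subseteq> K" "0 \<le> p z" "(\<Sum>z | p z \<noteq> 0. p z) = 1"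
  using assms by (auto simp: fin_prob_measure_def)

text \<open>Associativity applied to three Dirac measures, read off as the mass at \<open>v\<close>;
  the sums over all of \<open>K\<close> reduce to the finite supports.\<close>

lemma hypergroup_assoc_points:
  assumes h: "hypergroup K c" and K: "x \<in> K" "y \<in> K" "z \<in> K"
  shows "integ (c x y) (\<lambda>w. of_real (c w z v)) = integ (c y z) (\<lambda>w. of_real (c x w v))"
proof -
  have fin: "fin_prob_measure K (c x y)" if "x \<in> K" "y \<in> K" for x y using h that by (simp add: hypergroup_def)
  have dd: "convolution K c (cdirac x) (cdirac y) = (\<lambda>w. of_real (c x y w))" if "x \<in> K" "y \<in> K" for x y
  proof
    fix w
    show "convolution K c (cdirac x) (cdirac y) w = of_real (c x y w)"
      using convolution_finite[of "{x}" K "cdirac x" "{y}" "cdirac y" c w] that by (auto simp: cdirac_def)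
  qed
  have "convolution K c (convolution K c (cdirac x) (cdirac y)) (cdirac z) =
      convolution K c (cdirac x) (convolution K c (cdirac y) (cdirac z))"
    using h cdirac_bounded_measure[OF K(1)] cdirac_bounded_measure[OF K(2)] cdirac_bounded_measure[OF K(3)]
    unfolding hypergroup_def by blast
  then have eq: "convolution K c (\<lambda>w. of_real (c x y w)) (cdirac z) v = convolution K c (cdirac x) (\<lambda>w. of_real (c y z w)) v"
    unfolding dd[OF K(1,2)] dd[OF K(2,3)] by simp
  have "convolution K c (\<lambda>w. of_real (c x y w)) (cdirac z) v = integ (c x y) (\<lambda>w. of_real (c w z v))"
    using convolution_finite[of "{w. c x y w \<noteq> 0}" K "\<lambda>w. of_real (c x y w)" "{z}" "cdirac z" c v]
      fin_prob_measureD(1,2)[OF fin[OF K(1,2)]] K(3) by (auto simp: cdirac_def integ_def)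
  moreover have "convolution K c (cdirac x) (\<lambda>w. of_real (c y z w)) v = integ (c y z) (\<lambda>w. of_real (c x w v))"
    using convolution_finite[of "{x}" K "cdirac x" "{w. c y z w \<noteq> 0}" "\<lambda>w. of_real (c y z w)" c v]
      fin_prob_measureD(1,2)[OF fin[OF K(2,3)]] K(1) by (auto simp: cdirac_def integ_def)
  ultimately show ?thesis using eq by simp
qed

lemma abs_summable_times:
  fixes f :: "'k \<Rightarrow> complex" and g :: "'l \<Rightarrow> complex"
  assumes f: "f abs_summable_on A" and g: "g abs_summable_on B"
  shows "(\<lambda>(x, y). f x * g y) abs_summable_on A \<times> B"
  unfolding Infinite_Sum.abs_summable_on_Sigma_iff
proof (intro conjI ballI)
  fix x assume "x \<in> A"
  show "(\<lambda>y. case (x, y) of (x, y) \<Rightarrow> f x * g y) abs_summable_on B"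
    using summable_on_cmult_right[OF g, of "norm (f x)"] by (simp add: norm_mult)
next
  have "(\<lambda>x. norm (f x) * infsum (\<lambda>y. norm (g y)) B) summable_on A"
    by (rule summable_on_cmult_left[OF f])
  then show "(\<lambda>x. \<Sum>\<^sub>\<infinity>y\<in>B. norm (case (x, y) of (x, y) \<Rightarrow> f x * g y)) abs_summable_on A"
    by (simp add: norm_mult infsum_cmult_right' abs_mult infsum_nonneg)
qed

text \<open>For each \<open>t\<close> the masses \<open>k t w\<close> sum to 1 over
  \<open>w\<close>, so the majorant \<open>a t * k t w\<close> has the same total norm as
  \<open>a\<close>. In the use below \<open>t\<close> is a triple of points, \<open>w\<close> an
  intermediate point of their product and \<open>b t w\<close> the mass passed on from it.\<close>

lemma abs_summable_kernel:
  fixes a :: "'t \<Rightarrow> complex" and k :: "'t \<Rightarrow> 'k \<Rightarrow> real" and b :: "'t \<Rightarrow> 'k \<Rightarrow> real"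
  assumes a: "a abs_summable_on I" and k: "\<And>t. t \<in> I \<Longrightarrow> fin_prob_measure K (k t)"
    and b: "\<And>t w. t \<in> I \<Longrightarrow> w \<in> K \<Longrightarrow> \<bar>b t w\<bar> \<le> 1"
  shows "(\<lambda>(t, w). a t * of_real (k t w * b t w)) abs_summable_on I \<times> K"
proof (rule Infinite_Sum.abs_summable_on_comparison_test)
  have inner: "(\<Sum>\<^sub>\<infinity>w\<in>K. norm (a t * of_real (k t w))) = norm (a t)"
    and inner': "(\<lambda>w. norm (a t * of_real (k t w))) summable_on K" if t: "t \<in> I" for t
  proof -
    note f = fin_prob_measureD[OF k[OF t]]
    have eq: "norm (a t * of_real (k t w)) = norm (a t) * k t w" for w using f(3) by (simp add: norm_mult)
    have "(\<lambda>w. norm (a t) * k t w) summable_on K \<longleftrightarrow> (\<lambda>w. norm (a t) * k t w) summable_on {w. k t w \<noteq> 0}"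
      by (rule summable_on_cong_neutral) (use f(2) in auto)
    then show "(\<lambda>w. norm (a t * of_real (k t w))) summable_on K" unfolding eq using f(1) by simp
    have "(\<Sum>\<^sub>\<infinity>w\<in>K. norm (a t) * k t w) = (\<Sum>\<^sub>\<infinity>w\<in>{w. k t w \<noteq> 0}. norm (a t) * k t w)"
      by (rule infsum_cong_neutral) (use f(2) in auto)
    also have "\<dots> = norm (a t)" using f(1,4) by (simp add: sum_distrib_left[symmetric])
    finally show "(\<Sum>\<^sub>\<infinity>w\<in>K. norm (a t * of_real (k t w))) = norm (a t)" unfolding eq .
  qed
  show "(\<lambda>(t, w). a t * of_real (k t w)) abs_summable_on I \<times> K"
    unfolding Infinite_Sum.abs_summable_on_Sigma_iff
  proof (intro conjI ballI)
    fix t assume "t \<in> I"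
    then show "(\<lambda>w. case (t, w) of (t, w) \<Rightarrow> a t * of_real (k t w)) abs_summable_on K" using inner' by simp
  next
    have "(\<lambda>t. \<Sum>\<^sub>\<infinity>w\<in>K. norm (case (t, w) of (t, w) \<Rightarrow> a t * of_real (k t w))) abs_summable_on I \<longleftrightarrow>
        (\<lambda>t. norm (a t)) abs_summable_on I"
      by (rule summable_on_cong) (use inner in simp)
    then show "(\<lambda>t. \<Sum>\<^sub>\<infinity>w\<in>K. norm (case (t, w) of (t, w) \<Rightarrow> a t * of_real (k t w))) abs_summable_on I"
      using a by simp
  qed
  fix p assume "p \<in> I \<times> K"
  then obtain t w where p: "p = (t, w)" "t \<in> I" "w \<in> K" by blast
  have "\<bar>k t w\<bar> * \<bar>b t w\<bar> \<le> \<bar>k t w\<bar> * 1" using b[OF p(2,3)] by (intro mult_left_mono) auto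
  then show "norm (case p of (t, w) \<Rightarrow> a t * of_real (k t w * b t w)) \<le> norm (case p of (t, w) \<Rightarrow> a t * of_real (k t w))"
    unfolding p by (simp add: norm_mult abs_mult mult_left_mono)
qed

text \<open>Absolute summability allows passing to an unordered sum over the product set and, along
  the bijection \<open>h\<close>, back to a differently grouped iterated sum.\<close>

lemma iterated_infsum_reindex:
  fixes F :: "'t \<times> 'k \<Rightarrow> complex"
  assumes F: "F abs_summable_on I \<times> K" and h: "bij_betw h (I \<times> K) (P \<times> Q)"
    and eq: "\<And>p. p \<in> I \<times> K \<Longrightarrow> \<Psi> (h p) = F p"
  shows "(\<Sum>\<^sub>\<infinity>u\<in>P. \<Sum>\<^sub>\<infinity>v\<in>Q. \<Psi> (u, v)) = (\<Sum>\<^sub>\<infinity>t\<in>I. \<Sum>\<^sub>\<infinity>w\<in>K. F (t, w))"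
proof -
  have s: "F summable_on I \<times> K" using F by (rule abs_summable_summable)
  then have "(\<lambda>p. \<Psi> (h p)) summable_on I \<times> K" using eq summable_on_cong by (metis (no_types, lifting))
  then have "\<Psi> summable_on P \<times> Q" using summable_on_reindex_bij_betw[OF h] by blast
  then have "(\<Sum>\<^sub>\<infinity>u\<in>P. \<Sum>\<^sub>\<infinity>v\<in>Q. \<Psi> (u, v)) = infsum \<Psi> (P \<times> Q)" by (rule infsum_Sigma_banach)
  also have "\<dots> = infsum (\<lambda>p. \<Psi> (h p)) (I \<times> K)" by (rule infsum_reindex_bij_betw[OF h, symmetric])
  also have "\<dots> = infsum F (I \<times> K)" by (rule infsum_cong) (rule eq)
  also have "\<dots> = (\<Sum>\<^sub>\<infinity>t\<in>I. \<Sum>\<^sub>\<infinity>w\<in>K. F (t, w))" by (rule infsum_Sigma_banach[OF s, symmetric])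
  finally show ?thesis .
qed

lemma fin_prob_le_one:
  assumes "fin_prob_measure K p"
  shows "\<bar>p z\<bar> \<le> 1"
proof (cases "p z = 0")
  case False
  then have "p z \<le> (\<Sum>z | p z \<noteq> 0. p z)"
    using fin_prob_measureD[OF assms] by (intro member_le_sum) auto
  then show ?thesis using fin_prob_measureD[OF assms] by simp
qed simp

text \<open>Both sides are rewritten as absolutely convergent sums over the triples \<open>(x, y, z)\<close> and the
  intermediate point \<open>w\<close>.\<close>
lemma convolution_assoc:
  assumes fin: "\<And>x y. x \<in> K \<Longrightarrow> y \<in> K \<Longrightarrow> fin_prob_measure K (c x y)"
    and assoc: "\<And>x y z v. x \<in> K \<Longrightarrow> y \<in> K \<Longrightarrow> z \<in> K \<Longrightarrow>
      integ (c x y) (\<lambda>w. of_real (c w z v)) = integ (c y z) (\<lambda>w. of_real (c x w v))"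
    and \<mu>: "\<mu> \<in> bounded_measures K" and \<nu>: "\<nu> \<in> bounded_measures K" and \<rho>: "\<rho> \<in> bounded_measures K"
  shows "convolution K c (convolution K c \<mu> \<nu>) \<rho> = convolution K c \<mu> (convolution K c \<nu> \<rho>)"
proof
  fix v
  let ?I = "K \<times> (K \<times> K)"
  let ?a = "\<lambda>(x, y, z). \<mu> x * (\<nu> y * \<rho> z)"
  have sum: "\<mu> abs_summable_on K" "\<nu> abs_summable_on K" "\<rho> abs_summable_on K"
    using \<mu> \<nu> \<rho> by (auto simp: bounded_measures_def)
  have a: "?a abs_summable_on ?I"
    using abs_summable_times[OF sum(1) abs_summable_times[OF sum(2,3)]] by (simp add: case_prod_unfold)
  have integ_inf: "(\<Sum>\<^sub>\<infinity>w\<in>K. of_real (p w * f w)) = integ p (\<lambda>w. of_real (f w))"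
    if "fin_prob_measure K p" for p f
    unfolding integ_def using fin_prob_measureD[OF that]
    by (subst infsum_finite_support[of "{w. p w \<noteq> 0}"]) auto
  let ?k1 = "\<lambda>(x, y, z). c x y" and ?b1 = "\<lambda>(x, y, z). \<lambda>w. c w z v"
  let ?F1 = "\<lambda>(t, w). ?a t * of_real (?k1 t w * ?b1 t w)"
  have F1: "?F1 abs_summable_on ?I \<times> K"
    by (rule abs_summable_kernel[OF a]) (auto intro: fin fin_prob_le_one)
  let ?k2 = "\<lambda>(x, y, z). c y z" and ?b2 = "\<lambda>(x, y, z). \<lambda>w. c x w v"
  let ?F2 = "\<lambda>(t, w). ?a t * of_real (?k2 t w * ?b2 t w)"
  have F2: "?F2 abs_summable_on ?I \<times> K"
    by (rule abs_summable_kernel[OF a]) (auto intro: fin fin_prob_le_one)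
  \<comment> \<open>The grouping of variables in which each side comes out of
    \<open>convolution\<close>: the first pair belongs to the outer convolution, the second to the
    inner one.\<close>
  let ?\<Psi>1 = "\<lambda>((w, z), (x, y)). \<mu> x * \<nu> y * of_real (c x y w) * (\<rho> z * of_real (c w z v))"
  let ?\<Psi>2 = "\<lambda>((x, w), (y, z)). \<nu> y * \<rho> z * of_real (c y z w) * (\<mu> x * of_real (c x w v))"
  have "convolution K c (convolution K c \<mu> \<nu>) \<rho> v = (\<Sum>\<^sub>\<infinity>u\<in>K \<times> K. \<Sum>\<^sub>\<infinity>p\<in>K \<times> K. ?\<Psi>1 (u, p))"
    unfolding convolution_def
    by (rule infsum_cong) (simp add: case_prod_unfold infsum_cmult_left'[symmetric] mult.assoc)
  also have "\<dots> = (\<Sum>\<^sub>\<infinity>t\<in>?I. \<Sum>\<^sub>\<infinity>w\<in>K. ?F1 (t, w))"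
    by (rule iterated_infsum_reindex[OF F1, where h = "\<lambda>((x, y, z), w). ((w, z), (x, y))"])
       (auto intro!: bij_betwI[where g = "\<lambda>((w, z), (x, y)). ((x, y, z), w)"])
  also have "\<dots> = (\<Sum>\<^sub>\<infinity>t\<in>?I. \<Sum>\<^sub>\<infinity>w\<in>K. ?F2 (t, w))"
  proof (rule infsum_cong)
    fix t assume "t \<in> ?I"
    then obtain x y z where t: "t = (x, y, z)" "x \<in> K" "y \<in> K" "z \<in> K" by auto
    show "(\<Sum>\<^sub>\<infinity>w\<in>K. ?F1 (t, w)) = (\<Sum>\<^sub>\<infinity>w\<in>K. ?F2 (t, w))"
      unfolding t(1) prod.case infsum_cmult_right' integ_inf[OF fin[OF t(2,3)]] integ_inf[OF fin[OF t(3,4)]]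
        assoc[OF t(2-4)] ..
  qed
  also have "\<dots> = (\<Sum>\<^sub>\<infinity>u\<in>K \<times> K. \<Sum>\<^sub>\<infinity>p\<in>K \<times> K. ?\<Psi>2 (u, p))"
    by (rule iterated_infsum_reindex[OF F2, where h = "\<lambda>((x, y, z), w). ((x, w), (y, z))", symmetric])
       (auto intro!: bij_betwI[where g = "\<lambda>((x, w), (y, z)). ((x, y, z), w)"])
  also have "\<dots> = convolution K c \<mu> (convolution K c \<nu> \<rho>) v"
    unfolding convolution_def
    by (rule infsum_cong) (simp only: case_prod_unfold fst_conv snd_conv infsum_cmult_left', simp only: mult_ac)
  finally show "convolution K c (convolution K c \<mu> \<nu>) \<rho> v = convolution K c \<mu> (convolution K c \<nu> \<rho>) v" .
qed

lemma push_forward_involution: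
  assumes "\<And>x. x \<in> K \<Longrightarrow> \<iota> x \<in> K \<and> \<iota> (\<iota> x) = x"
  shows "push_forward K \<iota> p z = (if z \<in> K then p (\<iota> z) else 0)"
proof -
  have "{w \<in> K. \<iota> w = z} = (if z \<in> K then {\<iota> z} else {})" using assms by auto
  then show ?thesis by (simp add: push_forward_def)
qed

section \<open>The semidirect product\<close>

lemma continuous_map_prod_discrete:
  "continuous_map (prod_topology X (discrete_topology A)) Y f \<longleftrightarrow> (\<forall>a\<in>A. continuous_map X Y (\<lambda>x. f (x, a)))"
proof
  assume f: "continuous_map (prod_topology X (discrete_topology A)) Y f"
  show "\<forall>a\<in>A. continuous_map X Y (\<lambda>x. f (x, a))"
  proof
    fix a assume "a \<in> A"
    then have "continuous_map X (prod_topology X (discrete_topology A)) (\<lambda>x. (x, a))"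
      by (auto intro!: continuous_map_pairedI)
    from continuous_map_compose[OF this f] show "continuous_map X Y (\<lambda>x. f (x, a))" by (simp add: o_def)
  qed
next
  assume f: "\<forall>a\<in>A. continuous_map X Y (\<lambda>x. f (x, a))"
  show "continuous_map (prod_topology X (discrete_topology A)) Y f"
    unfolding continuous_map_def
  proof (intro conjI allI impI)
    show "f \<in> topspace (prod_topology X (discrete_topology A)) \<rightarrow> topspace Y"
      using f by (auto simp: continuous_map_def)
    fix U assume U: "openin Y U"
    have "{p \<in> topspace (prod_topology X (discrete_topology A)). f p \<in> U} =
        (\<Union>a\<in>A. {x \<in> topspace X. f (x, a) \<in> U} \<times> {a})" by auto
    moreover have "openin (prod_topology X (discrete_topology A)) ({x \<in> topspace X. f (x, a) \<in> U} \<times> {a})"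
      if "a \<in> A" for a
      using f U that by (auto simp: openin_prod_Times_iff continuous_map_def)
    ultimately show "openin (prod_topology X (discrete_topology A))
        {p \<in> topspace (prod_topology X (discrete_topology A)). f p \<in> U}" by auto
  qed
qed

locale semidirect_action =
  fixes H :: "'h monoid" and T :: "'h topology" and G0 :: "'g monoid" and \<alpha> :: "'g \<Rightarrow> 'h \<Rightarrow> 'h"
  assumes compact_group_H: "compact_group H T" and comm_group_H: "comm_group H"
    and group_G0: "group G0" and finite_G0: "finite (carrier G0)"
    and action: "acts_by_continuous_automorphisms G0 H T \<alpha>"
begin

sublocale H: compact_abelian H T
  by (rule compact_abelian.intro[OF compact_group_H comm_group_H])

sublocale G0: group G0 by (rule group_G0)

abbreviation G :: "('h \<times> 'g) monoid" where "G \<equiv> semidirect H G0 \<alpha>"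
abbreviation TG :: "('h \<times> 'g) topology" where "TG \<equiv> semidirect_topology T G0"
abbreviation N :: "('h \<times> 'g) set" where "N \<equiv> semidirect_normal H G0"
abbreviation L :: "('h \<times> 'g) monoid" where "L \<equiv> subgroup_monoid G N"
abbreviation S :: "('h \<times> 'g) topology" where "S \<equiv> subtopology TG N"

lemma \<alpha>_auto: "g \<in> carrier G0 \<Longrightarrow> \<alpha> g \<in> auto H"
proof -
  assume g: "g \<in> carrier G0"
  have "\<alpha> \<in> hom G0 (AutoGroup H)"
    using action by (simp add: acts_by_continuous_automorphisms_def group_hom_def group_hom_axioms_def)
  then show ?thesis using g by (auto simp: hom_def AutoGroup_def)
qed

lemma \<alpha>_closed: "g \<in> carrier G0 \<Longrightarrow> h \<in> carrier H \<Longrightarrow> \<alpha> g h \<in> carrier H"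
  using \<alpha>_auto by (auto simp: auto_def hom_def)

lemma \<alpha>_mult: "g \<in> carrier G0 \<Longrightarrow> h \<in> carrier H \<Longrightarrow> k \<in> carrier H \<Longrightarrow>
    \<alpha> g (h \<otimes>\<^bsub>H\<^esub> k) = \<alpha> g h \<otimes>\<^bsub>H\<^esub> \<alpha> g k"
  using \<alpha>_auto by (auto simp: auto_def hom_def)

lemma \<alpha>_comp: "g \<in> carrier G0 \<Longrightarrow> g' \<in> carrier G0 \<Longrightarrow> h \<in> carrier H \<Longrightarrow> \<alpha> (g \<otimes>\<^bsub>G0\<^esub> g') h = \<alpha> g (\<alpha> g' h)"
proof -
  assume g: "g \<in> carrier G0" "g' \<in> carrier G0" and h: "h \<in> carrier H"
  have "\<alpha> \<in> hom G0 (AutoGroup H)"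
    using action by (simp add: acts_by_continuous_automorphisms_def group_hom_def group_hom_axioms_def)
  then have "\<alpha> (g \<otimes>\<^bsub>G0\<^esub> g') = \<alpha> g \<otimes>\<^bsub>AutoGroup H\<^esub> \<alpha> g'" using g by (simp add: hom_mult)
  then show ?thesis using \<alpha>_auto[OF g(1)] \<alpha>_auto[OF g(2)] h
    by (simp add: AutoGroup_def BijGroup_def auto_def compose_def)
qed

lemma \<alpha>_one: "h \<in> carrier H \<Longrightarrow> \<alpha> \<one>\<^bsub>G0\<^esub> h = h"
proof -
  assume h: "h \<in> carrier H"
  have "group_hom G0 (AutoGroup H) \<alpha>" using action by (simp add: acts_by_continuous_automorphisms_def)
  from group_hom.hom_one[OF this] show ?thesis using h by (simp add: AutoGroup_def BijGroup_def)
qed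

lemma \<alpha>_cont: "g \<in> carrier G0 \<Longrightarrow> continuous_map T T (\<alpha> g)"
  using action by (simp add: acts_by_continuous_automorphisms_def)

lemma \<alpha>_inv: "g \<in> carrier G0 \<Longrightarrow> h \<in> carrier H \<Longrightarrow> \<alpha> g (\<alpha> (inv\<^bsub>G0\<^esub> g) h) = h"
    "g \<in> carrier G0 \<Longrightarrow> h \<in> carrier H \<Longrightarrow> \<alpha> (inv\<^bsub>G0\<^esub> g) (\<alpha> g h) = h"
  by (simp_all add: \<alpha>_comp[symmetric] \<alpha>_one)

lemma \<alpha>_H_one: "g \<in> carrier G0 \<Longrightarrow> \<alpha> g \<one>\<^bsub>H\<^esub> = \<one>\<^bsub>H\<^esub>"
  using \<alpha>_mult[of g "\<one>\<^bsub>H\<^esub>" "\<one>\<^bsub>H\<^esub>"] \<alpha>_closed[of g "\<one>\<^bsub>H\<^esub>"] by simp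

lemma carrier_G: "carrier G = carrier H \<times> carrier G0"
  and mult_G: "(h, g) \<otimes>\<^bsub>G\<^esub> (k, l) = (h \<otimes>\<^bsub>H\<^esub> \<alpha> g k, g \<otimes>\<^bsub>G0\<^esub> l)"
  and one_G: "\<one>\<^bsub>G\<^esub> = (\<one>\<^bsub>H\<^esub>, \<one>\<^bsub>G0\<^esub>)"
  by (simp_all add: semidirect_def)

lemma N_eq: "N = carrier H \<times> {\<one>\<^bsub>G0\<^esub>}"
  by (simp add: semidirect_normal_def)

sublocale G: group G
proof (rule groupI)
  fix x y z assume "x \<in> carrier G" "y \<in> carrier G" "z \<in> carrier G"
  then show "x \<otimes>\<^bsub>G\<^esub> y \<otimes>\<^bsub>G\<^esub> z = x \<otimes>\<^bsub>G\<^esub> (y \<otimes>\<^bsub>G\<^esub> z)"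
    by (auto simp: carrier_G mult_G \<alpha>_mult \<alpha>_comp \<alpha>_closed H.m_assoc G0.m_assoc)
next
  fix x assume "x \<in> carrier G"
  then obtain h g where x: "x = (h, g)" "h \<in> carrier H" "g \<in> carrier G0" by (auto simp: carrier_G)
  have "(\<alpha> (inv\<^bsub>G0\<^esub> g) (inv\<^bsub>H\<^esub> h), inv\<^bsub>G0\<^esub> g) \<otimes>\<^bsub>G\<^esub> x = \<one>\<^bsub>G\<^esub>"
    using x \<alpha>_mult[of "inv\<^bsub>G0\<^esub> g" "inv\<^bsub>H\<^esub> h" h] by (simp add: mult_G one_G \<alpha>_H_one)
  then show "\<exists>y\<in>carrier G. y \<otimes>\<^bsub>G\<^esub> x = \<one>\<^bsub>G\<^esub>"
    using x by (intro bexI[of _ "(\<alpha> (inv\<^bsub>G0\<^esub> g) (inv\<^bsub>H\<^esub> h), inv\<^bsub>G0\<^esub> g)"]) (auto simp: carrier_G \<alpha>_closed)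
qed (auto simp: carrier_G mult_G one_G \<alpha>_closed \<alpha>_one)

lemma inv_G:
  assumes "h \<in> carrier H" "g \<in> carrier G0"
  shows "inv\<^bsub>G\<^esub> (h, g) = (\<alpha> (inv\<^bsub>G0\<^esub> g) (inv\<^bsub>H\<^esub> h), inv\<^bsub>G0\<^esub> g)"
  by (rule G.inv_equality)
     (use assms \<alpha>_mult[of "inv\<^bsub>G0\<^esub> g" "inv\<^bsub>H\<^esub> h" h] in \<open>auto simp: carrier_G mult_G one_G \<alpha>_closed \<alpha>_H_one\<close>)

lemma N_iff: "x \<in> carrier G \<Longrightarrow> x \<in> N \<longleftrightarrow> snd x = \<one>\<^bsub>G0\<^esub>"
  by (auto simp: N_eq carrier_G)

lemma N_subset: "x \<in> N \<Longrightarrow> x \<in> carrier G"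
  by (auto simp: N_eq carrier_G)

lemma snd_mult: "snd (x \<otimes>\<^bsub>G\<^esub> y) = snd x \<otimes>\<^bsub>G0\<^esub> snd y"
  by (cases x, cases y) (simp add: mult_G)

lemma snd_inv: "x \<in> carrier G \<Longrightarrow> snd (inv\<^bsub>G\<^esub> x) = inv\<^bsub>G0\<^esub> (snd x)"
  by (cases x) (auto simp: carrier_G inv_G)

lemma snd_closed: "x \<in> carrier G \<Longrightarrow> snd x \<in> carrier G0"
  by (auto simp: carrier_G)

lemma subgroup_N: "subgroup N G"
proof (rule G.subgroupI)
  show "N \<noteq> {}" using H.one_closed by (auto simp: N_eq)
  show "inv\<^bsub>G\<^esub> a \<in> N" if "a \<in> N" for a
    using that N_subset[OF that] by (simp add: N_iff snd_inv)
  show "a \<otimes>\<^bsub>G\<^esub> b \<in> N" if "a \<in> N" "b \<in> N" for a b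
    using that N_subset[OF that(1)] N_subset[OF that(2)] by (simp add: N_iff snd_mult)
qed (use N_subset in auto)

lemma N_commute: "x \<in> N \<Longrightarrow> y \<in> N \<Longrightarrow> x \<otimes>\<^bsub>G\<^esub> y = y \<otimes>\<^bsub>G\<^esub> x"
  by (auto simp: N_eq mult_G \<alpha>_one H.m_comm)

sublocale L: group L by (rule subgroup.subgroup_is_group[OF subgroup_N G.is_group])

lemma inv_L: "x \<in> N \<Longrightarrow> inv\<^bsub>L\<^esub> x = inv\<^bsub>G\<^esub> x"
  by (rule G.m_inv_consistent[OF subgroup_N])

lemma topspace_TG: "topspace TG = carrier G"
  by (simp add: semidirect_topology_def carrier_G H.topspace_T)

lemma topspace_S: "topspace S = N"
  using N_subset by (auto simp: topspace_TG)

lemma continuous_TG: "continuous_map TG Y f \<longleftrightarrow> (\<forall>g\<in>carrier G0. continuous_map T Y (\<lambda>h. f (h, g)))"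
  by (simp add: semidirect_topology_def continuous_map_prod_discrete)

lemma continuous_into_TG:
  "continuous_map X T u \<Longrightarrow> g \<in> carrier G0 \<Longrightarrow> continuous_map X TG (\<lambda>x. (u x, g))"
  unfolding semidirect_topology_def by (rule continuous_map_pairedI) auto

lemma continuous_inv_G: "continuous_map TG TG (\<lambda>x. inv\<^bsub>G\<^esub> x)"
  unfolding continuous_TG
proof
  fix g assume g: "g \<in> carrier G0"
  have "continuous_map T T (\<lambda>h. \<alpha> (inv\<^bsub>G0\<^esub> g) (inv\<^bsub>H\<^esub> h))"
    using continuous_map_compose[OF H.cont_inv \<alpha>_cont[of "inv\<^bsub>G0\<^esub> g"]] g by (simp add: o_def)
  from continuous_into_TG[OF this, of "inv\<^bsub>G0\<^esub> g"]
  show "continuous_map T TG (\<lambda>h. inv\<^bsub>G\<^esub> (h, g))"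
    by (rule continuous_map_eq) (use g in \<open>auto simp: inv_G H.topspace_T\<close>)
qed

lemma continuous_right_G: "y \<in> carrier G \<Longrightarrow> continuous_map TG TG (\<lambda>x. x \<otimes>\<^bsub>G\<^esub> y)"
  unfolding continuous_TG
proof
  fix g assume y: "y \<in> carrier G" and g: "g \<in> carrier G0"
  obtain k l where kl: "y = (k, l)" "k \<in> carrier H" "l \<in> carrier G0" using y by (auto simp: carrier_G)
  have "continuous_map T T (\<lambda>h. h \<otimes>\<^bsub>H\<^esub> \<alpha> g k)"
    using g kl by (intro H.cont_mult2 H.cont_constT \<alpha>_closed) auto
  from continuous_into_TG[OF this, of "g \<otimes>\<^bsub>G0\<^esub> l"] show "continuous_map T TG (\<lambda>h. (h, g) \<otimes>\<^bsub>G\<^esub> y)"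
    using g kl by (simp add: mult_G)
qed

lemma continuous_left_G: "y \<in> carrier G \<Longrightarrow> continuous_map TG TG (\<lambda>x. y \<otimes>\<^bsub>G\<^esub> x)"
  unfolding continuous_TG
proof
  fix g assume y: "y \<in> carrier G" and g: "g \<in> carrier G0"
  obtain k l where kl: "y = (k, l)" "k \<in> carrier H" "l \<in> carrier G0" using y by (auto simp: carrier_G)
  have "continuous_map T T (\<lambda>h. k \<otimes>\<^bsub>H\<^esub> \<alpha> l h)"
    using kl by (intro H.cont_mult2 H.cont_constT \<alpha>_cont) auto
  from continuous_into_TG[OF this, of "l \<otimes>\<^bsub>G0\<^esub> g"] show "continuous_map T TG (\<lambda>h. y \<otimes>\<^bsub>G\<^esub> (h, g))"
    using g kl by (simp add: mult_G)
qed

lemma continuous_slice: "continuous_map TG euclidean f \<Longrightarrow> g \<in> carrier G0 \<Longrightarrow> H.cont (\<lambda>h. f (h, g))"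
  by (simp add: continuous_TG)

lemma continuous_S_slice: "continuous_map S euclidean f \<Longrightarrow> H.cont (\<lambda>h. f (h, \<one>\<^bsub>G0\<^esub>))"
proof -
  assume f: "continuous_map S euclidean f"
  have "continuous_map T TG (\<lambda>h. (h, \<one>\<^bsub>G0\<^esub>))" by (rule continuous_into_TG) auto
  then have "continuous_map T S (\<lambda>h. (h, \<one>\<^bsub>G0\<^esub>))"
    by (rule continuous_map_into_subtopology) (auto simp: H.topspace_T N_eq)
  from continuous_map_compose[OF this f] show ?thesis by (simp add: o_def)
qed

text \<open>\<open>N\<close> is the slice over one point of the discrete factor, so continuity is
  checked on each slice separately, where the extension is either \<open>f\<close> or zero.\<close>

lemma continuous_extend:
  assumes "continuous_map S euclidean f"
  shows "continuous_map TG euclidean (\<lambda>x. if x \<in> N then f x else (0::complex))"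
  unfolding continuous_TG
proof
  fix g assume g: "g \<in> carrier G0"
  show "H.cont (\<lambda>h. if (h, g) \<in> N then f (h, g) else 0)"
  proof (cases "g = \<one>\<^bsub>G0\<^esub>")
    case True
    show ?thesis by (rule continuous_map_eq[OF continuous_S_slice[OF assms]]) (auto simp: True N_eq H.topspace_T)
  next
    case False
    then show ?thesis by (simp add: N_eq)
  qed
qed

section \<open>Haar integrals on the semidirect product and on its normal subgroup\<close>

definition MG :: "('h \<times> 'g \<Rightarrow> complex) \<Rightarrow> complex" where
  "MG f = (\<Sum>g\<in>carrier G0. H.mean (\<lambda>h. f (h, g))) / of_nat (card (carrier G0))"

definition MN :: "('h \<times> 'g \<Rightarrow> complex) \<Rightarrow> complex" where
  "MN f = H.mean (\<lambda>h. f (h, \<one>\<^bsub>G0\<^esub>))"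

lemma card_G0: "card (carrier G0) > 0"
  using finite_G0 G0.one_closed by (auto simp: card_gt_0_iff)

sublocale MG: invariant_mean G TG MG
proof unfold_locales
  fix f g :: "'h \<times> 'g \<Rightarrow> complex" and c and y assume f: "continuous_map TG euclidean f"
  show "MG g = MG f" if "\<And>x. x \<in> carrier G \<Longrightarrow> f x = g x"
    unfolding MG_def using that continuous_slice[OF f]
    by (intro arg_cong2[of _ _ _ _ "(/)"] sum.cong H.mean_cong) (auto simp: carrier_G)
  show "MG (\<lambda>x. f x + g x) = MG f + MG g" if "continuous_map TG euclidean g"
    unfolding MG_def using continuous_slice[OF f] continuous_slice[OF that]
    by (simp add: H.mean_add sum.distrib add_divide_distrib)
  show "MG (\<lambda>x. c * f x) = c * MG f"
    unfolding MG_def using continuous_slice[OF f] by (simp add: H.mean_scale sum_distrib_left)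
  show "MG (\<lambda>x. f (x \<otimes>\<^bsub>G\<^esub> y)) = MG f" if y: "y \<in> carrier G"
  proof -
    obtain k l where kl: "y = (k, l)" "k \<in> carrier H" "l \<in> carrier G0" using y by (auto simp: carrier_G)
    \<comment> \<open>Right translation by \<open>(k, l)\<close> carries the slice of
      \<open>g\<close> to that of \<open>g\<close> times \<open>l\<close> and acts inside it as the
      translation by \<open>\<alpha> g k\<close>. No automorphism acts on the variable
      \<open>h\<close>, so translation invariance on \<open>H\<close> suffices.\<close>
    have "(\<Sum>g\<in>carrier G0. H.mean (\<lambda>h. f ((h, g) \<otimes>\<^bsub>G\<^esub> y))) = (\<Sum>g\<in>carrier G0. H.mean (\<lambda>h. f (h, g \<otimes>\<^bsub>G0\<^esub> l)))"
    proof (rule sum.cong)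
      fix g assume g: "g \<in> carrier G0"
      show "H.mean (\<lambda>h. f ((h, g) \<otimes>\<^bsub>G\<^esub> y)) = H.mean (\<lambda>h. f (h, g \<otimes>\<^bsub>G0\<^esub> l))"
        using H.mean_translate[OF continuous_slice[OF f, of "g \<otimes>\<^bsub>G0\<^esub> l"] \<alpha>_closed[OF g kl(2)]] g kl
        by (simp add: mult_G)
    qed simp
    also have "\<dots> = (\<Sum>g\<in>carrier G0. H.mean (\<lambda>h. f (h, g)))"
      by (rule sum.reindex_bij_witness[of _ "\<lambda>g. g \<otimes>\<^bsub>G0\<^esub> inv\<^bsub>G0\<^esub> l" "\<lambda>g. g \<otimes>\<^bsub>G0\<^esub> l"])
         (use kl in \<open>auto simp: G0.m_assoc\<close>)
    finally show ?thesis by (simp add: MG_def)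
  qed
next
  show "MG (\<lambda>x. 1) = 1" unfolding MG_def using card_G0 by (simp add: H.mean_const)
qed (auto simp: topspace_TG intro: continuous_inv_G)

sublocale MN: invariant_mean L S MN
proof unfold_locales
  show "topspace S = carrier L" unfolding topspace_S by simp
  show "continuous_map S S (\<lambda>x. inv\<^bsub>L\<^esub> x)"
  proof (rule continuous_map_eq)
    show "continuous_map S S (\<lambda>x. inv\<^bsub>G\<^esub> x)"
      using continuous_inv_G subgroup.m_inv_closed[OF subgroup_N] topspace_S
      by (intro continuous_map_into_subtopology continuous_map_from_subtopology) auto
  qed (use topspace_S inv_L in auto)
  fix f g :: "'h \<times> 'g \<Rightarrow> complex" and c and y assume f: "continuous_map S euclidean f"
  show "MN g = MN f" if "\<And>x. x \<in> carrier L \<Longrightarrow> f x = g x"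
    unfolding MN_def using that by (intro H.mean_cong continuous_S_slice[OF f]) (auto simp: N_eq)
  show "MN (\<lambda>x. f x + g x) = MN f + MN g" if "continuous_map S euclidean g"
    unfolding MN_def using continuous_S_slice[OF f] continuous_S_slice[OF that] by (rule H.mean_add)
  show "MN (\<lambda>x. c * f x) = c * MN f"
    unfolding MN_def using continuous_S_slice[OF f] by (rule H.mean_scale)
  show "MN (\<lambda>x. f (x \<otimes>\<^bsub>L\<^esub> y)) = MN f" if "y \<in> carrier L"
  proof -
    obtain k where k: "y = (k, \<one>\<^bsub>G0\<^esub>)" "k \<in> carrier H" using \<open>y \<in> carrier L\<close> by (auto simp: N_eq)
    show ?thesis unfolding MN_def using H.mean_translate[OF continuous_S_slice[OF f] k(2)] k
      by (simp add: mult_G \<alpha>_one)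
  qed
next
  show "MN (\<lambda>x. 1) = 1" unfolding MN_def by (rule H.mean_const)
qed

lemma irreducible_L_degree: "irreducible_rep L S \<tau> \<Longrightarrow> degree_rep L \<tau> = 1"
  by (rule abelian_irreducible_degree) (auto simp: N_commute)

definition char_rep :: "('h \<Rightarrow> complex) \<Rightarrow> 'h \<times> 'g \<Rightarrow> complex mat" where
  "char_rep f = (\<lambda>x. mat 1 1 (\<lambda>_. f (fst x)))"

lemma character_one: "H.character f \<Longrightarrow> f \<one>\<^bsub>H\<^esub> = 1"
proof -
  assume f: "H.character f"
  then have "f \<one>\<^bsub>H\<^esub> = f \<one>\<^bsub>H\<^esub> * f \<one>\<^bsub>H\<^esub>" "norm (f \<one>\<^bsub>H\<^esub>) = 1"
    unfolding H.character_def using H.one_closed H.r_one by metis+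
  then show ?thesis by auto
qed

lemma char_rep_facts:
  assumes f: "H.character f"
  shows "irreducible_rep L S (char_rep f)" and "h \<in> carrier H \<Longrightarrow> ch L (char_rep f) (h, \<one>\<^bsub>G0\<^esub>) = f h"
proof -
  have one: "char_rep f \<one>\<^bsub>L\<^esub> = 1\<^sub>m 1"
    using character_one[OF f] by (intro eq_matI) (auto simp: char_rep_def one_G)
  have c: "char_rep f g \<in> carrier_mat 1 1" for g by (simp add: char_rep_def)
  have mult: "char_rep f (x \<otimes>\<^bsub>L\<^esub> y) = char_rep f x * char_rep f y" if "x \<in> carrier L" "y \<in> carrier L" for x y
    using that f by (intro eq_matI) (auto simp: char_rep_def N_eq mult_G \<alpha>_one H.character_def scalar_prod_def)
  have cont: "continuous_map S euclidean (\<lambda>x. char_rep f x $$ (i, j))" if "i < 1" "j < 1" for i j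
  proof -
    have "continuous_map TG euclidean (\<lambda>x. f (fst x))"
      unfolding continuous_TG using f by (simp add: H.character_def)
    then show ?thesis using that by (simp add: char_rep_def continuous_map_from_subtopology)
  qed
  note r = representationI[OF one c mult cont]
  show "irreducible_rep L S (char_rep f)" by (rule degree_one_irreducible[OF r])
  show "ch L (char_rep f) (h, \<one>\<^bsub>G0\<^esub>) = f h" if "h \<in> carrier H"
    using that r(2) by (subst ch_eq[OF r(1)]) (auto simp: N_eq mtrace_def char_rep_def)
qed

lemma restrict_rep_facts:
  assumes \<pi>: "representation G TG \<pi>"
  shows "representation L S (restrict \<pi> N)" "degree_rep L (restrict \<pi> N) = degree_rep G \<pi>"
    and "x \<in> N \<Longrightarrow> ch L (restrict \<pi> N) x = ch G \<pi> x"
proof -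
  let ?n = "degree_rep G \<pi>"
  have oneN: "\<one>\<^bsub>G\<^esub> \<in> N" by (rule subgroup.one_closed[OF subgroup_N])
  have 1: "restrict \<pi> N \<one>\<^bsub>L\<^esub> = 1\<^sub>m ?n" using rep_one[OF \<pi>] oneN by simp
  have 2: "restrict \<pi> N g \<in> carrier_mat ?n ?n" if "g \<in> carrier L" for g
    using that rep_carrier[OF \<pi> N_subset] by simp
  have 3: "restrict \<pi> N (g \<otimes>\<^bsub>L\<^esub> h) = restrict \<pi> N g * restrict \<pi> N h" if "g \<in> carrier L" "h \<in> carrier L" for g h
    using that subgroup.m_closed[OF subgroup_N] rep_mult[OF \<pi> N_subset N_subset] by simp
  have 4: "continuous_map S euclidean (\<lambda>g. restrict \<pi> N g $$ (i, j))" if "i < ?n" "j < ?n" for i j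
    by (rule continuous_map_eq[OF continuous_map_from_subtopology[OF rep_cont[OF \<pi> that]]]) (simp add: topspace_S)
  note r = representationI[where \<pi> = "restrict \<pi> N" and G = L, OF 1 2 3 4]
  show "representation L S (restrict \<pi> N)" "degree_rep L (restrict \<pi> N) = ?n" using r by auto
  show "ch L (restrict \<pi> N) x = ch G \<pi> x" if "x \<in> N"
    using that ch_eq[OF r(1), of x] ch_eq[OF \<pi> N_subset[OF that]] r(2) by simp
qed

lemma coset_eq: "r \<in> carrier G \<Longrightarrow> r <#\<^bsub>G\<^esub> N = carrier H \<times> {snd r}"
proof -
  assume "r \<in> carrier G"
  then obtain k l where r: "r = (k, l)" "k \<in> carrier H" "l \<in> carrier G0" by (auto simp: carrier_G)
  have "(m, l) \<in> r <#\<^bsub>G\<^esub> N" if m: "m \<in> carrier H" for m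
  proof -
    let ?h = "\<alpha> (inv\<^bsub>G0\<^esub> l) (inv\<^bsub>H\<^esub> k \<otimes>\<^bsub>H\<^esub> m)"
    have "r \<otimes>\<^bsub>G\<^esub> (?h, \<one>\<^bsub>G0\<^esub>) = (m, l)"
      using r m by (simp add: mult_G \<alpha>_inv H.m_assoc[symmetric])
    moreover have "(?h, \<one>\<^bsub>G0\<^esub>) \<in> N" using r m by (simp add: N_eq \<alpha>_closed)
    ultimately show ?thesis unfolding l_coset_def by force
  qed
  moreover have "r <#\<^bsub>G\<^esub> N \<subseteq> carrier H \<times> {l}"
    using r by (auto simp: l_coset_def N_eq mult_G \<alpha>_closed)
  ultimately show ?thesis using r(1) by auto
qed

lemma coset_inj: "inj_on (\<lambda>l. carrier H \<times> {l}) X"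
  by (rule inj_onI) (use H.one_closed in auto)

text \<open>Cosets of \<open>N\<close> correspond to second components. Whatever representatives
  \<open>SOME\<close> picks, their second components enumerate \<open>G0\<close> without
  repetition.\<close>

lemma transversal_facts:
  defines "rs \<equiv> SOME rs. left_transversal G N rs"
  shows "set rs \<subseteq> carrier G" "distinct (map snd rs)" "snd ` set rs = carrier G0"
proof -
  have lc: "lcosets\<^bsub>G\<^esub> N = (\<lambda>l. carrier H \<times> {l}) ` carrier G0"
  proof -
    have "lcosets\<^bsub>G\<^esub> N = (\<lambda>r. carrier H \<times> {snd r}) ` carrier G"
      unfolding LCOSETS_def using coset_eq by auto
    also have "\<dots> = (\<lambda>l. carrier H \<times> {l}) ` snd ` carrier G" by (simp add: image_image)
    also have "snd ` carrier G = carrier G0" using H.one_closed by (force simp: carrier_G)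
    finally show ?thesis .
  qed
  have mp: "map (\<lambda>r. r <#\<^bsub>G\<^esub> N) rs = map (\<lambda>l. carrier H \<times> {l}) (map snd rs)" if "set rs \<subseteq> carrier G" for rs
    using that by (auto simp: coset_eq subset_iff)
  obtain ls where ls: "set ls = carrier G0" "distinct ls" using finite_distinct_list[OF finite_G0] by blast
  let ?rs = "map (\<lambda>l. (\<one>\<^bsub>H\<^esub>, l)) ls"
  have sub: "set ?rs \<subseteq> carrier G" using ls by (auto simp: carrier_G)
  have "left_transversal G N ?rs"
    unfolding left_transversal_def mp[OF sub] lc
    using sub ls by (simp add: o_def distinct_map coset_inj)
  then have tr: "left_transversal G N rs" unfolding rs_def by (rule someI)
  then show sub: "set rs \<subseteq> carrier G" by (simp add: left_transversal_def)
  show "distinct (map snd rs)" using tr unfolding left_transversal_def mp[OF sub]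
    by (auto simp: distinct_map intro: inj_on_imageI2)
  have "(\<lambda>l. carrier H \<times> {l}) ` snd ` set rs = (\<lambda>l. carrier H \<times> {l}) ` carrier G0"
    using tr unfolding left_transversal_def mp[OF sub] lc by (simp add: image_image)
  then show "snd ` set rs = carrier G0"
    by (rule inj_on_image_eq_iff[OF coset_inj subset_UNIV subset_UNIV, THEN iffD1])
qed

text \<open>The component \<open>k\<close> cancels because \<open>H\<close> is commutative, so
  conjugation by a representative acts on \<open>H\<close> through its second component
  only.\<close>

lemma conj_N:
  assumes r: "k \<in> carrier H" "l \<in> carrier G0" and h: "h \<in> carrier H"
  shows "inv\<^bsub>G\<^esub> (k, l) \<otimes>\<^bsub>G\<^esub> (h, \<one>\<^bsub>G0\<^esub>) \<otimes>\<^bsub>G\<^esub> (k, l) = (\<alpha> (inv\<^bsub>G0\<^esub> l) h, \<one>\<^bsub>G0\<^esub>)"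
proof -
  let ?r = "(k, l)" and ?x = "(h, \<one>\<^bsub>G0\<^esub>)" and ?y = "(\<alpha> (inv\<^bsub>G0\<^esub> l) h, \<one>\<^bsub>G0\<^esub>)"
  have c: "?r \<in> carrier G" "?x \<in> carrier G" "?y \<in> carrier G" using r h by (auto simp: carrier_G \<alpha>_closed)
  have "?x \<otimes>\<^bsub>G\<^esub> ?r = ?r \<otimes>\<^bsub>G\<^esub> ?y" using r h by (simp add: mult_G \<alpha>_one \<alpha>_inv H.m_comm)
  then have "inv\<^bsub>G\<^esub> ?r \<otimes>\<^bsub>G\<^esub> (?x \<otimes>\<^bsub>G\<^esub> ?r) = ?y" using c by (simp add: G.m_assoc[symmetric])
  then show ?thesis using c by (simp add: G.m_assoc)
qed

text \<open>The matrix of an element permutes the cosets, with entries from the extension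
  \<open>s\<close> of \<open>\<sigma>\<close> by zero. An element outside the normal subgroup
  \<open>N\<close> fixes no coset, so the character vanishes there; on \<open>N\<close> every coset
  is fixed, and the trace runs over all conjugates.\<close>

lemma induced_rep_facts:
  assumes \<sigma>: "representation L S \<sigma>" "degree_rep L \<sigma> = 1"
  shows "representation G TG (induced_rep G N \<sigma>)" "degree_rep G (induced_rep G N \<sigma>) = card (carrier G0)"
    and "h \<in> carrier H \<Longrightarrow> g \<in> carrier G0 \<Longrightarrow> ch G (induced_rep G N \<sigma>) (h, g) =
      (if g = \<one>\<^bsub>G0\<^esub> then (\<Sum>l\<in>carrier G0. ch L \<sigma> (\<alpha> (inv\<^bsub>G0\<^esub> l) h, \<one>\<^bsub>G0\<^esub>)) / of_nat (card (carrier G0)) else 0)"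
proof -
  define rs where "rs = (SOME rs. left_transversal G N rs)"
  note tr = transversal_facts[folded rs_def]
  define n where "n = length rs"
  have n: "n = card (carrier G0)"
    using distinct_card[OF tr(2)] tr(3) by (simp add: n_def)
  have rc: "rs ! i \<in> carrier G" if "i < n" for i using tr(1) that by (auto simp: n_def)
  \<comment> \<open>\<open>degree_rep\<close> looks only at the unit element, which \<open>G\<close>
    and \<open>L\<close> share.\<close>
  have \<sigma>_deg: "degree_rep G \<sigma> = 1" using \<sigma>(2) by (simp add: degree_rep_def)
  define s where "s x = (if x \<in> N then \<sigma> x $$ (0, 0) else 0)" for x
  let ?c = "\<lambda>i g j. inv\<^bsub>G\<^esub> (rs ! i) \<otimes>\<^bsub>G\<^esub> g \<otimes>\<^bsub>G\<^esub> rs ! j"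
  define R where "R = induced_rep G N \<sigma>"
  have R: "R g = mat n n (\<lambda>(i, j). s (?c i g j))" for g
    unfolding R_def induced_rep_def rs_def[symmetric] Let_def \<sigma>_deg by (simp add: n_def s_def cong: if_cong)
  have cc: "?c i g j \<in> carrier G" if "i < n" "j < n" "g \<in> carrier G" for i j g using rc that by auto
  have cN: "?c i g j \<in> N \<longleftrightarrow> snd (rs ! i) = snd g \<otimes>\<^bsub>G0\<^esub> snd (rs ! j)" if "i < n" "j < n" "g \<in> carrier G" for i j g
  proof -
    note d = snd_closed[OF rc[OF that(1)]] snd_closed[OF rc[OF that(2)]] snd_closed[OF that(3)]
    have "?c i g j \<in> N \<longleftrightarrow> inv\<^bsub>G0\<^esub> (snd (rs ! i)) \<otimes>\<^bsub>G0\<^esub> (snd g \<otimes>\<^bsub>G0\<^esub> snd (rs ! j)) = \<one>\<^bsub>G0\<^esub>"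
      using cc[OF that] rc[OF that(1)] d by (simp add: N_iff snd_mult snd_inv G0.m_assoc)
    also have "\<dots> \<longleftrightarrow> snd g \<otimes>\<^bsub>G0\<^esub> snd (rs ! j) = snd (rs ! i)"
      using d by (metis G0.inv_closed G0.inv_equality G0.inv_inv G0.l_inv G0.m_closed)
    finally show ?thesis by auto
  qed
  \<comment> \<open>For \<open>x\<close> outside \<open>N\<close> both sides are zero because
    \<open>y\<close> lies in \<open>N\<close>; for two factors outside \<open>N\<close> the equation
    can fail.\<close>
  have s_mult: "s (x \<otimes>\<^bsub>G\<^esub> y) = s x * s y" if x: "x \<in> carrier G" and y: "y \<in> N" for x y
  proof (cases "x \<in> N")
    case True
    have "\<sigma> (x \<otimes>\<^bsub>G\<^esub> y) = \<sigma> x * \<sigma> y" using rep_mult[OF \<sigma>(1), of x y] True y by simp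
    moreover have "\<sigma> x \<in> carrier_mat 1 1" "\<sigma> y \<in> carrier_mat 1 1"
      using rep_carrier[OF \<sigma>(1), of x] rep_carrier[OF \<sigma>(1), of y] True y \<sigma>(2) by auto
    ultimately show ?thesis using True y subgroup.m_closed[OF subgroup_N]
      by (simp add: s_def scalar_prod_def)
  next
    case False
    have yc: "y \<in> carrier G" by (rule N_subset[OF y])
    have "x \<otimes>\<^bsub>G\<^esub> y \<notin> N"
      using False x y yc by (simp add: N_iff snd_mult snd_closed)
    then show ?thesis using False by (simp add: s_def)
  qed
  have R_one: "R \<one>\<^bsub>G\<^esub> = 1\<^sub>m n"
  proof (rule eq_matI)
    fix i j assume "i < dim_row (1\<^sub>m n :: complex mat)" "j < dim_col (1\<^sub>m n :: complex mat)"
    then have ij: "i < n" "j < n" by auto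
    have "snd (rs ! i) = snd (rs ! j) \<longleftrightarrow> i = j"
      using nth_eq_iff_index_eq[OF tr(2), of i j] ij by (simp add: n_def)
    then have "?c i \<one>\<^bsub>G\<^esub> j \<in> N \<longleftrightarrow> i = j" using cN[OF ij G.one_closed] snd_closed[OF rc[OF ij(2)]] by (simp add: one_G)
    moreover have "?c i \<one>\<^bsub>G\<^esub> i = \<one>\<^bsub>G\<^esub>" using rc[OF ij(1)] by simp
    moreover have "\<sigma> \<one>\<^bsub>G\<^esub> = 1\<^sub>m 1" using rep_one[OF \<sigma>(1)] \<sigma>(2) by simp
    ultimately show "R \<one>\<^bsub>G\<^esub> $$ (i, j) = 1\<^sub>m n $$ (i, j)" using ij by (auto simp: R s_def)
  qed (simp_all add: R)
  have R_mult: "R (g \<otimes>\<^bsub>G\<^esub> h) = R g * R h" if g: "g \<in> carrier G" and h: "h \<in> carrier G" for g h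
  proof (rule eq_matI)
    fix i j assume "i < dim_row (R g * R h)" "j < dim_col (R g * R h)"
    then have ij: "i < n" "j < n" by (auto simp: R)
    \<comment> \<open>Only the coset that contains \<open>h\<close> times the representative of
      column \<open>j\<close> contributes to the matrix product; \<open>k\<close> is its
      index.\<close>
    have "snd h \<otimes>\<^bsub>G0\<^esub> snd (rs ! j) \<in> set (map snd rs)"
      using snd_closed[OF h] snd_closed[OF rc[OF ij(2)]] tr(3) by simp
    then obtain k where k: "k < n" "snd (rs ! k) = snd h \<otimes>\<^bsub>G0\<^esub> snd (rs ! j)"
      unfolding in_set_conv_nth by (auto simp: n_def)
    have other: "s (?c l h j) = 0" if l: "l < n" "l \<noteq> k" for l
    proof -
      have "snd (rs ! l) \<noteq> snd (rs ! k)"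
        using nth_eq_iff_index_eq[OF tr(2), of l k] l k by (simp add: n_def)
      then have "?c l h j \<notin> N" using cN[OF l(1) ij(2) h] k(2) by simp
      then show ?thesis by (simp add: s_def)
    qed
    have "(R g * R h) $$ (i, j) = (\<Sum>l<n. s (?c i g l) * s (?c l h j))"
      by (subst index_mult_mat_sum[of _ n n _ n]) (use ij in \<open>auto simp: R\<close>)
    also have "\<dots> = (\<Sum>l<n. if l = k then s (?c i g k) * s (?c k h j) else 0)"
      by (rule sum.cong) (use other in auto)
    also have "\<dots> = s (?c i g k) * s (?c k h j)" using k by simp
    also have "\<dots> = s (?c i g k \<otimes>\<^bsub>G\<^esub> ?c k h j)"
      by (rule s_mult[symmetric, OF cc[OF ij(1) k(1) g]]) (use cN[OF k(1) ij(2) h] k(2) in simp)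
    also have "?c i g k \<otimes>\<^bsub>G\<^esub> ?c k h j = ?c i (g \<otimes>\<^bsub>G\<^esub> h) j"
    proof -
      note c = rc[OF ij(1)] rc[OF ij(2)] rc[OF k(1)] g h
      have "rs ! k \<otimes>\<^bsub>G\<^esub> (inv\<^bsub>G\<^esub> (rs ! k) \<otimes>\<^bsub>G\<^esub> (h \<otimes>\<^bsub>G\<^esub> rs ! j)) = h \<otimes>\<^bsub>G\<^esub> rs ! j"
        using c by (simp add: G.m_assoc[symmetric])
      then show ?thesis using c by (simp add: G.m_assoc)
    qed
    finally show "R (g \<otimes>\<^bsub>G\<^esub> h) $$ (i, j) = (R g * R h) $$ (i, j)" using ij by (simp add: R)
  qed (simp_all add: R)
  have R_cont: "continuous_map TG euclidean (\<lambda>g. R g $$ (i, j))" if ij: "i < n" "j < n" for i j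
  proof -
    have "continuous_map S euclidean (\<lambda>x. \<sigma> x $$ (0, 0))" using rep_cont[OF \<sigma>(1), of 0 0] \<sigma>(2) by simp
    from continuous_extend[OF this] have s: "continuous_map TG euclidean s" by (simp add: s_def[abs_def])
    have "continuous_map TG TG (\<lambda>g. ?c i g j)"
      using continuous_map_compose[OF continuous_left_G[OF G.inv_closed[OF rc[OF ij(1)]]] continuous_right_G[OF rc[OF ij(2)]]]
      by (simp add: o_def)
    from continuous_map_compose[OF this s] show ?thesis using ij by (simp add: R o_def)
  qed
  have R_carrier: "R g \<in> carrier_mat n n" for g by (simp add: R)
  note r = representationI[where \<pi> = R and G = G, OF R_one R_carrier R_mult R_cont]
  show "representation G TG (induced_rep G N \<sigma>)" "degree_rep G (induced_rep G N \<sigma>) = card (carrier G0)"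
    using r unfolding R_def n by auto
  assume h: "h \<in> carrier H" and g: "g \<in> carrier G0"
  have hg: "(h, g) \<in> carrier G" using h g by (simp add: carrier_G)
  have tr_R: "ch G (induced_rep G N \<sigma>) (h, g) = (\<Sum>i<n. s (?c i (h, g) i)) / of_nat n"
    using ch_eq[OF r(1) hg] r(2) by (simp add: R_def[symmetric] mtrace_def R)
  show "ch G (induced_rep G N \<sigma>) (h, g) =
      (if g = \<one>\<^bsub>G0\<^esub> then (\<Sum>l\<in>carrier G0. ch L \<sigma> (\<alpha> (inv\<^bsub>G0\<^esub> l) h, \<one>\<^bsub>G0\<^esub>)) / of_nat (card (carrier G0)) else 0)"
  proof (cases "g = \<one>\<^bsub>G0\<^esub>")
    case True
    have "s (?c i (h, g) i) = ch L \<sigma> (\<alpha> (inv\<^bsub>G0\<^esub> (snd (rs ! i))) h, \<one>\<^bsub>G0\<^esub>)" if i: "i < n" for i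
    proof -
      obtain k l where kl: "rs ! i = (k, l)" "k \<in> carrier H" "l \<in> carrier G0"
        using rc[OF i] by (auto simp: carrier_G)
      have N: "(\<alpha> (inv\<^bsub>G0\<^esub> l) h, \<one>\<^bsub>G0\<^esub>) \<in> N" using kl h by (simp add: N_eq \<alpha>_closed)
      then have "ch L \<sigma> (\<alpha> (inv\<^bsub>G0\<^esub> l) h, \<one>\<^bsub>G0\<^esub>) = s (\<alpha> (inv\<^bsub>G0\<^esub> l) h, \<one>\<^bsub>G0\<^esub>)"
        using ch_eq[OF \<sigma>(1), of "(\<alpha> (inv\<^bsub>G0\<^esub> l) h, \<one>\<^bsub>G0\<^esub>)"] rep_carrier[OF \<sigma>(1), of "(\<alpha> (inv\<^bsub>G0\<^esub> l) h, \<one>\<^bsub>G0\<^esub>)"] \<sigma>(2)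
        by (simp add: s_def mtrace_def)
      then show ?thesis using conj_N[OF kl(2,3) h] kl(1) True by simp
    qed
    then have "(\<Sum>i<n. s (?c i (h, g) i)) = (\<Sum>i<n. ch L \<sigma> (\<alpha> (inv\<^bsub>G0\<^esub> (map snd rs ! i)) h, \<one>\<^bsub>G0\<^esub>))"
      by (simp add: n_def)
    also have "\<dots> = (\<Sum>l\<leftarrow>map snd rs. ch L \<sigma> (\<alpha> (inv\<^bsub>G0\<^esub> l) h, \<one>\<^bsub>G0\<^esub>))"
      by (simp add: sum_list_sum_nth atLeast0LessThan n_def)
    also have "\<dots> = (\<Sum>l\<in>carrier G0. ch L \<sigma> (\<alpha> (inv\<^bsub>G0\<^esub> l) h, \<one>\<^bsub>G0\<^esub>))"
      using sum_list_distinct_conv_sum_set[OF tr(2)] tr(3) by simp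
    finally show ?thesis using True tr_R n by simp
  next
    case False
    have "?c i (h, g) i \<notin> N" if i: "i < n" for i
    proof -
      note d = snd_closed[OF rc[OF i]]
      show ?thesis using cN[OF i i hg] False d g by (simp add: G0.r_cancel_one)
    qed
    then show ?thesis using tr_R False by (simp add: s_def)
  qed
qed

end

section \<open>Associativity and the action\<close>

lemma integ_cong: "(\<And>z. p z \<noteq> 0 \<Longrightarrow> f z = g z) \<Longrightarrow> integ p f = integ p g"
  unfolding integ_def by (rule sum.cong) auto

text \<open>\<open>r\<close> is the mixture of the measures \<open>k w\<close> with weights
  \<open>p\<close>; an iterated convolution of points has this form as a function of the end point,
  and its integrals are computed in two stages.\<close>

lemma integ_compose:
  fixes p :: "'k \<Rightarrow> real" and k :: "'k \<Rightarrow> 'l \<Rightarrow> real"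
  assumes p: "finite {w. p w \<noteq> 0}" and k: "\<forall>w. p w \<noteq> 0 \<longrightarrow> finite {v. k w v \<noteq> 0}"
  defines "r \<equiv> \<lambda>v. \<Sum>w | p w \<noteq> 0. p w * k w v"
  shows "finite {v. r v \<noteq> 0}" "{v. r v \<noteq> 0} \<subseteq> (\<Union>w\<in>{w. p w \<noteq> 0}. {v. k w v \<noteq> 0})"
    and "integ r f = integ p (\<lambda>w. integ (k w) f)"
proof -
  let ?S = "\<Union>w\<in>{w. p w \<noteq> 0}. {v. k w v \<noteq> 0}"
  have S: "finite ?S" using p k by auto
  show sub: "{v. r v \<noteq> 0} \<subseteq> ?S"
  proof
    fix v assume "v \<in> {v. r v \<noteq> 0}"
    then have "r v \<noteq> 0" by simp
    then obtain w where "w \<in> {w. p w \<noteq> 0}" "p w * k w v \<noteq> 0"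
      unfolding r_def by (rule sum.not_neutral_contains_not_neutral)
    then show "v \<in> ?S" by auto
  qed
  show "finite {v. r v \<noteq> 0}" using sub S by (rule finite_subset)
  have "integ r f = (\<Sum>v\<in>?S. of_real (r v) * f v)" by (rule integ_eq[OF S sub])
  also have "\<dots> = (\<Sum>v\<in>?S. \<Sum>w | p w \<noteq> 0. of_real (p w) * (of_real (k w v) * f v))"
    by (simp add: r_def sum_distrib_right mult.assoc)
  also have "\<dots> = (\<Sum>w | p w \<noteq> 0. \<Sum>v\<in>?S. of_real (p w) * (of_real (k w v) * f v))" by (rule sum.swap)
  also have "\<dots> = (\<Sum>w | p w \<noteq> 0. of_real (p w) * integ (k w) f)"
  proof (rule sum.cong[OF refl])
    fix w assume "w \<in> {w. p w \<noteq> 0}"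
    then have "{v. k w v \<noteq> 0} \<subseteq> ?S" by blast
    from integ_eq[OF S this, of f] show "(\<Sum>v\<in>?S. of_real (p w) * (of_real (k w v) * f v)) = of_real (p w) * integ (k w) f"
      by (simp add: sum_distrib_left)
  qed
  finally show "integ r f = integ p (\<lambda>w. integ (k w) f)" by (simp add: integ_def)
qed

lemma fin_prob_measure_mono: "fin_prob_measure A p \<Longrightarrow> A \<subseteq> B \<Longrightarrow> fin_prob_measure B p"
  by (auto simp: fin_prob_measure_def)

text \<open>Writing \<open>ch G \<rho> x\<close> as the character of the contragredient at
  \<open>inv x\<close> reduces this to orthogonality; it decides when the unit lies in the support
  of a product.\<close>

lemma (in invariant_mean) mean_ch_mult_ch:
  assumes \<pi>: "irreducible_rep G T \<pi>" and \<rho>: "irreducible_rep G T \<rho>"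
  shows "M (\<lambda>x. ch G \<pi> x * ch G \<rho> x) \<noteq> 0 \<longleftrightarrow> ch G \<pi> = ch G (contragredient G \<rho>)"
proof -
  let ?\<rho> = "contragredient G \<rho>"
  note c = irreducible_contragredient[OF \<rho>]
  have "M (\<lambda>x. ch G ?\<rho> (inv x) * ch G \<pi> x) = M (\<lambda>x. ch G \<pi> x * ch G \<rho> x)"
  proof (rule M_cong)
    show "contf (\<lambda>x. ch G \<pi> x * ch G \<rho> x)"
      using contf_ch[OF irreducible_repD(1)[OF \<pi>]] contf_ch[OF irreducible_repD(1)[OF \<rho>]] by (rule continuous_map_mult)
    fix x assume "x \<in> carrier G"
    then show "ch G \<pi> x * ch G \<rho> x = ch G ?\<rho> (inv x) * ch G \<pi> x"
      using ch_contragredient[OF irreducible_repD(1)[OF \<rho>], of "inv x"] by simp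
  qed
  then show ?thesis using ch_orthogonal[OF c \<pi>] ch_norm[OF c] by metis
qed

text \<open>The equality case of the triangle inequality: real parts are at most 1 and their mean is
  1, so each is 1, and modulus 1 leaves no imaginary part.\<close>

lemma mean_of_unit_complex_eq_1:
  fixes z :: "'i \<Rightarrow> complex"
  assumes "finite I" "I \<noteq> {}" "\<And>i. i \<in> I \<Longrightarrow> norm (z i) = 1" "(\<Sum>i\<in>I. z i) / of_nat (card I) = 1" and i: "i \<in> I"
  shows "z i = 1"
proof -
  have "(\<Sum>i\<in>I. z i) = of_nat (card I)" using assms(1,2,4) by (simp add: field_simps)
  then have "(\<Sum>i\<in>I. Re (z i)) = real (card I)" by (metis Re_sum of_real_of_nat_eq Re_complex_of_real)
  then have "(\<Sum>i\<in>I. 1 - Re (z i)) = 0" by (simp add: sum_subtractf)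
  moreover have "0 \<le> 1 - Re (z i)" if "i \<in> I" for i
    using assms(3)[OF that] complex_Re_le_cmod[of "z i"] by simp
  ultimately have "\<forall>i\<in>I. 1 - Re (z i) = 0"
    using sum_nonneg_eq_0_iff[OF assms(1), of "\<lambda>i. 1 - Re (z i)"] by blast
  then have "Re (z i) = 1" using i by force
  moreover have "(Re (z i))\<^sup>2 + (Im (z i))\<^sup>2 = 1" using assms(3)[OF i] by (simp add: cmod_power2[symmetric])
  ultimately show ?thesis by (simp add: complex_eq_iff)
qed

declare K_conv.simps [simp del]

context semidirect_action
begin

section \<open>The convolution in terms of the represented functions\<close>

definition dual :: "tag \<Rightarrow> ('h \<times> 'g) point set" where
  "dual s = (case s of Circ \<Rightarrow> dual_points G TG Circ | Bullet \<Rightarrow> dual_points L S Bullet)"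

text \<open>The group law of order 2 with unit \<open>Circ\<close>. The convolution of two points is
  supported on the product of their tags.\<close>

definition tag_mult :: "tag \<Rightarrow> tag \<Rightarrow> tag" where
  "tag_mult s t = (if s = t then Circ else Bullet)"

abbreviation K :: "('h \<times> 'g) point set" where "K \<equiv> K_points G TG N"
abbreviation cv :: "('h \<times> 'g) point \<Rightarrow> ('h \<times> 'g) point \<Rightarrow> ('h \<times> 'g) point \<Rightarrow> real" where
  "cv \<equiv> K_conv G TG N"

lemma dual_simps: "dual Circ = dual_points G TG Circ" "dual Bullet = dual_points L S Bullet"
  by (simp_all add: dual_def)

lemma snd_dual: "z \<in> dual s \<Longrightarrow> snd z = s"
  by (cases s) (auto simp: dual_def dual_points_def)

lemma K_eq: "K = dual Circ \<union> dual Bullet"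
  by (simp add: K_points_def dual_def)

lemma K_iff: "x \<in> K \<longleftrightarrow> x \<in> dual (snd x)"
  using snd_dual[of x] by (cases "snd x") (auto simp: K_eq)

lemma dual_subset_K: "dual s \<subseteq> K"
  by (cases s) (auto simp: K_eq)

lemma cv_Circ_Circ:
  assumes "(f, Circ) \<in> dual Circ" "(f', Circ) \<in> dual Circ"
  shows "fin_prob_measure (dual Circ) (cv (f, Circ) (f', Circ))"
    and "g \<in> carrier G \<Longrightarrow> integ (cv (f, Circ) (f', Circ)) (\<lambda>z. fst z g) = f g * f' g"
proof -
  note i = MG.rep_of_spec[OF assms(1)[unfolded dual_simps]] MG.rep_of_spec[OF assms(2)[unfolded dual_simps]]
  note r = irreducible_repD[OF i(1)] irreducible_repD[OF i(3)]
  note t = tensor_rep_facts[OF r(1) refl r(4) refl G.one_closed topspace_TG]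
  have pos: "0 < degree_rep G (tensor_rep (rep_of G TG f) (rep_of G TG f'))" using t(2) r by simp
  show "fin_prob_measure (dual Circ) (cv (f, Circ) (f', Circ))"
    unfolding dual_simps K_conv.simps by (rule MG.fin_prob_ch_measure[OF t(1) pos])
  show "g \<in> carrier G \<Longrightarrow> integ (cv (f, Circ) (f', Circ)) (\<lambda>z. fst z g) = f g * f' g"
    unfolding K_conv.simps using MG.integ_ch_measure[OF t(1) pos] t(3) i(2,4) by simp
qed

lemma cv_Circ_Bullet:
  assumes "(f, Circ) \<in> dual Circ" "(f', Bullet) \<in> dual Bullet"
  shows "fin_prob_measure (dual Bullet) (cv (f, Circ) (f', Bullet))"
    and "fin_prob_measure (dual Bullet) (cv (f', Bullet) (f, Circ))"
    and "g \<in> N \<Longrightarrow> integ (cv (f, Circ) (f', Bullet)) (\<lambda>z. fst z g) = f g * f' g"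
    and "g \<in> N \<Longrightarrow> integ (cv (f', Bullet) (f, Circ)) (\<lambda>z. fst z g) = f' g * f g"
proof -
  note i = MG.rep_of_spec[OF assms(1)[unfolded dual_simps]] MN.rep_of_spec[OF assms(2)[unfolded dual_simps]]
  note r = irreducible_repD[OF i(1)] irreducible_repD[OF i(3)]
  let ?\<pi> = "restrict (rep_of G TG f) N" and ?\<tau> = "rep_of L S f'"
  note R = restrict_rep_facts[OF r(1)]
  have top: "topspace S = carrier L" unfolding topspace_S by simp
  note t = tensor_rep_facts[OF R(1) refl r(4) refl L.one_closed top]
  note t' = tensor_rep_facts[OF r(4) refl R(1) refl L.one_closed top]
  have pos: "0 < degree_rep L (tensor_rep ?\<pi> ?\<tau>)" "0 < degree_rep L (tensor_rep ?\<tau> ?\<pi>)"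
    using t(2) t'(2) R(2) r by simp_all
  show "fin_prob_measure (dual Bullet) (cv (f, Circ) (f', Bullet))"
    unfolding dual_simps K_conv.simps Let_def by (rule MN.fin_prob_ch_measure[OF t(1) pos(1)])
  show "fin_prob_measure (dual Bullet) (cv (f', Bullet) (f, Circ))"
    unfolding dual_simps K_conv.simps Let_def by (rule MN.fin_prob_ch_measure[OF t'(1) pos(2)])
  assume g: "g \<in> N"
  then have gL: "g \<in> carrier L" by simp
  show "integ (cv (f, Circ) (f', Bullet)) (\<lambda>z. fst z g) = f g * f' g"
    unfolding K_conv.simps Let_def MN.integ_ch_measure[OF t(1) pos(1) gL] t(3)[OF gL] R(3)[OF g] i(2,4) ..
  show "integ (cv (f', Bullet) (f, Circ)) (\<lambda>z. fst z g) = f' g * f g"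
    unfolding K_conv.simps Let_def MN.integ_ch_measure[OF t'(1) pos(2) gL] t'(3)[OF gL] R(3)[OF g] i(2,4) ..
qed

lemma cv_Bullet_Bullet:
  assumes "(f, Bullet) \<in> dual Bullet" "(f', Bullet) \<in> dual Bullet"
  shows "fin_prob_measure (dual Circ) (cv (f, Bullet) (f', Bullet))"
    and "h \<in> carrier H \<Longrightarrow> g \<in> carrier G0 \<Longrightarrow> integ (cv (f, Bullet) (f', Bullet)) (\<lambda>z. fst z (h, g)) =
      (if g = \<one>\<^bsub>G0\<^esub> then (\<Sum>l\<in>carrier G0. f (\<alpha> (inv\<^bsub>G0\<^esub> l) h, \<one>\<^bsub>G0\<^esub>) * f' (\<alpha> (inv\<^bsub>G0\<^esub> l) h, \<one>\<^bsub>G0\<^esub>)) /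
         of_nat (card (carrier G0)) else 0)"
proof -
  note i = MN.rep_of_spec[OF assms(1)[unfolded dual_simps]] MN.rep_of_spec[OF assms(2)[unfolded dual_simps]]
  note r = irreducible_repD[OF i(1)] irreducible_repD[OF i(3)]
  have top: "topspace S = carrier L" unfolding topspace_S by simp
  note t = tensor_rep_facts[OF r(1) irreducible_L_degree[OF i(1)] r(4) irreducible_L_degree[OF i(3)] L.one_closed top]
  let ?\<sigma> = "tensor_rep (rep_of L S f) (rep_of L S f')"
  have d1: "degree_rep L ?\<sigma> = 1" using t(2) by simp
  note I = induced_rep_facts[OF t(1) d1]
  have pos: "0 < degree_rep G (induced_rep G N ?\<sigma>)" using I(2) card_G0 by simp
  show "fin_prob_measure (dual Circ) (cv (f, Bullet) (f', Bullet))"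
    unfolding dual_simps K_conv.simps Let_def by (rule MG.fin_prob_ch_measure[OF I(1) pos])
  assume h: "h \<in> carrier H" and g: "g \<in> carrier G0"
  have "ch L ?\<sigma> (\<alpha> (inv\<^bsub>G0\<^esub> l) h, \<one>\<^bsub>G0\<^esub>) = f (\<alpha> (inv\<^bsub>G0\<^esub> l) h, \<one>\<^bsub>G0\<^esub>) * f' (\<alpha> (inv\<^bsub>G0\<^esub> l) h, \<one>\<^bsub>G0\<^esub>)"
    if "l \<in> carrier G0" for l
    using t(3)[of "(\<alpha> (inv\<^bsub>G0\<^esub> l) h, \<one>\<^bsub>G0\<^esub>)"] i(2,4) that h by (simp add: N_eq \<alpha>_closed)
  then have "(\<Sum>l\<in>carrier G0. ch L ?\<sigma> (\<alpha> (inv\<^bsub>G0\<^esub> l) h, \<one>\<^bsub>G0\<^esub>)) =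
      (\<Sum>l\<in>carrier G0. f (\<alpha> (inv\<^bsub>G0\<^esub> l) h, \<one>\<^bsub>G0\<^esub>) * f' (\<alpha> (inv\<^bsub>G0\<^esub> l) h, \<one>\<^bsub>G0\<^esub>))" by simp
  moreover have "(h, g) \<in> carrier G" using h g by (simp add: carrier_G)
  ultimately show "integ (cv (f, Bullet) (f', Bullet)) (\<lambda>z. fst z (h, g)) =
      (if g = \<one>\<^bsub>G0\<^esub> then (\<Sum>l\<in>carrier G0. f (\<alpha> (inv\<^bsub>G0\<^esub> l) h, \<one>\<^bsub>G0\<^esub>) * f' (\<alpha> (inv\<^bsub>G0\<^esub> l) h, \<one>\<^bsub>G0\<^esub>)) /
         of_nat (card (carrier G0)) else 0)"
    unfolding K_conv.simps Let_def using MG.integ_ch_measure[OF I(1) pos] I(3)[OF h g] by simp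
qed

lemma cv_fin_prob:
  assumes "x \<in> K" "y \<in> K"
  shows "fin_prob_measure (dual (tag_mult (snd x) (snd y))) (cv x y)"
proof -
  obtain f s f' t where xy: "x = (f, s)" "y = (f', t)" by (cases x, cases y)
  have "(f, s) \<in> dual s" "(f', t) \<in> dual t" using assms K_iff xy by auto
  then show ?thesis unfolding xy
    by (cases s; cases t) (auto simp: tag_mult_def intro!: cv_Circ_Circ(1) cv_Circ_Bullet(1,2) cv_Bullet_Bullet(1))
qed

text \<open>Associativity is evaluated at the points of the characters \<open>f\<close>, \<open>cnj f\<close> and \<open>1\<close> of \<open>H\<close>: bracketed
  one way the product is \<open>1\<close> on \<open>H\<close>, the other way it is \<open>f\<close> times the mean of \<open>cnj f\<close> over orbits of
  \<open>\<alpha>\<close>.\<close>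
lemma trivial_action_if_hypergroup:
  assumes hyp: "hypergroup K cv" and g: "g \<in> carrier G0" and h: "h \<in> carrier H"
  shows "\<alpha> g h = h"
proof (rule ccontr)
  assume ne: "\<alpha> g h \<noteq> h"
  \<comment> \<open>A character \<open>f\<close> with \<open>f a \<noteq> 1\<close> takes different
    values at \<open>h\<close> and \<open>\<alpha> g h\<close>, while associativity will yield
    \<open>f (\<alpha> g h) = f h\<close>.\<close>
  define a where "a = inv\<^bsub>H\<^esub> h \<otimes>\<^bsub>H\<^esub> \<alpha> g h"
  have gh: "\<alpha> g h \<in> carrier H" by (rule \<alpha>_closed[OF g h])
  have ha: "h \<otimes>\<^bsub>H\<^esub> a = \<alpha> g h" using h gh by (simp add: a_def H.m_assoc[symmetric])
  have a: "a \<in> carrier H" "a \<noteq> \<one>\<^bsub>H\<^esub>" using h gh ne ha by (auto simp: a_def)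
  obtain f where f: "H.character f" "f a \<noteq> 1" by (rule H.characters_separate_points[OF a])
  have norm_f: "norm (f k) = 1" if "k \<in> carrier H" for k using f(1) that by (simp add: H.character_def)
  have f': "H.character (\<lambda>x. cnj (f x))" using f(1) by (auto simp: H.character_def intro: continuous_map_cnj)
  have f1: "H.character (\<lambda>x. 1)" by (simp add: H.character_def)
  let ?x = "(ch L (char_rep f), Bullet)" and ?y = "(ch L (char_rep (\<lambda>x. cnj (f x))), Bullet)"
    and ?e = "(ch L (char_rep (\<lambda>x. 1)), Bullet)"
  have D: "?x \<in> dual Bullet" "?y \<in> dual Bullet" "?e \<in> dual Bullet"
    using char_rep_facts(1)[OF f(1)] char_rep_facts(1)[OF f'] char_rep_facts(1)[OF f1]
    by (auto simp: dual_simps dual_points_def)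
  then have xK: "?x \<in> K" "?y \<in> K" "?e \<in> K" using dual_subset_K by blast+
  have hN: "(h, \<one>\<^bsub>G0\<^esub>) \<in> N" using h by (simp add: N_eq)
  let ?ev = "\<lambda>z. fst z (h, \<one>\<^bsub>G0\<^esub>)"
  have one: "f k * cnj (f k) = 1" if "k \<in> carrier H" for k
    using norm_f[OF that] by (simp add: complex_norm_square[symmetric])
  have supp: "w \<in> dual Circ" if "cv u v w \<noteq> 0" "u \<in> dual Bullet" "v \<in> dual Bullet" for u v w
  proof -
    have "fin_prob_measure (dual Circ) (cv u v)"
      using cv_fin_prob[of u v] that dual_subset_K snd_dual[OF that(2)] snd_dual[OF that(3)]
      by (auto simp: tag_mult_def)
    then show ?thesis using that(1) by (auto simp: fin_prob_measure_def)
  qed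
  note fin = fin_prob_measureD[OF cv_fin_prob]
  have chf: "fst ?x (k, \<one>\<^bsub>G0\<^esub>) = f k" "fst ?y (k, \<one>\<^bsub>G0\<^esub>) = cnj (f k)" "fst ?e (k, \<one>\<^bsub>G0\<^esub>) = 1"
    if "k \<in> carrier H" for k
    using char_rep_facts(2)[OF f(1) that] char_rep_facts(2)[OF f' that] char_rep_facts(2)[OF f1 that] by simp_all
  \<comment> \<open>Both bracketings agree as mass functions of the end point; integrating the
    evaluation at a point over \<open>h\<close> against them gives an equation between
    numbers.\<close>
  have "integ (cv ?x ?y) (\<lambda>w. integ (cv w ?e) ?ev) = integ (cv ?y ?e) (\<lambda>w. integ (cv ?x w) ?ev)"
  proof -
    let ?p = "\<lambda>v. \<Sum>w | cv ?x ?y w \<noteq> 0. cv ?x ?y w * cv w ?e v"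
    let ?q = "\<lambda>v. \<Sum>w | cv ?y ?e w \<noteq> 0. cv ?y ?e w * cv ?x w v"
    have "?p = ?q"
    proof
      fix v
      have "complex_of_real (?p v) = complex_of_real (?q v)"
        using hypergroup_assoc_points[OF hyp xK, of v] by (simp add: integ_def)
      then show "?p v = ?q v" by (simp only: of_real_eq_iff)
    qed
    moreover have "integ ?p ?ev = integ (cv ?x ?y) (\<lambda>w. integ (cv w ?e) ?ev)"
      by (rule integ_compose(3)[OF fin(1)[OF xK(1,2)]])
         (use supp D dual_subset_K xK(3) in \<open>blast intro: fin(1)\<close>)
    moreover have "integ ?q ?ev = integ (cv ?y ?e) (\<lambda>w. integ (cv ?x w) ?ev)"
      by (rule integ_compose(3)[OF fin(1)[OF xK(2,3)]])
         (use supp D dual_subset_K xK(1) in \<open>blast intro: fin(1)\<close>)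
    ultimately show ?thesis by simp
  qed
  \<comment> \<open>Convolving a \<open>Circ\<close> point with \<open>?e\<close> only restricts its
    function to \<open>N\<close>, which an evaluation at a point of \<open>N\<close> does not
    notice.\<close>
  also have "integ (cv ?x ?y) (\<lambda>w. integ (cv w ?e) ?ev) = integ (cv ?x ?y) ?ev"
  proof (rule integ_cong)
    fix w assume "cv ?x ?y w \<noteq> 0"
    from supp[OF this D(1,2)] have w: "w \<in> dual Circ" .
    then obtain u where w': "w = (u, Circ)" using snd_dual by (metis prod.collapse)
    show "integ (cv w ?e) ?ev = ?ev w"
      unfolding w' using cv_Circ_Bullet(3)[OF w[unfolded w'] D(3) hN] chf(3)[OF h] by simp
  qed
  also have "\<dots> = 1"
  proof -
    have "(\<Sum>l\<in>carrier G0. fst ?x (\<alpha> (inv\<^bsub>G0\<^esub> l) h, \<one>\<^bsub>G0\<^esub>) * fst ?y (\<alpha> (inv\<^bsub>G0\<^esub> l) h, \<one>\<^bsub>G0\<^esub>)) = of_nat (card (carrier G0))"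
      using chf one \<alpha>_closed h by simp
    then show ?thesis using cv_Bullet_Bullet(2)[OF D(1,2) h G0.one_closed] card_G0 by simp
  qed
  also have "integ (cv ?y ?e) (\<lambda>w. integ (cv ?x w) ?ev) = integ (cv ?y ?e) (\<lambda>w. f h * ?ev w)"
  proof (rule integ_cong)
    fix w assume "cv ?y ?e w \<noteq> 0"
    from supp[OF this D(2,3)] have w: "w \<in> dual Circ" .
    then obtain u where w': "w = (u, Circ)" using snd_dual by (metis prod.collapse)
    show "integ (cv ?x w) ?ev = f h * ?ev w"
      unfolding w' using cv_Circ_Bullet(4)[OF w[unfolded w'] D(1) hN] chf(1)[OF h] by simp
  qed
  also have "\<dots> = f h * integ (cv ?y ?e) ?ev" by (simp add: integ_def sum_distrib_left mult_ac)
  also have "integ (cv ?y ?e) ?ev = (\<Sum>l\<in>carrier G0. cnj (f (\<alpha> (inv\<^bsub>G0\<^esub> l) h))) / of_nat (card (carrier G0))"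
    using cv_Bullet_Bullet(2)[OF D(2,3) h G0.one_closed] chf(2,3) \<alpha>_closed h by simp
  finally have "(\<Sum>l\<in>carrier G0. f h * cnj (f (\<alpha> (inv\<^bsub>G0\<^esub> l) h))) / of_nat (card (carrier G0)) = 1"
    by (simp add: sum_distrib_left)
  \<comment> \<open>The summation index enters through its inverse, so the term with
    \<open>\<alpha> g h\<close> is the one at the inverse of \<open>g\<close>.\<close>
  from mean_of_unit_complex_eq_1[OF finite_G0 _ _ this, of "inv\<^bsub>G0\<^esub> g"]
  have "f h * cnj (f (\<alpha> g h)) = 1"
    using g norm_f h \<alpha>_closed G0.one_closed by (auto simp: norm_mult)
  then have "f h * (cnj (f (\<alpha> g h)) * f (\<alpha> g h)) = f (\<alpha> g h)" by (simp add: mult.assoc[symmetric])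
  then have "f (\<alpha> g h) = f h" using one[OF gh] by (simp add: mult.commute)
  moreover have "f (\<alpha> g h) = f h * f a" using f(1) h a(1) ha by (metis H.character_def)
  moreover have "f h \<noteq> 0" using norm_f[OF h] by auto
  ultimately show False using f(2) by simp
qed

text \<open>The extension by zero to \<open>G\<close>. When the action is trivial, it turns all four cases of the
  convolution into pointwise multiplication.\<close>
definition hat :: "('h \<times> 'g) point \<Rightarrow> 'h \<times> 'g \<Rightarrow> complex" where
  "hat x g = (if snd x = Circ \<or> g \<in> N then fst x g else 0)"

lemma continuous_hat:
  assumes "x \<in> K"
  shows "continuous_map TG euclidean (hat x)"
proof (cases "snd x")
  case Circ
  then have "x \<in> dual_points G TG Circ" using assms K_iff by (metis dual_simps(1))
  then obtain \<pi> where "irreducible_rep G TG \<pi>" "x = (ch G \<pi>, Circ)" by (rule MG.dual_pointsE)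
  then show ?thesis using MG.contf_ch[OF irreducible_repD(1)] by (simp add: hat_def[abs_def])
next
  case Bullet
  then have "x \<in> dual_points L S Bullet" using assms K_iff by (metis dual_simps(2))
  then obtain \<pi> where \<pi>: "irreducible_rep L S \<pi>" "x = (ch L \<pi>, Bullet)" by (rule MN.dual_pointsE)
  from continuous_extend[OF MN.contf_ch[OF irreducible_repD(1)[OF \<pi>(1)]]]
  show ?thesis by (simp add: hat_def[abs_def] \<pi>(2) cong: if_cong)
qed

text \<open>On a single component \<open>hat\<close> agrees with the represented function wherever
  that function carries information, so this is uniqueness of measures on the dual of
  \<open>G\<close> or on the dual of \<open>N\<close>.\<close>

lemma measure_eq_hat:
  assumes p: "finite {z. p z \<noteq> 0}" "{z. p z \<noteq> 0} \<subseteq> dual s" and q: "finite {z. q z \<noteq> 0}" "{z. q z \<noteq> 0} \<subseteq> dual s"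
    and eq: "\<And>g. g \<in> carrier G \<Longrightarrow> integ p (\<lambda>z. hat z g) = integ q (\<lambda>z. hat z g)"
  shows "p = q"
proof -
  have hat: "integ r (\<lambda>z. hat z g) = integ r (\<lambda>z. fst z g)" if r: "{z. r z \<noteq> 0} \<subseteq> dual s" and g: "s = Circ \<or> g \<in> N" for r g
    by (rule integ_cong) (use r g snd_dual in \<open>auto simp: hat_def\<close>)
  show ?thesis
  proof (cases s)
    case Circ
    show ?thesis
      by (rule MG.measure_eqI[OF p(1) _ q(1)]) (use p(2) q(2) eq hat[OF p(2)] hat[OF q(2)] in \<open>auto simp: Circ dual_simps\<close>)
  next
    case Bullet
    show ?thesis
      by (rule MN.measure_eqI[OF p(1) _ q(1)])
         (use p(2) q(2) eq[OF N_subset] hat[OF p(2)] hat[OF q(2)] in \<open>auto simp: Bullet dual_simps\<close>)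
  qed
qed

section \<open>The unit and the involution\<close>

definition unit_point :: "('h \<times> 'g) point" where
  "unit_point = (ch G (\<lambda>x. mat 1 1 (\<lambda>_. 1)), Circ)"

lemma trivial_rep: "irreducible_rep G TG (\<lambda>x. mat 1 1 (\<lambda>_. 1))"
  and ch_trivial_rep: "g \<in> carrier G \<Longrightarrow> ch G (\<lambda>x. mat 1 1 (\<lambda>_. 1)) g = 1"
proof -
  have 1: "(\<lambda>x. mat 1 1 (\<lambda>_. 1)) \<one>\<^bsub>G\<^esub> = (1\<^sub>m 1 :: complex mat)" by (rule eq_matI) auto
  have "mat 1 1 (\<lambda>_. 1) * mat 1 1 (\<lambda>_. 1) = (mat 1 1 (\<lambda>_. 1) :: complex mat)"
    by (rule eq_matI) (auto simp: scalar_prod_def)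
  note r = representationI[where \<pi> = "\<lambda>x. mat 1 1 (\<lambda>_. 1)" and G = G and T = TG, OF 1 _ this[symmetric]]
  have "representation G TG (\<lambda>x. mat 1 1 (\<lambda>_. 1))" "degree_rep G (\<lambda>x. mat 1 1 (\<lambda>_. 1)) = 1"
    by (rule r; simp)+
  then show "irreducible_rep G TG (\<lambda>x. mat 1 1 (\<lambda>_. 1))" by (rule degree_one_irreducible)
  show "ch G (\<lambda>x. mat 1 1 (\<lambda>_. 1)) g = 1" if "g \<in> carrier G"
    unfolding ch_def degree_rep_def using that by simp
qed

lemma unit_point_dual: "unit_point \<in> dual Circ"
  using trivial_rep by (auto simp: unit_point_def dual_simps dual_points_def)

lemma hat_unit_point: "g \<in> carrier G \<Longrightarrow> hat unit_point g = 1"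
  using ch_trivial_rep by (simp add: hat_def unit_point_def)

text \<open>\<open>restrict\<close> keeps the function undefined off its group, as \<open>ch\<close>
  is, so that the result is literally the character of the contragredient. On \<open>N\<close> the
  inverse in \<open>G\<close> agrees with the inverse in \<open>L\<close>.\<close>

definition involution :: "('h \<times> 'g) point \<Rightarrow> ('h \<times> 'g) point" where
  "involution x = (restrict (\<lambda>g. fst x (inv\<^bsub>G\<^esub> g)) (if snd x = Circ then carrier G else N), snd x)"

lemma involution_Circ:
  "representation G TG \<pi> \<Longrightarrow> involution (ch G \<pi>, Circ) = (ch G (contragredient G \<pi>), Circ)"
  by (simp add: involution_def MG.ch_contragredient_fun)

lemma involution_Bullet:
  assumes "representation L S \<pi>"
  shows "involution (ch L \<pi>, Bullet) = (ch L (contragredient L \<pi>), Bullet)"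
proof -
  have "restrict (\<lambda>g. ch L \<pi> (inv\<^bsub>G\<^esub> g)) N = restrict (\<lambda>g. ch L \<pi> (inv\<^bsub>L\<^esub> g)) N"
    by (rule restrict_ext) (simp add: inv_L)
  then show ?thesis using MN.ch_contragredient_fun[OF assms] by (simp add: involution_def)
qed

lemma involution_dual: "x \<in> dual s \<Longrightarrow> involution x \<in> dual s"
proof (cases s)
  case Circ
  assume "x \<in> dual s"
  then have "x \<in> dual_points G TG Circ" by (simp add: Circ dual_simps)
  then obtain \<pi> where "irreducible_rep G TG \<pi>" "x = (ch G \<pi>, Circ)" by (rule MG.dual_pointsE)
  then show ?thesis using MG.irreducible_contragredient involution_Circ[OF irreducible_repD(1)]
    by (auto simp: Circ dual_simps dual_points_def)
next
  case Bullet
  assume "x \<in> dual s"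
  then have "x \<in> dual_points L S Bullet" by (simp add: Bullet dual_simps)
  then obtain \<pi> where "irreducible_rep L S \<pi>" "x = (ch L \<pi>, Bullet)" by (rule MN.dual_pointsE)
  then show ?thesis using MN.irreducible_contragredient involution_Bullet[OF irreducible_repD(1)]
    by (auto simp: Bullet dual_simps dual_points_def)
qed

lemma snd_involution: "snd (involution x) = snd x"
  by (simp add: involution_def)

lemma involution_K: "x \<in> K \<Longrightarrow> involution x \<in> K"
  using involution_dual by (simp add: K_iff snd_involution)

lemma hat_involution: "g \<in> carrier G \<Longrightarrow> hat (involution x) g = hat x (inv\<^bsub>G\<^esub> g)"
proof -
  assume g: "g \<in> carrier G"
  have "inv\<^bsub>G\<^esub> g \<in> N \<longleftrightarrow> g \<in> N"
    using g subgroup.m_inv_closed[OF subgroup_N, of g] subgroup.m_inv_closed[OF subgroup_N, of "inv\<^bsub>G\<^esub> g"] by auto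
  then show ?thesis using g by (auto simp: hat_def involution_def)
qed

text \<open>Uniqueness of measures, applied to two Dirac measures.\<close>

lemma K_eqI:
  assumes x: "x \<in> K" and y: "y \<in> K" and s: "snd x = snd y"
    and eq: "\<And>g. g \<in> carrier G \<Longrightarrow> hat x g = hat y g"
  shows "x = y"
proof -
  have "dirac x = dirac y"
    by (rule measure_eq_hat[of _ "snd x"])
       (use x y s eq K_iff in \<open>auto simp: integ_dirac\<close>, auto simp: dirac_def split: if_splits)
  then have "dirac x x = dirac y x" by simp
  then show ?thesis by (simp add: dirac_def split: if_splits)
qed

lemma involution_involution: "x \<in> K \<Longrightarrow> involution (involution x) = x"
  by (rule K_eqI) (simp_all add: involution_K snd_involution hat_involution)

text \<open>For mixed tags both sides vanish off \<open>N\<close>, as the \<open>Bullet\<close>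
  factor does. For two \<open>Bullet\<close> points the induced character vanishes off
  \<open>N\<close>, and on \<open>N\<close> its mean over conjugates has equal terms because the
  action is trivial.\<close>

lemma hat_cv:
  assumes triv: "\<And>g h. g \<in> carrier G0 \<Longrightarrow> h \<in> carrier H \<Longrightarrow> \<alpha> g h = h"
    and K: "x \<in> K" "y \<in> K" and g: "g \<in> carrier G"
  shows "integ (cv x y) (\<lambda>w. hat w g) = hat x g * hat y g"
proof -
  obtain f s f' t where xy: "x = (f, s)" "y = (f', t)" by (cases x, cases y)
  have d: "(f, s) \<in> dual s" "(f', t) \<in> dual t" using K K_iff xy by auto
  have tag: "snd w = tag_mult s t" if "cv x y w \<noteq> 0" for w
  proof -
    have "w \<in> dual (tag_mult s t)" using fin_prob_measureD(2)[OF cv_fin_prob[OF K]] that xy by auto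
    then show ?thesis by (rule snd_dual)
  qed
  have odd: "integ (cv x y) (\<lambda>w. hat w g) = (if g \<in> N then integ (cv x y) (\<lambda>w. fst w g) else 0)" if "s \<noteq> t"
  proof -
    have "integ (cv x y) (\<lambda>w. hat w g) = integ (cv x y) (\<lambda>w. if g \<in> N then fst w g else 0)"
      by (rule integ_cong) (use tag that in \<open>auto simp: hat_def tag_mult_def\<close>)
    then show ?thesis by (simp add: integ_def)
  qed
  have even: "integ (cv x y) (\<lambda>w. hat w g) = integ (cv x y) (\<lambda>w. fst w g)" if "s = t"
    by (rule integ_cong) (use tag that in \<open>auto simp: hat_def tag_mult_def\<close>)
  show ?thesis
  proof (cases s; cases t)
    assume st: "s = Circ" "t = Circ"
    then show ?thesis using even cv_Circ_Circ(2) d g by (simp add: xy hat_def)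
  next
    assume st: "s = Circ" "t = Bullet"
    then show ?thesis using odd cv_Circ_Bullet(3) d by (simp add: xy hat_def)
  next
    assume st: "s = Bullet" "t = Circ"
    then show ?thesis using odd cv_Circ_Bullet(4) d by (simp add: xy hat_def)
  next
    assume st: "s = Bullet" "t = Bullet"
    obtain h l where hl: "g = (h, l)" "h \<in> carrier H" "l \<in> carrier G0" using g by (auto simp: carrier_G)
    have "integ (cv x y) (\<lambda>w. fst w g) = (if l = \<one>\<^bsub>G0\<^esub> then f (h, \<one>\<^bsub>G0\<^esub>) * f' (h, \<one>\<^bsub>G0\<^esub>) else 0)"
      using cv_Bullet_Bullet(2)[OF _ _ hl(2,3), of f f'] d st triv hl(2) card_G0 by (simp add: xy hl(1))
    then show ?thesis using even st hl by (auto simp: xy hat_def N_eq)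
  qed
qed

text \<open>\<open>N\<close> is one of as many slices as \<open>G0\<close> has elements, and the
  other slices contribute zero.\<close>

lemma MG_Bullet:
  assumes "continuous_map S euclidean f"
  shows "MG (\<lambda>g. if g \<in> N then f g else 0) = MN f / of_nat (card (carrier G0))"
proof -
  have "H.mean (\<lambda>h. if (h, g) \<in> N then f (h, g) else 0) = (if g = \<one>\<^bsub>G0\<^esub> then MN f else 0)" for g
  proof (cases "g = \<one>\<^bsub>G0\<^esub>")
    case True
    have "H.mean (\<lambda>h. if (h, \<one>\<^bsub>G0\<^esub>) \<in> N then f (h, \<one>\<^bsub>G0\<^esub>) else 0) = H.mean (\<lambda>h. f (h, \<one>\<^bsub>G0\<^esub>))"
      by (rule H.mean_cong[OF continuous_S_slice[OF assms]]) (simp add: N_eq)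
    then show ?thesis unfolding True MN_def by simp
  next
    case False
    then show ?thesis by (simp add: N_eq H.mean_const)
  qed
  then show ?thesis using finite_G0 by (simp add: MG_def)
qed

lemma hypergroup_if_trivial_action:
  assumes triv: "\<And>g h. g \<in> carrier G0 \<Longrightarrow> h \<in> carrier H \<Longrightarrow> \<alpha> g h = h"
  shows "hypergroup K cv"
proof -
  have fin: "fin_prob_measure K (cv x y)" if "x \<in> K" "y \<in> K" for x y
    by (rule fin_prob_measure_mono[OF cv_fin_prob[OF that] dual_subset_K])
  note fd = fin_prob_measureD[OF cv_fin_prob]
  have hat_cv: "integ (cv x y) (\<lambda>w. hat w g) = hat x g * hat y g"
    if "x \<in> K" "y \<in> K" "g \<in> carrier G" for x y g
    by (rule hat_cv) (use triv that in auto)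
  have supp: "w \<in> K" "snd w = tag_mult (snd x) (snd y)" if "cv x y w \<noteq> 0" "x \<in> K" "y \<in> K" for x y w
  proof -
    have w: "w \<in> dual (tag_mult (snd x) (snd y))" using fd(2)[OF that(2,3)] that(1) by blast
    show "w \<in> K" using w dual_subset_K by blast
    show "snd w = tag_mult (snd x) (snd y)" by (rule snd_dual[OF w])
  qed
  have eK: "unit_point \<in> K" using unit_point_dual dual_subset_K by blast
  have snd_e: "snd unit_point = Circ" by (simp add: unit_point_def)
  have assoc: "integ (cv x y) (\<lambda>w. of_real (cv w z v)) = integ (cv y z) (\<lambda>w. of_real (cv x w v))"
    if x: "x \<in> K" and y: "y \<in> K" and z: "z \<in> K" for x y z v
  proof -
    let ?p = "\<lambda>v. \<Sum>w | cv x y w \<noteq> 0. cv x y w * cv w z v" and ?q = "\<lambda>v. \<Sum>w | cv y z w \<noteq> 0. cv y z w * cv x w v"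
    have kp: "\<forall>w. cv x y w \<noteq> 0 \<longrightarrow> finite {v. cv w z v \<noteq> 0}" using fd(1)[OF supp(1)[OF _ x y] z] by blast
    have kq: "\<forall>w. cv y z w \<noteq> 0 \<longrightarrow> finite {v. cv x w v \<noteq> 0}" using fd(1)[OF x supp(1)[OF _ y z]] by blast
    note P = integ_compose[of "cv x y" "\<lambda>w. cv w z", OF fd(1)[OF x y] kp]
    note Q = integ_compose[of "cv y z" "\<lambda>w. cv x w", OF fd(1)[OF y z] kq]
    define s where "s = tag_mult (tag_mult (snd x) (snd y)) (snd z)"
    \<comment> \<open>Associativity of the tag product places both bracketings on the same
      component, as a comparison through \<open>hat\<close> requires.\<close>
    have s: "s = tag_mult (snd x) (tag_mult (snd y) (snd z))"
      unfolding s_def by (cases "snd x"; cases "snd y"; cases "snd z") (simp_all add: tag_mult_def)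
    have "?p = ?q"
    proof (rule measure_eq_hat[OF P(1) _ Q(1), of s])
      show "{v. ?p v \<noteq> 0} \<subseteq> dual s"
      proof (rule subset_trans, rule P(2), rule UN_least)
        fix w assume "w \<in> {w. cv x y w \<noteq> 0}"
        then have w: "cv x y w \<noteq> 0" by simp
        from fd(2)[OF supp(1)[OF w x y] z] show "{v. cv w z v \<noteq> 0} \<subseteq> dual s"
          unfolding supp(2)[OF w x y] s_def .
      qed
      show "{v. ?q v \<noteq> 0} \<subseteq> dual s"
      proof (rule subset_trans, rule Q(2), rule UN_least)
        fix w assume "w \<in> {w. cv y z w \<noteq> 0}"
        then have w: "cv y z w \<noteq> 0" by simp
        from fd(2)[OF x supp(1)[OF w y z]] show "{v. cv x w v \<noteq> 0} \<subseteq> dual s"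
          unfolding supp(2)[OF w y z] s .
      qed
      fix g assume g: "g \<in> carrier G"
      have "integ (cv x y) (\<lambda>w. integ (cv w z) (\<lambda>v. hat v g)) = integ (cv x y) (\<lambda>w. hat w g) * hat z g"
        unfolding integ_def[of "cv x y"] sum_distrib_right
        by (rule sum.cong) (use supp x y z g hat_cv in auto)
      moreover have "integ (cv y z) (\<lambda>w. integ (cv x w) (\<lambda>v. hat v g)) = hat x g * integ (cv y z) (\<lambda>w. hat w g)"
        unfolding integ_def[of "cv y z"] sum_distrib_left
        by (rule sum.cong) (use supp x y z g hat_cv in auto)
      ultimately show "integ ?p (\<lambda>v. hat v g) = integ ?q (\<lambda>v. hat v g)"
        unfolding P(3) Q(3) by (simp add: hat_cv x y z g)
    qed
    then have "complex_of_real (?p v) = complex_of_real (?q v)" by (rule arg_cong[THEN fun_cong, of _ _ "\<lambda>p v. complex_of_real (p v)"])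
    then show ?thesis by (simp add: integ_def)
  qed
  have unit: "cv unit_point x = dirac x" "cv x unit_point = dirac x" if x: "x \<in> K" for x
  proof -
    have t: "tag_mult Circ (snd x) = snd x" "tag_mult (snd x) Circ = snd x"
      by (cases "snd x"; simp add: tag_mult_def)+
    have dx: "finite {z. dirac x z \<noteq> 0}" "{z. dirac x z \<noteq> 0} \<subseteq> dual (snd x)"
      using x K_iff by (auto simp: dirac_def)
    show "cv unit_point x = dirac x"
      by (rule measure_eq_hat[OF fd(1)[OF eK x] fd(2)[OF eK x, unfolded snd_e t] dx])
         (simp add: hat_cv eK x integ_dirac hat_unit_point)
    show "cv x unit_point = dirac x"
      by (rule measure_eq_hat[OF fd(1)[OF x eK] fd(2)[OF x eK, unfolded snd_e t] dx])
         (simp add: hat_cv eK x integ_dirac hat_unit_point)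
  qed
  have inv_K: "\<And>x. x \<in> K \<Longrightarrow> involution x \<in> K \<and> involution (involution x) = x"
    by (simp add: involution_K involution_involution)
  have anti: "cv (involution x) (involution y) = push_forward K involution (cv y x)" if x: "x \<in> K" and y: "y \<in> K" for x y
  proof -
    let ?q = "push_forward K involution (cv y x)"
    have q: "?q = (\<lambda>z. if z \<in> K then cv y x (involution z) else 0)"
      by (rule ext) (rule push_forward_involution[OF inv_K])
    have bij: "{z. ?q z \<noteq> 0} = involution ` {w. cv y x w \<noteq> 0}"
    proof (intro equalityI subsetI)
      fix z assume "z \<in> {z. ?q z \<noteq> 0}"
      then have "z \<in> K" "cv y x (involution z) \<noteq> 0" by (auto simp: q split: if_splits)
      then show "z \<in> involution ` {w. cv y x w \<noteq> 0}"
        using involution_involution by (intro image_eqI[of _ _ "involution z"]) auto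
    next
      fix z assume "z \<in> involution ` {w. cv y x w \<noteq> 0}"
      then show "z \<in> {z. ?q z \<noteq> 0}" using supp(1)[OF _ y x] inv_K by (auto simp: q)
    qed
    have t: "tag_mult (snd (involution x)) (snd (involution y)) = tag_mult (snd y) (snd x)"
      by (auto simp: snd_involution tag_mult_def)
    note ix = involution_K[OF x] and iy = involution_K[OF y]
    show ?thesis
    proof (rule measure_eq_hat[OF fd(1)[OF ix iy] fd(2)[OF ix iy, unfolded t]])
      show "finite {z. ?q z \<noteq> 0}" unfolding bij using fd(1)[OF y x] by simp
      show "{z. ?q z \<noteq> 0} \<subseteq> dual (tag_mult (snd y) (snd x))"
        unfolding bij using fd(2)[OF y x] involution_dual by blast
      fix g assume g: "g \<in> carrier G"
      have inj: "inj_on involution {w. cv y x w \<noteq> 0}"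
        by (rule inj_on_inverseI[of _ involution]) (use supp(1)[OF _ y x] involution_involution in auto)
      have "integ ?q (\<lambda>z. hat z g) = (\<Sum>w | cv y x w \<noteq> 0. of_real (?q (involution w)) * hat (involution w) g)"
        unfolding integ_def bij by (simp add: sum.reindex[OF inj])
      also have "\<dots> = integ (cv y x) (\<lambda>w. hat w (inv\<^bsub>G\<^esub> g))"
        unfolding integ_def
        by (rule sum.cong) (use supp(1)[OF _ y x] inv_K g in \<open>auto simp: q hat_involution\<close>)
      \<comment> \<open>Complex values commute, so the reversed order of the factors in
        \<open>cv y x\<close> makes no difference after passing to \<open>hat\<close>.\<close>
      also have "\<dots> = hat (involution x) g * hat (involution y) g"
        using hat_cv[OF y x] g by (simp add: hat_involution)
      finally show "integ (cv (involution x) (involution y)) (\<lambda>z. hat z g) = integ ?q (\<lambda>z. hat z g)"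
        by (simp add: hat_cv[OF ix iy g])
    qed
  qed
  have mass: "cv x y unit_point \<noteq> 0 \<longleftrightarrow> x = involution y" if x: "x \<in> K" and y: "y \<in> K" for x y
  proof (cases "snd x = snd y")
    case False
    \<comment> \<open>A product of points with different tags lives on \<open>Bullet\<close>, while
      the unit has tag \<open>Circ\<close>; the involution keeps tags, so both sides of the
      equivalence fail.\<close>
    have "cv x y unit_point = 0"
    proof (rule ccontr)
      assume "cv x y unit_point \<noteq> 0"
      from supp(2)[OF this x y] False snd_e show False by (simp add: tag_mult_def)
    qed
    then show ?thesis using False snd_involution by metis
  next
    case True
    let ?\<pi> = "\<lambda>x. mat 1 1 (\<lambda>_. 1 :: complex)"
    have sub: "{w. cv x y w \<noteq> 0} \<subseteq> dual_points G TG Circ"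
      using fd(2)[OF x y] True by (simp add: tag_mult_def dual_simps)
    \<comment> \<open>Inserting the trivial character, whose value is 1, brings the mean into the
      form of \<open>MG.mean_integ\<close>, which isolates the mass at the unit.\<close>
    have "MG (\<lambda>g. ch G ?\<pi> (inv\<^bsub>G\<^esub> g) * integ (cv x y) (\<lambda>z. fst z g)) = MG (\<lambda>g. hat x g * hat y g)"
    proof (rule MG.M_cong[OF continuous_map_mult[OF continuous_hat[OF x] continuous_hat[OF y]]])
      fix g assume g: "g \<in> carrier G"
      have "integ (cv x y) (\<lambda>z. fst z g) = integ (cv x y) (\<lambda>z. hat z g)"
        by (rule integ_cong) (use supp(2)[OF _ x y] True in \<open>auto simp: hat_def tag_mult_def\<close>)
      then show "hat x g * hat y g = ch G ?\<pi> (inv\<^bsub>G\<^esub> g) * integ (cv x y) (\<lambda>z. fst z g)"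
        unfolding hat_cv[OF x y g, symmetric] ch_trivial_rep[OF G.inv_closed[OF g]] by simp
    qed
    moreover have "MG (\<lambda>g. ch G ?\<pi> (inv\<^bsub>G\<^esub> g) * integ (cv x y) (\<lambda>z. fst z g)) =
        of_real (cv x y unit_point) * MG (\<lambda>g. ch G ?\<pi> (inv\<^bsub>G\<^esub> g) * ch G ?\<pi> g)"
      unfolding unit_point_def by (rule MG.mean_integ[OF fd(1)[OF x y] sub trivial_rep])
    ultimately have "MG (\<lambda>g. hat x g * hat y g) =
        of_real (cv x y unit_point) * MG (\<lambda>g. ch G ?\<pi> (inv\<^bsub>G\<^esub> g) * ch G ?\<pi> g)" by (rule trans[OF sym])
    then have nz: "cv x y unit_point \<noteq> 0 \<longleftrightarrow> MG (\<lambda>g. hat x g * hat y g) \<noteq> 0"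
      using MG.ch_norm[OF trivial_rep] by (simp only: mult_eq_0_iff of_real_eq_0_iff) argo
    show ?thesis
    proof (cases "snd y")
      case Circ
      have "x \<in> dual_points G TG Circ" "y \<in> dual_points G TG Circ"
        using x y True Circ by (simp_all add: K_iff dual_simps)
      then obtain \<pi> \<rho> where \<pi>: "irreducible_rep G TG \<pi>" "x = (ch G \<pi>, Circ)"
        and \<rho>: "irreducible_rep G TG \<rho>" "y = (ch G \<rho>, Circ)" by (elim MG.dual_pointsE)
      have "MG (\<lambda>g. hat x g * hat y g) = MG (\<lambda>g. ch G \<pi> g * ch G \<rho> g)" by (simp add: hat_def \<pi>(2) \<rho>(2))
      then show ?thesis
        using nz MG.mean_ch_mult_ch[OF \<pi>(1) \<rho>(1)] involution_Circ[OF irreducible_repD(1)[OF \<rho>(1)]] \<pi>(2) \<rho>(2) by simp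
    next
      case Bullet
      have "x \<in> dual_points L S Bullet" "y \<in> dual_points L S Bullet"
        using x y True Bullet by (simp_all add: K_iff dual_simps)
      then obtain \<pi> \<rho> where \<pi>: "irreducible_rep L S \<pi>" "x = (ch L \<pi>, Bullet)"
        and \<rho>: "irreducible_rep L S \<rho>" "y = (ch L \<rho>, Bullet)" by (elim MN.dual_pointsE)
      \<comment> \<open>The mean over \<open>G\<close> of a function supported on \<open>N\<close>
        is a positive multiple of its mean over \<open>N\<close>, so orthogonality of the characters
        of \<open>N\<close> decides whether it vanishes.\<close>
      have "(\<lambda>g. hat x g * hat y g) = (\<lambda>g. if g \<in> N then ch L \<pi> g * ch L \<rho> g else 0)"
        by (rule ext) (simp add: hat_def \<pi>(2) \<rho>(2))
      then have "MG (\<lambda>g. hat x g * hat y g) = MN (\<lambda>g. ch L \<pi> g * ch L \<rho> g) / of_nat (card (carrier G0))"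
        using MG_Bullet[OF continuous_map_mult[OF MN.contf_ch[OF irreducible_repD(1)[OF \<pi>(1)]]
              MN.contf_ch[OF irreducible_repD(1)[OF \<rho>(1)]]]] by simp
      then show ?thesis
        using nz card_G0 MN.mean_ch_mult_ch[OF \<pi>(1) \<rho>(1)] involution_Bullet[OF irreducible_repD(1)[OF \<rho>(1)]] \<pi>(2) \<rho>(2)
        by simp
    qed
  qed
  show ?thesis
    unfolding hypergroup_def
  proof (intro conjI)
    show "\<forall>x\<in>K. \<forall>y\<in>K. fin_prob_measure K (cv x y)" using fin by blast
    show "\<forall>\<mu>\<in>bounded_measures K. \<forall>\<nu>\<in>bounded_measures K. \<forall>\<rho>\<in>bounded_measures K.
        convolution K cv (convolution K cv \<mu> \<nu>) \<rho> = convolution K cv \<mu> (convolution K cv \<nu> \<rho>)"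
    proof (intro ballI)
      fix \<mu> \<nu> \<rho> assume m: "\<mu> \<in> bounded_measures K" "\<nu> \<in> bounded_measures K" "\<rho> \<in> bounded_measures K"
      show "convolution K cv (convolution K cv \<mu> \<nu>) \<rho> = convolution K cv \<mu> (convolution K cv \<nu> \<rho>)"
        by (rule convolution_assoc[OF _ _ m]) (rule fin assoc; assumption)+
    qed
    show "\<exists>e\<in>K. (\<forall>x\<in>K. cv e x = dirac x \<and> cv x e = dirac x) \<and>
        (\<exists>\<iota>. (\<forall>x\<in>K. \<iota> x \<in> K \<and> \<iota> (\<iota> x) = x) \<and>
          (\<forall>x\<in>K. \<forall>y\<in>K. cv (\<iota> x) (\<iota> y) = push_forward K \<iota> (cv y x)) \<and>
          (\<forall>x\<in>K. \<forall>y\<in>K. cv x y e \<noteq> 0 \<longleftrightarrow> x = \<iota> y))"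
      by (rule bexI[OF _ eK], rule conjI, blast intro: unit, rule exI[of _ involution])
         (simp add: inv_K anti mass)
  qed
qed

end

theorem corollary3p17:
  fixes H :: "'h monoid" and T :: "'h topology"
    and G\<^sub>0 :: "'g monoid" and \<alpha> :: "'g \<Rightarrow> 'h \<Rightarrow> 'h"
  assumes "compact_group H T" and "comm_group H" and "second_countable T"
    and "group G\<^sub>0" and "finite (carrier G\<^sub>0)"
    and "acts_by_continuous_automorphisms G\<^sub>0 H T \<alpha>"
  defines "G \<equiv> semidirect H G\<^sub>0 \<alpha>"
    and "T\<^sub>G \<equiv> semidirect_topology T G\<^sub>0"
    and "N \<equiv> semidirect_normal H G\<^sub>0"
  shows "hypergroup (K_points G T\<^sub>G N) (K_conv G T\<^sub>G N) \<longleftrightarrow>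
         (\<forall>g\<in>carrier G\<^sub>0. \<forall>h\<in>carrier H. \<alpha> g h = h)"
proof -
  interpret semidirect_action H T G\<^sub>0 \<alpha>
    by (rule semidirect_action.intro) (use assms in simp_all)
  show ?thesis
    unfolding G_def T\<^sub>G_def N_def
    using trivial_action_if_hypergroup hypergroup_if_trivial_action by blast
qed

end
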